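(* Let $J$ be the Jacobian of a genus $2$ curve $C:y^2=f(x)$ over $\mathbb{Q}$, and let $P\in J$ be a simple quadratic $5$-torsion point defined over $K=\mathbb{Q}(\sqrt{d})$. Let $p\neq5$ be a rational prime of good reduction which splits in $K$. Then the reduction $J/\mathbb{F}_p$ admits a nontrivial $\mathbb{F}_p$-rational $5$-torsion point.
   Context: $C$ has two points at infinity $\infty_1,\infty_2$. Mumford coordinates of $[P_1]+[P_2]-[\infty_1]-[\infty_2]$ are the unique pair $(u,v)$ with $u$ monic of degree $\le2$ vanishing at $x(P_1),x(P_2)$, $v$ of degree $\le1$ with $v(x(P_i))=y(P_i)$, and $u\mid v^2-f$. A simple quadratic $5$-torsion point is a point $P\in J[5]$ of the form $[P_1]+[P_2]-[\infty_1]-[\infty_2]$ with $P_1,P_2$ affine, whose Mumford coordinates $(x^2+\alpha x+\beta,\ \gamma x+\delta)$ satisfy $\alpha,\beta\in\mathbb{Q}$ and $(\gamma,\delta)=(a\sqrt{d},b\sqrt{d})$ for some $a,b\in\mathbb{Q}$ and square-free $d\in\mathbb{Z}$. *)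

theory Defs
  imports
    "HOL-Algebra.Algebraic_Closure_Type"
    "HOL-Algebra.Coset"
    "HOL-Algebra.Ideal"
    "HOL-Library.Poly_Mapping"
    "Berlekamp_Zassenhaus.Finite_Field"
    Complex_Main
begin

section \<open>Curves of genus 2\<close>

text \<open>
  A curve of genus 2 is given by a Weierstrass equation \<open>y\<^sup>2 + h(x) y = g(x)\<close> with
  \<open>deg h \<le> 3\<close> and \<open>deg g \<le> 6\<close>; the term \<open>h(x) y\<close> is needed for reduction modulo 2. The complete
  curve is covered by the affine chart \<open>(x, y)\<close> and the chart \<open>(s, t) = (1/x, y/x\<^sup>3)\<close>, in which
  the equation becomes \<open>t\<^sup>2 + s\<^sup>3 h(1/s) t = s\<^sup>6 g(1/s)\<close>. The points at infinity are those with \<open>s = 0\<close>.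
\<close>

text \<open>The binary form \<open>\<Sum>i. f\<^sub>i X\<^sup>i Z\<^sup>n\<^sup>-\<^sup>i\<close> attached to \<open>f\<close>, evaluated at \<open>(X, Z) = (L, M)\<close>.\<close>

definition hom_subst :: "nat \<Rightarrow> 'a::comm_ring_1 poly \<Rightarrow> 'a poly \<Rightarrow> 'a poly \<Rightarrow> 'a poly" where
  "hom_subst n f L M = (\<Sum>i\<le>n. smult (Polynomial.coeff f i) (L ^ i * M ^ (n - i)))"

definition rev_poly :: "nat \<Rightarrow> 'a::comm_ring_1 poly \<Rightarrow> 'a poly" where
  "rev_poly n f = hom_subst n f 1 [:0, 1:]"

datatype 'a point = Affine 'a 'a | Inf 'a

definition affine_points :: "'a::field poly \<Rightarrow> 'a poly \<Rightarrow> 'a point set" where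
  "affine_points h g = {Affine a b | a b. b ^ 2 + poly h a * b = poly g a}"

definition infinite_points :: "'a::field poly \<Rightarrow> 'a poly \<Rightarrow> 'a point set" where
  "infinite_points h g =
     {Inf b | b. b ^ 2 + poly (rev_poly 3 h) 0 * b = poly (rev_poly 6 g) 0}"

definition points :: "'a::field poly \<Rightarrow> 'a poly \<Rightarrow> 'a point set" where
  "points h g = affine_points h g \<union> infinite_points h g"

definition singular_at :: "'a::field poly \<Rightarrow> 'a poly \<Rightarrow> 'a \<Rightarrow> 'a \<Rightarrow> bool" where
  "singular_at h g a b \<longleftrightarrow>
     b ^ 2 + poly h a * b = poly g a \<and>
     2 * b + poly h a = 0 \<and>
     poly (pderiv h) a * b = poly (pderiv g) a"

text \<open>
  Over an algebraically closed field a Weierstrass equation defines a curve of genus 2 iff both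
  charts are nonsingular.
\<close>

definition genus2_curve :: "'a::alg_closed_field poly \<Rightarrow> 'a poly \<Rightarrow> bool" where
  "genus2_curve h g \<longleftrightarrow>
     Polynomial.degree h \<le> 3 \<and> Polynomial.degree g \<le> 6 \<and>
     (\<forall>a b. \<not> singular_at h g a b) \<and>
     (\<forall>b. \<not> singular_at (rev_poly 3 h) (rev_poly 6 g) 0 b)"


section \<open>Divisors and the Jacobian\<close>

text \<open>
  Order of vanishing of \<open>F\<close> at a nonsingular point \<open>(a, b)\<close> of the plane curve \<open>E = 0\<close>: the largest
  \<open>n\<close> such that \<open>F\<close> lies in the \<open>n\<close>-th power of the maximal ideal \<open>(x - a, y - b)\<close> modulo \<open>E\<close>.
  The type \<open>'a poly poly\<close> stands for \<open>k[x][y]\<close>.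
\<close>

definition plane_ord :: "'a::field poly poly \<Rightarrow> 'a \<Rightarrow> 'a \<Rightarrow> 'a poly poly \<Rightarrow> nat" where
  "plane_ord E a b F = (GREATEST n.
     \<exists>G :: nat \<Rightarrow> 'a poly poly.
       E dvd F - (\<Sum>i\<le>n. [:[:-a, 1:]:] ^ i * [:[:-b:], 1:] ^ (n - i) * G i))"

text \<open>
  A pair \<open>(A, B)\<close> with \<open>deg A \<le> N\<close> and \<open>deg B \<le> N - 3\<close> represents the weighted homogeneous form
  \<open>A(X, Z) + B(X, Z) Y\<close> of degree \<open>N\<close> on the curve, where \<open>X, Z\<close> have weight 1 and \<open>Y\<close> has
  weight 3. It is \<open>A + B y\<close> on the affine chart and \<open>s\<^sup>N A(1/s) + s\<^sup>N\<^sup>-\<^sup>3 B(1/s) t\<close> on the other one.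
  Every nonzero rational function is a quotient of two nonzero forms of the same degree.
\<close>

definition is_form :: "nat \<Rightarrow> 'a::field poly \<Rightarrow> 'a poly \<Rightarrow> bool" where
  "is_form N A B \<longleftrightarrow>
     3 \<le> N \<and> Polynomial.degree A \<le> N \<and> Polynomial.degree B \<le> N - 3 \<and> (A, B) \<noteq> (0, 0)"

fun form_ord ::
  "'a::field poly \<Rightarrow> 'a poly \<Rightarrow> nat \<Rightarrow> 'a poly \<Rightarrow> 'a poly \<Rightarrow> 'a point \<Rightarrow> nat" where
  "form_ord h g N A B (Affine a b) = plane_ord [:- g, h, 1:] a b [:A, B:]"
| "form_ord h g N A B (Inf b) =
     plane_ord [:- rev_poly 6 g, rev_poly 3 h, 1:] 0 b [:rev_poly N A, rev_poly (N - 3) B:]"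

type_synonym 'a divisor = "'a point \<Rightarrow>\<^sub>0 int"

definition div_degree :: "'a divisor \<Rightarrow> int" where
  "div_degree D = (\<Sum>Q\<in>Poly_Mapping.keys D. Poly_Mapping.lookup D Q)"

definition div0_group :: "'a::field poly \<Rightarrow> 'a poly \<Rightarrow> 'a divisor monoid" where
  "div0_group h g =
     \<lparr>carrier = {D. Poly_Mapping.keys D \<subseteq> points h g \<and> div_degree D = 0},
      monoid.mult = (+), one = 0\<rparr>"

definition principal_divisors :: "'a::field poly \<Rightarrow> 'a poly \<Rightarrow> 'a divisor set" where
  "principal_divisors h g =
     {D. Poly_Mapping.keys D \<subseteq> points h g \<and>
         (\<exists>N A1 B1 A2 B2. is_form N A1 B1 \<and> is_form N A2 B2 \<and>
            (\<forall>Q\<in>points h g. Poly_Mapping.lookup D Q =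
               int (form_ord h g N A1 B1 Q) - int (form_ord h g N A2 B2 Q)))}"

text \<open>
  The group of \<open>k\<close>-points of the Jacobian (\<open>k\<close> algebraically closed): divisors of degree 0 modulo
  principal divisors.
\<close>

definition jacobian :: "'a::alg_closed_field poly \<Rightarrow> 'a poly \<Rightarrow> 'a divisor set monoid" where
  "jacobian h g = div0_group h g Mod principal_divisors h g"

definition torsion_points :: "('a, 'b) monoid_scheme \<Rightarrow> nat \<Rightarrow> 'a set" where
  "torsion_points G n = {c \<in> carrier G. c [^]\<^bsub>G\<^esub> n = \<one>\<^bsub>G\<^esub>}"


section \<open>Simple quadratic 5-torsion points\<close>

text \<open>
  Mumford coordinates of \<open>[P\<^sub>1] + [P\<^sub>2] - [\<infinity>\<^sub>1] - [\<infinity>\<^sub>2]\<close> with \<open>P\<^sub>1, P\<^sub>2\<close> affine on \<open>y\<^sup>2 = f(x)\<close>.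
  The roots of \<open>u\<close> are counted with multiplicity; for \<open>P\<^sub>1 = P\<^sub>2\<close> this is what makes \<open>(u, v)\<close> unique.
\<close>

definition mumford_coordinates ::
  "'a::field poly \<Rightarrow> 'a \<times> 'a \<Rightarrow> 'a \<times> 'a \<Rightarrow> 'a poly \<Rightarrow> 'a poly \<Rightarrow> bool" where
  "mumford_coordinates f P1 P2 u v \<longleftrightarrow>
     u = [:- fst P1, 1:] * [:- fst P2, 1:] \<and>
     Polynomial.degree v \<le> 1 \<and> poly v (fst P1) = snd P1 \<and> poly v (fst P2) = snd P2 \<and>
     u dvd v ^ 2 - f"

definition simple_quadratic_5_torsion :: "rat poly \<Rightarrow> int \<Rightarrow> complex divisor set \<Rightarrow> bool" where
  "simple_quadratic_5_torsion f d P \<longleftrightarrow>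
     (let fC = map_poly of_rat f :: complex poly;
          D_inf = (\<Sum>Q\<in>infinite_points 0 fC. Poly_Mapping.single Q 1)
      in squarefree d \<and>
         P \<in> torsion_points (jacobian 0 fC) 5 \<and>
         (\<exists>x1 y1 x2 y2 u v. \<exists>\<alpha> \<beta> a b :: rat.
            Affine x1 y1 \<in> affine_points 0 fC \<and> Affine x2 y2 \<in> affine_points 0 fC \<and>
            P = principal_divisors 0 fC #>\<^bsub>div0_group 0 fC\<^esub>
                  (Poly_Mapping.single (Affine x1 y1) 1 + Poly_Mapping.single (Affine x2 y2) 1 - D_inf) \<and>
            mumford_coordinates fC (x1, y1) (x2, y2) u v \<and>
            u = [:of_rat \<beta>, of_rat \<alpha>, 1:] \<and>
            v = [:of_rat b * csqrt (of_int d), of_rat a * csqrt (of_int d):]))"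


section \<open>Splitting of primes\<close>

definition quadratic_field :: "int \<Rightarrow> complex set" where
  "quadratic_field d = {of_rat q + of_rat r * csqrt (of_int d) | q r. True}"

definition ring_of_integers :: "complex set \<Rightarrow> complex ring" where
  "ring_of_integers K = ring_of_type_algebra\<lparr>carrier := {z \<in> K. algebraic_int z}\<rparr>"

definition field_degree :: "complex set \<Rightarrow> nat" where
  "field_degree K = vector_space.dim (\<lambda>(q::rat) (z::complex). of_rat q * z) K"

definition primes_above :: "complex set \<Rightarrow> nat \<Rightarrow> complex set set" where
  "primes_above K p = {I. primeideal I (ring_of_integers K) \<and> of_nat p \<in> I}"

text \<open>
  A rational prime splits (completely) in \<open>K\<close> if there are \<open>[K : \<rat>]\<close> primes of \<open>K\<close> above it.
\<close>

definition splits_in :: "nat \<Rightarrow> complex set \<Rightarrow> bool" where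
  "splits_in p K \<longleftrightarrow> finite (primes_above K p) \<and> card (primes_above K p) = field_degree K"


section \<open>Good reduction\<close>

text \<open>
  The isomorphisms between genus 2 curves in Weierstrass form are the substitutions
  \<open>x = (a X + b) / (c X + d)\<close>, \<open>y = (e Y + t(X)) / (c X + d)\<^sup>3\<close>; they turn \<open>y\<^sup>2 + h y = g\<close> into
  \<open>Y\<^sup>2 + h' Y = g'\<close> with \<open>h'\<close> and \<open>g'\<close> as follows.
\<close>

definition isomorphic_models ::
  "'a::field poly \<Rightarrow> 'a poly \<Rightarrow> 'a poly \<Rightarrow> 'a poly \<Rightarrow> bool" where
  "isomorphic_models h g h' g' \<longleftrightarrow>
     (\<exists>a b c d e t.
        a * d - b * c \<noteq> 0 \<and> e \<noteq> 0 \<and> Polynomial.degree t \<le> 3 \<and>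
        (let H = hom_subst 3 h [:b, a:] [:d, c:]; G = hom_subst 6 g [:b, a:] [:d, c:]
         in smult e h' = H + 2 * t \<and> smult (e ^ 2) g' = G - H * t - t ^ 2))"

type_synonym 'p Fp_bar = "'p mod_ring alg_closure"

definition reduction :: "int poly \<Rightarrow> 'p::prime_card Fp_bar poly" where
  "reduction q = map_poly of_int q"

text \<open>
  \<open>Y\<^sup>2 + h Y = g\<close> is an integral model of \<open>y\<^sup>2 = f(x)\<close> whose reduction modulo \<open>p = CARD('p)\<close> is
  smooth of genus 2. The curve has good reduction at \<open>p\<close> iff such a model exists, and the special
  fibre is then unique up to isomorphism. Models with coefficients in the localization of
  \<open>\<int>\<close> at \<open>p\<close> need not be considered separately: replacing \<open>(h, g)\<close> by \<open>(m h, m\<^sup>2 g)\<close>, where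
  \<open>p\<close> does not divide \<open>m\<close>, clears denominators without changing the curve over that ring.
\<close>

definition good_model :: "'p::prime_card itself \<Rightarrow> rat poly \<Rightarrow> int poly \<Rightarrow> int poly \<Rightarrow> bool" where
  "good_model TYPE('p) f h g \<longleftrightarrow>
     Polynomial.degree h \<le> 3 \<and> Polynomial.degree g \<le> 6 \<and>
     isomorphic_models 0 f (map_poly of_int h) (map_poly of_int g) \<and>
     genus2_curve (reduction h :: 'p Fp_bar poly) (reduction g)"


section \<open>Rational points of the Jacobian over a prime field\<close>

fun frob_point :: "'p::prime_card Fp_bar point \<Rightarrow> 'p Fp_bar point" where
  "frob_point (Affine a b) = Affine (a ^ CARD('p)) (b ^ CARD('p))"
| "frob_point (Inf b) = Inf (b ^ CARD('p))"

definition frob_divisor :: "'p::prime_card Fp_bar divisor \<Rightarrow> 'p Fp_bar divisor" where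
  "frob_divisor D =
     (\<Sum>Q\<in>Poly_Mapping.keys D. Poly_Mapping.single (frob_point Q) (Poly_Mapping.lookup D Q))"

text \<open>
  A point of the Jacobian, that is, a divisor class, is rational over the prime field iff it is
  fixed by the Frobenius automorphism, which topologically generates the absolute Galois group.
\<close>

definition Fp_rational :: "'p::prime_card Fp_bar divisor set \<Rightarrow> bool" where
  "Fp_rational c \<longleftrightarrow> frob_divisor ` c = c"

end

theory Submission
  imports Defs
begin

text \<open>
  The equation \<open>5 ([P\<^sub>1] + [P\<^sub>2] - [\<infinity>\<^sub>1] - [\<infinity>\<^sub>2]) = 0\<close> says that some form \<open>F\<close> of degree 5 on the curve has
  divisor \<open>5 ([P\<^sub>1] + [P\<^sub>2])\<close>; this survives the change to the good model. By Chevalley's extension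
  theorem there is a place \<open>R \<rightarrow> k\<close> of the complex numbers, where \<open>k\<close> is an algebraic closure of the
  prime field with \<open>p\<close> elements. Scaled to have coefficients in \<open>R\<close> and nonzero reduction, \<open>F\<close> reduces
  to a form with divisor \<open>5 ([Q\<^sub>1] + [Q\<^sub>2])\<close>, where \<open>Q\<^sub>i\<close> is the reduction of \<open>P\<^sub>i\<close>. With \<open>\<iota>\<close> the
  hyperelliptic involution, the class of \<open>[Q\<^sub>1] - [\<iota> Q\<^sub>2]\<close> is therefore
  5-torsion. It is nontrivial as soon as \<open>Q\<^sub>1 \<noteq> \<iota> Q\<^sub>2\<close>, which holds because the reduction is injective on
  5-torsion for \<open>p \<noteq> 5\<close>. Since \<open>p\<close> splits in \<open>\<rat>(\<surd>d)\<close>, the place maps the elements of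
  that field which lie in \<open>R\<close> to the prime field. All symmetric expressions in \<open>P\<^sub>1\<close> and \<open>P\<^sub>2\<close> lie in the field, so
  Frobenius permutes \<open>{Q\<^sub>1, Q\<^sub>2}\<close>, and this fixes the class because all divisors \<open>[Q] + [\<iota> Q]\<close> are
  linearly equivalent.
\<close>

text \<open>Orders of vanishing do not pass through a place, polynomial identities do. That
  \<open>F\<close> has divisor 5 (P1 + P2) is therefore encoded by identities: if
  \<open>w + y\<close> vanishes at the opposite of P1, then \<open>F (w + y)^5\<close> is divisible
  by the fifth power of the linear form of P1; likewise for P2, and for both at once, which settles
  P1 = P2. They bound the orders from below; the norm of \<open>F\<close> bounds them from above.
  The same identities carry \<open>F\<close> through a change of model. Injectivity on 5-torsion is
  proved by hand. If P1 and the opposite P2' of P2 had the same reduction Q, the function with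
  divisor 5 P1 - 5 P2' would be a local unit times (T1 / T2)^5, with local parameters T1 = T2 -
  \<delta>, and would reduce to a constant c. To first order (1 - \<delta> / T2)^5 is 1 - 5 \<delta>
  / T2. So the function minus c, scaled by the larger of its own size and that of \<delta>, would
  reduce to a function whose only pole is at most simple and at Q. Genus 2 makes it constant, the
  choice of c makes it zero, and the term 5 c \<delta> / T2 is left with nothing to cancel it. The
  class [Q1] - [\<iota> Q2] is preferred because it does not mention the points at infinity, which a
  change of model moves.\<close>

section \<open>Homogeneous evaluation of binary forms\<close>

text \<open>The degree-\<open>n\<close> homogenization of \<open>A\<close> at
  \<open>(Xs : Zs)\<close>, with coefficients mapped by \<open>\<phi>\<close>. Constant polynomials
  as coefficients give \<open>hom_subst\<close>, \<open>fps_const\<close> gives evaluation along a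
  branch, and the identity gives plain values, so one set of lemmas serves all three.\<close>

definition heval :: "('a::comm_ring_1 \<Rightarrow> 'b::comm_ring_1) \<Rightarrow> nat \<Rightarrow> 'a poly \<Rightarrow> 'b \<Rightarrow> 'b \<Rightarrow> 'b" where
  "heval \<phi> n A Xs Zs = (\<Sum>i\<le>n. \<phi> (Polynomial.coeff A i) * Xs ^ i * Zs ^ (n - i))"

context comm_ring_hom begin

lemma heval_0 [simp]: "heval hom n 0 Xs Zs = 0"
  by (simp add: heval_def)

lemma heval_add: "heval hom n (A + B) Xs Zs = heval hom n A Xs Zs + heval hom n B Xs Zs"
  by (simp add: heval_def hom_add distrib_right sum.distrib)

lemma heval_smult: "heval hom n (smult c A) Xs Zs = hom c * heval hom n A Xs Zs"
  by (simp add: heval_def hom_mult sum_distrib_left mult.assoc)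

lemma heval_uminus: "heval hom n (- A) Xs Zs = - heval hom n A Xs Zs"
  using heval_smult[of n "- 1" A Xs Zs] by (simp add: hom_uminus)

lemma heval_diff: "heval hom n (A - B) Xs Zs = heval hom n A Xs Zs - heval hom n B Xs Zs"
  using heval_add[of n A "- B" Xs Zs] by (simp add: heval_uminus)

lemma heval_pCons:
  "heval hom (Suc n) (pCons a A) Xs Zs = hom a * Zs ^ Suc n + Xs * heval hom n A Xs Zs"
  unfolding heval_def
  by (subst sum.atMost_Suc_shift) (simp add: sum_distrib_left mult_ac)

lemma heval_raise:
  assumes "Polynomial.degree A \<le> n"
  shows "heval hom (n + k) A Xs Zs = Zs ^ k * heval hom n A Xs Zs"
proof -
  have "heval hom (n + k) A Xs Zs = (\<Sum>i\<le>n. hom (Polynomial.coeff A i) * Xs ^ i * Zs ^ (n + k - i))"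
    unfolding heval_def using assms by (intro sum.mono_neutral_right) (auto simp: coeff_eq_0)
  also have "\<dots> = Zs ^ k * heval hom n A Xs Zs"
    unfolding heval_def sum_distrib_left
  proof (rule sum.cong)
    fix i assume "i \<in> {..n}"
    then have "n + k - i = k + (n - i)" by simp
    then show "hom (Polynomial.coeff A i) * Xs ^ i * Zs ^ (n + k - i)
        = Zs ^ k * (hom (Polynomial.coeff A i) * Xs ^ i * Zs ^ (n - i))"
      by (simp add: power_add mult_ac)
  qed simp
  finally show ?thesis .
qed

lemma heval_mult:
  assumes "Polynomial.degree A \<le> n" "Polynomial.degree B \<le> m"
  shows "heval hom (n + m) (A * B) Xs Zs = heval hom n A Xs Zs * heval hom m B Xs Zs"
  using assms(1)
proof (induction n arbitrary: A)
  case 0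
  then obtain a where "A = [:a:]" by (auto elim: degree_eq_zeroE)
  then show ?case by (simp add: heval_smult) (simp add: heval_def)
next
  case (Suc n)
  obtain a A' where A: "A = pCons a A'" by (cases A)
  have A': "Polynomial.degree A' \<le> n" using Suc.prems A by (auto simp: degree_pCons_eq_if split: if_splits)
  have "heval hom (Suc n + m) (A * B) Xs Zs
      = hom a * heval hom (m + Suc n) B Xs Zs + heval hom (Suc (n + m)) (pCons 0 (A' * B)) Xs Zs"
    by (simp add: A mult_pCons_left heval_add heval_smult add.commute)
  also have "\<dots> = hom a * (Zs ^ Suc n * heval hom m B Xs Zs) + Xs * (heval hom n A' Xs Zs * heval hom m B Xs Zs)"
    using heval_raise[OF assms(2), of "Suc n" Xs Zs] Suc.IH[OF A']
    by (simp add: heval_pCons)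
  also have "\<dots> = heval hom (Suc n) A Xs Zs * heval hom m B Xs Zs"
    by (simp add: A heval_pCons algebra_simps)
  finally show ?case .
qed

lemma heval_1: "heval hom n 1 Xs Zs = Zs ^ n"
  using heval_raise[of 1 0 n Xs Zs] by (simp add: heval_def)

lemma heval_power:
  assumes "Polynomial.degree A \<le> n"
  shows "heval hom (n * k) (A ^ k) Xs Zs = heval hom n A Xs Zs ^ k"
proof (induction k)
  case (Suc k)
  have "Polynomial.degree (A ^ k) \<le> n * k"
    by (rule le_trans[OF degree_power_le mult_le_mono1[OF assms]])
  from heval_mult[OF assms this, of Xs Zs] Suc show ?case by (simp add: add.commute mult.commute)
qed (simp add: heval_def)

lemma heval_scale: "heval hom n A (u * Xs) (u * Zs) = u ^ n * heval hom n A Xs Zs"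
  unfolding heval_def sum_distrib_left
proof (rule sum.cong)
  fix i assume "i \<in> {..n}"
  then have "u ^ n = u ^ i * u ^ (n - i)" by (simp flip: power_add)
  then show "hom (Polynomial.coeff A i) * (u * Xs) ^ i * (u * Zs) ^ (n - i)
      = u ^ n * (hom (Polynomial.coeff A i) * Xs ^ i * Zs ^ (n - i))"
    by (simp add: power_mult_distrib mult_ac)
qed simp

lemma heval_Z_1:
  assumes "Polynomial.degree A \<le> n"
  shows "heval hom n A Xs 1 = poly (map_poly hom A) Xs"
proof -
  have "poly (map_poly hom A) Xs = (\<Sum>i\<le>n. Polynomial.coeff (map_poly hom A) i * Xs ^ i)"
    by (rule poly_as_sum_of_monoms'[THEN arg_cong[of _ _ "\<lambda>p. poly p Xs"], unfolded poly_sum poly_monom, symmetric])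
       (use assms degree_map_poly_le le_trans in blast)
  then show ?thesis by (simp add: heval_def)
qed

end

lemma coeff_rev_poly:
  "Polynomial.coeff (rev_poly n f) k = (if k \<le> n then Polynomial.coeff f (n - k) else 0)"
proof -
  have mon: "smult c ([:0, 1:] ^ j) = Polynomial.monom c j" for c :: 'a and j
    by (simp add: monom_altdef)
  have "rev_poly n f = (\<Sum>i\<le>n. Polynomial.monom (Polynomial.coeff f i) (n - i))"
    unfolding rev_poly_def hom_subst_def by (simp add: mon)
  then have "Polynomial.coeff (rev_poly n f) k = (\<Sum>i\<le>n. if n - i = k then Polynomial.coeff f i else 0)"
    by (simp add: coeff_sum)
  also have "\<dots> = (\<Sum>i\<le>n. if i = n - k \<and> k \<le> n then Polynomial.coeff f i else 0)"
    by (rule sum.cong) auto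
  also have "\<dots> = (if k \<le> n then Polynomial.coeff f (n - k) else 0)"
    by (cases "k \<le> n") auto
  finally show ?thesis .
qed

lemma degree_rev_poly: "Polynomial.degree (rev_poly n f) \<le> n"
  by (rule degree_le) (simp add: coeff_rev_poly)

lemma rev_rev_poly: "Polynomial.degree f \<le> n \<Longrightarrow> rev_poly n (rev_poly n f) = f"
  by (rule poly_eqI) (auto simp: coeff_rev_poly coeff_eq_0)

lemma rev_poly_eq_0_iff: "Polynomial.degree f \<le> n \<Longrightarrow> rev_poly n f = 0 \<longleftrightarrow> f = 0"
proof
  assume "Polynomial.degree f \<le> n" "rev_poly n f = 0"
  then have "f = rev_poly n 0" using rev_rev_poly by metis
  then show "f = 0" by (simp add: rev_poly_def hom_subst_def)
qed (simp add: rev_poly_def hom_subst_def)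

lemma poly_rev_poly_0: "poly (rev_poly n f) 0 = Polynomial.coeff f n"
  by (simp add: poly_0_coeff_0 coeff_rev_poly)

lemma (in comm_ring_hom) heval_rev_poly: "heval hom n (rev_poly n A) Xs Zs = heval hom n A Zs Xs"
  unfolding heval_def
  by (subst sum.nat_diff_reindex[symmetric, where n = "Suc n", unfolded lessThan_Suc_atMost])
     (auto simp: coeff_rev_poly mult_ac intro!: sum.cong)

lemma hom_subst_heval: "hom_subst n f L M = heval (\<lambda>c. [:c:]) n f L M"
  by (simp add: hom_subst_def heval_def mult.assoc)

interpretation const_poly_hom: comm_ring_hom "\<lambda>c::'a::comm_ring_1. [:c:]"
  by unfold_locales (auto simp: one_pCons)

interpretation fps_const_hom: comm_ring_hom "fps_const :: 'a::comm_ring_1 \<Rightarrow> 'a fps"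
  by unfold_locales auto

section \<open>Substitution of power series\<close>

definition fpoly :: "'a::field poly \<Rightarrow> 'a fps \<Rightarrow> 'a fps" where
  "fpoly q \<xi> = poly (map_poly fps_const q) \<xi>"

lemma fpoly_hom: "comm_ring_hom (\<lambda>q. fpoly q \<xi>)"
proof -
  interpret map_poly_comm_ring_hom "fps_const :: 'a \<Rightarrow> 'a fps" ..
  show ?thesis by unfold_locales (auto simp: fpoly_def hom_distribs)
qed

lemma fpoly_0 [simp]: "fpoly 0 \<xi> = 0" and fpoly_1 [simp]: "fpoly 1 \<xi> = 1"
  and fpoly_add: "fpoly (p + q) \<xi> = fpoly p \<xi> + fpoly q \<xi>"
  and fpoly_mult: "fpoly (p * q) \<xi> = fpoly p \<xi> * fpoly q \<xi>"
  and fpoly_diff: "fpoly (p - q) \<xi> = fpoly p \<xi> - fpoly q \<xi>"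
  and fpoly_uminus: "fpoly (- p) \<xi> = - fpoly p \<xi>"
  and fpoly_power: "fpoly (p ^ n) \<xi> = fpoly p \<xi> ^ n"
proof -
  interpret comm_ring_hom "\<lambda>q. fpoly q \<xi>" by (rule fpoly_hom)
  show "fpoly 0 \<xi> = 0" "fpoly 1 \<xi> = 1" "fpoly (p + q) \<xi> = fpoly p \<xi> + fpoly q \<xi>"
    "fpoly (p * q) \<xi> = fpoly p \<xi> * fpoly q \<xi>" "fpoly (p - q) \<xi> = fpoly p \<xi> - fpoly q \<xi>"
    "fpoly (- p) \<xi> = - fpoly p \<xi>" "fpoly (p ^ n) \<xi> = fpoly p \<xi> ^ n"
    by (simp_all add: hom_distribs)
qed

lemma fpoly_pCons [simp]: "fpoly (pCons a p) \<xi> = fps_const a + \<xi> * fpoly p \<xi>"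
  by (simp add: fpoly_def fps_const_hom.map_poly_pCons_hom)

lemma fpoly_smult: "fpoly (smult c p) \<xi> = fps_const c * fpoly p \<xi>"
  using fpoly_mult[of "[:c:]" p \<xi>] by simp

lemma fpoly_nth_0: "fpoly q \<xi> $ 0 = poly q (\<xi> $ 0)"
  by (induction q) simp_all

lemma fpoly_nth_1: "fpoly q \<xi> $ 1 = poly (pderiv q) (\<xi> $ 0) * \<xi> $ 1"
  by (induction q) (simp_all add: fps_mult_nth_1 fpoly_nth_0 pderiv_pCons algebra_simps)

lemma heval_fps_Z_1: "Polynomial.degree A \<le> n \<Longrightarrow> heval fps_const n A Xs 1 = fpoly A Xs"
  by (simp add: fps_const_hom.heval_Z_1 fpoly_def)

lemma heval_fps_X_1: "heval fps_const n A 1 Zs = fpoly (rev_poly n A) Zs"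
  using heval_fps_Z_1[OF degree_rev_poly, of n A Zs] by (simp add: fps_const_hom.heval_rev_poly)

section \<open>Hensel's lemma for power series\<close>

lemma poly_taylor2:
  fixes P :: "'a::idom poly"
  shows "\<exists>q. poly P (x + e) = poly P x + poly (pderiv P) x * e + e\<^sup>2 * q"
proof (induction P)
  case (pCons a P)
  then obtain q where q: "poly P (x + e) = poly P x + poly (pderiv P) x * e + e\<^sup>2 * q" by blast
  have "poly (pCons a P) (x + e) = poly (pCons a P) x + poly (pderiv (pCons a P)) x * e
      + e\<^sup>2 * (poly (pderiv P) x + (x + e) * q)"
    unfolding poly_pCons q pderiv_pCons poly_add by (simp add: algebra_simps power2_eq_square)
  then show ?case by blast
qed simp

lemma diff_dvd_poly_diff:
  fixes P :: "'a::comm_ring_1 poly"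
  shows "x - y dvd poly P x - poly P y"
proof (induction P)
  case (pCons a P)
  have "poly (pCons a P) x - poly (pCons a P) y = (x - y) * poly P x + y * (poly P x - poly P y)"
    by (simp add: algebra_simps)
  then show ?case using pCons by (metis dvd_add dvd_mult dvd_triv_left)
qed simp

lemma fps_X_power_dvd_iff: "fps_X ^ n dvd (f :: 'a::field fps) \<longleftrightarrow> (\<forall>k<n. f $ k = 0)"
proof
  assume "fps_X ^ n dvd f"
  then show "\<forall>k<n. f $ k = 0" by (auto simp: fps_X_power_mult_nth elim!: dvdE)
next
  assume *: "\<forall>k<n. f $ k = 0"
  have "f = fps_X ^ n * Abs_fps (\<lambda>i. f $ (i + n))"
    using * by (auto simp: fps_eq_iff fps_X_power_mult_nth)
  then show "fps_X ^ n dvd f" by (rule dvdI)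
qed

lemma fps_nth_0_poly:
  fixes P :: "'a::field fps poly"
  assumes "x $ 0 = y $ 0"
  shows "poly P x $ 0 = poly P y $ 0"
proof -
  have "fps_X ^ 1 dvd x - y" unfolding fps_X_power_dvd_iff using assms by simp
  then have "fps_X ^ 1 dvd poly P x - poly P y" using diff_dvd_poly_diff dvd_trans by blast
  then show ?thesis unfolding fps_X_power_dvd_iff by simp
qed

text \<open>Newton iteration, one coefficient per step. Only the constant coefficient
  \<open>c\<close> of the derivative matters, and it is the same for all approximations because they
  all vanish at 0.\<close>

lemma fps_hensel:
  fixes P :: "'a::field fps poly"
  assumes "Polynomial.coeff P 0 $ 0 = 0" and "Polynomial.coeff P 1 $ 0 \<noteq> 0"
  shows "\<exists>x. x $ 0 = 0 \<and> poly P x = 0"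
proof -
  define c where "c = Polynomial.coeff P 1 $ 0"
  have c: "c \<noteq> 0" using assms(2) by (simp add: c_def)
  define Good where "Good n x \<longleftrightarrow> x $ 0 = 0 \<and> fps_X ^ Suc n dvd poly P x" for n x
  have der: "poly (pderiv P) x $ 0 = c" if "x $ 0 = 0" for x
    using fps_nth_0_poly[of x 0 "pderiv P"] that by (simp add: c_def poly_0_coeff_0 coeff_pderiv)
  have step: "\<exists>y. Good (Suc n) y \<and> fps_X ^ Suc n dvd y - x" if "Good n x" for n x
  proof -
    have x0: "x $ 0 = 0" using that by (simp add: Good_def)
    \<comment> \<open>The multiple of \<open>fps_X ^ Suc n\<close> that cancels the lowest error
      coefficient to first order; the quadratic Taylor remainder has order at least 2 n + 2.\<close>
    define e where "e = fps_const (- (poly P x $ Suc n) / c) * fps_X ^ Suc n"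
    obtain q where q: "poly P (x + e) = poly P x + poly (pderiv P) x * e + e\<^sup>2 * q"
      using poly_taylor2 by blast
    have e: "fps_X ^ Suc n dvd e" by (simp add: e_def)
    have low: "poly P x $ k = 0" if "k < Suc n" for k
      using \<open>Good n x\<close> that unfolding Good_def fps_X_power_dvd_iff by blast
    have e2: "fps_X ^ Suc (Suc n) dvd e\<^sup>2 * q"
    proof -
      have "fps_X ^ Suc (Suc n) dvd fps_X ^ (Suc n + Suc n)" by (rule le_imp_power_dvd) simp
      also have "\<dots> dvd e * e" unfolding power_add using e by (rule mult_dvd_mono) (rule e)
      finally show ?thesis by (simp add: power2_eq_square dvd_mult2)
    qed
    have ek: "(poly (pderiv P) x * e) $ k = (if k < Suc n then 0 else
        poly (pderiv P) x $ (k - Suc n) * (- (poly P x $ Suc n) / c))" for k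
    proof -
      have "poly (pderiv P) x * e = fps_X ^ Suc n * (poly (pderiv P) x * fps_const (- (poly P x $ Suc n) / c))"
        by (simp add: e_def mult_ac)
      then show ?thesis unfolding fps_X_power_mult_nth by (simp only: fps_X_power_mult_nth) simp
    qed
    have "poly P (x + e) $ k = 0" if "k < Suc (Suc n)" for k
    proof -
      have "(e\<^sup>2 * q) $ k = 0" using e2 that unfolding fps_X_power_dvd_iff by blast
      then show ?thesis unfolding q fps_add_nth ek using low[of k] that der[OF x0] c
        by (cases "k < Suc n") (auto simp: less_Suc_eq)
    qed
    then have "fps_X ^ Suc (Suc n) dvd poly P (x + e)" unfolding fps_X_power_dvd_iff by blast
    moreover have "(x + e) $ 0 = 0" using x0 e unfolding fps_X_power_dvd_iff by simp
    ultimately show ?thesis using e unfolding Good_def by (intro exI[of _ "x + e"]) simp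
  qed
  have base: "Good 0 0" using assms(1) fps_X_power_dvd_iff[of 1 "Polynomial.coeff P 0"]
    by (simp add: Good_def poly_0_coeff_0)
  obtain s where s: "\<And>n. Good n (s n)" "\<And>n. fps_X ^ Suc n dvd s (Suc n) - s n"
    using dependent_nat_choice[of Good "\<lambda>n x y. fps_X ^ Suc n dvd y - x"] base step by blast
  \<comment> \<open>Coefficient \<open>k\<close> no longer changes from step \<open>k\<close> on, so
    the diagonal is the limit.\<close>
  define x where "x = Abs_fps (\<lambda>k. s k $ k)"
  have stab: "s (k + j) $ k = s k $ k" for k j
  proof (induction j)
    case (Suc j)
    have "(s (Suc (k + j)) - s (k + j)) $ k = 0"
      using s(2)[of "k + j"] unfolding fps_X_power_dvd_iff by simp
    then show ?case using Suc by simp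
  qed simp
  have cong: "fps_X ^ Suc n dvd x - s n" for n
    unfolding fps_X_power_dvd_iff
  proof (intro allI impI)
    fix k assume "k < Suc n"
    then show "(x - s n) $ k = 0" using stab[of k "n - k"] by (simp add: x_def)
  qed
  have "poly P x $ n = 0" for n
  proof -
    have "fps_X ^ Suc n dvd poly P x - poly P (s n)" using cong diff_dvd_poly_diff dvd_trans by blast
    then have "fps_X ^ Suc n dvd poly P x" using s(1)[of n] unfolding Good_def
      using dvd_add[of _ "poly P x - poly P (s n)" "poly P (s n)"] by simp
    then show ?thesis unfolding fps_X_power_dvd_iff by blast
  qed
  then have "poly P x = 0" by (simp add: fps_eq_iff)
  moreover have "x $ 0 = 0" using s(1)[of 0] by (simp add: x_def Good_def)
  ultimately show ?thesis by blast
qed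

section \<open>Branches of plane curves\<close>

text \<open>A local parametrization with nonzero velocity. The condition at index 1 excludes
  reparametrizations such as substituting a square for the variable, so orders in the series
  variable are orders at the point.\<close>

definition branch :: "'a::field poly \<Rightarrow> 'a poly \<Rightarrow> 'a \<Rightarrow> 'a \<Rightarrow> 'a fps \<Rightarrow> 'a fps \<Rightarrow> bool" where
  "branch h g a b \<xi> \<eta> \<longleftrightarrow> \<xi> $ 0 = a \<and> \<eta> $ 0 = b \<and> (\<xi> $ 1 \<noteq> 0 \<or> \<eta> $ 1 \<noteq> 0) \<and>
     \<eta>\<^sup>2 + fpoly h \<xi> * \<eta> = fpoly g \<xi>"

text \<open>Comparison of the coefficients of index 1 in the curve equation. It yields the case
  split used throughout: at an ordinary point x is a local parameter, at a ramification point of x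
  it is y.\<close>

lemma branch_tangent:
  assumes "branch h g a b \<xi> \<eta>"
  shows "(2 * b + poly h a) * \<eta> $ 1 + (poly (pderiv h) a * b - poly (pderiv g) a) * \<xi> $ 1 = 0"
proof -
  have "(\<eta>\<^sup>2 + fpoly h \<xi> * \<eta>) $ 1 = fpoly g \<xi> $ 1" using assms by (simp add: branch_def)
  then show ?thesis using assms
    by (simp add: branch_def power2_eq_square fps_mult_nth_1 fpoly_nth_0 fpoly_nth_1[unfolded One_nat_def] algebra_simps)
qed

lemma branch_on_curve:
  assumes "branch h g a b \<xi> \<eta>"
  shows "b\<^sup>2 + poly h a * b = poly g a"
proof -
  have "(\<eta>\<^sup>2 + fpoly h \<xi> * \<eta>) $ 0 = fpoly g \<xi> $ 0" using assms by (simp add: branch_def)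
  then show ?thesis using assms
    by (simp add: branch_def power2_eq_square fpoly_nth_0)
qed

lemma branch_ordinary:
  assumes "branch h g a b \<xi> \<eta>" "2 * b + poly h a \<noteq> 0"
  shows "\<xi> $ 1 \<noteq> 0"
  using branch_tangent[OF assms(1)] assms by (auto simp: branch_def)

lemma branch_ramified:
  assumes "branch h g a b \<xi> \<eta>" "\<not> singular_at h g a b" "2 * b + poly h a = 0"
  shows "\<xi> $ 1 = 0" "\<eta> $ 1 \<noteq> 0"
proof -
  show "\<xi> $ 1 = 0"
    using branch_tangent[OF assms(1)] assms branch_on_curve[OF assms(1)] by (auto simp: singular_at_def)
  then show "\<eta> $ 1 \<noteq> 0" using assms(1) by (auto simp: branch_def)
qed

lemma fps_nth_1_subdegree:
  assumes "(f :: 'a::field fps) $ 0 = 0" "f $ 1 \<noteq> 0"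
  shows "subdegree f = 1"
  using assms by (intro subdegreeI) auto

lemma fps_nth_0_subdegree: "(f :: 'a::field fps) $ 0 \<noteq> 0 \<Longrightarrow> subdegree f = 0"
  by (rule subdegree_eq_0) 

lemma poly_split_const: "\<exists>q. p = [:poly p a:] + [:- a, 1:] * q" for p :: "'a::comm_ring_1 poly"
proof -
  have "poly (p - [:poly p a:]) a = 0" by simp
  then obtain q where "p - [:poly p a:] = [:- a, 1:] * q"
    unfolding poly_eq_0_iff_dvd by (rule dvdE)
  then have "p = [:poly p a:] + [:- a, 1:] * q" by (metis add.commute diff_add_cancel)
  then show ?thesis by blast
qed

text \<open>\<open>poly q a\<close> is the x-derivative of the equation at the point, so at a
  ramification point nonsingularity says exactly that it is nonzero.\<close>

lemma curve_split:
  assumes "b\<^sup>2 + poly h a * b = poly g a"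
  obtains q where "[:b\<^sup>2:] + smult b h - g = [:- a, 1:] * q"
    and "poly q a = poly (pderiv h) a * b - poly (pderiv (g :: 'a::field poly)) a"
proof -
  let ?p = "[:b\<^sup>2:] + smult b h - g"
  have "poly ?p a = 0" using assms by (simp add: mult.commute)
  then obtain q where q: "?p = [:- a, 1:] * q" unfolding poly_eq_0_iff_dvd by (rule dvdE)
  have "poly (pderiv ?p) a = poly q a" unfolding q
    by (simp add: pderiv_mult pderiv_pCons del: mult_pCons_left)
  then have "poly q a = poly (pderiv h) a * b - poly (pderiv g) a"
    by (simp add: pderiv_add pderiv_diff pderiv_smult pderiv_pCons mult.commute)
  with q that show thesis by blast
qed

lemma fpoly_linear: "fpoly [:- a, 1:] \<xi> = \<xi> - fps_const a"
  by (simp flip: fps_const_neg)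

text \<open>The equation at \<open>y = b\<close> is subtracted from the equation along the branch;
  the difference factors as that of two values of a monic quadratic polynomial.\<close>

lemma branch_factor:
  assumes "branch h g a b \<xi> \<eta>" "[:b\<^sup>2:] + smult b h - g = [:- a, 1:] * q"
  shows "(\<eta> - fps_const b) * (\<eta> + fps_const b + fpoly h \<xi>) = - ((\<xi> - fps_const a) * fpoly q \<xi>)"
proof -
  have "fpoly ([:b\<^sup>2:] + smult b h - g) \<xi> = fpoly ([:- a, 1:] * q) \<xi>" using assms(2) by simp
  then have "fps_const b ^ 2 + fps_const b * fpoly h \<xi> - fpoly g \<xi> = (\<xi> - fps_const a) * fpoly q \<xi>"
    unfolding fpoly_mult fpoly_diff fpoly_add fpoly_smult fpoly_linear
    by (simp add: fps_const_power)
  moreover have "\<eta>\<^sup>2 + fpoly h \<xi> * \<eta> = fpoly g \<xi>" using assms(1) by (simp add: branch_def)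
  ultimately show ?thesis by (simp add: algebra_simps power2_eq_square)
qed

lemma branch_subdegree_ordinary:
  assumes "branch h g a b \<xi> \<eta>" "2 * b + poly h a \<noteq> 0"
  shows "subdegree (\<xi> - fps_const a) = 1"
  using branch_ordinary[OF assms] assms(1) by (intro fps_nth_1_subdegree) (auto simp: branch_def)

lemma branch_subdegree_ramified_y:
  assumes "branch h g a b \<xi> \<eta>" "\<not> singular_at h g a b" "2 * b + poly h a = 0" "poly w a = - b"
  shows "subdegree (\<eta> + fpoly w \<xi>) = 1"
  using branch_ramified[OF assms(1-3)] assms
  by (intro fps_nth_1_subdegree)
     (auto simp: branch_def fpoly_nth_0 fpoly_nth_1[unfolded One_nat_def])

text \<open>Both factors on the left of \<open>branch_factor\<close> have order 1 at a ramification
  point, and \<open>q\<close> is a unit there.\<close>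

lemma branch_subdegree_ramified:
  assumes br: "branch h g a b \<xi> \<eta>" and ns: "\<not> singular_at h g a b" and ram: "2 * b + poly h a = 0"
  shows "subdegree (\<xi> - fps_const a) = 2"
proof -
  have cv: "b\<^sup>2 + poly h a * b = poly g a" by (rule branch_on_curve[OF br])
  from curve_split[OF cv] obtain q where q: "[:b\<^sup>2:] + smult b h - g = [:- a, 1:] * q"
    and qa: "poly q a = poly (pderiv h) a * b - poly (pderiv g) a" by blast
  have "poly q a \<noteq> 0" using ns ram cv by (simp add: qa singular_at_def)
  then have q0: "fpoly q \<xi> $ 0 \<noteq> 0" using br by (simp add: branch_def fpoly_nth_0)
  have 1: "subdegree (\<eta> - fps_const b) = 1"
    using branch_subdegree_ramified_y[OF br ns ram, of "[:- b:]"]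
    by (simp add: fps_const_neg[symmetric] del: fps_const_neg)
  have "poly ([:b:] + h) a = - b" using ram by (simp add: algebra_simps eq_neg_iff_add_eq_0)
  then have 2: "subdegree (\<eta> + fps_const b + fpoly h \<xi>) = 1"
    using branch_subdegree_ramified_y[OF br ns ram, of "[:b:] + h"]
    by (simp add: fpoly_add add.assoc)
  have nz: "\<eta> - fps_const b \<noteq> 0" "\<eta> + fps_const b + fpoly h \<xi> \<noteq> 0" using 1 2 by auto
  have "subdegree ((\<xi> - fps_const a) * fpoly q \<xi>) = 2"
    using 1 2 nz branch_factor[OF br q]
    by (metis one_add_one subdegree_mult subdegree_uminus)
  moreover from this have "(\<xi> - fps_const a) * fpoly q \<xi> \<noteq> 0" by auto
  ultimately show ?thesis using q0 by (auto simp: fps_nth_0_subdegree)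
qed

text \<open>Hensel's lemma solves for y in terms of x where the y-derivative is nonzero, and for x
  in terms of y otherwise.\<close>

lemma branch_exists:
  assumes cv: "b\<^sup>2 + poly h a * b = poly g a" and ns: "\<not> singular_at h g a b"
  shows "\<exists>\<xi> \<eta>. branch h g a b \<xi> \<eta>"
proof (cases "2 * b + poly h a = 0")
  case False
  let ?x = "fps_const a + fps_X" and ?b = "fps_const b"
  let ?P = "[:?b\<^sup>2 + fpoly h ?x * ?b - fpoly g ?x, 2 * ?b + fpoly h ?x, 1:]"
  have "\<exists>z. z $ 0 = 0 \<and> poly ?P z = 0"
    by (rule fps_hensel)
       (use cv False in \<open>simp_all add: fpoly_nth_0 power2_eq_square numeral_fps_const\<close>)
  then obtain z where z: "z $ 0 = 0" "poly ?P z = 0" by blast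
  have "(?b + z)\<^sup>2 + fpoly h ?x * (?b + z) = fpoly g ?x"
    using z(2) by (simp add: algebra_simps power2_eq_square)
  then have "branch h g a b ?x (?b + z)" using z(1) by (simp add: branch_def)
  then show ?thesis by blast
next
  case True
  let ?y = "fps_const b + fps_X"
  \<comment> \<open>\<open>H q\<close> is \<open>q\<close> expanded around \<open>a\<close>, as a
    polynomial in the unknown x - a over the power series ring whose variable is y - b.\<close>
  define H where "H q = pcompose (map_poly fps_const q) [:fps_const a, 1:]" for q :: "'a poly"
  let ?P = "[:?y\<^sup>2:] + smult ?y (H h) - H g"
  have val: "poly (H q) z = fpoly q (fps_const a + z)" for q z
    by (simp add: H_def poly_pcompose fpoly_def)
  have c0: "Polynomial.coeff (H q) 0 $ 0 = poly q a" for q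
    using val[of q 0] by (simp add: fpoly_nth_0 poly_0_coeff_0)
  have c1: "Polynomial.coeff (H q) 1 $ 0 = poly (pderiv q) a" for q
  proof -
    have der: "pderiv (map_poly fps_const q) = map_poly fps_const (pderiv q)"
      by (rule poly_eqI) (simp add: coeff_pderiv del: of_nat_Suc flip: fps_of_nat)
    have "Polynomial.coeff (H q) 1 = poly (pderiv (H q)) 0"
      by (simp add: poly_0_coeff_0 coeff_pderiv)
    also have "\<dots> = fpoly (pderiv q) (fps_const a)"
      by (simp add: H_def pderiv_pcompose poly_pcompose pderiv_pCons fpoly_def der)
    finally show ?thesis by (simp add: fpoly_nth_0)
  qed
  have "\<exists>z. z $ 0 = 0 \<and> poly ?P z = 0"
  proof (rule fps_hensel)
    show "Polynomial.coeff ?P 0 $ 0 = 0"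
      using cv c0[of h] c0[of g] by (simp add: power2_eq_square mult.commute)
    show "Polynomial.coeff ?P 1 $ 0 \<noteq> 0"
      using ns cv True c1[of h] c1[of g] by (simp add: singular_at_def mult.commute)
  qed
  then obtain z where z: "z $ 0 = 0" "poly ?P z = 0" by blast
  have "?y\<^sup>2 + fpoly h (fps_const a + z) * ?y = fpoly g (fps_const a + z)"
    using z(2) by (simp add: val mult.commute)
  then have "branch h g a b (fps_const a + z) ?y" using z(1) by (simp add: branch_def)
  then show ?thesis by blast
qed

section \<open>Order of vanishing along a branch\<close>

definition fpoly2 :: "'a::field poly poly \<Rightarrow> 'a fps \<Rightarrow> 'a fps \<Rightarrow> 'a fps" where
  "fpoly2 F \<xi> \<eta> = poly (map_poly (\<lambda>q. fpoly q \<xi>) F) \<eta>"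

lemma fpoly2_hom: "comm_ring_hom (\<lambda>F. fpoly2 F \<xi> \<eta>)"
proof -
  interpret f: comm_ring_hom "\<lambda>q. fpoly q \<xi>" by (rule fpoly_hom)
  interpret map_poly_comm_ring_hom "\<lambda>q. fpoly q \<xi>" ..
  show ?thesis by unfold_locales (auto simp: fpoly2_def hom_distribs)
qed

lemma fpoly2_pCons [simp]: "fpoly2 (pCons q F) \<xi> \<eta> = fpoly q \<xi> + \<eta> * fpoly2 F \<xi> \<eta>"
proof -
  interpret comm_ring_hom "\<lambda>q. fpoly q \<xi>" by (rule fpoly_hom)
  show ?thesis by (simp add: fpoly2_def map_poly_pCons_hom)
qed

lemma fpoly2_0 [simp]: "fpoly2 0 \<xi> \<eta> = 0"
  by (simp add: fpoly2_def)

lemma fpoly2_1 [simp]: "fpoly2 1 \<xi> \<eta> = 1"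
  by (simp add: fpoly2_def)

lemma bipoly_split_const:
  fixes F :: "'a::field poly poly"
  obtains K L where "F = [:[:poly (poly F [:b:]) a:]:] + [:[:- a, 1:]:] * K + [:[:- b:], 1:] * L"
proof -
  obtain L where L: "F = [:poly F [:b:]:] + [:- [:b:], 1:] * L" using poly_split_const by blast
  obtain K where K: "poly F [:b:] = [:poly (poly F [:b:]) a:] + [:- a, 1:] * K"
    using poly_split_const by blast
  have "F = [:[:poly (poly F [:b:]) a:] + [:- a, 1:] * K:] + [:- [:b:], 1:] * L"
    using L K by simp
  also have "\<dots> = [:[:poly (poly F [:b:]) a:]:] + [:[:- a, 1:]:] * [:K:] + [:[:- b:], 1:] * L"
    by simp
  finally show thesis by (rule that)
qed

text \<open>Membership of \<open>F\<close> in the n-th power of the maximal ideal modulo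
  \<open>E\<close> is shown to be equivalent to divisibility by \<open>fps_X ^ n\<close> along the
  branch. One direction is immediate (\<open>J_imp\<close>), the other is
  \<open>key\<close>.\<close>

lemma plane_ord_branch:
  assumes br: "branch h g a b \<xi> \<eta>" and ns: "\<not> singular_at h g a b"
    and nz: "fpoly2 F \<xi> \<eta> \<noteq> 0"
  shows "plane_ord [:- g, h, 1:] a b F = subdegree (fpoly2 F \<xi> \<eta>)"
proof -
  define E where "E = [:- g, h, 1:]"
  define x where "x = [:[:- a, 1:]:]"
  define y where "y = [:[:- b:], 1:]"
  define ev where "ev G = fpoly2 G \<xi> \<eta>" for G
  interpret ev: comm_ring_hom ev unfolding ev_def by (rule fpoly2_hom)
  define J where "J n G \<longleftrightarrow> (\<exists>H. E dvd G - (\<Sum>i\<le>n. x ^ i * y ^ (n - i) * H i))" for n :: nat and G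
  have cv: "b\<^sup>2 + poly h a * b = poly g a" by (rule branch_on_curve[OF br])
  have evE: "ev E = 0" using br by (simp add: ev_def E_def branch_def fpoly_uminus algebra_simps power2_eq_square)
  have evx: "ev x = \<xi> - fps_const a" by (simp add: ev_def x_def flip: fps_const_neg)
  have evy: "ev y = \<eta> - fps_const b" by (simp add: ev_def y_def flip: fps_const_neg)
  have dv: "fps_X dvd ev x" "fps_X dvd ev y"
    using br fps_X_power_dvd_iff[of 1 "ev x"] fps_X_power_dvd_iff[of 1 "ev y"]
    by (simp_all add: evx evy branch_def)
  have ev_cong: "ev G = ev G'" if "E dvd G - G'" for G G'
  proof -
    from that obtain k where "G - G' = E * k" by (rule dvdE)
    then have "ev (G - G') = ev (E * k)" by (rule arg_cong)
    then have "ev G - ev G' = ev E * ev k" by (simp only: ev.hom_minus ev.hom_mult)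
    then show ?thesis by (simp add: evE)
  qed
  have split: "\<exists>K L. G = [:[:poly (poly G [:b:]) a:]:] + x * K + y * L" for G
  proof -
    obtain K L where "G = [:[:poly (poly G [:b:]) a:]:] + [:[:- a, 1:]:] * K + [:[:- b:], 1:] * L"
      by (rule bipoly_split_const)
    then show ?thesis unfolding x_def y_def by (intro exI)
  qed
  have J_imp: "fps_X ^ n dvd ev G" if J: "J n G" for n G
  proof -
    from J[unfolded J_def] obtain H where "E dvd G - (\<Sum>i\<le>n. x ^ i * y ^ (n - i) * H i)" ..
    then have "ev G = ev (\<Sum>i\<le>n. x ^ i * y ^ (n - i) * H i)" by (rule ev_cong)
    also have "\<dots> = (\<Sum>i\<le>n. ev x ^ i * ev y ^ (n - i) * ev (H i))" by (simp add: ev.hom_sum hom_distribs)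
    also have "fps_X ^ n dvd \<dots>"
    proof (rule dvd_sum)
      fix i assume "i \<in> {..n}"
      then have "fps_X ^ n = (fps_X ^ i * fps_X ^ (n - i) :: 'a fps)" by (simp flip: power_add)
      then show "fps_X ^ n dvd ev x ^ i * ev y ^ (n - i) * ev (H i)"
        using mult_dvd_mono[OF dvd_power_same[OF dv(1), of i] dvd_power_same[OF dv(2), of "n - i"]]
        by (simp only: dvd_mult2)
    qed
    finally show ?thesis .
  qed
  have J_add: "J n (G1 + G2)" if "J n G1" "J n G2" for n G1 G2
  proof -
    from that(1)[unfolded J_def] obtain H1 where H1: "E dvd G1 - (\<Sum>i\<le>n. x ^ i * y ^ (n - i) * H1 i)" ..
    from that(2)[unfolded J_def] obtain H2 where H2: "E dvd G2 - (\<Sum>i\<le>n. x ^ i * y ^ (n - i) * H2 i)" ..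
    from dvd_add[OF H1 H2] show ?thesis unfolding J_def
      by (intro exI[of _ "\<lambda>i. H1 i + H2 i"]) (simp add: algebra_simps sum.distrib)
  qed
  have J_mult: "J n (G1 * G2)" if "J n G1" for n G1 G2
  proof -
    from that[unfolded J_def] obtain H1 where H1: "E dvd G1 - (\<Sum>i\<le>n. x ^ i * y ^ (n - i) * H1 i)" ..
    from dvd_mult2[OF H1, of G2] show ?thesis unfolding J_def
      by (intro exI[of _ "\<lambda>i. H1 i * G2"]) (simp add: algebra_simps sum_distrib_left)
  qed
  have J_E: "J n (E * G)" for n G
    unfolding J_def by (rule exI[of _ "\<lambda>_. 0"]) simp
  have J_lin: "J n ((k * x + l * y) ^ n)" for n k l
    unfolding J_def binomial_ring
    by (rule exI[of _ "\<lambda>i. of_nat (n choose i) * k ^ i * l ^ (n - i)"])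
       (simp add: power_mult_distrib mult_ac)
  \<comment> \<open>\<open>t\<close> is a coordinate with nonzero velocity and \<open>t'\<close> the
    other one. The relation \<open>u * t' = q * t\<close> modulo \<open>E\<close>, with
    \<open>u\<close> invertible at the point, says that \<open>t\<close> alone generates the maximal
    ideal locally.\<close>
  have key: "J n G"
    if G: "fps_X ^ n dvd ev G"
      and t: "(t = x \<and> t' = y) \<or> (t = y \<and> t' = x)" and t1: "ev t $ 1 \<noteq> 0"
      and ut: "E dvd u * t' - q * t" and u0: "poly (poly u [:b:]) a \<noteq> 0" for G t t' u q n
  proof -
    have ev0: "ev G $ 0 = poly (poly G [:b:]) a" for G
    proof -
      obtain K L where KL: "G = [:[:poly (poly G [:b:]) a:]:] + x * K + y * L"
        using split[of G] by (elim exE) (rule that)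
      have "ev G = ev ([:[:poly (poly G [:b:]) a:]:] + x * K + y * L)" using KL by (rule arg_cong)
      then have "ev G = ev [:[:poly (poly G [:b:]) a:]:] + ev x * ev K + ev y * ev L"
        by (simp only: ev.hom_add ev.hom_mult)
      moreover have "ev x $ 0 = 0" "ev y $ 0 = 0" using br by (simp_all add: evx evy branch_def)
      ultimately show ?thesis by (simp add: ev_def)
    qed
    have dvt: "fps_X dvd ev t" using dv t by auto
    then obtain w where w: "ev t = fps_X * w" by (rule dvdE)
    have w0: "w $ 0 \<noteq> 0" using t1 by (simp add: w)
    \<comment> \<open>One factor \<open>t\<close> is peeled off at a time: the cofactor vanishes at
      the point, so it is a combination of \<open>t\<close> and \<open>t'\<close>, and
      multiplication by \<open>u\<close> turns the \<open>t'\<close> term into a multiple of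
      \<open>t\<close>.\<close>
    have "\<exists>G'. E dvd u ^ n * G - t ^ n * G'" using G
    proof (induction n)
      case (Suc n)
      have "fps_X ^ n dvd ev G" using Suc.prems by (metis dvd_mult_right power_Suc)
      with Suc.IH obtain G' where G': "E dvd u ^ n * G - t ^ n * G'" by blast
      then have "ev (u ^ n * G) = ev (t ^ n * G')" by (rule ev_cong)
      then have "ev u ^ n * ev G = fps_X ^ n * (w ^ n * ev G')"
        by (simp add: hom_distribs w power_mult_distrib)
      moreover have "fps_X ^ Suc n dvd ev u ^ n * ev G" using Suc.prems by (rule dvd_mult)
      ultimately have "fps_X ^ n * fps_X dvd fps_X ^ n * (w ^ n * ev G')" by (metis power_Suc2)
      then have "fps_X dvd w ^ n * ev G'" by simp
      then have "(w ^ n * ev G') $ 0 = 0" using fps_X_power_dvd_iff[of 1 "w ^ n * ev G'"] by simp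
      then have "ev G' $ 0 = 0" using w0 by (simp add: fps_power_zeroth)
      then have "poly (poly G' [:b:]) a = 0" by (simp add: ev0)
      moreover obtain K L where "G' = [:[:poly (poly G' [:b:]) a:]:] + x * K + y * L"
        using split[of G'] by (elim exE) (rule that)
      ultimately have "G' = x * K + y * L" by simp
      then have "\<exists>K L. G' = t * K + t' * L" using t by (auto intro: add.commute)
      then obtain K L where G'_eq: "G' = t * K + t' * L" by (elim exE) (rule that)
      have "u ^ Suc n * G - t ^ Suc n * (u * K + q * L)
          = u * (u ^ n * G - t ^ n * G') + t ^ n * L * (u * t' - q * t)"
        unfolding G'_eq by (simp add: algebra_simps)
      also have "E dvd \<dots>" by (rule dvd_add[OF dvd_mult[OF G'] dvd_mult[OF ut]])
      finally show ?case by blast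
    qed (rule exI[of _ G], simp)
    then obtain G' where "E dvd u ^ n * G - t ^ n * G'" ..
    then obtain M where "u ^ n * G - t ^ n * G' = E * M" by (rule dvdE)
    then have uG: "u ^ n * G = t ^ n * G' + E * M" by (simp only: diff_eq_eq add.commute)
    \<comment> \<open>It remains to remove \<open>u ^ n\<close> without localizing. Up to the
      constant \<open>c\<close>, \<open>u\<close> is \<open>1 - \<rho>\<close> with
      \<open>\<rho>\<close> in the maximal ideal; one geometric sum gives
      \<open>u * s = 1 - \<rho> ^ n\<close>, a second one gives
      \<open>(u * s) ^ n + \<rho> ^ n * v = 1\<close>, and \<open>\<rho> ^ n\<close> lies in the
      n-th power of the ideal.\<close>
    define c where "c = [:[:inverse (poly (poly u [:b:]) a):]:]"
    obtain K L where KL: "u = [:[:poly (poly u [:b:]) a:]:] + x * K + y * L"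
      using split[of u] by (elim exE) (rule that)
    define \<rho> where "\<rho> = (- c * K) * x + (- c * L) * y"
    have "c * [:[:poly (poly u [:b:]) a:]:] = 1" using u0 by (simp add: c_def)
    moreover have "u * c = ([:[:poly (poly u [:b:]) a:]:] + x * K + y * L) * c" using KL by (rule arg_cong)
    ultimately have uc: "u * c = 1 - \<rho>"
      by (simp only: \<rho>_def distrib_right) (simp add: algebra_simps)
    define s where "s = c * (\<Sum>i<n. \<rho> ^ i)"
    have us: "u * s = 1 - \<rho> ^ n" by (simp add: s_def mult.assoc[symmetric] uc one_diff_power_eq)
    define v where "v = (\<Sum>i<n. (1 - \<rho> ^ n) ^ i)"
    have "1 - (1 - \<rho> ^ n) ^ n = \<rho> ^ n * v"
      using one_diff_power_eq[of "1 - \<rho> ^ n" n] by (simp add: v_def)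
    then have "(u * s) ^ n = 1 - \<rho> ^ n * v" unfolding us by (simp add: algebra_simps)
    then have one: "(u * s) ^ n + \<rho> ^ n * v = 1" by simp
    have "G = ((u * s) ^ n + \<rho> ^ n * v) * G" unfolding one by simp
    then have "G = (u * s) ^ n * G + \<rho> ^ n * (v * G)" by (simp only: distrib_right mult.assoc)
    also have "\<dots> = t ^ n * (G' * s ^ n) + E * (M * s ^ n) + \<rho> ^ n * (v * G)"
    proof -
      have "(u * s) ^ n * G = (u ^ n * G) * s ^ n" by (simp add: power_mult_distrib)
      then show ?thesis unfolding uG by (simp add: algebra_simps)
    qed
    finally have G_eq: "G = t ^ n * (G' * s ^ n) + E * (M * s ^ n) + \<rho> ^ n * (v * G)" .
    have "J n (t ^ n)" using t J_lin[of n 1 0] J_lin[of n 0 1] by auto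
    then have "J n (t ^ n * (G' * s ^ n) + E * (M * s ^ n) + \<rho> ^ n * (v * G))"
      using J_lin[of n "- c * K" "- c * L"] unfolding \<rho>_def by (intro J_add J_mult J_E)
    then show ?thesis using G_eq by simp
  qed
  from curve_split[OF cv] obtain q where q: "[:b\<^sup>2:] + smult b h - g = [:- a, 1:] * q"
    and qa: "poly q a = poly (pderiv h) a * b - poly (pderiv g) a" by blast
  \<comment> \<open>The two cases below read off the invertible cofactor from this decomposition of
    \<open>E\<close>: that of \<open>y\<close> at an ordinary point, and \<open>q\<close> at a
    ramification point.\<close>
  have "E = [:[:b\<^sup>2:] + smult b h - g:] + y * [:[:b:] + h, 1:]"
    by (simp add: E_def y_def power2_eq_square algebra_simps)
  then have E_eq: "E = x * [:q:] + y * [:[:b:] + h, 1:]" unfolding q by (simp add: x_def)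
  have rw: "c * s - - d * r = r * d + s * c" for c d r s :: "'a poly poly" by (simp add: algebra_simps)
  have J_iff: "J n G \<longleftrightarrow> fps_X ^ n dvd ev G" for n G
  proof
    assume G: "fps_X ^ n dvd ev G"
    show "J n G"
    proof (cases "2 * b + poly h a = 0")
      case False
      show ?thesis
      proof (rule key[OF G, of x y "[:[:b:] + h, 1:]" "- [:q:]"])
        show "ev x $ 1 \<noteq> 0" using branch_ordinary[OF br False] by (simp add: evx)
        show "E dvd [:[:b:] + h, 1:] * y - - [:q:] * x" by (simp only: rw E_eq dvd_refl)
        show "poly (poly [:[:b:] + h, 1:] [:b:]) a \<noteq> 0" using False by (simp add: algebra_simps)
      qed simp
    next
      case True
      show ?thesis
      proof (rule key[OF G, of y x "[:q:]" "- [:[:b:] + h, 1:]"])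
        show "ev y $ 1 \<noteq> 0" using branch_ramified[OF br ns True] by (simp add: evy)
        show "E dvd [:q:] * x - - [:[:b:] + h, 1:] * y" by (simp only: rw E_eq add.commute dvd_refl)
        show "poly (poly [:q:] [:b:]) a \<noteq> 0" using ns True cv by (simp add: qa singular_at_def)
      qed simp
    qed
  qed (rule J_imp)
  have sd: "fps_X ^ n dvd ev F \<longleftrightarrow> n \<le> subdegree (ev F)" for n
  proof
    assume "fps_X ^ n dvd ev F"
    then have "\<forall>k<n. ev F $ k = 0" unfolding fps_X_power_dvd_iff .
    moreover have "ev F $ subdegree (ev F) \<noteq> 0" using nz by (simp add: ev_def)
    ultimately show "n \<le> subdegree (ev F)" by (meson not_le)
  next
    assume "n \<le> subdegree (ev F)"
    then show "fps_X ^ n dvd ev F" unfolding fps_X_power_dvd_iff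
      by (intro allI impI nth_less_subdegree_zero) (rule less_le_trans)
  qed
  have "plane_ord [:- g, h, 1:] a b F = (GREATEST n. J n F)"
    unfolding plane_ord_def J_def E_def x_def y_def by (rule refl)
  also have "\<dots> = subdegree (ev F)"
    unfolding J_iff sd by (rule Greatest_equality) auto
  finally show ?thesis by (simp add: ev_def)
qed

section \<open>Forms on a curve of genus 2\<close>

type_synonym 'a form = "'a poly \<times> 'a poly"

text \<open>The product of \<open>A + B y\<close> and \<open>C + D y\<close> modulo
  \<open>y^2 = g - h y\<close>.\<close>

definition fmul :: "'a::comm_ring_1 poly \<Rightarrow> 'a poly \<Rightarrow> 'a form \<Rightarrow> 'a form \<Rightarrow> 'a form" where
  "fmul h g F G = (fst F * fst G + g * snd F * snd G,
     fst F * snd G + snd F * fst G - h * snd F * snd G)"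

text \<open>The hyperelliptic involution, which replaces y by \<open>- y - h\<close>, applied to
  \<open>A + B y\<close>.\<close>

definition fconj :: "'a::comm_ring_1 poly \<Rightarrow> 'a form \<Rightarrow> 'a form" where
  "fconj h F = (fst F - h * snd F, - snd F)"

text \<open>The product of a form with its conjugate, a polynomial in x alone
  (\<open>fmul_fconj\<close>). It reduces questions about forms to questions about
  polynomials.\<close>

definition fnorm :: "'a::comm_ring_1 poly \<Rightarrow> 'a poly \<Rightarrow> 'a form \<Rightarrow> 'a poly" where
  "fnorm h g F = fst F ^ 2 - h * fst F * snd F - g * snd F ^ 2"

definition fpow :: "'a::comm_ring_1 poly \<Rightarrow> 'a poly \<Rightarrow> 'a form \<Rightarrow> nat \<Rightarrow> 'a form" where
  "fpow h g F n = (fmul h g F ^^ n) (1, 0)"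

definition isf :: "nat \<Rightarrow> 'a::comm_ring_1 form \<Rightarrow> bool" where
  "isf N F \<longleftrightarrow> Polynomial.degree (fst F) \<le> N \<and> (snd F = 0 \<or> Polynomial.degree (snd F) + 3 \<le> N)"

lemma fmul_commute: "fmul h g F G = fmul h g G F"
  by (simp add: fmul_def algebra_simps)

lemma fmul_assoc: "fmul h g (fmul h g F G) H = fmul h g F (fmul h g G H)"
  by (simp add: fmul_def algebra_simps)

lemma fmul_left_commute: "fmul h g F (fmul h g G H) = fmul h g G (fmul h g F H)"
  by (metis fmul_assoc fmul_commute)

lemmas fmul_ac = fmul_assoc fmul_commute fmul_left_commute

lemma fmul_scalar: "fmul h g (q, 0) F = (q * fst F, q * snd F)"
  by (simp add: fmul_def)

lemma fmul_scalar_scalar: "fmul h g (p, 0) (q, 0) = (p * q, 0)"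
  by (simp add: fmul_def)

lemma fmul_one: "fmul h g (1, 0) F = F" "fmul h g F (1, 0) = F"
  by (simp_all add: fmul_def)

lemma fmul_fconj: "fmul h g F (fconj h F) = (fnorm h g F, 0)"
  by (simp add: fmul_def fconj_def fnorm_def algebra_simps power2_eq_square)

lemma fpow_0: "fpow h g F 0 = (1, 0)" and fpow_Suc: "fpow h g F (Suc n) = fmul h g F (fpow h g F n)"
  by (simp_all add: fpow_def)

lemma fpow_mult: "fpow h g (fmul h g F G) n = fmul h g (fpow h g F n) (fpow h g G n)"
  by (induction n) (simp_all add: fpow_0 fpow_Suc fmul_one, metis fmul_assoc fmul_left_commute)

lemma fpow_scalar: "fpow h g (q, 0) n = (q ^ n, 0)"
  by (induction n) (simp_all add: fpow_0 fpow_Suc fmul_def)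

lemma isf_fmul:
  assumes "Polynomial.degree h \<le> 3" "Polynomial.degree g \<le> 6" "isf N F" "isf M G"
  shows "isf (N + M) (fmul h g F G)"
proof -
  have m: "Polynomial.degree (p * q) \<le> n + m"
    if "Polynomial.degree p \<le> n" "Polynomial.degree q \<le> m" for p q :: "'a poly" and n m
    using degree_mult_le[of p q] that by linarith
  have a: "Polynomial.degree (fst F * fst G) \<le> N + M"
    using assms by (intro m) (auto simp: isf_def)
  have b: "Polynomial.degree (g * snd F * snd G) \<le> N + M"
  proof (cases "snd F = 0 \<or> snd G = 0")
    case False
    then have *: "Polynomial.degree (snd F) + 3 \<le> N" "Polynomial.degree (snd G) + 3 \<le> M"
      using assms by (auto simp: isf_def)
    have "Polynomial.degree (g * snd F * snd G) \<le> 6 + Polynomial.degree (snd F) + Polynomial.degree (snd G)"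
      by (intro m assms order_refl)
    then show ?thesis using * by linarith
  qed auto
  have c: "p * q = 0 \<or> Polynomial.degree (p * q) + 3 \<le> N + M"
    if "Polynomial.degree p \<le> n" "q = 0 \<or> Polynomial.degree q + 3 \<le> k" "n + k = N + M" for p q :: "'a poly" and n k
    using m[of p n q "Polynomial.degree q"] that by (cases "q = 0") auto
  have d: "h * snd F * snd G = 0 \<or> Polynomial.degree (h * snd F * snd G) + 3 \<le> N + M"
  proof (cases "snd F = 0 \<or> snd G = 0")
    case False
    then have *: "Polynomial.degree (snd F) + 3 \<le> N" "Polynomial.degree (snd G) + 3 \<le> M"
      using assms by (auto simp: isf_def)
    have "Polynomial.degree (h * snd F * snd G) \<le> 3 + Polynomial.degree (snd F) + Polynomial.degree (snd G)"
      by (intro m assms order_refl)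
    then show ?thesis using * by linarith
  qed auto
  have sum: "p + q - r = 0 \<or> Polynomial.degree (p + q - r) + 3 \<le> n"
    if "p = 0 \<or> Polynomial.degree p + 3 \<le> n" "q = 0 \<or> Polynomial.degree q + 3 \<le> n"
      "r = 0 \<or> Polynomial.degree r + 3 \<le> n" for p q r :: "'a poly" and n
  proof (cases "3 \<le> n")
    case True
    then have "Polynomial.degree p \<le> n - 3" "Polynomial.degree q \<le> n - 3" "Polynomial.degree r \<le> n - 3"
      using that by auto
    then have "Polynomial.degree (p + q - r) \<le> n - 3" by (intro degree_diff_le degree_add_le)
    then show ?thesis using True by linarith
  qed (use that in auto)
  have "fst F * snd G = 0 \<or> Polynomial.degree (fst F * snd G) + 3 \<le> N + M"
    using assms by (intro c[of _ N _ M]) (auto simp: isf_def)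
  moreover have "snd F * fst G = 0 \<or> Polynomial.degree (snd F * fst G) + 3 \<le> N + M"
    using assms by (subst (1 2) mult.commute, intro c[of _ M _ N]) (auto simp: isf_def)
  ultimately have "snd (fmul h g F G) = 0 \<or> Polynomial.degree (snd (fmul h g F G)) + 3 \<le> N + M"
    unfolding fmul_def snd_conv by (intro sum d)
  moreover have "Polynomial.degree (fst (fmul h g F G)) \<le> N + M"
    unfolding fmul_def fst_conv by (intro degree_add_le a b)
  ultimately show ?thesis by (simp add: isf_def)
qed

lemma isf_scalar: "isf N (q, 0) \<longleftrightarrow> Polynomial.degree q \<le> N"
  by (simp add: isf_def)

lemma isf_fpow:
  assumes "Polynomial.degree h \<le> 3" "Polynomial.degree g \<le> 6" "isf N F"
  shows "isf (n * N) (fpow h g F n)"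
  by (induction n) (use assms in \<open>auto simp: fpow_0 fpow_Suc isf_scalar intro: isf_fmul\<close>)

lemma isf_fconj:
  assumes "Polynomial.degree h \<le> 3" "isf N F"
  shows "isf N (fconj h F)"
proof (cases "snd F = 0")
  case False
  then have "Polynomial.degree (snd F) + 3 \<le> N" using assms by (simp add: isf_def)
  moreover have "Polynomial.degree (h * snd F) \<le> Polynomial.degree (snd F) + 3"
    using degree_mult_le[of h "snd F"] assms(1) by linarith
  ultimately show ?thesis using assms(2) by (auto simp: isf_def fconj_def intro!: degree_diff_le)
qed (use assms in \<open>simp add: isf_def fconj_def\<close>)

lemma isf_mono: "isf N F \<Longrightarrow> N \<le> M \<Longrightarrow> isf M F"
  by (auto simp: isf_def)

section \<open>Orders of vanishing of forms\<close>

text \<open>Weighted homogeneous coordinates along a branch, normalized according to the chart of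
  the point, so that the affine points and those at infinity share one evaluation.\<close>

fun tri :: "'a::field poly \<Rightarrow> 'a poly \<Rightarrow> 'a point \<Rightarrow> 'a fps \<Rightarrow> 'a fps \<Rightarrow> 'a fps \<Rightarrow> bool" where
  "tri h g (Affine a b) Xs Zs Ys \<longleftrightarrow> Zs = 1 \<and> branch h g a b Xs Ys"
| "tri h g (Inf b) Xs Zs Ys \<longleftrightarrow> Xs = 1 \<and> branch (rev_poly 3 h) (rev_poly 6 g) 0 b Zs Ys"

text \<open>The truncation in \<open>N - 3\<close> is harmless under \<open>isf N F\<close>, where a
  nonzero second component forces \<open>3 \<le> N\<close>.\<close>

definition fev :: "nat \<Rightarrow> 'a::field form \<Rightarrow> 'a fps \<Rightarrow> 'a fps \<Rightarrow> 'a fps \<Rightarrow> 'a fps" where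
  "fev N F Xs Zs Ys = heval fps_const N (fst F) Xs Zs + heval fps_const (N - 3) (snd F) Xs Zs * Ys"

lemma fev_scalar: "fev N (q, 0) Xs Zs Ys = heval fps_const N q Xs Zs"
  by (simp add: fev_def)

lemma points_nonsingular:
  assumes "genus2_curve h g"
  shows "\<not> singular_at h g a b" "\<not> singular_at (rev_poly 3 h) (rev_poly 6 g) 0 b"
  using assms by (auto simp: genus2_curve_def)

lemma genus2_degree:
  assumes "genus2_curve h g"
  shows "Polynomial.degree h \<le> 3" "Polynomial.degree g \<le> 6"
  using assms by (auto simp: genus2_curve_def)

lemma points_simps:
  "Affine a b \<in> points h g \<longleftrightarrow> b\<^sup>2 + poly h a * b = poly g a"
  "Inf b \<in> points h g \<longleftrightarrow> b\<^sup>2 + poly (rev_poly 3 h) 0 * b = poly (rev_poly 6 g) 0"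
  by (auto simp: points_def affine_points_def infinite_points_def)

lemma tri_exists:
  assumes "genus2_curve h g" "Q \<in> points h g"
  shows "\<exists>Xs Zs Ys. tri h g Q Xs Zs Ys"
proof (cases Q)
  case (Affine a b)
  with branch_exists[of b h a g] points_nonsingular[OF assms(1)] assms(2) show ?thesis
    by (auto simp: points_simps)
next
  case (Inf b)
  with branch_exists[of b "rev_poly 3 h" 0 "rev_poly 6 g"] points_nonsingular[OF assms(1)] assms(2)
  show ?thesis by (auto simp: points_simps)
qed

lemma tri_point: "tri h g Q Xs Zs Ys \<Longrightarrow> Q \<in> points h g"
  by (cases Q) (auto simp: points_simps dest: branch_on_curve)

lemma tri_curve:
  assumes "Polynomial.degree h \<le> 3" "Polynomial.degree g \<le> 6" "tri h g Q Xs Zs Ys"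
  shows "Ys\<^sup>2 + heval fps_const 3 h Xs Zs * Ys = heval fps_const 6 g Xs Zs"
  using assms by (cases Q) (auto simp: heval_fps_Z_1 heval_fps_X_1 branch_def)

lemma (in comm_ring_hom) heval_fmul:
  assumes h: "Polynomial.degree h \<le> 3" and g: "Polynomial.degree g \<le> 6"
    and F: "isf N F" and G: "isf M G"
  shows "heval hom (N + M) (fst (fmul h g F G)) Xs Zs
      = heval hom N (fst F) Xs Zs * heval hom M (fst G) Xs Zs
        + heval hom 6 g Xs Zs * heval hom (N - 3) (snd F) Xs Zs * heval hom (M - 3) (snd G) Xs Zs"
    and "heval hom (N + M - 3) (snd (fmul h g F G)) Xs Zs
      = heval hom N (fst F) Xs Zs * heval hom (M - 3) (snd G) Xs Zs
        + heval hom (N - 3) (snd F) Xs Zs * heval hom M (fst G) Xs Zs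
        - heval hom 3 h Xs Zs * heval hom (N - 3) (snd F) Xs Zs * heval hom (M - 3) (snd G) Xs Zs"
proof -
  let ?e = "\<lambda>n q. heval hom n q Xs Zs"
  obtain A B where FAB: "F = (A, B)" by (cases F)
  obtain C D where GCD: "G = (C, D)" by (cases G)
  have A: "Polynomial.degree A \<le> N" "B = 0 \<or> Polynomial.degree B + 3 \<le> N" using F by (auto simp: FAB isf_def)
  have C: "Polynomial.degree C \<le> M" "D = 0 \<or> Polynomial.degree D + 3 \<le> M" using G by (auto simp: GCD isf_def)
  have 1: "?e (N + M) (A * C) = ?e N A * ?e M C" by (rule heval_mult) (use A C in auto)
  have 2: "?e (N + M) (g * B * D) = ?e 6 g * ?e (N - 3) B * ?e (M - 3) D"
  proof (cases "B = 0 \<or> D = 0")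
    case False
    then have B: "Polynomial.degree B \<le> N - 3" "3 \<le> N" and D: "Polynomial.degree D \<le> M - 3" "3 \<le> M"
      using A C by auto
    have "N + M = 6 + ((N - 3) + (M - 3))" using B D by simp
    moreover have "Polynomial.degree (B * D) \<le> (N - 3) + (M - 3)"
      using degree_mult_le[of B D] B D by linarith
    ultimately have "?e (N + M) (g * (B * D)) = ?e 6 g * ?e ((N - 3) + (M - 3)) (B * D)"
      using heval_mult[OF g] by metis
    also have "?e ((N - 3) + (M - 3)) (B * D) = ?e (N - 3) B * ?e (M - 3) D"
      by (rule heval_mult) (use B D in auto)
    finally show ?thesis by (simp add: mult.assoc)
  qed auto
  have 3: "?e (N + M - 3) (A * D) = ?e N A * ?e (M - 3) D"
  proof (cases "D = 0")
    case False
    then have D: "Polynomial.degree D \<le> M - 3" "3 \<le> M" using C by auto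
    then have "N + M - 3 = N + (M - 3)" by simp
    then show ?thesis using heval_mult[OF A(1) D(1)] by metis
  qed auto
  have 4: "?e (N + M - 3) (B * C) = ?e (N - 3) B * ?e M C"
  proof (cases "B = 0")
    case False
    then have B: "Polynomial.degree B \<le> N - 3" "3 \<le> N" using A by auto
    then have "N + M - 3 = (N - 3) + M" by simp
    then show ?thesis using heval_mult[OF B(1) C(1)] by metis
  qed auto
  have 5: "?e (N + M - 3) (h * B * D) = ?e 3 h * ?e (N - 3) B * ?e (M - 3) D"
  proof (cases "B = 0 \<or> D = 0")
    case False
    then have B: "Polynomial.degree B \<le> N - 3" "3 \<le> N" and D: "Polynomial.degree D \<le> M - 3" "3 \<le> M"
      using A C by auto
    have "N + M - 3 = 3 + ((N - 3) + (M - 3))" using B D by simp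
    moreover have "Polynomial.degree (B * D) \<le> (N - 3) + (M - 3)"
      using degree_mult_le[of B D] B D by linarith
    ultimately have "?e (N + M - 3) (h * (B * D)) = ?e 3 h * ?e ((N - 3) + (M - 3)) (B * D)"
      using heval_mult[OF h] by metis
    also have "?e ((N - 3) + (M - 3)) (B * D) = ?e (N - 3) B * ?e (M - 3) D"
      by (rule heval_mult) (use B D in auto)
    finally show ?thesis by (simp add: mult.assoc)
  qed auto
  show "?e (N + M) (fst (fmul h g F G)) = ?e N (fst F) * ?e M (fst G)
      + ?e 6 g * ?e (N - 3) (snd F) * ?e (M - 3) (snd G)"
    unfolding fmul_def FAB GCD fst_conv snd_conv heval_add 1 2 ..
  show "?e (N + M - 3) (snd (fmul h g F G)) = ?e N (fst F) * ?e (M - 3) (snd G)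
      + ?e (N - 3) (snd F) * ?e M (fst G) - ?e 3 h * ?e (N - 3) (snd F) * ?e (M - 3) (snd G)"
    unfolding fmul_def FAB GCD fst_conv snd_conv heval_add heval_diff 3 4 5 ..
qed

lemma fev_fmul:
  assumes h: "Polynomial.degree h \<le> 3" and g: "Polynomial.degree g \<le> 6"
    and cv: "Ys\<^sup>2 + heval fps_const 3 h Xs Zs * Ys = heval fps_const 6 g Xs Zs"
    and F: "isf N F" and G: "isf M G"
  shows "fev (N + M) (fmul h g F G) Xs Zs Ys = fev N F Xs Zs Ys * fev M G Xs Zs Ys"
  unfolding fev_def fps_const_hom.heval_fmul[OF h g F G] cv[symmetric]
  by (simp add: algebra_simps power2_eq_square)

lemma fev_fpow:
  assumes h: "Polynomial.degree h \<le> 3" and g: "Polynomial.degree g \<le> 6"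
    and cv: "Ys\<^sup>2 + heval fps_const 3 h Xs Zs * Ys = heval fps_const 6 g Xs Zs"
    and F: "isf N F"
  shows "fev (n * N) (fpow h g F n) Xs Zs Ys = fev N F Xs Zs Ys ^ n"
proof (induction n)
  case 0
  show ?case by (simp add: fpow_0 fev_def heval_def)
next
  case (Suc n)
  then show ?case using fev_fmul[OF h g cv F isf_fpow[OF h g F, of n]] by (simp add: fpow_Suc)
qed

lemma fev_raise:
  assumes "isf N F"
  shows "fev (N + k) F Xs Zs Ys = Zs ^ k * fev N F Xs Zs Ys"
proof (cases "snd F = 0")
  case True
  then show ?thesis using assms fps_const_hom.heval_raise[of "fst F" N k Xs Zs]
    by (simp add: fev_def isf_def)
next
  case False
  then have B: "Polynomial.degree (snd F) \<le> N - 3" "3 \<le> N" using assms by (auto simp: isf_def)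
  then have "N + k - 3 = (N - 3) + k" by simp
  then show ?thesis
    using assms fps_const_hom.heval_raise[of "fst F" N k Xs Zs] fps_const_hom.heval_raise[OF B(1), of k Xs Zs]
    by (simp add: fev_def isf_def algebra_simps)
qed

text \<open>The conjugate form along a branch is the form along the conjugate branch of
  \<open>tri_iota\<close>.\<close>

lemma fev_fconj:
  assumes "Polynomial.degree h \<le> 3" "isf N F"
  shows "fev N (fconj h F) Xs Zs Ys = fev N F Xs Zs (- Ys - heval fps_const 3 h Xs Zs)"
proof (cases "snd F = 0")
  case False
  then have B: "Polynomial.degree (snd F) \<le> N - 3" "3 \<le> N" using assms by (auto simp: isf_def)
  then have "heval fps_const (3 + (N - 3)) (h * snd F) Xs Zs
      = heval fps_const 3 h Xs Zs * heval fps_const (N - 3) (snd F) Xs Zs"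
    by (intro fps_const_hom.heval_mult assms(1))
  then show ?thesis using B(2)
    by (simp add: fev_def fconj_def fps_const_hom.heval_diff fps_const_hom.heval_uminus algebra_simps)
qed (simp add: fev_def fconj_def)

lemma is_form_isf: "is_form N A B \<longleftrightarrow> 3 \<le> N \<and> isf N (A, B) \<and> (A, B) \<noteq> (0, 0)"
  by (auto simp: is_form_def isf_def)

lemma form_ord_fev:
  assumes cv: "genus2_curve h g" and t: "tri h g Q Xs Zs Ys" and F: "is_form N A B"
    and nz: "fev N (A, B) Xs Zs Ys \<noteq> 0"
  shows "form_ord h g N A B Q = subdegree (fev N (A, B) Xs Zs Ys)"
proof (cases Q)
  case (Affine a b)
  then have Z: "Zs = 1" and br: "branch h g a b Xs Ys" using t by auto
  have "fpoly2 [:A, B:] Xs Ys = fev N (A, B) Xs Zs Ys"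
    using F by (simp add: fev_def Z is_form_def heval_fps_Z_1 mult.commute)
  then show ?thesis
    using plane_ord_branch[OF br points_nonsingular(1)[OF cv], of "[:A, B:]"] nz Affine by simp
next
  case (Inf b)
  then have X: "Xs = 1" and br: "branch (rev_poly 3 h) (rev_poly 6 g) 0 b Zs Ys" using t by auto
  have "fpoly2 [:rev_poly N A, rev_poly (N - 3) B:] Zs Ys = fev N (A, B) Xs Zs Ys"
    by (simp add: fev_def X heval_fps_X_1 mult.commute)
  then show ?thesis
    using plane_ord_branch[OF br points_nonsingular(2)[OF cv], of "[:rev_poly N A, rev_poly (N - 3) B:]"] nz Inf
    by simp
qed

section \<open>Nonzero forms do not vanish identically\<close>

text \<open>The hypothesis factors the equation as \<open>(y + \<tau>) (y - \<tau> + h)\<close>; a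
  common point of the two components is singular.\<close>

lemma singular_of_root:
  assumes t: "\<tau>\<^sup>2 = h * \<tau> + g" and r: "poly (\<tau> + \<tau> - h) a = 0"
  shows "singular_at h g a (- poly \<tau> a)"
proof -
  have h: "poly h a = poly \<tau> a + poly \<tau> a" using r by simp
  have g: "g = \<tau>\<^sup>2 - h * \<tau>" using t by simp
  show ?thesis unfolding singular_at_def g
    by (simp add: h pderiv_diff pderiv_mult power2_eq_square algebra_simps)
qed

text \<open>The two components would meet at any zero of the cubic form \<open>?m\<close>. Without
  affine zeros \<open>?m\<close> is a constant polynomial, and then it vanishes at infinity as a
  form of degree 3.\<close>

lemma curve_no_section:
  assumes cv: "genus2_curve h g" and t: "\<tau>\<^sup>2 = h * \<tau> + g"
  shows False
proof -
  let ?m = "\<tau> + \<tau> - h"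
  have m: "poly ?m a \<noteq> 0" for a
    using singular_of_root[OF t, of a] points_nonsingular(1)[OF cv] by blast
  have dt: "Polynomial.degree \<tau> \<le> 3"
  proof (rule ccontr)
    assume "\<not> ?thesis"
    then have d: "4 \<le> Polynomial.degree \<tau>" by simp
    then have "\<tau> \<noteq> 0" by auto
    then have "Polynomial.degree (h * \<tau> + g) = 2 * Polynomial.degree \<tau>"
      using t degree_power_eq[of \<tau> 2] by simp
    moreover have "Polynomial.degree (h * \<tau> + g) \<le> max (3 + Polynomial.degree \<tau>) 6"
      using genus2_degree[OF cv] degree_mult_le[of h \<tau>]
      by (intro degree_add_le) auto
    ultimately show False using d by simp
  qed
  have "Polynomial.degree ?m = 0"
    using m alg_closed_imp_poly_has_root[of ?m] by (metis neq0_conv)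
  then have "Polynomial.degree ?m < 3" by linarith
  then have m3: "Polynomial.coeff ?m 3 = 0" by (rule coeff_eq_0)
  have rev: "rev_poly n q = heval (\<lambda>c. [:c:]) n q 1 [:0, 1:]" for n and q :: "'a poly"
    by (simp add: rev_poly_def hom_subst_heval)
  have "rev_poly (3 + 3) (\<tau> * \<tau>) = rev_poly 3 \<tau> * rev_poly 3 \<tau>"
    unfolding rev by (rule const_poly_hom.heval_mult[OF dt dt])
  moreover have "rev_poly (3 + 3) (h * \<tau>) = rev_poly 3 h * rev_poly 3 \<tau>"
    unfolding rev by (rule const_poly_hom.heval_mult[OF genus2_degree(1)[OF cv] dt])
  moreover have "rev_poly 6 (h * \<tau> + g) = rev_poly 6 (h * \<tau>) + rev_poly 6 g"
    unfolding rev by (rule const_poly_hom.heval_add)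
  ultimately have "(rev_poly 3 \<tau>)\<^sup>2 = rev_poly 3 h * rev_poly 3 \<tau> + rev_poly 6 g"
    using t by (simp add: power2_eq_square)
  moreover have "poly (rev_poly 3 \<tau> + rev_poly 3 \<tau> - rev_poly 3 h) 0 = 0"
    using m3 by (simp only: poly_add poly_diff poly_rev_poly_0 coeff_add coeff_diff)
  ultimately show False using singular_of_root points_nonsingular(2)[OF cv] by blast
qed

text \<open>A vanishing norm makes A / B a root of the monic equation
  \<open>\<tau>^2 = h \<tau> + g\<close>, hence a polynomial. This is made explicit by cancelling
  roots of \<open>B\<close>, which are also roots of \<open>A\<close>, until \<open>B\<close> is
  constant.\<close>

lemma fnorm_nonzero:
  assumes cv: "genus2_curve h g" and nz: "F \<noteq> (0, 0)"
  shows "fnorm h g F \<noteq> 0"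
proof
  assume n0: "fnorm h g F = 0"
  obtain A B where F: "F = (A, B)" by (cases F)
  have eq: "A\<^sup>2 = h * A * B + g * B\<^sup>2" using n0 by (simp add: fnorm_def F algebra_simps)
  have B: "B \<noteq> 0" using eq nz by (auto simp: F)
  have "\<exists>\<tau>. \<tau>\<^sup>2 = h * \<tau> + g"
    using eq B
  proof (induction "Polynomial.degree B" arbitrary: A B rule: less_induct)
    case less
    show ?case
    proof (cases "Polynomial.degree B = 0")
      case True
      then obtain b where b: "B = [:b:]" by (auto elim: degree_eq_zeroE)
      then have b0: "b \<noteq> 0" using less.prems by auto
      have "(smult (1 / b) A)\<^sup>2 = smult (1 / b\<^sup>2) (A\<^sup>2)" by (simp add: power2_eq_square)
      also have "\<dots> = h * smult (1 / b) A + g"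
        unfolding less.prems b using b0
        by (simp add: smult_add_right power2_eq_square)
      finally show ?thesis by blast
    next
      case False
      then obtain a where a: "poly B a = 0" using alg_closed_imp_poly_has_root[of B] by blast
      have "poly (A\<^sup>2) a = 0" unfolding less.prems by (simp add: a)
      then have "poly A a = 0" by simp
      with a obtain A' B' where A': "A = [:- a, 1:] * A'" and B': "B = [:- a, 1:] * B'"
        unfolding poly_eq_0_iff_dvd by (elim dvdE)
      have "B' \<noteq> 0" using less.prems B' by auto
      then have deg: "Polynomial.degree B' < Polynomial.degree B" unfolding B'
        by (subst degree_mult_eq) auto
      have "[:- a, 1:]\<^sup>2 * A'\<^sup>2 = [:- a, 1:]\<^sup>2 * (h * A' * B' + g * B'\<^sup>2)"
        using less.prems(1) unfolding A' B' by (simp only: power_mult_distrib) (simp only: algebra_simps power2_eq_square)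
      then have "A'\<^sup>2 = h * A' * B' + g * B'\<^sup>2" by simp
      then show ?thesis using less.hyps[OF deg] \<open>B' \<noteq> 0\<close> by blast
    qed
  qed
  then show False using curve_no_section[OF cv] by blast
qed

lemma fmul_eq_0:
  assumes "genus2_curve h g" "fmul h g F G = (0, 0)" "F \<noteq> (0, 0)"
  shows "G = (0, 0)"
proof -
  have "fmul h g (fconj h F) (fmul h g F G) = (0, 0)" unfolding assms(2) by (simp add: fmul_def)
  then have "fmul h g (fnorm h g F, 0) G = (0, 0)" by (metis fmul_assoc fmul_commute fmul_fconj)
  then show ?thesis using fnorm_nonzero[OF assms(1,3)] by (cases G) (simp add: fmul_def)
qed

lemma branch_nonconstant:
  assumes "branch h g a b \<xi> \<eta>" "\<not> singular_at h g a b"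
  shows "\<xi> - fps_const a \<noteq> 0"
  using branch_subdegree_ordinary[OF assms(1)] branch_subdegree_ramified[OF assms]
  by (cases "2 * b + poly h a = 0") auto

lemma fpoly_nonzero:
  assumes "branch h g a b \<xi> \<eta>" "\<not> singular_at h g a b" "q \<noteq> 0"
  shows "fpoly q \<xi> \<noteq> 0"
proof -
  obtain r where r: "q = [:- a, 1:] ^ Polynomial.order a q * r" "\<not> [:- a, 1:] dvd r"
    using order_decomp[OF assms(3)] by blast
  have "fpoly r \<xi> $ 0 \<noteq> 0"
    using r(2) assms(1) by (simp add: fpoly_nth_0 branch_def poly_eq_0_iff_dvd)
  then have "fpoly r \<xi> \<noteq> 0" by auto
  moreover have "fpoly q \<xi> = (\<xi> - fps_const a) ^ Polynomial.order a q * fpoly r \<xi>"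
    by (subst r(1)) (simp only: fpoly_mult fpoly_power fpoly_linear)
  ultimately show ?thesis using branch_nonconstant[OF assms(1,2)] by simp
qed

lemma heval_nonzero:
  assumes cv: "genus2_curve h g" and t: "tri h g Q Xs Zs Ys"
    and q: "q \<noteq> 0" "Polynomial.degree q \<le> n"
  shows "heval fps_const n q Xs Zs \<noteq> 0"
proof (cases Q)
  case (Affine a b)
  then have "fpoly q Xs \<noteq> 0" using t by (intro fpoly_nonzero[OF _ points_nonsingular(1)[OF cv] q(1)]) auto
  then show ?thesis using t q Affine by (simp add: heval_fps_Z_1)
next
  case (Inf b)
  then show ?thesis using t q fpoly_nonzero[of "rev_poly 3 h" "rev_poly 6 g" 0 b Zs Ys "rev_poly n q"]
      points_nonsingular(2)[OF cv]
    by (auto simp: heval_fps_X_1 rev_poly_eq_0_iff)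
qed

text \<open>The product with the conjugate value is the value of the norm, a nonzero polynomial in
  x, and x is not constant along a branch.\<close>

lemma fev_nonzero:
  assumes cv: "genus2_curve h g" and t: "tri h g Q Xs Zs Ys" and F: "isf N F" "F \<noteq> (0, 0)"
  shows "fev N F Xs Zs Ys \<noteq> 0"
proof -
  note d = genus2_degree[OF cv]
  have "fev N F Xs Zs Ys * fev N (fconj h F) Xs Zs Ys = fev (N + N) (fnorm h g F, 0) Xs Zs Ys"
    unfolding fmul_fconj[symmetric] by (rule fev_fmul[OF d tri_curve[OF d t] F(1) isf_fconj[OF d(1) F(1)], symmetric])
  moreover have "isf (N + N) (fnorm h g F, 0)"
    unfolding fmul_fconj[symmetric] by (rule isf_fmul[OF d F(1) isf_fconj[OF d(1) F(1)]])
  ultimately show ?thesis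
    using heval_nonzero[OF cv t fnorm_nonzero[OF cv F(2)]] by (auto simp: fev_scalar isf_scalar)
qed

section \<open>Fibres of the hyperelliptic map\<close>

text \<open>The linear form that cuts out the fibre of x through the point. At infinity this form is
  Z, whose dehomogenization is 1; it is always to be evaluated in degree 1.\<close>

fun lin :: "'a::field point \<Rightarrow> 'a poly" where
  "lin (Affine a b) = [:- a, 1:]"
| "lin (Inf b) = 1"

fun iota :: "'a::field poly \<Rightarrow> 'a point \<Rightarrow> 'a point" where
  "iota h (Affine a b) = Affine a (- b - poly h a)"
| "iota h (Inf b) = Inf (- b - Polynomial.coeff h 3)"

text \<open>The value at a point of the cubic form \<open>w + y\<close>, read in the chart of the
  point.\<close>

fun wval :: "'a::field poly \<Rightarrow> 'a point \<Rightarrow> 'a" where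
  "wval w (Affine a b) = poly w a + b"
| "wval w (Inf b) = Polynomial.coeff w 3 + b"

lemma lin_nonzero [simp]: "lin P \<noteq> 0" and degree_lin: "Polynomial.degree (lin P) \<le> 1"
  by (cases P; simp)+

lemma iota_iota [simp]: "iota h (iota h P) = P"
  by (cases P) auto

lemma iota_eq_iff: "iota h Q = P \<longleftrightarrow> Q = iota h P"
  by (metis iota_iota)

lemma iota_points: "iota h P \<in> points h g \<longleftrightarrow> P \<in> points h g"
  by (cases P) (auto simp: points_simps poly_rev_poly_0 power2_eq_square algebra_simps)

lemma tri_iota:
  assumes h: "Polynomial.degree h \<le> 3" and t: "tri h g Q Xs Zs Ys"
  shows "tri h g (iota h Q) Xs Zs (- Ys - heval fps_const 3 h Xs Zs)"
proof -
  have *: "branch h g a (- b - poly h a) \<xi> (- \<eta> - fpoly h \<xi>)" if "branch h g a b \<xi> \<eta>"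
    for h g :: "'a poly" and a b \<xi> \<eta>
  proof -
    have "(- \<eta> - fpoly h \<xi>)\<^sup>2 + fpoly h \<xi> * (- \<eta> - fpoly h \<xi>) = \<eta>\<^sup>2 + fpoly h \<xi> * \<eta>"
      by (simp add: power2_eq_square algebra_simps)
    then show ?thesis using that
      by (auto simp: branch_def fpoly_nth_0 fpoly_nth_1[unfolded One_nat_def])
  qed
  show ?thesis using t h *[of _ _ _ _ Xs Ys] *[of "rev_poly 3 h" "rev_poly 6 g" 0 _ Zs Ys]
    by (cases Q) (auto simp: heval_fps_Z_1 heval_fps_X_1 poly_rev_poly_0)
qed

text \<open>The fibre over \<open>a\<close> consists of \<open>b\<close> and
  \<open>- b - h(a)\<close>. At an ordinary point exactly one bracket is 1 and the order is 1; at a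
  ramification point both are 1 and the order is 2.\<close>

lemma branch_fibre:
  assumes br: "branch h g a b' \<xi> \<eta>" and ns: "\<not> singular_at h g a b'"
    and b: "b\<^sup>2 + poly h a * b = poly g a"
  shows "subdegree (\<xi> - fps_const a) = of_bool (b' = b) + of_bool (b' = - b - poly h a)"
proof -
  have "(b' - b) * (b' + b + poly h a) = (b'\<^sup>2 + poly h a * b') - (b\<^sup>2 + poly h a * b)"
    by (simp add: power2_eq_square algebra_simps)
  then have "(b' - b) * (b' + b + poly h a) = 0" using branch_on_curve[OF br] b by simp
  then have "b' - b = 0 \<or> b' + b + poly h a = 0" unfolding mult_eq_0_iff .
  then have or: "b' = b \<or> b' = - b - poly h a"
  proof
    assume z: "b' + b + poly h a = 0"
    have "b' = (b' + b + poly h a) - b - poly h a" by simp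
    then show ?thesis unfolding z by simp
  qed simp
  show ?thesis
  proof (cases "2 * b' + poly h a = 0")
    case True
    then have e: "b' = - b' - poly h a" by (simp add: algebra_simps eq_neg_iff_add_eq_0)
    from or have "b' = b"
    proof
      assume "b' = - b - poly h a"
      then have "- b' - poly h a = - b - poly h a" using e by metis
      then show ?thesis by simp
    qed
    with e have *: "(b' = b) = True" "(b' = - b - poly h a) = True" by metis+
    show ?thesis unfolding * using branch_subdegree_ramified[OF br ns True] by simp
  next
    case False
    then have "b' \<noteq> - b' - poly h a" by (auto simp: algebra_simps eq_neg_iff_add_eq_0)
    with or have "(b' = b) \<noteq> (b' = - b - poly h a)" by auto
    then show ?thesis using branch_subdegree_ordinary[OF br False] by auto
  qed
qed

lemma heval_lin_Affine: "heval fps_const 1 [:- a, 1:] Xs 1 = Xs - fps_const (a :: 'a::field)"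
  by (subst heval_fps_Z_1) (simp_all only: fpoly_linear, simp)

lemma subdegree_lin:
  assumes cv: "genus2_curve h g" and t: "tri h g Q Xs Zs Ys" and P: "P \<in> points h g"
  shows "subdegree (heval fps_const 1 (lin P) Xs Zs) = of_bool (Q = P) + of_bool (Q = iota h P)"
proof (cases P)
  case PA: (Affine a b)
  show ?thesis
  proof (cases Q)
    case (Affine a' b')
    then have Z: "Zs = 1" and br: "branch h g a' b' Xs Ys" using t by auto
    have ev: "heval fps_const 1 (lin P) Xs Zs = Xs - fps_const a"
      using heval_lin_Affine[of a Xs] by (simp add: PA Z)
    show ?thesis
    proof (cases "a' = a")
      case True
      then show ?thesis
        using branch_fibre[OF br points_nonsingular(1)[OF cv], of b] P
        unfolding ev by (simp add: PA Affine points_simps)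
    next
      case False
      then have "(Xs - fps_const a) $ 0 \<noteq> 0" using br by (simp add: branch_def)
      then show ?thesis unfolding ev using False by (simp add: PA Affine fps_nth_0_subdegree)
    qed
  next
    case (Inf b')
    then have X: "Xs = 1" and br: "branch (rev_poly 3 h) (rev_poly 6 g) 0 b' Zs Ys" using t by auto
    have "heval fps_const 1 (lin P) Xs Zs = 1 - fps_const a * Zs"
      by (simp add: PA X heval_def flip: fps_const_neg)
    moreover have "(1 - fps_const a * Zs) $ 0 \<noteq> 0" using br by (simp add: branch_def)
    ultimately show ?thesis by (simp add: PA Inf fps_nth_0_subdegree)
  qed
next
  case PI: (Inf b)
  have ev: "heval fps_const 1 (lin P) Xs Zs = Zs" using fps_const_hom.heval_1[of 1 Xs Zs] by (simp add: PI)
  show ?thesis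
  proof (cases Q)
    case (Affine a' b')
    then show ?thesis using t unfolding ev by (simp add: PI)
  next
    case (Inf b')
    then have br: "branch (rev_poly 3 h) (rev_poly 6 g) 0 b' Zs Ys" using t by auto
    show ?thesis
      using branch_fibre[OF br points_nonsingular(2)[OF cv], of b] P
      unfolding ev by (simp add: PI Inf points_simps poly_rev_poly_0)
  qed
qed

lemma isf_wform: "Polynomial.degree w \<le> 3 \<Longrightarrow> isf 3 (w, 1)"
  by (simp add: isf_def)

lemma fev_wform_nth_0:
  assumes "Polynomial.degree w \<le> 3" "tri h g Q Xs Zs Ys"
  shows "fev 3 (w, 1) Xs Zs Ys $ 0 = wval w Q"
  using assms by (cases Q)
    (auto simp: fev_def heval_fps_Z_1 heval_fps_X_1 fps_const_hom.heval_1 branch_def fpoly_nth_0 poly_rev_poly_0)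

text \<open>The branch is at \<open>P\<close>, the vanishing at the opposite point. If the two
  differ, the orders are 0 and 1; if they agree, they are 1 and 2. The exact value is what turns a
  divisibility identity back into a lower bound for \<open>F\<close> in
  \<open>quintic_divI\<close>.\<close>

lemma subdegree_wform:
  assumes cv: "genus2_curve h g" and t: "tri h g P Xs Zs Ys"
    and w: "Polynomial.degree w \<le> 3" "wval w (iota h P) = 0"
  shows "subdegree (fev 3 (w, 1) Xs Zs Ys) + 1 = subdegree (heval fps_const 1 (lin P) Xs Zs)"
proof -
  have main: "subdegree (fpoly v \<xi> + \<eta>) + 1 = subdegree (\<xi> - fps_const a)"
    if br: "branch h g a b \<xi> \<eta>" and ns: "\<not> singular_at h g a b" and v: "poly v a = b + poly h a"
    for h g v :: "'a poly" and a b \<xi> \<eta>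
  proof (cases "2 * b + poly h a = 0")
    case True
    then have "poly v a = - b" using v by (simp add: algebra_simps eq_neg_iff_add_eq_0)
    then show ?thesis
      using branch_subdegree_ramified[OF br ns True] branch_subdegree_ramified_y[OF br ns True, of v]
      by (simp add: add.commute)
  next
    case False
    have "(fpoly v \<xi> + \<eta>) $ 0 \<noteq> 0" using br v False by (simp add: branch_def fpoly_nth_0 algebra_simps)
    then show ?thesis using branch_subdegree_ordinary[OF br False] by (simp add: fps_nth_0_subdegree)
  qed
  show ?thesis
  proof (cases P)
    case (Affine a b)
    then have Z: "Zs = 1" and br: "branch h g a b Xs Ys" using t by auto
    have "poly w a = b + poly h a" using w by (simp add: Affine algebra_simps eq_neg_iff_add_eq_0)
    from main[OF br points_nonsingular(1)[OF cv] this]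
    have "subdegree (fev 3 (w, 1) Xs Zs Ys) + 1 = subdegree (Xs - fps_const a)"
      using w(1) by (simp add: Z fev_def heval_fps_Z_1 fps_const_hom.heval_1)
    then show ?thesis unfolding Affine Z lin.simps heval_lin_Affine .
  next
    case (Inf b)
    then have X: "Xs = 1" and br: "branch (rev_poly 3 h) (rev_poly 6 g) 0 b Zs Ys" using t by auto
    have "poly (rev_poly 3 w) 0 = b + poly (rev_poly 3 h) 0"
      using w by (simp add: Inf poly_rev_poly_0 algebra_simps eq_neg_iff_add_eq_0)
    from main[OF br points_nonsingular(2)[OF cv] this]
    have "subdegree (fpoly (rev_poly 3 w) Zs + Ys) + 1 = subdegree Zs" by simp
    moreover have "heval fps_const 1 1 1 Zs = Zs" "heval fps_const 0 1 1 Zs = 1"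
      using fps_const_hom.heval_1[of 1 1 Zs] fps_const_hom.heval_1[of 0 1 Zs] by simp_all
    ultimately show ?thesis unfolding Inf X lin.simps by (simp add: fev_def heval_fps_X_1[of 3])
  qed
qed

section \<open>Divisibility of forms\<close>

text \<open>\<open>A + B y\<close> vanishes on the whole fibre over \<open>a\<close>, with
  multiplicity. Two distinct points give two independent linear equations for \<open>A(a)\<close>
  and \<open>B(a)\<close>; at a ramification point the second equation is the coefficient of index
  1.\<close>

lemma chart_vanish:
  fixes h g A B :: "'a::alg_closed_field poly"
  assumes ns: "\<And>b. \<not> singular_at h g a b"
    and le: "\<And>b \<xi> \<eta>. branch h g a b \<xi> \<eta> \<Longrightarrow>
      subdegree (\<xi> - fps_const a) \<le> subdegree (fpoly A \<xi> + fpoly B \<xi> * \<eta>)"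
  shows "poly A a = 0 \<and> poly B a = 0"
proof -
  obtain b where "poly [:- poly g a, poly h a, 1:] b = 0"
    using alg_closed_imp_poly_has_root[of "[:- poly g a, poly h a, 1:]"] by auto
  then have b: "b\<^sup>2 + poly h a * b = poly g a" by (simp add: power2_eq_square algebra_simps)
  obtain \<xi> \<eta> where br: "branch h g a b \<xi> \<eta>" using branch_exists[OF b ns] by blast
  show ?thesis
  proof (cases "2 * b + poly h a = 0")
    case True
    have "2 \<le> subdegree (fpoly A \<xi> + fpoly B \<xi> * \<eta>)"
      using le[OF br] branch_subdegree_ramified[OF br ns True] by simp
    then have "(fpoly A \<xi> + fpoly B \<xi> * \<eta>) $ 0 = 0" "(fpoly A \<xi> + fpoly B \<xi> * \<eta>) $ 1 = 0"
      by (auto intro!: nth_less_subdegree_zero simp del: fps_add_nth)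
    then have "poly A a + poly B a * b = 0" "poly B a * \<eta> $ 1 = 0"
      using br branch_ramified(1)[OF br ns True]
      by (simp_all add: branch_def fps_mult_nth_1 fpoly_nth_0 fpoly_nth_1[unfolded One_nat_def])
    then show ?thesis using branch_ramified(2)[OF br ns True] by simp
  next
    case False
    let ?c = "- b - poly h a"
    have c: "?c\<^sup>2 + poly h a * ?c = poly g a" using b by (simp add: power2_eq_square algebra_simps)
    obtain \<xi>' \<eta>' where br': "branch h g a ?c \<xi>' \<eta>'" using branch_exists[OF c ns] by blast
    have *: "poly A a + poly B a * e = 0" if "branch h g a e \<xi> \<eta>" "2 * e + poly h a \<noteq> 0" for e \<xi> \<eta>
    proof -
      have "1 \<le> subdegree (fpoly A \<xi> + fpoly B \<xi> * \<eta>)"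
        using le[OF that(1)] branch_subdegree_ordinary[OF that] by simp
      then have "(fpoly A \<xi> + fpoly B \<xi> * \<eta>) $ 0 = 0" by (intro nth_less_subdegree_zero) simp
      then show ?thesis using that(1) by (simp add: branch_def fpoly_nth_0)
    qed
    have "2 * ?c + poly h a \<noteq> 0"
    proof
      assume "2 * ?c + poly h a = 0"
      moreover have "- (2 * b + poly h a) = 2 * ?c + poly h a" by (simp add: algebra_simps)
      ultimately have "- (2 * b + poly h a) = 0" by (simp only:)
      then have "2 * b + poly h a = 0" unfolding neg_equal_0_iff_equal .
      then show False using False by contradiction
    qed
    then have 1: "poly A a + poly B a * b = 0" and 2: "poly A a + poly B a * ?c = 0"
      using *[OF br False] *[OF br'] by auto
    have "poly B a * (2 * b + poly h a) = (poly A a + poly B a * b) - (poly A a + poly B a * ?c)"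
      by (simp add: algebra_simps)
    then have "poly B a = 0" unfolding 1 2 using False by simp
    then show ?thesis using 1 by simp
  qed
qed

text \<open>Induction on the degree of \<open>M\<close> as a form: one linear factor is split off at
  a time and divides both components by \<open>chart_vanish\<close>.\<close>

lemma form_divide:
  fixes h g M :: "'a::alg_closed_field poly"
  assumes cv: "genus2_curve h g" and F: "isf N F" "F \<noteq> (0, 0)"
    and M: "M \<noteq> 0" "Polynomial.degree M \<le> m"
    and le: "\<And>Q Xs Zs Ys. tri h g Q Xs Zs Ys \<Longrightarrow>
      subdegree (heval fps_const m M Xs Zs) \<le> subdegree (fev N F Xs Zs Ys)"
  shows "\<exists>G. m \<le> N \<and> isf (N - m) G \<and> F = fmul h g (M, 0) G"
  using F M le
proof (induction m arbitrary: N F M)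
  case 0
  then obtain c where c: "M = [:c:]" by (auto elim: degree_eq_zeroE)
  then have "c \<noteq> 0" using 0 by auto
  then have "F = fmul h g (M, 0) (smult (1 / c) (fst F), smult (1 / c) (snd F))"
    by (simp add: fmul_scalar c)
  moreover have "isf N (smult (1 / c) (fst F), smult (1 / c) (snd F))"
    using 0(1) by (auto simp: isf_def)
  ultimately show ?case by (metis diff_zero le0)
next
  case (Suc m)
  note d = genus2_degree[OF cv]
  obtain A B where FAB: "F = (A, B)" by (cases F)
  have A: "Polynomial.degree A \<le> N" "B = 0 \<or> Polynomial.degree B + 3 \<le> N"
    using Suc.prems(1) by (auto simp: FAB isf_def)
  show ?case
  proof (cases "Polynomial.degree M = 0")
    case False
    then obtain a where "poly M a = 0" using alg_closed_imp_poly_has_root[of M] by blast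
    then obtain M' where M': "M = [:- a, 1:] * M'" unfolding poly_eq_0_iff_dvd by (rule dvdE)
    have M'0: "M' \<noteq> 0" using Suc.prems M' by auto
    then have degM: "Polynomial.degree M = Suc (Polynomial.degree M')"
      unfolding M' by (subst degree_mult_eq) auto
    then have M'd: "Polynomial.degree M' \<le> m" using Suc.prems by simp
    have evM: "heval fps_const (Suc m) M Xs Zs = heval fps_const 1 [:- a, 1:] Xs Zs * heval fps_const m M' Xs Zs"
      for Xs Zs using fps_const_hom.heval_mult[of "[:- a, 1:]" 1 M' m Xs Zs] M'd by (simp add: M')
    have nzM': "heval fps_const m M' Xs Zs \<noteq> 0" "heval fps_const 1 [:- a, 1:] Xs Zs \<noteq> 0"
      if "tri h g Q Xs Zs Ys" for Q Xs Zs Ys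
      using heval_nonzero[OF cv that M'0 M'd] heval_nonzero[OF cv that, of "[:- a, 1:]" 1] by auto
    have "poly A a = 0 \<and> poly B a = 0"
    proof (rule chart_vanish[OF points_nonsingular(1)[OF cv]])
      fix b \<xi> \<eta> assume br: "branch h g a b \<xi> \<eta>"
      then have t: "tri h g (Affine a b) \<xi> 1 \<eta>" by simp
      have "subdegree (heval fps_const 1 [:- a, 1:] \<xi> 1) \<le> subdegree (fev N F \<xi> 1 \<eta>)"
        using Suc.prems(5)[OF t] nzM'[OF t] unfolding evM by simp
      moreover have "fev N F \<xi> 1 \<eta> = fpoly A \<xi> + fpoly B \<xi> * \<eta>"
        using A by (auto simp: fev_def FAB heval_fps_Z_1)
      ultimately show "subdegree (\<xi> - fps_const a) \<le> subdegree (fpoly A \<xi> + fpoly B \<xi> * \<eta>)"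
        using heval_lin_Affine[of a \<xi>] by simp
    qed
    then obtain A' B' where A': "A = [:- a, 1:] * A'" and B': "B = [:- a, 1:] * B'"
      unfolding poly_eq_0_iff_dvd by (elim conjE dvdE)
    have FF: "F = fmul h g ([:- a, 1:], 0) (A', B')" by (simp add: fmul_scalar FAB A' B')
    have dA: "Polynomial.degree A = Suc (Polynomial.degree A')" if "A' \<noteq> 0"
      unfolding A' using that by (subst degree_mult_eq) auto
    have dB: "Polynomial.degree B = Suc (Polynomial.degree B')" if "B' \<noteq> 0"
      unfolding B' using that by (subst degree_mult_eq) auto
    have B0: "B = 0 \<longleftrightarrow> B' = 0" and A0: "A = 0 \<longleftrightarrow> A' = 0" unfolding A' B' mult_eq_0_iff by auto
    have N1: "1 \<le> N" using Suc.prems(2) A dA dB B0 A0 by (cases "A' = 0") (auto simp: FAB)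
    have F': "isf (N - 1) (A', B')" "(A', B') \<noteq> (0, 0)"
      using Suc.prems(2) A dA dB B0 A0 N1 by (cases "A' = 0"; cases "B' = 0"; auto simp: FAB isf_def)+
    have "\<exists>G. m \<le> N - 1 \<and> isf (N - 1 - m) G \<and> (A', B') = fmul h g (M', 0) G"
    proof (rule Suc.IH[OF F' M'0 M'd])
      fix Q Xs Zs Ys assume t: "tri h g Q Xs Zs Ys"
      have "fev (1 + (N - 1)) F Xs Zs Ys = fev 1 ([:- a, 1:], 0) Xs Zs Ys * fev (N - 1) (A', B') Xs Zs Ys"
        unfolding FF by (rule fev_fmul[OF d tri_curve[OF d t] _ F'(1)]) (simp add: isf_scalar)
      then have "fev N F Xs Zs Ys = heval fps_const 1 [:- a, 1:] Xs Zs * fev (N - 1) (A', B') Xs Zs Ys"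
        using N1 by (simp add: fev_scalar)
      then show "subdegree (heval fps_const m M' Xs Zs) \<le> subdegree (fev (N - 1) (A', B') Xs Zs Ys)"
        using Suc.prems(5)[OF t] nzM'[OF t] fev_nonzero[OF cv t F'] unfolding evM by simp
    qed
    then obtain G where "m \<le> N - 1" "isf (N - 1 - m) G" "(A', B') = fmul h g (M', 0) G" by blast
    then show ?thesis using N1
      by (intro exI[of _ G]) (auto simp: FF M' fmul_assoc[symmetric] fmul_scalar_scalar)
  next
    case True
    \<comment> \<open>A constant polynomial regarded in degree \<open>Suc m\<close> still has the
      factor Z. Divisibility by Z means that both components have smaller degree than
      allowed.\<close>
    then have Md: "Polynomial.degree M \<le> m" by simp
    have evM: "heval fps_const (Suc m) M Xs Zs = Zs * heval fps_const m M Xs Zs" for Xs Zs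
      using fps_const_hom.heval_raise[OF Md, of 1 Xs Zs] by simp
    have "poly (rev_poly N A) 0 = 0 \<and> poly (rev_poly (N - 3) B) 0 = 0"
    proof (rule chart_vanish[OF points_nonsingular(2)[OF cv]])
      fix b \<xi> \<eta> assume br: "branch (rev_poly 3 h) (rev_poly 6 g) 0 b \<xi> \<eta>"
      then have t: "tri h g (Inf b) 1 \<xi> \<eta>" by simp
      have "\<xi> \<noteq> 0" using branch_nonconstant[OF br points_nonsingular(2)[OF cv]] by simp
      then have "subdegree \<xi> \<le> subdegree (fev N F 1 \<xi> \<eta>)"
        using Suc.prems(5)[OF t] heval_nonzero[OF cv t Suc.prems(3) Md] unfolding evM by simp
      then show "subdegree (\<xi> - fps_const 0)
          \<le> subdegree (fpoly (rev_poly N A) \<xi> + fpoly (rev_poly (N - 3) B) \<xi> * \<eta>)"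
        by (simp add: fev_def FAB heval_fps_X_1)
    qed
    then have cA: "Polynomial.coeff A N = 0" and cB: "Polynomial.coeff B (N - 3) = 0"
      by (auto simp: poly_rev_poly_0)
    have dA: "A = 0 \<or> Polynomial.degree A < N"
      using A(1) cA by (metis leading_coeff_0_iff le_neq_implies_less)
    have dB: "B = 0 \<or> Polynomial.degree B + 3 < N"
    proof (cases "B = 0")
      case False
      then have "Polynomial.degree B \<noteq> N - 3" using cB by (metis leading_coeff_0_iff)
      then show ?thesis using False A(2) by auto
    qed simp
    have N1: "1 \<le> N" using dA dB Suc.prems(2) by (auto simp: FAB)
    have F': "isf (N - 1) F" using dA dB N1 by (auto simp: isf_def FAB)
    have "\<exists>G. m \<le> N - 1 \<and> isf (N - 1 - m) G \<and> F = fmul h g (M, 0) G"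
    proof (rule Suc.IH[OF F' Suc.prems(2,3) Md])
      fix Q Xs Zs Ys assume t: "tri h g Q Xs Zs Ys"
      have e: "fev N F Xs Zs Ys = Zs * fev (N - 1) F Xs Zs Ys"
        using fev_raise[OF F', of 1 Xs Zs Ys] N1 by simp
      then have "Zs \<noteq> 0" using fev_nonzero[OF cv t Suc.prems(1,2)] by auto
      then show "subdegree (heval fps_const m M Xs Zs) \<le> subdegree (fev (N - 1) F Xs Zs Ys)"
        using Suc.prems(5)[OF t] heval_nonzero[OF cv t Suc.prems(3) Md] fev_nonzero[OF cv t F' Suc.prems(2)]
        unfolding evM e by simp
    qed
    then show ?thesis using N1 by auto
  qed
qed


section \<open>The divisor of a quintic form\<close>

text \<open>\<open>F\<close> is a form of degree 5 with divisor \<open>5 (P1 + P2)\<close>, where \<open>P1\<close> and \<open>P2\<close> may coincide.\<close>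

definition quintic_div :: "'a::field poly \<Rightarrow> 'a poly \<Rightarrow> 'a point \<Rightarrow> 'a point \<Rightarrow> 'a form \<Rightarrow> bool" where
  "quintic_div h g P1 P2 F \<longleftrightarrow> isf 5 F \<and> F \<noteq> (0, 0) \<and>
     (\<forall>Q Xs Zs Ys. tri h g Q Xs Zs Ys \<longrightarrow>
        subdegree (fev 5 F Xs Zs Ys) = 5 * (of_bool (Q = P1) + of_bool (Q = P2)))"

section \<open>Algebraic characterization of the divisor 5 (P1 + P2)\<close>

lemma degree_lin_power: "Polynomial.degree (lin P ^ n) \<le> n"
  using degree_power_le[of "lin P" n] mult_le_mono1[OF degree_lin[of P], of n] by linarith

lemma degree_lin_mult_power: "Polynomial.degree ((lin P1 * lin P2) ^ n) \<le> 2 * n"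
proof -
  have "Polynomial.degree (lin P1 * lin P2) \<le> 2"
    using degree_mult_le[of "lin P1" "lin P2"] degree_lin[of P1] degree_lin[of P2] by linarith
  from mult_le_mono1[OF this, of n] show ?thesis
    using degree_power_le[of "lin P1 * lin P2" n] by linarith
qed

lemma subdegree_lin_power:
  assumes cv: "genus2_curve h g" and t: "tri h g Q Xs Zs Ys" and P: "P \<in> points h g"
  shows "subdegree (heval fps_const n (lin P ^ n) Xs Zs) = n * (of_bool (Q = P) + of_bool (Q = iota h P))"
  using subdegree_lin[OF assms] fps_const_hom.heval_power[OF degree_lin[of P], of n Xs Zs]
  by (simp add: subdegree_power)

lemma heval_lin_mult_power:
  "heval fps_const (2 * n) ((lin P1 * lin P2) ^ n) Xs Zs
    = heval fps_const n (lin P1 ^ n) Xs Zs * heval fps_const n (lin P2 ^ n) Xs Zs"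
  using fps_const_hom.heval_mult[OF degree_lin_power[of P1 n] degree_lin_power[of P2 n], of Xs Zs]
  by (simp add: power_mult_distrib mult_2)

lemma subdegree_lin_mult_power:
  assumes cv: "genus2_curve h g" and t: "tri h g Q Xs Zs Ys"
    and P: "P1 \<in> points h g" "P2 \<in> points h g"
  shows "subdegree (heval fps_const (2 * n) ((lin P1 * lin P2) ^ n) Xs Zs)
    = n * (of_bool (Q = P1) + of_bool (Q = iota h P1)) + n * (of_bool (Q = P2) + of_bool (Q = iota h P2))"
proof -
  have "heval fps_const n (lin P ^ n) Xs Zs \<noteq> 0" for P
    by (rule heval_nonzero[OF cv t _ degree_lin_power]) simp
  then show ?thesis unfolding heval_lin_mult_power
    by (simp add: subdegree_lin_power[OF cv t P(1)] subdegree_lin_power[OF cv t P(2)])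
qed

context
  fixes h g :: "'a::alg_closed_field poly"
  assumes cv: "genus2_curve h g"
begin

lemma fmul_nonzero: "F \<noteq> (0, 0) \<Longrightarrow> G \<noteq> (0, 0) \<Longrightarrow> fmul h g F G \<noteq> (0, 0)"
  using fmul_eq_0[OF cv] by blast

lemma form_divide_exact:
  assumes "isf N F" "F \<noteq> (0, 0)" "M \<noteq> 0" "Polynomial.degree M \<le> m" "N = m + k"
    and "\<And>Q Xs Zs Ys. tri h g Q Xs Zs Ys \<Longrightarrow>
      subdegree (heval fps_const m M Xs Zs) \<le> subdegree (fev N F Xs Zs Ys)"
  shows "\<exists>G. isf k G \<and> F = fmul h g (M, 0) G"
  using form_divide[OF cv assms(1-4,6)] assms(5) by auto

lemma isf_wpow: "Polynomial.degree w \<le> 3 \<Longrightarrow> isf 15 (fpow h g (w, 1) 5)"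
  using isf_fpow[OF genus2_degree[OF cv] isf_wform, of w 5] by simp

lemma fpow_nonzero: "F \<noteq> (0, 0) \<Longrightarrow> fpow h g F n \<noteq> (0, 0)"
  by (induction n) (simp_all add: fpow_0 fpow_Suc fmul_nonzero)

lemma fev_wpow:
  "tri h g Q Xs Zs Ys \<Longrightarrow> Polynomial.degree w \<le> 3 \<Longrightarrow>
    fev 15 (fpow h g (w, 1) 5) Xs Zs Ys = fev 3 (w, 1) Xs Zs Ys ^ 5"
  using fev_fpow[OF genus2_degree[OF cv] tri_curve[OF genus2_degree[OF cv]] isf_wform, of Q Xs Zs Ys w 5]
  by simp

lemma subdegree_wform_ge:
  assumes t: "tri h g Q Xs Zs Ys" and w: "Polynomial.degree w \<le> 3" "wval w Q = 0"
  shows "1 \<le> subdegree (fev 3 (w, 1) Xs Zs Ys)"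
proof -
  have "fev 3 (w, 1) Xs Zs Ys \<noteq> 0" by (rule fev_nonzero[OF cv t isf_wform[OF w(1)]]) simp
  moreover have "fev 3 (w, 1) Xs Zs Ys $ 0 = 0" using fev_wform_nth_0[OF w(1) t] w(2) by simp
  ultimately show ?thesis by (metis One_nat_def Suc_leI gr0I subdegree_eq_0_iff)
qed

lemma subdegree_lin_le:
  assumes t: "tri h g Q Xs Zs Ys" and w: "Polynomial.degree w \<le> 3" "wval w (iota h P) = 0"
  shows "of_bool (Q = P) + of_bool (Q = iota h P) \<le> of_bool (Q = P) + subdegree (fev 3 (w, 1) Xs Zs Ys)"
  using subdegree_wform_ge[OF t w(1)] w(2) by (cases "Q = iota h P") auto

text \<open>The factor \<open>(w + y)^5\<close> has order at least 5 at the opposite of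
  \<open>P1\<close> and so completes 5 P1 to the divisor of \<open>lin P1 ^ 5\<close>.\<close>

lemma quintic_div_identity1:
  assumes F: "quintic_div h g P1 P2 F" and P: "P1 \<in> points h g" "P2 \<in> points h g"
    and w: "Polynomial.degree w \<le> 3" "wval w (iota h P1) = 0"
  shows "\<exists>G. isf 15 G \<and> fmul h g F (fpow h g (w, 1) 5) = fmul h g (lin P1 ^ 5, 0) G"
proof -
  note d = genus2_degree[OF cv]
  have F5: "isf 5 F" "F \<noteq> (0, 0)" using F by (auto simp: quintic_div_def)
  have W: "fpow h g (w, 1) 5 \<noteq> (0, 0)" by (rule fpow_nonzero) simp
  have 1: "isf (5 + 15) (fmul h g F (fpow h g (w, 1) 5))" by (rule isf_fmul[OF d F5(1) isf_wpow[OF w(1)]])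
  have 2: "fmul h g F (fpow h g (w, 1) 5) \<noteq> (0, 0)" by (rule fmul_nonzero[OF F5(2) W])
  have "subdegree (heval fps_const 5 (lin P1 ^ 5) Xs Zs)
      \<le> subdegree (fev (5 + 15) (fmul h g F (fpow h g (w, 1) 5)) Xs Zs Ys)"
    if t: "tri h g Q Xs Zs Ys" for Q Xs Zs Ys
  proof -
    have "fev (5 + 15) (fmul h g F (fpow h g (w, 1) 5)) Xs Zs Ys = fev 5 F Xs Zs Ys * fev 3 (w, 1) Xs Zs Ys ^ 5"
      unfolding fev_fmul[OF d tri_curve[OF d t] F5(1) isf_wpow[OF w(1)]] fev_wpow[OF t w(1)] ..
    moreover have "fev 5 F Xs Zs Ys \<noteq> 0" "fev 3 (w, 1) Xs Zs Ys \<noteq> 0"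
      by (rule fev_nonzero[OF cv t F5]) (rule fev_nonzero[OF cv t isf_wform[OF w(1)]], simp)
    ultimately have "subdegree (fev (5 + 15) (fmul h g F (fpow h g (w, 1) 5)) Xs Zs Ys)
        = 5 * (of_bool (Q = P1) + of_bool (Q = P2)) + 5 * subdegree (fev 3 (w, 1) Xs Zs Ys)"
      using F t by (simp add: quintic_div_def subdegree_power)
    then show ?thesis using subdegree_lin_power[OF cv t P(1), of 5] subdegree_lin_le[OF t w] by simp
  qed
  then show ?thesis by (intro form_divide_exact[OF 1 2 _ degree_lin_power]) simp_all
qed

text \<open>Needed for \<open>P1 = P2\<close>: the single identities then detect only order 5, this
  one detects order 10.\<close>

lemma quintic_div_identity12:
  assumes F: "quintic_div h g P1 P2 F" and P: "P1 \<in> points h g" "P2 \<in> points h g"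
    and w1: "Polynomial.degree w1 \<le> 3" "wval w1 (iota h P1) = 0"
    and w2: "Polynomial.degree w2 \<le> 3" "wval w2 (iota h P2) = 0"
  shows "\<exists>G. isf 25 G \<and> fmul h g F (fmul h g (fpow h g (w1, 1) 5) (fpow h g (w2, 1) 5))
    = fmul h g ((lin P1 * lin P2) ^ 5, 0) G"
proof -
  note d = genus2_degree[OF cv]
  let ?W = "fmul h g (fpow h g (w1, 1) 5) (fpow h g (w2, 1) 5)"
  have F5: "isf 5 F" "F \<noteq> (0, 0)" using F by (auto simp: quintic_div_def)
  have W: "?W \<noteq> (0, 0)" by (intro fmul_nonzero fpow_nonzero) simp_all
  have W30: "isf (15 + 15) ?W" by (rule isf_fmul[OF d isf_wpow[OF w1(1)] isf_wpow[OF w2(1)]])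
  have 1: "isf (5 + (15 + 15)) (fmul h g F ?W)" by (rule isf_fmul[OF d F5(1) W30])
  have 2: "fmul h g F ?W \<noteq> (0, 0)" by (rule fmul_nonzero[OF F5(2) W])
  have "subdegree (heval fps_const (2 * 5) ((lin P1 * lin P2) ^ 5) Xs Zs)
      \<le> subdegree (fev (5 + (15 + 15)) (fmul h g F ?W) Xs Zs Ys)"
    if t: "tri h g Q Xs Zs Ys" for Q Xs Zs Ys
  proof -
    have "fev (5 + (15 + 15)) (fmul h g F ?W) Xs Zs Ys
        = fev 5 F Xs Zs Ys * (fev 3 (w1, 1) Xs Zs Ys ^ 5 * fev 3 (w2, 1) Xs Zs Ys ^ 5)"
      unfolding fev_fmul[OF d tri_curve[OF d t] F5(1) W30]
        fev_fmul[OF d tri_curve[OF d t] isf_wpow[OF w1(1)] isf_wpow[OF w2(1)]]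
        fev_wpow[OF t w1(1)] fev_wpow[OF t w2(1)] ..
    moreover have "fev 5 F Xs Zs Ys \<noteq> 0" by (rule fev_nonzero[OF cv t F5])
    moreover have "fev 3 (w1, 1) Xs Zs Ys \<noteq> 0" "fev 3 (w2, 1) Xs Zs Ys \<noteq> 0"
      by (rule fev_nonzero[OF cv t isf_wform[OF w1(1)]], simp, rule fev_nonzero[OF cv t isf_wform[OF w2(1)]], simp)
    ultimately have "subdegree (fev (5 + (15 + 15)) (fmul h g F ?W) Xs Zs Ys)
        = 5 * (of_bool (Q = P1) + of_bool (Q = P2))
          + (5 * subdegree (fev 3 (w1, 1) Xs Zs Ys) + 5 * subdegree (fev 3 (w2, 1) Xs Zs Ys))"
      using F t by (simp add: quintic_div_def subdegree_power)
    then show ?thesis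
      using subdegree_lin_mult_power[OF cv t P, of 5] subdegree_lin_le[OF t w1] subdegree_lin_le[OF t w2]
      by simp
  qed
  then show ?thesis by (intro form_divide_exact[OF 1 2 _ degree_lin_mult_power]) simp_all
qed

lemma quintic_div_commute: "quintic_div h g P1 P2 F \<longleftrightarrow> quintic_div h g P2 P1 F"
  by (auto simp: quintic_div_def add.commute)

lemma subdegree_norm:
  assumes t: "tri h g Q Xs Zs Ys" and F: "isf N F" "F \<noteq> (0, 0)"
  shows "subdegree (heval fps_const (N + N) (fnorm h g F) Xs Zs)
    = subdegree (fev N F Xs Zs Ys) + subdegree (fev N F Xs Zs (- Ys - heval fps_const 3 h Xs Zs))"
proof -
  note d = genus2_degree[OF cv]
  have "heval fps_const (N + N) (fnorm h g F) Xs Zs = fev (N + N) (fmul h g F (fconj h F)) Xs Zs Ys"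
    unfolding fmul_fconj fev_scalar ..
  also have "\<dots> = fev N F Xs Zs Ys * fev N F Xs Zs (- Ys - heval fps_const 3 h Xs Zs)"
    unfolding fev_fmul[OF d tri_curve[OF d t] F(1) isf_fconj[OF d(1) F(1)]] fev_fconj[OF d(1) F(1)] ..
  finally show ?thesis
    using fev_nonzero[OF cv t F] fev_nonzero[OF cv tri_iota[OF d(1) t] F] by simp
qed

lemma degree_fnorm: "isf N F \<Longrightarrow> Polynomial.degree (fnorm h g F) \<le> N + N"
  using isf_fmul[OF genus2_degree[OF cv], of N F N "fconj h F"] isf_fconj[OF genus2_degree(1)[OF cv], of N F]
  by (simp add: fmul_fconj isf_scalar)

text \<open>The order of the norm at a point is the sum of the orders of \<open>F\<close> there and
  at the opposite point. So the norm is divisible by the tenth-degree form on the right, and the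
  cofactor has degree 0.\<close>

lemma quintic_div_norm:
  assumes F: "quintic_div h g P1 P2 F" and P: "P1 \<in> points h g" "P2 \<in> points h g"
  shows "\<exists>c. c \<noteq> 0 \<and> fnorm h g F = smult c ((lin P1 * lin P2) ^ 5)"
proof -
  note d = genus2_degree[OF cv]
  have F5: "isf 5 F" "F \<noteq> (0, 0)" using F by (auto simp: quintic_div_def)
  have n0: "fnorm h g F \<noteq> 0" by (rule fnorm_nonzero[OF cv F5(2)])
  have 1: "isf (5 + 5) (fnorm h g F, 0)" using degree_fnorm[OF F5(1)] by (simp add: isf_scalar)
  have "subdegree (heval fps_const (2 * 5) ((lin P1 * lin P2) ^ 5) Xs Zs)
      \<le> subdegree (fev (5 + 5) (fnorm h g F, 0) Xs Zs Ys)" if t: "tri h g Q Xs Zs Ys" for Q Xs Zs Ys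
  proof -
    have "subdegree (fev 5 F Xs Zs Ys) = 5 * (of_bool (Q = P1) + of_bool (Q = P2))"
      "subdegree (fev 5 F Xs Zs (- Ys - heval fps_const 3 h Xs Zs))
        = 5 * (of_bool (iota h Q = P1) + of_bool (iota h Q = P2))"
      using F t tri_iota[OF d(1) t] unfolding quintic_div_def by blast+
    then show ?thesis unfolding fev_scalar subdegree_norm[OF t F5] subdegree_lin_mult_power[OF cv t P]
      by (simp add: iota_eq_iff)
  qed
  then have "\<exists>G. isf 0 G \<and> (fnorm h g F, 0) = fmul h g ((lin P1 * lin P2) ^ 5, 0) G"
    by (intro form_divide_exact[OF 1 _ _ degree_lin_mult_power]) (simp_all add: n0)
  then obtain G where G: "isf 0 G" "(fnorm h g F, 0) = fmul h g ((lin P1 * lin P2) ^ 5, 0) G" by blast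
  then have "Polynomial.degree (fst G) = 0" by (simp add: isf_def)
  then obtain c where "fst G = [:c:]" by (auto elim: degree_eq_zeroE)
  then have "fnorm h g F = smult c ((lin P1 * lin P2) ^ 5)" using G(2) by (simp add: fmul_scalar)
  with n0 show ?thesis by (intro exI[of _ c]) auto
qed

text \<open>The converse of the preceding identities. Its hypotheses are polynomial identities and a
  nonvanishing constant, and can therefore be checked after a pullback or a reduction.\<close>

lemma quintic_divI:
  assumes F: "isf 5 F" and P: "P1 \<in> points h g" "P2 \<in> points h g" "P1 \<noteq> iota h P2"
    and N: "fnorm h g F = smult c ((lin P1 * lin P2) ^ 5)" "c \<noteq> 0"
    and w1: "Polynomial.degree w1 \<le> 3" "wval w1 (iota h P1) = 0"
    and w2: "Polynomial.degree w2 \<le> 3" "wval w2 (iota h P2) = 0"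
    and G1: "isf 15 G1" "fmul h g F (fpow h g (w1, 1) 5) = fmul h g (lin P1 ^ 5, 0) G1"
    and G2: "isf 15 G2" "fmul h g F (fpow h g (w2, 1) 5) = fmul h g (lin P2 ^ 5, 0) G2"
    and G: "isf 25 G" "fmul h g F (fmul h g (fpow h g (w1, 1) 5) (fpow h g (w2, 1) 5))
      = fmul h g ((lin P1 * lin P2) ^ 5, 0) G"
  shows "quintic_div h g P1 P2 F"
proof -
  note d = genus2_degree[OF cv]
  have F0: "F \<noteq> (0, 0)" using N by (auto simp: fnorm_def)
  have L0: "(lin P ^ n, 0) \<noteq> (0, 0 :: 'a poly)" "((lin P1 * lin P2) ^ n, 0) \<noteq> (0, 0 :: 'a poly)" for P n by auto
  have wp0: "fpow h g (w, 1) 5 \<noteq> (0, 0)" for w by (rule fpow_nonzero) simp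
  \<comment> \<open>The identity gives ord \<open>F\<close> + 5 ord \<open>(w + y)\<close> = 5 ord
    \<open>(lin P)\<close> + ord \<open>G\<close>, and by \<open>subdegree_wform\<close> the order
    of \<open>lin P\<close> exceeds that of \<open>w + y\<close> by 1.\<close>
  have single: "5 \<le> subdegree (fev 5 F Xs Zs Ys)"
    if w: "Polynomial.degree w \<le> 3" "wval w (iota h P) = 0" and t: "tri h g P Xs Zs Ys"
      and G: "isf 15 G" "fmul h g F (fpow h g (w, 1) 5) = fmul h g (lin P ^ 5, 0) G"
    for w P Xs Zs Ys G
  proof -
    have G0: "G \<noteq> (0, 0)" using G(2) fmul_nonzero[OF F0 wp0[of w]] by (auto simp: fmul_scalar)
    have "fev (5 + 15) (fmul h g F (fpow h g (w, 1) 5)) Xs Zs Ys = fev (5 + 15) (fmul h g (lin P ^ 5, 0) G) Xs Zs Ys"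
      using G(2) by simp
    then have "fev 5 F Xs Zs Ys * fev 3 (w, 1) Xs Zs Ys ^ 5 = heval fps_const 5 (lin P ^ 5) Xs Zs * fev 15 G Xs Zs Ys"
      unfolding fev_fmul[OF d tri_curve[OF d t] F isf_wpow[OF w(1)]] fev_wpow[OF t w(1)] fev_scalar[symmetric]
      by (subst (asm) fev_fmul[OF d tri_curve[OF d t] _ G(1)]) (simp_all add: isf_scalar degree_lin_power fev_scalar)
    then have "subdegree (fev 5 F Xs Zs Ys * fev 3 (w, 1) Xs Zs Ys ^ 5)
        = subdegree (heval fps_const 5 (lin P ^ 5) Xs Zs * fev 15 G Xs Zs Ys)" by simp
    moreover have "fev 5 F Xs Zs Ys \<noteq> 0" "fev 3 (w, 1) Xs Zs Ys \<noteq> 0" "fev 15 G Xs Zs Ys \<noteq> 0"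
      using fev_nonzero[OF cv t F F0] fev_nonzero[OF cv t isf_wform[OF w(1)]] fev_nonzero[OF cv t G(1) G0]
      by auto
    moreover have "heval fps_const 5 (lin P ^ 5) Xs Zs \<noteq> 0"
      by (rule heval_nonzero[OF cv t _ degree_lin_power]) simp
    ultimately have "subdegree (fev 5 F Xs Zs Ys) + 5 * subdegree (fev 3 (w, 1) Xs Zs Ys)
        = subdegree (heval fps_const 5 (lin P ^ 5) Xs Zs) + subdegree (fev 15 G Xs Zs Ys)"
      by (simp add: subdegree_power)
    moreover have "subdegree (heval fps_const 5 (lin P ^ 5) Xs Zs) = 5 * subdegree (heval fps_const 1 (lin P) Xs Zs)"
      using fps_const_hom.heval_power[OF degree_lin[of P], of 5 Xs Zs] by (simp add: subdegree_power)
    ultimately show ?thesis using subdegree_wform[OF cv t w] by linarith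
  qed
  have double: "10 \<le> subdegree (fev 5 F Xs Zs Ys)"
    if t: "tri h g P1 Xs Zs Ys" and eq: "P1 = P2" for Xs Zs Ys
  proof -
    let ?W = "fmul h g (fpow h g (w1, 1) 5) (fpow h g (w2, 1) 5)"
    have W30: "isf (15 + 15) ?W" by (rule isf_fmul[OF d isf_wpow[OF w1(1)] isf_wpow[OF w2(1)]])
    have W0: "?W \<noteq> (0, 0)" by (rule fmul_nonzero[OF wp0 wp0])
    have G0: "G \<noteq> (0, 0)" using G(2) fmul_nonzero[OF F0 W0] by (auto simp: fmul_scalar)
    have "fev (5 + (15 + 15)) (fmul h g F ?W) Xs Zs Ys = fev (2 * 5 + 25) (fmul h g ((lin P1 * lin P2) ^ 5, 0) G) Xs Zs Ys"
      using G(2) by simp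
    moreover have "fev (5 + (15 + 15)) (fmul h g F ?W) Xs Zs Ys
        = fev 5 F Xs Zs Ys * (fev 3 (w1, 1) Xs Zs Ys ^ 5 * fev 3 (w2, 1) Xs Zs Ys ^ 5)"
      unfolding fev_fmul[OF d tri_curve[OF d t] F W30]
        fev_fmul[OF d tri_curve[OF d t] isf_wpow[OF w1(1)] isf_wpow[OF w2(1)]]
        fev_wpow[OF t w1(1)] fev_wpow[OF t w2(1)] ..
    moreover have e: "fev (2 * 5 + 25) (fmul h g ((lin P1 * lin P2) ^ 5, 0) G) Xs Zs Ys
        = fev (2 * 5) ((lin P1 * lin P2) ^ 5, 0) Xs Zs Ys * fev 25 G Xs Zs Ys"
      by (rule fev_fmul[OF d tri_curve[OF d t] _ G(1)]) (simp only: isf_scalar degree_lin_mult_power)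
    moreover note e[unfolded fev_scalar]
    ultimately have "subdegree (fev 5 F Xs Zs Ys * (fev 3 (w1, 1) Xs Zs Ys ^ 5 * fev 3 (w2, 1) Xs Zs Ys ^ 5))
        = subdegree (heval fps_const (2 * 5) ((lin P1 * lin P2) ^ 5) Xs Zs * fev 25 G Xs Zs Ys)" by metis
    moreover have "fev 5 F Xs Zs Ys \<noteq> 0" "fev 3 (w1, 1) Xs Zs Ys \<noteq> 0" "fev 3 (w2, 1) Xs Zs Ys \<noteq> 0"
      "fev 25 G Xs Zs Ys \<noteq> 0"
      using fev_nonzero[OF cv t F F0] fev_nonzero[OF cv t isf_wform[OF w1(1)]]
        fev_nonzero[OF cv t isf_wform[OF w2(1)]] fev_nonzero[OF cv t G(1) G0] by auto
    moreover have "heval fps_const (2 * 5) ((lin P1 * lin P2) ^ 5) Xs Zs \<noteq> 0"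
      by (rule heval_nonzero[OF cv t _ degree_lin_mult_power]) simp
    ultimately have "subdegree (fev 5 F Xs Zs Ys)
          + (5 * subdegree (fev 3 (w1, 1) Xs Zs Ys) + 5 * subdegree (fev 3 (w2, 1) Xs Zs Ys))
        = subdegree (heval fps_const (2 * 5) ((lin P1 * lin P2) ^ 5) Xs Zs) + subdegree (fev 25 G Xs Zs Ys)"
      by (simp add: subdegree_power)
    moreover have "subdegree (heval fps_const (2 * 5) ((lin P1 * lin P2) ^ 5) Xs Zs)
        = 10 * subdegree (heval fps_const 1 (lin P1) Xs Zs)"
      using subdegree_lin_mult_power[OF cv t P(1,2), of 5] subdegree_lin[OF cv t P(1)] eq by simp
    ultimately show ?thesis
      using subdegree_wform[OF cv t w1] subdegree_wform[OF cv t w2(1)] w2(2) eq by simp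
  qed
  have lower: "5 * (of_bool (Q = P1) + of_bool (Q = P2)) \<le> subdegree (fev 5 F Xs Zs Ys)"
    if t: "tri h g Q Xs Zs Ys" for Q Xs Zs Ys
  proof (cases "Q = P1")
    case True
    then show ?thesis using t double[of Xs Zs Ys] single[OF w1 _ G1, of Xs Zs Ys] by (cases "P1 = P2") auto
  next
    case False
    then show ?thesis using t single[OF w2 _ G2, of Xs Zs Ys] by (cases "Q = P2") auto
  qed
  have "subdegree (fev 5 F Xs Zs Ys) = 5 * (of_bool (Q = P1) + of_bool (Q = P2))"
    if t: "tri h g Q Xs Zs Ys" for Q Xs Zs Ys
  proof -
    have "heval fps_const (5 + 5) (fnorm h g F) Xs Zs = fps_const c * heval fps_const (2 * 5) ((lin P1 * lin P2) ^ 5) Xs Zs"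
      unfolding N(1) fps_const_hom.heval_smult by simp
    moreover have "heval fps_const (2 * 5) ((lin P1 * lin P2) ^ 5) Xs Zs \<noteq> 0"
      by (rule heval_nonzero[OF cv t _ degree_lin_mult_power]) simp
    ultimately have "subdegree (heval fps_const (5 + 5) (fnorm h g F) Xs Zs)
        = subdegree (heval fps_const (2 * 5) ((lin P1 * lin P2) ^ 5) Xs Zs)"
      using N(2) by simp
    then have "subdegree (fev 5 F Xs Zs Ys) + subdegree (fev 5 F Xs Zs (- Ys - heval fps_const 3 h Xs Zs))
        = 5 * (of_bool (Q = P1) + of_bool (Q = iota h P1)) + 5 * (of_bool (Q = P2) + of_bool (Q = iota h P2))"
      unfolding subdegree_norm[OF t F F0] subdegree_lin_mult_power[OF cv t P(1,2)] .
    \<comment> \<open>The lower bounds at \<open>Q\<close> and at its opposite add up to the value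
      that the norm prescribes for the sum, so both are equalities.\<close>
    moreover note lower[OF t] lower[OF tri_iota[OF d(1) t]]
    ultimately show ?thesis by (simp add: iota_eq_iff)
  qed
  then show ?thesis using F F0 by (auto simp: quintic_div_def)
qed

end

section \<open>The quintic form of a 5-torsion class\<close>

text \<open>With D = div (F1 / F2), the quotient is F1 times the conjugate of F2, over the norm of
  F2. Multiplication by \<open>Z^5\<close> removes the pole at infinity, so the norm divides the
  numerator and leaves a form of degree 5. Degree 6 and \<open>2 \<noteq> 0\<close> give two
  distinct points at infinity, at which Z vanishes simply.\<close>

lemma torsion_quintic_form:
  fixes f :: "'a::alg_closed_field poly"
  assumes cv: "genus2_curve 0 f" and f: "Polynomial.degree f = 6" and two: "(2 :: 'a) \<noteq> 0"
    and D: "D \<in> principal_divisors 0 f"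
    and lookup_D: "\<And>Q. Q \<in> points 0 f \<Longrightarrow> Poly_Mapping.lookup D Q
      = 5 * (of_bool (Q = P1) + of_bool (Q = P2) - of_bool (Q \<in> infinite_points 0 f))"
  shows "\<exists>F. quintic_div 0 f P1 P2 F"
proof -
  note d = genus2_degree[OF cv]
  obtain b where b: "b\<^sup>2 = Polynomial.coeff f 6" using nth_root_exists[of 2 "Polynomial.coeff f 6"] by auto
  have "Polynomial.coeff f 6 \<noteq> 0" using f by (metis leading_coeff_neq_0 degree_0 zero_neq_numeral)
  then have b0: "b \<noteq> 0" using b by auto
  have Ib: "Inf b \<in> points 0 f" using b by (simp add: points_simps poly_rev_poly_0)
  have inf: "Q \<in> infinite_points 0 f \<longleftrightarrow> Q = Inf b \<or> Q = iota 0 (Inf b)" for Q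
    by (auto simp: infinite_points_def poly_rev_poly_0 b[symmetric] power2_eq_iff)
  have bb: "Inf b \<noteq> iota 0 (Inf b)"
  proof
    assume "Inf b = iota 0 (Inf b)"
    then have "b + b = 0" by (simp add: eq_neg_iff_add_eq_0)
    then show False using b0 two by (simp flip: mult_2)
  qed
  have sdZ: "subdegree Zs = of_bool (Q \<in> infinite_points 0 f)" if "tri 0 f Q Xs Zs Ys" for Q Xs Zs Ys
    using subdegree_lin[OF cv that Ib] fps_const_hom.heval_1[of 1 Xs Zs] bb by (auto simp: inf)
  from D obtain N A1 B1 A2 B2 where N: "is_form N A1 B1" "is_form N A2 B2"
    and ord: "\<And>Q. Q \<in> points 0 f \<Longrightarrow> Poly_Mapping.lookup D Q
      = int (form_ord 0 f N A1 B1 Q) - int (form_ord 0 f N A2 B2 Q)"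
    unfolding principal_divisors_def by blast
  let ?F1 = "(A1, B1)" and ?F2 = "(A2, B2)"
  have F1: "isf N ?F1" "?F1 \<noteq> (0, 0)" and F2: "isf N ?F2" "?F2 \<noteq> (0, 0)"
    using N by (auto simp: is_form_isf)
  let ?G = "fmul 0 f ?F1 (fconj 0 ?F2)" and ?n = "fnorm 0 f ?F2"
  have c2: "isf N (fconj 0 ?F2)" "fconj 0 ?F2 \<noteq> (0, 0)" using isf_fconj[OF d(1) F2(1)] F2(2)
    by (auto simp: fconj_def)
  have G: "isf (N + N) ?G" "?G \<noteq> (0, 0)"
    using isf_fmul[OF d F1(1) c2(1)] fmul_nonzero[OF cv F1(2) c2(2)] by auto
  \<comment> \<open>Raising the degree by 5 is the multiplication by \<open>Z^5\<close>.\<close>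
  have G5: "isf (N + N + 5) ?G" by (rule isf_mono[OF G(1)]) simp
  have n0: "?n \<noteq> 0" by (rule fnorm_nonzero[OF cv F2(2)])
  have nd: "Polynomial.degree ?n \<le> N + N" by (rule degree_fnorm[OF cv F2(1)])
  have sdG: "subdegree (fev (N + N + 5) ?G Xs Zs Ys)
      = subdegree (heval fps_const (N + N) ?n Xs Zs) + 5 * (of_bool (Q = P1) + of_bool (Q = P2))"
    if t: "tri 0 f Q Xs Zs Ys" for Q Xs Zs Ys
  proof -
    let ?Y = "- Ys - heval fps_const 3 0 Xs Zs"
    have "fev (N + N + 5) ?G Xs Zs Ys = Zs ^ 5 * (fev N ?F1 Xs Zs Ys * fev N ?F2 Xs Zs ?Y)"
      unfolding fev_raise[OF G(1)] fev_fmul[OF d tri_curve[OF d t] F1(1) c2(1)] fev_fconj[OF d(1) F2(1)] ..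
    moreover from this have "Zs \<noteq> 0" using fev_nonzero[OF cv t G5 G(2)] by auto
    moreover have nz: "fev N ?F1 Xs Zs Ys \<noteq> 0" "fev N ?F2 Xs Zs Ys \<noteq> 0" "fev N ?F2 Xs Zs ?Y \<noteq> 0"
      using fev_nonzero[OF cv t F1] fev_nonzero[OF cv t F2] fev_nonzero[OF cv tri_iota[OF d(1) t] F2] by auto
    ultimately have "subdegree (fev (N + N + 5) ?G Xs Zs Ys)
        = 5 * of_bool (Q \<in> infinite_points 0 f) + (subdegree (fev N ?F1 Xs Zs Ys) + subdegree (fev N ?F2 Xs Zs ?Y))"
      using sdZ[OF t] by (simp add: subdegree_power)
    moreover have "subdegree (heval fps_const (N + N) ?n Xs Zs)
        = subdegree (fev N ?F2 Xs Zs Ys) + subdegree (fev N ?F2 Xs Zs ?Y)"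
      by (rule subdegree_norm[OF cv t F2])
    moreover have "int (subdegree (fev N ?F1 Xs Zs Ys)) - int (subdegree (fev N ?F2 Xs Zs Ys))
        = 5 * (of_bool (Q = P1) + of_bool (Q = P2) - of_bool (Q \<in> infinite_points 0 f))"
      using ord[OF tri_point[OF t]] lookup_D[OF tri_point[OF t]]
        form_ord_fev[OF cv t N(1) nz(1)] form_ord_fev[OF cv t N(2) nz(2)] by simp
    ultimately show ?thesis by (auto simp: of_bool_def split: if_splits)
  qed
  have "\<exists>F. isf 5 F \<and> ?G = fmul 0 f (?n, 0) F"
    by (rule form_divide_exact[OF cv G5 G(2) n0 nd refl]) (subst sdG, assumption, rule le_add1)
  then obtain F where F: "isf 5 F" "?G = fmul 0 f (?n, 0) F" by blast
  have F0: "F \<noteq> (0, 0)" using F(2) G(2) by (auto simp: fmul_def)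
  have "subdegree (fev 5 F Xs Zs Ys) = 5 * (of_bool (Q = P1) + of_bool (Q = P2))"
    if t: "tri 0 f Q Xs Zs Ys" for Q Xs Zs Ys
  proof -
    have "isf (N + N) (?n, 0)" using nd by (simp add: isf_scalar)
    then have "fev (N + N + 5) ?G Xs Zs Ys = fev (N + N) (?n, 0) Xs Zs Ys * fev 5 F Xs Zs Ys"
      unfolding F(2) by (rule fev_fmul[OF d tri_curve[OF d t] _ F(1)])
    then show ?thesis
      using sdG[OF t] heval_nonzero[OF cv t n0 nd] fev_nonzero[OF cv t F(1) F0] by (simp add: fev_scalar)
  qed
  then have "quintic_div 0 f P1 P2 F" unfolding quintic_div_def using F(1) F0 by blast
  then show ?thesis by blast
qed

section \<open>Change of Weierstrass model\<close>

lemma degree_power_le_exponent: "Polynomial.degree A \<le> 1 \<Longrightarrow> Polynomial.degree (A ^ k) \<le> k"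
  using degree_power_le[of A k] mult_le_mono1[of "Polynomial.degree A" 1 k] by linarith

lemma (in comm_ring_hom) heval_sum: "heval hom n (\<Sum>i\<in>I. A i) Xs Zs = (\<Sum>i\<in>I. heval hom n (A i) Xs Zs)"
  by (induction I rule: infinite_finite_induct) (simp_all add: heval_add)

lemma (in comm_ring_hom) heval_hom_subst:
  assumes "Polynomial.degree L \<le> 1" "Polynomial.degree M \<le> 1"
  shows "heval hom n (hom_subst n f L M) Xs Zs = heval hom n f (heval hom 1 L Xs Zs) (heval hom 1 M Xs Zs)"
proof -
  have "heval hom n (hom_subst n f L M) Xs Zs
      = (\<Sum>i\<le>n. hom (Polynomial.coeff f i) * heval hom n (L ^ i * M ^ (n - i)) Xs Zs)"
    unfolding hom_subst_def heval_sum heval_smult ..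
  also have "\<dots> = (\<Sum>i\<le>n. hom (Polynomial.coeff f i) * heval hom 1 L Xs Zs ^ i * heval hom 1 M Xs Zs ^ (n - i))"
  proof (rule sum.cong[OF refl])
    fix i assume "i \<in> {..n}"
    then have n: "n = 1 * i + 1 * (n - i)" by simp
    have "heval hom (1 * i + 1 * (n - i)) (L ^ i * M ^ (n - i)) Xs Zs
        = heval hom (1 * i) (L ^ i) Xs Zs * heval hom (1 * (n - i)) (M ^ (n - i)) Xs Zs"
      using assms by (intro heval_mult) (simp_all add: degree_power_le_exponent)
    then show "hom (Polynomial.coeff f i) * heval hom n (L ^ i * M ^ (n - i)) Xs Zs
        = hom (Polynomial.coeff f i) * heval hom 1 L Xs Zs ^ i * heval hom 1 M Xs Zs ^ (n - i)"
      unfolding heval_power[OF assms(1)] heval_power[OF assms(2)] n[symmetric] by (simp add: mult.assoc)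
  qed
  finally show ?thesis by (simp add: heval_def)
qed

lemma id_ring_hom: "comm_ring_hom (\<lambda>x::'a::comm_ring_1. x)"
  by unfold_locales auto

abbreviation hpoly :: "nat \<Rightarrow> 'a::comm_ring_1 poly \<Rightarrow> 'a \<Rightarrow> 'a \<Rightarrow> 'a" where
  "hpoly \<equiv> heval (\<lambda>x. x)"

lemma hpoly_Z_nonzero:
  fixes A :: "'a::field poly"
  assumes "Polynomial.degree A \<le> n" "z \<noteq> 0"
  shows "hpoly n A x z = z ^ n * poly A (x / z)"
proof -
  have "hpoly n A (z * (x / z)) (z * 1) = z ^ n * hpoly n A (x / z) 1" by (rule comm_ring_hom.heval_scale[OF id_ring_hom])
  moreover have "map_poly (\<lambda>x. x) A = A" by (rule poly_eqI) (simp add: coeff_map_poly)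
  moreover have "z * (x / z) = x" using assms(2) by simp
  ultimately show ?thesis using comm_ring_hom.heval_Z_1[OF id_ring_hom assms(1), of "x / z"] by (simp only: mult_1_right)
qed

lemma hpoly_Z_0: "hpoly n A x 0 = Polynomial.coeff A n * x ^ n"
proof -
  have "hpoly n A x 0 = (\<Sum>i\<le>n. if i = n then Polynomial.coeff A n * x ^ n else 0)"
    unfolding heval_def by (rule sum.cong) (auto simp: power_0_left)
  then show ?thesis by simp
qed

lemma poly_hom_subst: "poly (hom_subst n f L M) z = hpoly n f (poly L z) (poly M z)"
  by (simp add: hom_subst_def heval_def poly_sum mult.assoc)

lemma degree_hom_subst:
  assumes "Polynomial.degree L \<le> 1" "Polynomial.degree M \<le> 1"
  shows "Polynomial.degree (hom_subst n f L M) \<le> n"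
  unfolding hom_subst_def
proof (rule degree_sum_le)
  fix i assume "i \<in> {..n}"
  have "Polynomial.degree (smult (Polynomial.coeff f i) (L ^ i * M ^ (n - i)))
      \<le> Polynomial.degree (L ^ i) + Polynomial.degree (M ^ (n - i))"
    using degree_smult_le degree_mult_le le_trans by blast
  then show "Polynomial.degree (smult (Polynomial.coeff f i) (L ^ i * M ^ (n - i))) \<le> n"
    using degree_power_le_exponent[OF assms(1), of i] degree_power_le_exponent[OF assms(2), of "n - i"] \<open>i \<in> {..n}\<close> by simp
qed simp

text \<open>The point with weighted homogeneous coordinates \<open>(x : z : y)\<close>.\<close>

definition tpt :: "'a::field \<Rightarrow> 'a \<Rightarrow> 'a \<Rightarrow> 'a point" where
  "tpt x z y = (if z = 0 then Inf (y / x ^ 3) else Affine (x / z) (y / z ^ 3))"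

lemma tpt_points:
  fixes h g :: "'a::field poly"
  assumes "Polynomial.degree h \<le> 3" "Polynomial.degree g \<le> 6" "x \<noteq> 0 \<or> z \<noteq> 0"
    and "y\<^sup>2 + hpoly 3 h x z * y = hpoly 6 g x z"
  shows "tpt x z y \<in> points h g"
proof -
  have *: "(y / u ^ 3)\<^sup>2 + H * (y / u ^ 3) = G"
    if "y\<^sup>2 + u ^ 3 * H * y = u ^ 6 * G" "u \<noteq> 0" for u H G :: 'a
  proof -
    have "(y / u ^ 3)\<^sup>2 + H * (y / u ^ 3) = (y\<^sup>2 + u ^ 3 * H * y) / u ^ 6"
    proof -
      have "u ^ 6 = u ^ 3 * u ^ 3" by (simp flip: power_add)
      moreover have "(y / u ^ 3)\<^sup>2 = y\<^sup>2 / (u ^ 3 * u ^ 3)" by (simp add: power2_eq_square)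
      moreover have "H * (y / v) = v * H * y / (v * v)" if "v \<noteq> 0" for v using that by simp
      from this[of "u ^ 3"] have "H * (y / u ^ 3) = u ^ 3 * H * y / (u ^ 3 * u ^ 3)" using that(2) by simp
      ultimately show ?thesis by (simp only: add_divide_distrib)
    qed
    then show ?thesis unfolding that(1) using that(2) by simp
  qed
  show ?thesis
  proof (cases "z = 0")
    case True
    then show ?thesis using assms *[of x "Polynomial.coeff h 3" "Polynomial.coeff g 6"]
      by (simp add: tpt_def points_simps poly_rev_poly_0 hpoly_Z_0 mult.commute)
  next
    case False
    then show ?thesis using assms *[of z "poly h (x / z)" "poly g (x / z)"]
      by (simp add: tpt_def points_simps hpoly_Z_nonzero)
  qed
qed

lemma iota_tpt:
  assumes "Polynomial.degree h \<le> 3" "x \<noteq> 0 \<or> z \<noteq> 0"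
  shows "iota h (tpt x z y) = tpt x z (- y - hpoly 3 h x z)"
  using assms by (cases "z = 0") (simp_all add: tpt_def hpoly_Z_0 hpoly_Z_nonzero diff_divide_distrib)

lemma wval_tpt:
  assumes "Polynomial.degree w \<le> 3" "x \<noteq> 0 \<or> z \<noteq> 0" "hpoly 3 w x z + y = 0"
  shows "wval w (tpt x z y) = 0"
proof (cases "z = 0")
  case True
  then have "x \<noteq> 0" "Polynomial.coeff w 3 * x ^ 3 + y = 0" using assms by (auto simp: hpoly_Z_0)
  moreover have "Polynomial.coeff w 3 + y / x ^ 3 = (Polynomial.coeff w 3 * x ^ 3 + y) / x ^ 3"
    using \<open>x \<noteq> 0\<close> by (simp add: add_divide_distrib)
  ultimately show ?thesis using True by (simp add: tpt_def)
next
  case False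
  then have "z ^ 3 * poly w (x / z) + y = 0" using assms by (simp add: hpoly_Z_nonzero)
  moreover have "poly w (x / z) + y / z ^ 3 = (z ^ 3 * poly w (x / z) + y) / z ^ 3"
    using False by (simp add: add_divide_distrib)
  ultimately show ?thesis using False by (simp add: tpt_def)
qed

lemma lin_tpt:
  assumes "x \<noteq> 0 \<or> z \<noteq> (0 :: 'a::field)"
  shows "\<exists>c. c \<noteq> 0 \<and> [:- x, z:] = smult c (lin (tpt x z y))"
  using assms by (intro exI[of _ "if z = 0 then - x else z"]) (auto simp: tpt_def)


text \<open>\<open>isomorphic_models\<close> for a source with \<open>h = 0\<close>, with its
  witnesses made explicit; the polynomial \<open>H\<close> is then zero.\<close>

definition same_curve :: "'a::field poly \<Rightarrow> 'a poly \<Rightarrow> 'a poly \<Rightarrow> 'a \<Rightarrow> 'a \<Rightarrow> 'a \<Rightarrow> 'a \<Rightarrow> 'a \<Rightarrow> 'a poly \<Rightarrow> bool" where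
  "same_curve f h g a b c d e t \<longleftrightarrow> a * d - b * c \<noteq> 0 \<and> e \<noteq> 0 \<and> Polynomial.degree t \<le> 3 \<and>
     smult e h = 2 * t \<and> smult (e\<^sup>2) g = hom_subst 6 f [:b, a:] [:d, c:] - t\<^sup>2"

lemma rev_poly_heval: "rev_poly n q = heval (\<lambda>c. [:c:]) n q 1 [:0, 1:]"
  by (simp add: rev_poly_def hom_subst_heval)

lemma rev_poly_smult: "rev_poly n (smult c q) = smult c (rev_poly n q)"
  unfolding rev_poly_heval const_poly_hom.heval_smult by simp

lemma rev_poly_mult:
  "Polynomial.degree p \<le> n \<Longrightarrow> Polynomial.degree q \<le> m \<Longrightarrow> rev_poly (n + m) (p * q) = rev_poly n p * rev_poly m q"
  unfolding rev_poly_heval by (rule const_poly_hom.heval_mult)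

text \<open>Exchange of X and Z: the columns of the matrix are swapped and the polynomials reversed.
  It makes every statement about affine points available at infinity.\<close>

lemma same_curve_swap:
  assumes "same_curve f h g a b c d e t"
  shows "same_curve f (rev_poly 3 h) (rev_poly 6 g) b a d c e (rev_poly 3 t)"
proof -
  have t: "Polynomial.degree t \<le> 3" and h: "smult e h = 2 * t"
    and g: "smult (e\<^sup>2) g = hom_subst 6 f [:b, a:] [:d, c:] - t\<^sup>2" and D: "a * d - b * c \<noteq> 0" "e \<noteq> 0"
    using assms by (auto simp: same_curve_def)
  have "b * c - a * d \<noteq> 0" using D(1) by (simp add: algebra_simps)
  moreover have "smult e (rev_poly 3 h) = 2 * rev_poly 3 t"
  proof -
    have "smult e (rev_poly 3 h) = rev_poly 3 (t + t)" by (simp only: rev_poly_smult[symmetric] h mult_2)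
    also have "\<dots> = rev_poly 3 t + rev_poly 3 t"
      unfolding rev_poly_heval by (rule const_poly_hom.heval_add)
    finally show ?thesis by (simp only: mult_2)
  qed
  moreover have "smult (e\<^sup>2) (rev_poly 6 g) = hom_subst 6 f [:a, b:] [:c, d:] - (rev_poly 3 t)\<^sup>2"
  proof -
    have "rev_poly 6 (hom_subst 6 f [:b, a:] [:d, c:])
        = heval (\<lambda>c. [:c:]) 6 f (heval (\<lambda>c. [:c:]) 1 [:b, a:] 1 [:0, 1:]) (heval (\<lambda>c. [:c:]) 1 [:d, c:] 1 [:0, 1:])"
      unfolding rev_poly_heval by (rule const_poly_hom.heval_hom_subst) simp_all
    also have "\<dots> = hom_subst 6 f [:a, b:] [:c, d:]" unfolding hom_subst_heval by (simp add: heval_def)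
    finally have 1: "rev_poly 6 (hom_subst 6 f [:b, a:] [:d, c:]) = hom_subst 6 f [:a, b:] [:c, d:]" .
    have "rev_poly (3 + 3) (t * t) = rev_poly 3 t * rev_poly 3 t" by (rule rev_poly_mult[OF t t])
    then have 2: "rev_poly 6 (t\<^sup>2) = (rev_poly 3 t)\<^sup>2" by (simp add: power2_eq_square)
    have "smult (e\<^sup>2) (rev_poly 6 g) = rev_poly 6 (hom_subst 6 f [:b, a:] [:d, c:] - t\<^sup>2)"
      by (simp flip: rev_poly_smult add: g)
    also have "\<dots> = rev_poly 6 (hom_subst 6 f [:b, a:] [:d, c:]) - rev_poly 6 (t\<^sup>2)"
      unfolding rev_poly_heval by (rule const_poly_hom.heval_diff)
    finally show ?thesis unfolding 1 2 .
  qed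
  ultimately show ?thesis using D(2) degree_rev_poly by (auto simp: same_curve_def)
qed

text \<open>Completing the square, \<open>h^2 + 4 g\<close> is the transformed sextic
  \<open>S\<close> up to nonzero constants, and a singular point is a double root of
  \<open>S\<close>. Where the denominator \<open>?M\<close> is nonzero this gives a double root of
  \<open>f\<close>; where it vanishes, \<open>S\<close> has the nonzero value
  \<open>f_6 L^6\<close>.\<close>

lemma same_curve_nonsingular:
  fixes f h g :: "'a::alg_closed_field poly"
  assumes cv: "genus2_curve 0 f" and f: "Polynomial.degree f = 6" and two: "(2 :: 'a) \<noteq> 0"
    and iso: "same_curve f h g a b c d e t"
  shows "\<not> singular_at h g x y"
proof
  assume s: "singular_at h g x y"
  let ?L = "[:b, a:]" and ?M = "[:d, c:]"
  define S where "S = hom_subst 6 f ?L ?M"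
  have D: "a * d - b * c \<noteq> 0" "e \<noteq> 0" and h: "smult e h = 2 * t" and g: "smult (e\<^sup>2) g = S - t\<^sup>2"
    using iso by (auto simp: same_curve_def S_def)
  have four: "(4 :: 'a) \<noteq> 0"
  proof -
    have "(4 :: 'a) = 2 * 2" by simp
    then show ?thesis using two by (metis mult_eq_0_iff)
  qed
  have "smult (e\<^sup>2) (h\<^sup>2 + 4 * g) = (smult e h)\<^sup>2 + 4 * smult (e\<^sup>2) g"
    by (simp add: smult_add_right power2_eq_square)
  also have "\<dots> = 4 * S" unfolding h g by (simp add: algebra_simps power2_eq_square)
  finally have disc: "smult (e\<^sup>2) (h\<^sup>2 + 4 * g) = 4 * S" .
  have s1: "y\<^sup>2 + poly h x * y = poly g x" "2 * y + poly h x = 0" "poly (pderiv h) x * y = poly (pderiv g) x"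
    using s by (auto simp: singular_at_def)
  have "poly (h\<^sup>2 + 4 * g) x = (2 * y + poly h x)\<^sup>2"
    by (simp add: s1(1)[symmetric] power2_eq_square algebra_simps)
  then have "poly (smult (e\<^sup>2) (h\<^sup>2 + 4 * g)) x = 0" using s1(2) by simp
  then have S0: "poly S x = 0" unfolding disc using four by simp
  have p4: "pderiv (4 * q) = 4 * pderiv q" for q :: "'a poly"
    by (simp add: pderiv_mult pderiv_numeral)
  have "poly (pderiv (h\<^sup>2 + 4 * g)) x = 2 * poly (pderiv h) x * (2 * y + poly h x)"
    by (simp add: pderiv_add pderiv_mult p4 s1(3)[symmetric] power2_eq_square algebra_simps)
  then have "poly (pderiv (smult (e\<^sup>2) (h\<^sup>2 + 4 * g))) x = 0" using s1(2) by (simp add: pderiv_smult)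
  then have S1: "poly (pderiv S) x = 0" unfolding disc p4 using four by simp
  show False
  proof (cases "poly ?M x = 0")
    case True
    then have "poly S x = Polynomial.coeff f 6 * poly ?L x ^ 6"
      unfolding S_def poly_hom_subst by (simp only: hpoly_Z_0)
    moreover have "Polynomial.coeff f 6 \<noteq> 0" using f by (metis leading_coeff_neq_0 degree_0 zero_neq_numeral)
    moreover have "poly ?L x \<noteq> 0"
    proof
      assume "poly ?L x = 0"
      then have "a * poly ?M x - c * poly ?L x = 0" using True by simp
      then show False using D(1) by (simp add: algebra_simps)
    qed
    ultimately show False using S0 by simp
  next
    case False
    define x0 where "x0 = poly ?L x / poly ?M x"
    have "poly S x = poly ?M x ^ 6 * poly f x0"
      unfolding S_def poly_hom_subst x0_def using f False by (intro hpoly_Z_nonzero) auto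
    then have f0: "poly f x0 = 0" using S0 False by simp
    then obtain q where q: "f = [:- x0, 1:] * q" unfolding poly_eq_0_iff_dvd by (rule dvdE)
    have "q \<noteq> 0" using f q by auto
    then have "Polynomial.degree f = Suc (Polynomial.degree q)" unfolding q by (subst degree_mult_eq) auto
    then have dq: "Polynomial.degree q \<le> 5" using f by simp
    have "heval (\<lambda>c. [:c:]) (1 + 5) ([:- x0, 1:] * q) ?L ?M
        = heval (\<lambda>c. [:c:]) 1 [:- x0, 1:] ?L ?M * heval (\<lambda>c. [:c:]) 5 q ?L ?M"
      by (rule const_poly_hom.heval_mult[OF _ dq]) simp
    then have S: "S = (?L - smult x0 ?M) * hom_subst 5 q ?L ?M"
      unfolding S_def hom_subst_heval q by (simp add: heval_def)
    have x0: "x0 * poly ?M x = poly ?L x" using False by (simp add: x0_def del: poly_pCons)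
    have L0: "poly (?L - smult x0 ?M) x = 0" by (simp only: poly_diff poly_smult x0 diff_self)
    have "poly (pderiv (?L - smult x0 ?M)) x * poly (hom_subst 5 q ?L ?M) x = 0"
    proof -
      have "poly (pderiv ((?L - smult x0 ?M) * hom_subst 5 q ?L ?M)) x = 0" using S1 by (simp only: S)
      then show ?thesis by (simp only: pderiv_mult poly_add poly_mult L0 mult_zero_left add_0_left mult.commute)
    qed
    moreover have "poly (hom_subst 5 q ?L ?M) x = poly ?M x ^ 5 * poly q x0"
      unfolding poly_hom_subst x0_def using dq False by (intro hpoly_Z_nonzero) auto
    moreover have "poly (pderiv (?L - smult x0 ?M)) x = a - x0 * c"
      by (simp add: pderiv_pCons)
    \<comment> \<open>The derivative of the factor \<open>?L - smult x0 ?M\<close> is nonzero by the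
      determinant, so the second zero of \<open>S\<close> must come from the cofactor
      \<open>q\<close>.\<close>
    moreover have "(a - x0 * c) * poly ?M x = a * d - b * c"
    proof -
      have "(a - x0 * c) * poly ?M x = a * poly ?M x - c * (x0 * poly ?M x)" by (simp add: algebra_simps)
      also have "x0 * poly ?M x = poly ?L x" by (rule x0)
      finally show ?thesis by (simp add: algebra_simps)
    qed
    ultimately have "poly q x0 = 0" using False D(1) by auto
    then have "poly (pderiv f) x0 = 0" unfolding q by (simp add: pderiv_mult del: mult_pCons_left)
    then have "singular_at 0 f x0 0" using f0 by (simp add: singular_at_def)
    then show False using points_nonsingular(1)[OF cv] by blast
  qed
qed

lemma same_curve_genus2:
  fixes f h g :: "'a::alg_closed_field poly"
  assumes "genus2_curve 0 f" "Polynomial.degree f = 6" "(2 :: 'a) \<noteq> 0" "same_curve f h g a b c d e t"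
    and "Polynomial.degree h \<le> 3" "Polynomial.degree g \<le> 6"
  shows "genus2_curve h g"
  using same_curve_nonsingular[OF assms(1-4)] same_curve_nonsingular[OF assms(1-3) same_curve_swap[OF assms(4)]]
    assms(5,6) by (auto simp: genus2_curve_def)

definition scale_form :: "'a::comm_ring_1 \<Rightarrow> 'a form \<Rightarrow> 'a form" where
  "scale_form c F = (smult c (fst F), smult c (snd F))"

lemma fmul_scale_form: "fmul h g (scale_form c F) G = scale_form c (fmul h g F G)"
  "fmul h g F (scale_form c G) = scale_form c (fmul h g F G)"
  by (simp_all add: fmul_def scale_form_def smult_add_right smult_diff_right)

lemma scale_form_scale_form: "scale_form a (scale_form b F) = scale_form (a * b) F"
  by (simp add: scale_form_def)

lemma scale_form_one: "scale_form 1 F = F"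
  by (simp add: scale_form_def)

lemma fpow_scale_form: "fpow h g (scale_form c F) n = scale_form (c ^ n) (fpow h g F n)"
  by (induction n) (simp_all add: fpow_0 fpow_Suc scale_form_one fmul_scale_form scale_form_scale_form mult.commute)

lemma isf_scale_form: "isf N F \<Longrightarrow> isf N (scale_form c F)"
  using degree_smult_le[of c "fst F"] degree_smult_le[of c "snd F"]
  by (auto simp: isf_def scale_form_def)

text \<open>Substitution of \<open>x = (a X + b Z) / (c X + d Z)\<close> and
  \<open>y = (e Y + t) / (c X + d Z)^3\<close> into \<open>A + B y\<close>, with denominators
  cleared in degree \<open>N\<close>.\<close>

definition pullback :: "'a::field \<Rightarrow> 'a \<Rightarrow> 'a \<Rightarrow> 'a \<Rightarrow> 'a \<Rightarrow> 'a poly \<Rightarrow> nat \<Rightarrow> 'a form \<Rightarrow> 'a form" where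
  "pullback a b c d e t N F =
     (hom_subst N (fst F) [:b, a:] [:d, c:] + hom_subst (N - 3) (snd F) [:b, a:] [:d, c:] * t,
      smult e (hom_subst (N - 3) (snd F) [:b, a:] [:d, c:]))"

lemma pullback_scalar: "pullback a b c d e t N (q, 0) = (hom_subst N q [:b, a:] [:d, c:], 0)"
  by (simp add: pullback_def hom_subst_def)

lemma isf_pullback:
  assumes "isf N F" "Polynomial.degree t \<le> 3"
  shows "isf N (pullback a b c d e t N F)"
proof -
  have l: "Polynomial.degree [:b, a:] \<le> 1" "Polynomial.degree [:d, c:] \<le> 1" by auto
  note dh = degree_hom_subst[OF l]
  show ?thesis
  proof (cases "snd F = 0")
    case True
    then show ?thesis using dh[of N "fst F"] by (simp add: isf_def pullback_def hom_subst_def)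
  next
    case False
    then have N: "3 \<le> N" using assms by (auto simp: isf_def)
    have "Polynomial.degree (hom_subst (N - 3) (snd F) [:b, a:] [:d, c:] * t) \<le> N"
      using degree_mult_le[of "hom_subst (N - 3) (snd F) [:b, a:] [:d, c:]" t] dh[of "N - 3" "snd F"] N assms(2)
      by linarith
    moreover have "Polynomial.degree (smult e (hom_subst (N - 3) (snd F) [:b, a:] [:d, c:])) + 3 \<le> N"
      using degree_smult_le[of e "hom_subst (N - 3) (snd F) [:b, a:] [:d, c:]"] dh[of "N - 3" "snd F"] N
      by linarith
    ultimately show ?thesis using dh[of N "fst F"] by (auto simp: isf_def pullback_def intro!: degree_add_le)
  qed
qed

text \<open>Multiplicativity is the compatibility of the two curve equations:
  \<open>(e Y + t)^2\<close> equals the transformed \<open>f\<close> modulo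
  \<open>Y^2 = g - h Y\<close>.\<close>

lemma pullback_fmul:
  assumes iso: "same_curve f h g a b c d e t" and f: "Polynomial.degree f \<le> 6"
    and F: "isf N F" and G: "isf M G"
  shows "pullback a b c d e t (N + M) (fmul 0 f F G)
    = fmul h g (pullback a b c d e t N F) (pullback a b c d e t M G)"
proof -
  let ?s = "\<lambda>n q. heval (\<lambda>c. [:c:]) n q [:b, a:] [:d, c:]"
  have h: "smult e h = 2 * t" and g: "?s 6 f = smult (e\<^sup>2) g + t\<^sup>2"
    using iso by (auto simp: same_curve_def hom_subst_heval)
  note e = const_poly_hom.heval_fmul[OF _ f F G, of 0 "[:b, a:]" "[:d, c:]", simplified]
  obtain A B C D where ABCD: "A = ?s N (fst F)" "B = ?s (N - 3) (snd F)" "C = ?s M (fst G)" "D = ?s (M - 3) (snd G)"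
    by blast
  have "pullback a b c d e t (N + M) (fmul 0 f F G)
      = (A * C + (smult (e\<^sup>2) g + t\<^sup>2) * B * D + (A * D + B * C) * t, smult e (A * D + B * C))"
    unfolding pullback_def hom_subst_heval e ABCD g by simp
  also have "\<dots> = fmul h g (A + B * t, smult e B) (C + D * t, smult e D)"
  proof -
    have "h * smult e B * smult e D = smult e (smult e h * B * D)" by simp
    then have "h * smult e B * smult e D = smult e (2 * t * B * D)" unfolding h .
    then show ?thesis
      by (simp add: fmul_def algebra_simps power2_eq_square smult_add_right)
  qed
  finally show ?thesis by (simp add: pullback_def hom_subst_heval ABCD)
qed

lemma pullback_fpow:
  assumes iso: "same_curve f h g a b c d e t" and f: "Polynomial.degree f \<le> 6" and F: "isf N F"
  shows "pullback a b c d e t (n * N) (fpow 0 f F n) = fpow h g (pullback a b c d e t N F) n"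
proof (induction n)
  case 0
  then show ?case by (simp add: fpow_0 pullback_scalar hom_subst_def)
next
  case (Suc n)
  have "isf (n * N) (fpow 0 f F n)" by (rule isf_fpow[OF _ f F]) simp
  then show ?case using pullback_fmul[OF iso f F] Suc by (simp add: fpow_Suc)
qed

lemma pullback_fconj:
  assumes "same_curve f h g a b c d e t"
  shows "pullback a b c d e t N (fconj 0 F) = fconj h (pullback a b c d e t N F)"
proof -
  let ?B = "hom_subst (N - 3) (snd F) [:b, a:] [:d, c:]"
  have "smult e h = 2 * t" using assms by (simp add: same_curve_def)
  then have "h * smult e ?B = 2 * t * ?B" by (metis mult_smult_left mult_smult_right)
  moreover have "hom_subst (N - 3) (- snd F) [:b, a:] [:d, c:] = - ?B"
    unfolding hom_subst_heval by (rule const_poly_hom.heval_uminus)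
  ultimately show ?thesis by (simp add: pullback_def fconj_def algebra_simps)
qed


locale model_change =
  fixes f h g :: "'a::alg_closed_field poly" and a b c d e :: 'a and t :: "'a poly"
  assumes f_curve: "genus2_curve 0 f" and f_degree: "Polynomial.degree f = 6" and two: "(2 :: 'a) \<noteq> 0"
    and iso: "same_curve f h g a b c d e t"
    and hg_degree: "Polynomial.degree h \<le> 3" "Polynomial.degree g \<le> 6"
begin

lemma hg_curve: "genus2_curve h g"
  by (rule same_curve_genus2[OF f_curve f_degree two iso hg_degree])

lemma det: "a * d - b * c \<noteq> 0" and e0: "e \<noteq> 0" and t_degree: "Polynomial.degree t \<le> 3"
  and h_eq: "smult e h = 2 * t" and g_eq: "smult (e\<^sup>2) g = hom_subst 6 f [:b, a:] [:d, c:] - t\<^sup>2"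
  using iso by (auto simp: same_curve_def)

text \<open>\<open>imx\<close> and \<open>imz\<close> apply the adjugate matrix to
  \<open>(x : 1)\<close>. The substitution then returns \<open>(D x : D)\<close> with D the
  determinant (\<open>subst_im\<close>), and this scaling enters \<open>imy\<close>.\<close>

definition imx :: "'a \<Rightarrow> 'a" where "imx x = d * x - b"
definition imz :: "'a \<Rightarrow> 'a" where "imz x = a - c * x"
text \<open>The solution Y of \<open>e Y + t(X, Z) = D^3 y\<close>; as y has weight 3, the scaling
  by D appears cubed.\<close>

definition imy :: "'a \<Rightarrow> 'a \<Rightarrow> 'a" where
  "imy x y = ((a * d - b * c) ^ 3 * y - hpoly 3 t (imx x) (imz x)) / e"

text \<open>The image of the affine point \<open>(x, y)\<close> under the inverse of the substitution.\<close>

definition im :: "'a \<Rightarrow> 'a \<Rightarrow> 'a point" where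
  "im x y = tpt (imx x) (imz x) (imy x y)"

lemma imxz_nonzero: "imx x \<noteq> 0 \<or> imz x \<noteq> 0"
proof (rule ccontr)
  assume "\<not> ?thesis"
  then have "a * imx x + b * imz x = 0" "c * imx x + d * imz x = 0" by auto
  then have "c * (a * imx x + b * imz x) - a * (c * imx x + d * imz x) = 0"
    and "d * (a * imx x + b * imz x) - b * (c * imx x + d * imz x) = 0" by simp_all
  moreover have "c * imx x + d * imz x = a * d - b * c" by (simp add: imx_def imz_def algebra_simps)
  ultimately show False using \<open>c * imx x + d * imz x = 0\<close> det by simp
qed

lemma subst_im:
  "hpoly 1 [:b, a:] (imx x) (imz x) = (a * d - b * c) * x"
  "hpoly 1 [:d, c:] (imx x) (imz x) = a * d - b * c"
  by (simp_all add: heval_def imx_def imz_def algebra_simps)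

lemma hpoly_subst_im:
  assumes "Polynomial.degree q \<le> n"
  shows "hpoly n (hom_subst n q [:b, a:] [:d, c:]) (imx x) (imz x) = (a * d - b * c) ^ n * poly q x"
proof -
  have "hpoly n (hom_subst n q [:b, a:] [:d, c:]) (imx x) (imz x)
      = hpoly n q ((a * d - b * c) * x) (a * d - b * c)"
    using comm_ring_hom.heval_hom_subst[OF id_ring_hom, of "[:b, a:]" "[:d, c:]" n q "imx x" "imz x"]
    by (simp only: subst_im) simp
  then show ?thesis using hpoly_Z_nonzero[OF assms det] det by simp
qed

lemma im_e: "e * imy x y + hpoly 3 t (imx x) (imz x) = (a * d - b * c) ^ 3 * y"
  using e0 by (simp add: imy_def)

lemma im_h: "e * hpoly 3 h (imx x) (imz x) = 2 * hpoly 3 t (imx x) (imz x)"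
proof -
  have "e * hpoly 3 h (imx x) (imz x) = hpoly 3 (smult e h) (imx x) (imz x)"
    by (rule comm_ring_hom.heval_smult[OF id_ring_hom, symmetric])
  also have "\<dots> = hpoly 3 (t + t) (imx x) (imz x)" by (simp only: h_eq mult_2)
  also have "\<dots> = 2 * hpoly 3 t (imx x) (imz x)"
    unfolding comm_ring_hom.heval_add[OF id_ring_hom] by simp
  finally show ?thesis .
qed

lemma im_g:
  "e\<^sup>2 * hpoly 6 g (imx x) (imz x) = (a * d - b * c) ^ 6 * poly f x - (hpoly 3 t (imx x) (imz x))\<^sup>2"
proof -
  have "e\<^sup>2 * hpoly 6 g (imx x) (imz x) = hpoly 6 (smult (e\<^sup>2) g) (imx x) (imz x)"
    by (rule comm_ring_hom.heval_smult[OF id_ring_hom, symmetric])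
  also have "\<dots> = hpoly 6 (hom_subst 6 f [:b, a:] [:d, c:]) (imx x) (imz x) - hpoly 6 (t\<^sup>2) (imx x) (imz x)"
    unfolding g_eq by (rule comm_ring_hom.heval_diff[OF id_ring_hom])
  also have "hpoly 6 (hom_subst 6 f [:b, a:] [:d, c:]) (imx x) (imz x) = (a * d - b * c) ^ 6 * poly f x"
    by (rule hpoly_subst_im) (simp add: f_degree)
  also have "hpoly 6 (t\<^sup>2) (imx x) (imz x) = (hpoly 3 t (imx x) (imz x))\<^sup>2"
    using comm_ring_hom.heval_power[OF id_ring_hom t_degree, of 2 "imx x" "imz x"] by simp
  finally show ?thesis .
qed

lemma im_points:
  assumes "Affine x y \<in> points 0 f"
  shows "im x y \<in> points h g"
  unfolding im_def
proof (rule tpt_points[OF hg_degree imxz_nonzero])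
  let ?H = "hpoly 3 h (imx x) (imz x)" and ?t = "hpoly 3 t (imx x) (imz x)"
  have "y\<^sup>2 = poly f x" using assms by (simp add: points_simps)
  then have "((a * d - b * c) ^ 3 * y)\<^sup>2 = (a * d - b * c) ^ 6 * poly f x"
    by (simp add: power_mult_distrib flip: power_mult)
  then have "(e * imy x y + ?t)\<^sup>2 = e\<^sup>2 * hpoly 6 g (imx x) (imz x) + ?t\<^sup>2" unfolding im_e im_g by simp
  then have "e\<^sup>2 * (imy x y)\<^sup>2 + 2 * ?t * (e * imy x y) = e\<^sup>2 * hpoly 6 g (imx x) (imz x)"
    by (simp add: power2_eq_square algebra_simps)
  then have "e\<^sup>2 * ((imy x y)\<^sup>2 + ?H * imy x y) = e\<^sup>2 * hpoly 6 g (imx x) (imz x)"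
    unfolding im_h[symmetric] by (simp add: power2_eq_square algebra_simps)
  then show "(imy x y)\<^sup>2 + ?H * imy x y = hpoly 6 g (imx x) (imz x)" using e0 by simp
qed

lemma im_lin: "\<exists>k. k \<noteq> 0 \<and> hom_subst 1 [:- x, 1:] [:b, a:] [:d, c:] = smult k (lin (im x y))"
proof -
  have "hom_subst 1 [:- x, 1:] [:b, a:] [:d, c:] = [:- imx x, imz x:]"
    by (simp add: hom_subst_def imx_def imz_def algebra_simps)
  then show ?thesis using lin_tpt[OF imxz_nonzero] by (simp add: im_def)
qed

lemma im_lin_power:
  "\<exists>k. k \<noteq> 0 \<and> hom_subst n ([:- x, 1:] ^ n) [:b, a:] [:d, c:] = smult k (lin (im x y) ^ n)"
proof -
  obtain k where k: "k \<noteq> 0" "hom_subst 1 [:- x, 1:] [:b, a:] [:d, c:] = smult k (lin (im x y))"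
    using im_lin by blast
  have "hom_subst (1 * n) ([:- x, 1:] ^ n) [:b, a:] [:d, c:] = hom_subst 1 [:- x, 1:] [:b, a:] [:d, c:] ^ n"
    unfolding hom_subst_heval by (rule const_poly_hom.heval_power) simp
  then show ?thesis using k by (intro exI[of _ "k ^ n"]) (simp add: smult_power)
qed

lemma im_lin_mult_power:
  "\<exists>k. k \<noteq> 0 \<and> hom_subst (2 * n) (([:- x1, 1:] * [:- x2, 1:]) ^ n) [:b, a:] [:d, c:]
    = smult k ((lin (im x1 y1) * lin (im x2 y2)) ^ n)"
proof -
  obtain k1 where k1: "k1 \<noteq> 0" "hom_subst n ([:- x1, 1:] ^ n) [:b, a:] [:d, c:] = smult k1 (lin (im x1 y1) ^ n)"
    using im_lin_power by blast
  obtain k2 where k2: "k2 \<noteq> 0" "hom_subst n ([:- x2, 1:] ^ n) [:b, a:] [:d, c:] = smult k2 (lin (im x2 y2) ^ n)"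
    using im_lin_power by blast
  have "hom_subst (n + n) ([:- x1, 1:] ^ n * [:- x2, 1:] ^ n) [:b, a:] [:d, c:]
      = hom_subst n ([:- x1, 1:] ^ n) [:b, a:] [:d, c:] * hom_subst n ([:- x2, 1:] ^ n) [:b, a:] [:d, c:]"
    unfolding hom_subst_heval by (intro const_poly_hom.heval_mult degree_power_le_exponent) simp_all
  then have "hom_subst (2 * n) (([:- x1, 1:] * [:- x2, 1:]) ^ n) [:b, a:] [:d, c:]
      = smult (k2 * k1) ((lin (im x1 y1) * lin (im x2 y2)) ^ n)"
    unfolding k1 k2 power_mult_distrib mult_2 by (simp only: mult_smult_left mult_smult_right smult_smult)
  then show ?thesis using k1(1) k2(1) by (intro exI[of _ "k2 * k1"]) simp
qed

text \<open>Up to the factor \<open>e\<close>, \<open>imw y + Y\<close> is the pullback of the cubic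
  form \<open>y Z^3 + Y\<close>, which vanishes at the opposite of a point with ordinate
  \<open>y\<close>.\<close>

definition imw :: "'a \<Rightarrow> 'a poly" where
  "imw y = smult (1 / e) (hom_subst 3 [:y:] [:b, a:] [:d, c:] + t)"

lemma imw_degree: "Polynomial.degree (imw y) \<le> 3"
  unfolding imw_def
  by (rule le_trans[OF degree_smult_le degree_add_le[OF degree_hom_subst t_degree]]) simp_all

lemma imw_wval: "wval (imw y) (iota h (im x y)) = 0"
  unfolding im_def iota_tpt[OF hg_degree(1) imxz_nonzero]
proof (rule wval_tpt[OF imw_degree imxz_nonzero])
  let ?H = "hpoly 3 h (imx x) (imz x)" and ?t = "hpoly 3 t (imx x) (imz x)"
  have "hpoly 3 (imw y) (imx x) (imz x) = 1 / e * ((a * d - b * c) ^ 3 * y + ?t)"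
    unfolding imw_def comm_ring_hom.heval_smult[OF id_ring_hom] comm_ring_hom.heval_add[OF id_ring_hom]
    by (subst hpoly_subst_im) simp_all
  also have "(a * d - b * c) ^ 3 * y + ?t = e * (imy x y + ?H)"
    using im_e[of x y, symmetric] by (simp add: distrib_left im_h)
  finally show "hpoly 3 (imw y) (imx x) (imz x) + (- imy x y - ?H) = 0" using e0 by simp
qed

lemma pullback_wform: "pullback a b c d e t 3 ([:y:], 1) = scale_form e (imw y, 1)"
  using e0 by (simp add: pullback_def imw_def scale_form_def hom_subst_def)

lemma pullback_wpow:
  "pullback a b c d e t 15 (fpow 0 f ([:y:], 1) 5) = scale_form (e ^ 5) (fpow h g (imw y, 1) 5)"
  using pullback_fpow[OF iso, of 3 "([:y:], 1)" 5]
  by (simp add: f_degree isf_def pullback_wform fpow_scale_form)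

lemma im_not_iota:
  assumes "\<not> (x1 = x2 \<and> y1 = - y2)"
  shows "im x1 y1 \<noteq> iota h (im x2 y2)"
proof
  let ?D = "a * d - b * c"
  assume eq: "im x1 y1 = iota h (im x2 y2)"
  have cross: "imx x1 * imz x2 - imx x2 * imz x1 = ?D * (x1 - x2)"
    by (simp add: imx_def imz_def algebra_simps)
  have "imx x1 * imz x2 = imx x2 * imz x1"
    using eq imxz_nonzero[of x1] imxz_nonzero[of x2]
    unfolding im_def iota_tpt[OF hg_degree(1) imxz_nonzero]
    by (auto simp: tpt_def field_simps split: if_splits)
  then have x: "x1 = x2" using cross det by simp
  have "imy x1 y1 = - imy x2 y2 - hpoly 3 h (imx x2) (imz x2)"
    using eq imxz_nonzero[of x2] unfolding im_def iota_tpt[OF hg_degree(1) imxz_nonzero] x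
    by (auto simp: tpt_def split: if_splits)
  then have "e * imy x1 y1 = e * (- imy x2 y2 - hpoly 3 h (imx x2) (imz x2))" by simp
  then have "e * imy x1 y1 = - (e * imy x2 y2) - e * hpoly 3 h (imx x2) (imz x2)"
    by (simp only: right_diff_distrib mult_minus_right)
  then have "e * imy x1 y1 + hpoly 3 t (imx x1) (imz x1) = - (e * imy x2 y2 + hpoly 3 t (imx x2) (imz x2))"
    unfolding im_h x by (simp add: algebra_simps)
  then have "?D ^ 3 * y1 = ?D ^ 3 * (- y2)" unfolding im_e by simp
  moreover have "?D ^ 3 \<noteq> 0" using det by (rule power_not_zero)
  ultimately have "y1 = - y2" by (metis mult_left_cancel)
  with x assms show False by simp
qed

text \<open>The norm formula and the divisibility identities are pulled back one by one, and
  \<open>quintic_divI\<close> reassembles the divisor on the new model.\<close>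

theorem quintic_div_im:
  assumes F: "quintic_div 0 f (Affine x1 y1) (Affine x2 y2) F"
    and P: "Affine x1 y1 \<in> points 0 f" "Affine x2 y2 \<in> points 0 f"
    and ne: "\<not> (x1 = x2 \<and> y1 = - y2)"
  shows "\<exists>F'. quintic_div h g (im x1 y1) (im x2 y2) F'"
proof -
  have f6: "Polynomial.degree f \<le> 6" by (simp add: f_degree)
  have F5: "isf 5 F" using F by (simp add: quintic_div_def)
  let ?T = "pullback a b c d e t"
  have w: "Polynomial.degree [:y:] \<le> 3" "wval [:y:] (iota 0 (Affine x y)) = 0" for x y :: 'a by simp_all
  obtain k where k: "k \<noteq> 0" "fnorm 0 f F = smult k ((lin (Affine x1 y1) * lin (Affine x2 y2)) ^ 5)"
    using quintic_div_norm[OF f_curve F P] by blast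
  obtain k' where k': "k' \<noteq> 0" "hom_subst (2 * 5) (([:- x1, 1:] * [:- x2, 1:]) ^ 5) [:b, a:] [:d, c:]
      = smult k' ((lin (im x1 y1) * lin (im x2 y2)) ^ 5)" using im_lin_mult_power by blast
  have "(fnorm h g (?T 5 F), 0) = fmul h g (?T 5 F) (?T 5 (fconj 0 F))"
    unfolding fmul_fconj[symmetric] pullback_fconj[OF iso] ..
  also have "\<dots> = ?T (5 + 5) (fmul 0 f F (fconj 0 F))"
    by (rule pullback_fmul[OF iso f6 F5 isf_fconj[OF _ F5], symmetric]) simp
  also have "\<dots> = (hom_subst (2 * 5) (fnorm 0 f F) [:b, a:] [:d, c:], 0)"
    unfolding fmul_fconj pullback_scalar by simp
  finally have "fnorm h g (?T 5 F) = hom_subst (2 * 5) (fnorm 0 f F) [:b, a:] [:d, c:]" by simp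
  also have "\<dots> = smult k (hom_subst (2 * 5) (([:- x1, 1:] * [:- x2, 1:]) ^ 5) [:b, a:] [:d, c:])"
    unfolding k(2) lin.simps hom_subst_heval const_poly_hom.heval_smult by simp
  finally have norm: "fnorm h g (?T 5 F) = smult (k * k') ((lin (im x1 y1) * lin (im x2 y2)) ^ 5)"
    unfolding k'(2) by simp
  have single: "\<exists>G'. isf 15 G' \<and> fmul h g (?T 5 F) (fpow h g (imw y, 1) 5) = fmul h g (lin (im x y) ^ 5, 0) G'"
    if G: "isf 15 G" "fmul 0 f F (fpow 0 f ([:y:], 1) 5) = fmul 0 f ([:- x, 1:] ^ 5, 0) G" for x y G
  proof -
    obtain k where k: "k \<noteq> 0" "hom_subst 5 ([:- x, 1:] ^ 5) [:b, a:] [:d, c:] = smult k (lin (im x y) ^ 5)"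
      using im_lin_power by blast
    have W: "isf 15 (fpow 0 f ([:y:], 1) 5)" by (rule isf_wpow[OF f_curve]) simp
    have "scale_form (e ^ 5) (fmul h g (?T 5 F) (fpow h g (imw y, 1) 5))
        = fmul h g (?T 5 F) (?T 15 (fpow 0 f ([:y:], 1) 5))"
      unfolding pullback_wpow fmul_scale_form ..
    also have "\<dots> = ?T (5 + 15) (fmul 0 f ([:- x, 1:] ^ 5, 0) G)"
      unfolding G(2)[symmetric] by (rule pullback_fmul[OF iso f6 F5 W, symmetric])
    also have "\<dots> = fmul h g (?T 5 ([:- x, 1:] ^ 5, 0)) (?T 15 G)"
      by (rule pullback_fmul[OF iso f6 _ G(1)]) (simp only: isf_scalar, rule degree_power_le_exponent, simp)
    also have "?T 5 ([:- x, 1:] ^ 5, 0) = scale_form k (lin (im x y) ^ 5, 0)"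
      unfolding pullback_scalar k(2) by (simp add: scale_form_def)
    finally have "scale_form (1 / e ^ 5) (scale_form (e ^ 5) (fmul h g (?T 5 F) (fpow h g (imw y, 1) 5)))
        = fmul h g (lin (im x y) ^ 5, 0) (scale_form (1 / e ^ 5) (scale_form k (?T 15 G)))"
      by (simp only: fmul_scale_form)
    then have "fmul h g (?T 5 F) (fpow h g (imw y, 1) 5)
        = fmul h g (lin (im x y) ^ 5, 0) (scale_form (1 / e ^ 5) (scale_form k (?T 15 G)))"
      using e0 by (simp add: scale_form_scale_form scale_form_one)
    then show ?thesis using isf_scale_form[OF isf_scale_form[OF isf_pullback[OF G(1) t_degree]]] by blast
  qed
  have "\<exists>G. isf 15 G \<and> fmul 0 f F (fpow 0 f ([:y1:], 1) 5) = fmul 0 f ([:- x1, 1:] ^ 5, 0) G"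
    using quintic_div_identity1[OF f_curve F P w] by simp
  with single obtain G1 where G1: "isf 15 G1"
    "fmul h g (?T 5 F) (fpow h g (imw y1, 1) 5) = fmul h g (lin (im x1 y1) ^ 5, 0) G1" by blast
  have "\<exists>G. isf 15 G \<and> fmul 0 f F (fpow 0 f ([:y2:], 1) 5) = fmul 0 f ([:- x2, 1:] ^ 5, 0) G"
    using quintic_div_identity1[OF f_curve F[unfolded quintic_div_commute[OF f_curve, of "Affine x1 y1"]] P(2,1) w] by simp
  with single obtain G2 where G2: "isf 15 G2"
    "fmul h g (?T 5 F) (fpow h g (imw y2, 1) 5) = fmul h g (lin (im x2 y2) ^ 5, 0) G2" by blast
  obtain G where G: "isf 25 G" "fmul 0 f F (fmul 0 f (fpow 0 f ([:y1:], 1) 5) (fpow 0 f ([:y2:], 1) 5))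
      = fmul 0 f (([:- x1, 1:] * [:- x2, 1:]) ^ 5, 0) G"
    using quintic_div_identity12[OF f_curve F P w w] by auto
  have W: "isf 15 (fpow 0 f ([:y:], 1) 5)" for y by (rule isf_wpow[OF f_curve]) simp
  have WW: "isf (15 + 15) (fmul 0 f (fpow 0 f ([:y1:], 1) 5) (fpow 0 f ([:y2:], 1) 5))"
    by (rule isf_fmul[OF _ f6 W W]) simp
  have "scale_form (e ^ 5 * e ^ 5) (fmul h g (?T 5 F) (fmul h g (fpow h g (imw y1, 1) 5) (fpow h g (imw y2, 1) 5)))
      = fmul h g (?T 5 F) (fmul h g (?T 15 (fpow 0 f ([:y1:], 1) 5)) (?T 15 (fpow 0 f ([:y2:], 1) 5)))"
    unfolding pullback_wpow fmul_scale_form scale_form_scale_form ..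
  also have "\<dots> = ?T (5 + (15 + 15)) (fmul 0 f (([:- x1, 1:] * [:- x2, 1:]) ^ 5, 0) G)"
    unfolding G(2)[symmetric] pullback_fmul[OF iso f6 F5 WW] pullback_fmul[OF iso f6 W W] ..
  also have "\<dots> = ?T (2 * 5 + 25) (fmul 0 f (([:- x1, 1:] * [:- x2, 1:]) ^ 5, 0) G)" by simp
  also have "\<dots> = fmul h g (?T (2 * 5) (([:- x1, 1:] * [:- x2, 1:]) ^ 5, 0)) (?T 25 G)"
    using degree_lin_mult_power[of "Affine x1 y1" "Affine x2 y2" 5]
    by (intro pullback_fmul[OF iso f6 _ G(1)]) (simp only: isf_scalar lin.simps)
  also have "?T (2 * 5) (([:- x1, 1:] * [:- x2, 1:]) ^ 5, 0)
      = scale_form k' ((lin (im x1 y1) * lin (im x2 y2)) ^ 5, 0)"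
    unfolding pullback_scalar k'(2) by (simp add: scale_form_def)
  finally have "scale_form (1 / (e ^ 5 * e ^ 5)) (scale_form (e ^ 5 * e ^ 5)
        (fmul h g (?T 5 F) (fmul h g (fpow h g (imw y1, 1) 5) (fpow h g (imw y2, 1) 5))))
      = fmul h g ((lin (im x1 y1) * lin (im x2 y2)) ^ 5, 0)
          (scale_form (1 / (e ^ 5 * e ^ 5)) (scale_form k' (?T 25 G)))"
    by (simp only: fmul_scale_form)
  then have G': "fmul h g (?T 5 F) (fmul h g (fpow h g (imw y1, 1) 5) (fpow h g (imw y2, 1) 5))
      = fmul h g ((lin (im x1 y1) * lin (im x2 y2)) ^ 5, 0)
          (scale_form (1 / (e ^ 5 * e ^ 5)) (scale_form k' (?T 25 G)))"
    using e0 by (simp add: scale_form_scale_form scale_form_one)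
  have "quintic_div h g (im x1 y1) (im x2 y2) (?T 5 F)"
    by (rule quintic_divI[OF hg_curve isf_pullback[OF F5 t_degree] im_points[OF P(1)] im_points[OF P(2)]
          im_not_iota[OF ne] norm _ imw_degree imw_wval imw_degree imw_wval G1 G2
          isf_scale_form[OF isf_scale_form[OF isf_pullback[OF G(1) t_degree]]] G'])
       (use k(1) k'(1) in simp)
  then show ?thesis by blast
qed

end

section \<open>Extension of places\<close>

locale subring_hom =
  fixes R :: "'a::field set" and rd :: "'a \<Rightarrow> 'b::field"
  assumes one_R: "1 \<in> R" and rd_1: "rd 1 = 1"
    and diff_R: "x \<in> R \<Longrightarrow> y \<in> R \<Longrightarrow> x - y \<in> R"
    and rd_diff: "x \<in> R \<Longrightarrow> y \<in> R \<Longrightarrow> rd (x - y) = rd x - rd y"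
    and mult_R: "x \<in> R \<Longrightarrow> y \<in> R \<Longrightarrow> x * y \<in> R"
    and rd_mult: "x \<in> R \<Longrightarrow> y \<in> R \<Longrightarrow> rd (x * y) = rd x * rd y"
begin

lemma zero_R: "0 \<in> R" and rd_0: "rd 0 = 0"
  using diff_R[OF one_R one_R] rd_diff[OF one_R one_R] by auto

lemma uminus_R: "x \<in> R \<Longrightarrow> - x \<in> R" and rd_uminus: "x \<in> R \<Longrightarrow> rd (- x) = - rd x"
  using diff_R[OF zero_R, of x] rd_diff[OF zero_R, of x] by (auto simp: rd_0)

lemma add_R: "x \<in> R \<Longrightarrow> y \<in> R \<Longrightarrow> x + y \<in> R"
  and rd_add: "x \<in> R \<Longrightarrow> y \<in> R \<Longrightarrow> rd (x + y) = rd x + rd y"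
  using diff_R[of x "- y"] rd_diff[of x "- y"] by (auto simp: uminus_R rd_uminus)

lemma sum_R: "(\<And>i. i \<in> I \<Longrightarrow> f i \<in> R) \<Longrightarrow> sum f I \<in> R \<and> rd (sum f I) = (\<Sum>i\<in>I. rd (f i))"
  by (induction I rule: infinite_finite_induct) (auto simp: zero_R rd_0 add_R rd_add)

lemma power_R: "x \<in> R \<Longrightarrow> x ^ n \<in> R" and rd_power: "x \<in> R \<Longrightarrow> rd (x ^ n) = rd x ^ n"
proof -
  have "x \<in> R \<Longrightarrow> x ^ n \<in> R \<and> rd (x ^ n) = rd x ^ n"
    by (induction n) (auto simp: one_R rd_1 mult_R rd_mult)
  then show "x \<in> R \<Longrightarrow> x ^ n \<in> R" "x \<in> R \<Longrightarrow> rd (x ^ n) = rd x ^ n" by auto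
qed

lemma of_nat_R: "of_nat n \<in> R" and rd_of_nat: "rd (of_nat n) = of_nat n"
proof -
  have "of_nat n \<in> R \<and> rd (of_nat n) = of_nat n"
    by (induction n) (auto simp: zero_R rd_0 one_R rd_1 add_R rd_add)
  then show "of_nat n \<in> R" "rd (of_nat n) = of_nat n" by auto
qed

lemma of_int_R: "of_int n \<in> R" and rd_of_int: "rd (of_int n) = of_int n"
  by (cases n; simp add: of_nat_R rd_of_nat uminus_R rd_uminus del: of_nat_Suc)+

definition Rp :: "'a poly \<Rightarrow> bool" where "Rp p \<longleftrightarrow> (\<forall>i. Polynomial.coeff p i \<in> R)"

definition rp :: "'a poly \<Rightarrow> 'b poly" where "rp p = map_poly rd p"

lemma coeff_rp: "Polynomial.coeff (rp p) i = rd (Polynomial.coeff p i)"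
  by (simp add: rp_def coeff_map_poly rd_0)

lemma degree_rp: "Polynomial.degree (rp p) \<le> Polynomial.degree p"
  unfolding rp_def by (rule degree_map_poly_le)

lemma Rp_pCons: "Rp (pCons x p) \<longleftrightarrow> x \<in> R \<and> Rp p"
  by (auto simp: Rp_def coeff_pCons split: nat.splits)

lemma rp_pCons: "rp (pCons x p) = pCons (rd x) (rp p)"
  by (rule poly_eqI) (simp add: coeff_rp coeff_pCons split: nat.splits)

lemma Rp_0: "Rp 0" and rp_0: "rp 0 = 0"
  by (simp_all add: Rp_def zero_R rp_def)

lemma Rp_1: "Rp 1" and rp_1: "rp 1 = 1"
  by (simp_all add: Rp_def poly_eq_iff coeff_rp one_R zero_R rd_1 rd_0)

lemma Rp_diff: "Rp p \<Longrightarrow> Rp q \<Longrightarrow> Rp (p - q)" and rp_diff: "Rp p \<Longrightarrow> Rp q \<Longrightarrow> rp (p - q) = rp p - rp q"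
  by (simp_all add: Rp_def diff_R poly_eq_iff coeff_rp rd_diff)

lemma Rp_add: "Rp p \<Longrightarrow> Rp q \<Longrightarrow> Rp (p + q)" and rp_add: "Rp p \<Longrightarrow> Rp q \<Longrightarrow> rp (p + q) = rp p + rp q"
  by (simp_all add: Rp_def add_R poly_eq_iff coeff_rp rd_add)

lemma Rp_uminus: "Rp p \<Longrightarrow> Rp (- p)" and rp_uminus: "Rp p \<Longrightarrow> rp (- p) = - rp p"
  by (simp_all add: Rp_def uminus_R poly_eq_iff coeff_rp rd_uminus)

lemma Rp_mult: "Rp p \<Longrightarrow> Rp q \<Longrightarrow> Rp (p * q)" and rp_mult: "Rp p \<Longrightarrow> Rp q \<Longrightarrow> rp (p * q) = rp p * rp q"
proof -
  assume pq: "Rp p" "Rp q"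
  have *: "Polynomial.coeff p i * Polynomial.coeff q j \<in> R" for i j
    using pq by (simp add: Rp_def mult_R)
  show "Rp (p * q)" unfolding Rp_def coeff_mult by (intro allI sum_R[THEN conjunct1] *)
  show "rp (p * q) = rp p * rp q"
  proof (rule poly_eqI)
    fix n
    have "rd (\<Sum>i\<le>n. Polynomial.coeff p i * Polynomial.coeff q (n - i))
        = (\<Sum>i\<le>n. rd (Polynomial.coeff p i * Polynomial.coeff q (n - i)))"
      by (intro sum_R[THEN conjunct2] *)
    then show "Polynomial.coeff (rp (p * q)) n = Polynomial.coeff (rp p * rp q) n"
      using pq by (simp add: coeff_rp coeff_mult rd_mult Rp_def)
  qed
qed

lemma Rp_smult: "x \<in> R \<Longrightarrow> Rp p \<Longrightarrow> Rp (smult x p)"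
  and rp_smult: "x \<in> R \<Longrightarrow> Rp p \<Longrightarrow> rp (smult x p) = smult (rd x) (rp p)"
  by (simp_all add: Rp_def mult_R poly_eq_iff coeff_rp rd_mult)

lemma Rp_power: "Rp p \<Longrightarrow> Rp (p ^ n)" and rp_power: "Rp p \<Longrightarrow> rp (p ^ n) = rp p ^ n"
proof -
  assume "Rp p"
  then have "Rp (p ^ n) \<and> rp (p ^ n) = rp p ^ n" by (induction n) (auto simp: Rp_1 rp_1 Rp_mult rp_mult)
  then show "Rp (p ^ n)" "rp (p ^ n) = rp p ^ n" by auto
qed

lemma Rp_monom: "x \<in> R \<Longrightarrow> Rp (Polynomial.monom x n)"
  and rp_monom: "rp (Polynomial.monom x n) = Polynomial.monom (rd x) n"
  by (simp_all add: Rp_def zero_R poly_eq_iff coeff_rp rd_0)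

lemma poly_R: "Rp p \<Longrightarrow> x \<in> R \<Longrightarrow> poly p x \<in> R"
  and rd_poly: "Rp p \<Longrightarrow> x \<in> R \<Longrightarrow> rd (poly p x) = poly (rp p) (rd x)"
proof -
  have "Rp p \<Longrightarrow> x \<in> R \<Longrightarrow> poly p x \<in> R \<and> rd (poly p x) = poly (rp p) (rd x)"
    by (induction p) (auto simp: zero_R rd_0 rp_0 Rp_pCons rp_pCons add_R mult_R rd_add rd_mult)
  then show "Rp p \<Longrightarrow> x \<in> R \<Longrightarrow> poly p x \<in> R"
    "Rp p \<Longrightarrow> x \<in> R \<Longrightarrow> rd (poly p x) = poly (rp p) (rd x)" by auto
qed

end

text \<open>A homomorphism from a subring, given by its graph so that Zorn's lemma applies to
  inclusion. The condition at 0 makes the graph single-valued, because differences stay in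
  it.\<close>

definition hom_graph :: "('a::field \<times> 'b::field) set \<Rightarrow> bool" where
  "hom_graph G \<longleftrightarrow> (1, 1) \<in> G \<and> (\<forall>u. (0, u) \<in> G \<longrightarrow> u = 0) \<and>
     (\<forall>x u y v. (x, u) \<in> G \<longrightarrow> (y, v) \<in> G \<longrightarrow> (x - y, u - v) \<in> G \<and> (x * y, u * v) \<in> G)"

lemma hom_graph_unique: "hom_graph G \<Longrightarrow> (x, u) \<in> G \<Longrightarrow> (x, v) \<in> G \<Longrightarrow> u = v"
  unfolding hom_graph_def by (metis diff_self eq_iff_diff_eq_0)

lemma hom_graph_Union:
  assumes "C \<noteq> {}" "\<And>G. G \<in> C \<Longrightarrow> hom_graph G" "\<And>G H. G \<in> C \<Longrightarrow> H \<in> C \<Longrightarrow> G \<subseteq> H \<or> H \<subseteq> G"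
  shows "hom_graph (\<Union>C)"
  unfolding hom_graph_def
proof (intro conjI allI impI)
  show "(1, 1) \<in> \<Union>C" using assms(1,2) by (auto simp: hom_graph_def)
  show "u = 0" if "(0, u) \<in> \<Union>C" for u using that assms(2) by (auto simp: hom_graph_def)
  fix x u y v assume "(x, u) \<in> \<Union>C" "(y, v) \<in> \<Union>C"
  then obtain G where "G \<in> C" "(x, u) \<in> G" "(y, v) \<in> G" using assms(3) by blast
  then have "(x - y, u - v) \<in> G \<and> (x * y, u * v) \<in> G" using assms(2) unfolding hom_graph_def by blast
  then show "(x - y, u - v) \<in> \<Union>C" "(x * y, u * v) \<in> \<Union>C" using \<open>G \<in> C\<close> by blast+
qed

locale maximal_hom = subring_hom R rd for R :: "'a::field set" and rd :: "'a \<Rightarrow> 'b::alg_closed_field" +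
  assumes maximal: "hom_graph G \<Longrightarrow> (\<And>x. x \<in> R \<Longrightarrow> (x, rd x) \<in> G) \<Longrightarrow> (x, u) \<in> G \<Longrightarrow> x \<in> R"
begin

text \<open>\<open>rd\<close> extends to the fractions with powers of \<open>x\<close> as
  denominators; by maximality these already lie in \<open>R\<close>.\<close>

lemma inverse_R:
  assumes x: "x \<in> R" "rd x \<noteq> 0"
  shows "inverse x \<in> R"
proof -
  define G where "G = {(y / x ^ n, rd y / rd x ^ n) | y n. y \<in> R}"
  have x0: "x \<noteq> 0" using x rd_0 by auto
  have "hom_graph G"
    unfolding hom_graph_def
  proof (intro conjI allI impI)
    show "(1, 1) \<in> G" unfolding G_def using one_R rd_1 by (intro CollectI exI[of _ 1] exI[of _ 0]) simp
    show "u = 0" if "(0, u) \<in> G" for u using that x0 rd_0 by (auto simp: G_def)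
    fix p u q v assume "(p, u) \<in> G" "(q, v) \<in> G"
    then obtain y n z m where y: "y \<in> R" "p = y / x ^ n" "u = rd y / rd x ^ n"
      and z: "z \<in> R" "q = z / x ^ m" "v = rd z / rd x ^ m" unfolding G_def by blast
    have key: "(w / x ^ k, rd w / rd x ^ k) \<in> G" if "w \<in> R" for w k
      unfolding G_def using that by (intro CollectI exI[of _ w] exI[of _ k]) simp
    have e: "p - q = (y * x ^ m - z * x ^ n) / x ^ (n + m)" "p * q = (y * z) / x ^ (n + m)"
      unfolding y(2) z(2) using x0 by (simp_all add: field_simps power_add)
    have r: "rd (y * x ^ m - z * x ^ n) = rd y * rd x ^ m - rd z * rd x ^ n" "rd (y * z) = rd y * rd z"
      using x(1) y(1) z(1) by (simp_all add: rd_diff rd_mult rd_power mult_R power_R)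
    have e': "u - v = (rd y * rd x ^ m - rd z * rd x ^ n) / rd x ^ (n + m)"
      "u * v = rd y * rd z / rd x ^ (n + m)"
      unfolding y(3) z(3) using x(2) by (simp_all add: field_simps power_add)
    have "y * x ^ m - z * x ^ n \<in> R" "y * z \<in> R" using x(1) y(1) z(1) by (simp_all add: diff_R mult_R power_R)
    from key[OF this(1), of "n + m"] key[OF this(2), of "n + m"]
    show "(p - q, u - v) \<in> G" "(p * q, u * v) \<in> G" unfolding e e' r by blast+
  qed
  moreover have "(y, rd y) \<in> G" if "y \<in> R" for y
    unfolding G_def using that by (intro CollectI exI[of _ y] exI[of _ 0]) simp
  moreover have "(inverse x, inverse (rd x)) \<in> G"
    unfolding G_def using one_R rd_1 by (intro CollectI exI[of _ 1] exI[of _ 1]) (simp add: field_simps)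
  ultimately show ?thesis by (rule maximal)
qed

lemma divide_R: "x \<in> R \<Longrightarrow> y \<in> R \<Longrightarrow> rd y \<noteq> 0 \<Longrightarrow> x / y \<in> R"
  using mult_R[OF _ inverse_R] by (simp add: divide_inverse)

lemma rd_divide:
  assumes xy: "x \<in> R" "y \<in> R" "rd y \<noteq> 0"
  shows "rd (x / y) = rd x / rd y"
proof -
  have "y \<noteq> 0" using xy(3) rd_0 by auto
  then have "rd x = rd (x / y) * rd y" using rd_mult[OF divide_R[OF xy] xy(2)] by simp
  then show ?thesis using xy(3) by simp
qed

text \<open>Such a relation \<open>1 = \<Sum>i>0. m\<^sub>i z\<^sup>i\<close>, up to a unit, with \<open>m\<^sub>i\<close> in the maximal ideal is the
  obstruction to extending the place to \<open>R[z]\<close>.\<close>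

definition obstruction :: "'a \<Rightarrow> nat \<Rightarrow> bool" where
  "obstruction z n \<longleftrightarrow> (\<exists>q. Rp q \<and> Polynomial.degree q \<le> n \<and> poly q z = 0 \<and>
     rd (Polynomial.coeff q 0) \<noteq> 0 \<and> (\<forall>i>0. rd (Polynomial.coeff q i) = 0))"

text \<open>Without an obstruction some value \<open>\<zeta>\<close> can be assigned to
  \<open>z\<close>, which extends \<open>rd\<close> and contradicts maximality. It has to be a
  common zero of the reductions of all relations satisfied by \<open>z\<close>. If these reductions
  are not all zero, one of least degree divides the others, and it is not constant since that would
  be an obstruction; its root exists because the target is algebraically closed.\<close>

lemma obstruction_exists:
  assumes "z \<notin> R"
  shows "\<exists>n. obstruction z n"
proof (rule ccontr)
  assume no: "\<not> ?thesis"
  define Ker where "Ker = {q. Rp q \<and> poly q z = 0}"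
  have "\<exists>\<zeta>. \<forall>p\<in>Ker. poly (rp p) \<zeta> = 0"
  proof (cases "\<forall>q\<in>Ker. rp q = 0")
    case False
    define N where "N q \<longleftrightarrow> q \<in> Ker \<and> rp q \<noteq> 0" for q
    from False obtain q0 where "N q0" by (auto simp: N_def)
    from ex_has_least_nat[of N, OF this, of "\<lambda>q. Polynomial.degree (rp q)"]
    obtain q where q: "q \<in> Ker" "rp q \<noteq> 0"
      and least: "\<And>p. p \<in> Ker \<Longrightarrow> rp p \<noteq> 0 \<Longrightarrow> Polynomial.degree (rp q) \<le> Polynomial.degree (rp p)"
      unfolding N_def by blast
    define d where "d = Polynomial.degree (rp q)"
    have lead: "rd (Polynomial.coeff q d) \<noteq> 0" using q(2) by (simp add: d_def flip: coeff_rp)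
    have d0: "d \<noteq> 0"
    proof
      assume "d = 0"
      then have "rd (Polynomial.coeff q i) = 0" if "i > 0" for i
        using that coeff_eq_0[of "rp q" i] by (simp add: d_def coeff_rp)
      moreover have "rd (Polynomial.coeff q 0) \<noteq> 0" using lead \<open>d = 0\<close> by simp
      ultimately have "obstruction z (Polynomial.degree q)" using q(1) by (auto simp: obstruction_def Ker_def)
      then show False using no by blast
    qed
    then obtain \<zeta> where \<zeta>: "poly (rp q) \<zeta> = 0" using alg_closed_imp_poly_has_root[of "rp q"] by (auto simp: d_def)
    have "poly (rp p) \<zeta> = 0" if "p \<in> Ker" for p
      using that
    proof (induction "Polynomial.degree (rp p)" arbitrary: p rule: less_induct)
      case less
      show ?case
      proof (cases "rp p = 0")
        case False
        define e where "e = Polynomial.degree (rp p)"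
        have de: "d \<le> e" using least[OF less.prems False] by (simp add: d_def e_def)
        have Rq: "Rp q" and Rpp: "Rp p" using q less.prems by (auto simp: Ker_def)
        have pe: "Polynomial.coeff p e \<in> R" "Polynomial.coeff q d \<in> R" using Rq Rpp by (auto simp: Rp_def)
        \<comment> \<open>One step of division by \<open>q\<close>. It can be done inside
          \<open>R\<close> because the coefficient of \<open>q\<close> at the reduced degree
          \<open>d\<close> is a unit there.\<close>
        define \<alpha> where "\<alpha> = Polynomial.coeff p e / Polynomial.coeff q d"
        have \<alpha>: "\<alpha> \<in> R" "rd \<alpha> * rd (Polynomial.coeff q d) = rd (Polynomial.coeff p e)"
          using divide_R[OF pe lead] rd_divide[OF pe lead] lead by (simp_all add: \<alpha>_def)
        define m where "m = Polynomial.monom \<alpha> (e - d)"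
        have m: "Rp m" "rp m = Polynomial.monom (rd \<alpha>) (e - d)" using \<alpha> by (simp_all add: m_def Rp_monom rp_monom)
        define p' where "p' = p - m * q"
        have p': "p' \<in> Ker" using q less.prems m(1) by (simp add: Ker_def p'_def Rp_diff Rp_mult)
        have rp': "rp p' = rp p - rp m * rp q" using Rq Rpp m(1) by (simp add: p'_def rp_diff rp_mult Rp_mult)
        have "Polynomial.degree (rp m * rp q) \<le> e"
          using degree_mult_le[of "rp m" "rp q"] degree_monom_le[of "rd \<alpha>" "e - d"] de by (simp add: m d_def)
        then have "Polynomial.degree (rp p') \<le> e" unfolding rp' by (intro degree_diff_le) (simp_all add: e_def)
        moreover have "Polynomial.coeff (rp p') e = 0"
          unfolding rp' m(2) using de \<alpha>(2) by (simp add: coeff_monom_mult coeff_rp)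
        ultimately have "Polynomial.degree (rp p') < e"
          using de d0 by (metis leading_coeff_0_iff degree_0 le_neq_implies_less le_zero_eq neq0_conv)
        then have "poly (rp p') \<zeta> = 0" using less.hyps[of p'] p' by (simp add: e_def)
        then show ?thesis unfolding rp' by (simp add: \<zeta>)
      qed simp
    qed
    then show ?thesis by blast
  qed auto
  then obtain \<zeta> where \<zeta>: "\<And>p. p \<in> Ker \<Longrightarrow> poly (rp p) \<zeta> = 0" by blast
  define G where "G = {(poly q z, poly (rp q) \<zeta>) | q. Rp q}"
  have "hom_graph G"
    unfolding hom_graph_def
  proof (intro conjI allI impI)
    show "(1, 1) \<in> G" unfolding G_def by (intro CollectI exI[of _ 1]) (simp add: Rp_1 rp_1)
    show "u = 0" if "(0, u) \<in> G" for u using that \<zeta> by (auto simp: G_def Ker_def)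
    fix p u q v assume "(p, u) \<in> G" "(q, v) \<in> G"
    then obtain P Q where PQ: "Rp P" "p = poly P z" "u = poly (rp P) \<zeta>" "Rp Q" "q = poly Q z" "v = poly (rp Q) \<zeta>"
      unfolding G_def by blast
    then have "p - q = poly (P - Q) z" "u - v = poly (rp (P - Q)) \<zeta>" "p * q = poly (P * Q) z"
      "u * v = poly (rp (P * Q)) \<zeta>" "Rp (P - Q)" "Rp (P * Q)"
      by (simp_all add: rp_diff rp_mult Rp_diff Rp_mult)
    then show "(p - q, u - v) \<in> G" "(p * q, u * v) \<in> G" unfolding G_def by blast+
  qed
  moreover have "(y, rd y) \<in> G" if "y \<in> R" for y
    unfolding G_def using that by (intro CollectI exI[of _ "[:y:]"]) (simp add: Rp_pCons Rp_0 rp_pCons rp_0)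
  moreover have "(z, \<zeta>) \<in> G"
    unfolding G_def by (intro CollectI exI[of _ "[:0, 1:]"])
      (simp add: Rp_pCons Rp_0 Rp_1 rp_pCons rp_0 rp_1 zero_R one_R rd_0 rd_1)
  ultimately have "z \<in> R" by (rule maximal)
  then show False using assms by blast
qed

text \<open>The relation for the inverse, multiplied by \<open>z ^ n\<close>, has a unit as
  coefficient of \<open>z ^ n\<close> and cancels the top term of the relation for \<open>z\<close>.
  The multiplier \<open>\<alpha>\<close> lies in the maximal ideal, so the reductions of all
  coefficients are unchanged.\<close>

lemma obstruction_reduce:
  assumes z: "z \<noteq> 0" and n: "obstruction z n" and k: "obstruction (inverse z) k" and kn: "k \<le> n"
  shows "n > 0 \<and> obstruction z (n - 1)"
proof -
  obtain q where q: "Rp q" "Polynomial.degree q \<le> n" "poly q z = 0" "rd (Polynomial.coeff q 0) \<noteq> 0"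
    "\<And>i. i > 0 \<Longrightarrow> rd (Polynomial.coeff q i) = 0" using n unfolding obstruction_def by blast
  obtain q' where q': "Rp q'" "Polynomial.degree q' \<le> k" "poly q' (inverse z) = 0" "rd (Polynomial.coeff q' 0) \<noteq> 0"
    "\<And>i. i > 0 \<Longrightarrow> rd (Polynomial.coeff q' i) = 0" using k unfolding obstruction_def by blast
  have n0: "n > 0"
  proof (rule ccontr)
    assume "\<not> n > 0"
    then obtain c where "q = [:c:]" using q(2) by (auto elim: degree_eq_zeroE)
    then show False using q(3,4) rd_0 by simp
  qed
  define r where "r = rev_poly n q'"
  have r: "Polynomial.coeff r i = (if i \<le> n then Polynomial.coeff q' (n - i) else 0)" for i
    by (simp add: r_def coeff_rev_poly)
  have Rr: "Rp r" using q'(1) zero_R by (simp add: Rp_def r)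
  have "poly r z = hpoly n r z 1"
    using comm_ring_hom.heval_Z_1[OF id_ring_hom degree_rev_poly, of n q' z]
      map_poly_idI[of r "\<lambda>x. x"] by (simp add: r_def)
  also have "\<dots> = hpoly n q' 1 z" unfolding r_def by (rule comm_ring_hom.heval_rev_poly[OF id_ring_hom])
  also have "\<dots> = z ^ n * poly q' (1 / z)" using q'(2) kn z by (intro hpoly_Z_nonzero) auto
  finally have rz: "poly r z = 0" using q'(3) by (simp add: inverse_eq_divide)
  define \<alpha> where "\<alpha> = Polynomial.coeff q n / Polynomial.coeff q' 0"
  have qn: "Polynomial.coeff q n \<in> R" "Polynomial.coeff q' 0 \<in> R" using q(1) q'(1) by (auto simp: Rp_def)
  have \<alpha>: "\<alpha> \<in> R" "rd \<alpha> = 0"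
    using divide_R[OF qn q'(4)] rd_divide[OF qn q'(4)] q(5)[OF n0] by (simp_all add: \<alpha>_def)
  define p where "p = q - smult \<alpha> r"
  have Rpp: "Rp p" using q(1) Rr \<alpha> by (simp add: p_def Rp_diff Rp_smult)
  have cp: "rd (Polynomial.coeff p i) = rd (Polynomial.coeff q i)" for i
    using q(1) Rr \<alpha> by (simp add: p_def Rp_def rd_diff rd_mult mult_R)
  have "Polynomial.degree p \<le> n"
    unfolding p_def using degree_rev_poly[of n q'] q(2)
    by (intro degree_diff_le le_trans[OF degree_smult_le]) (simp_all add: r_def)
  moreover have "Polynomial.coeff p n = 0"
  proof -
    have "Polynomial.coeff q' 0 \<noteq> 0" using q'(4) rd_0 by auto
    then show ?thesis by (simp add: p_def r \<alpha>_def)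
  qed
  ultimately have "Polynomial.degree p \<le> n - 1"
    using n0 by (metis Suc_pred' degree_0 leading_coeff_0_iff le_SucE le_zero_eq zero_le)
  then have "obstruction z (n - 1)" unfolding obstruction_def
    using Rpp q(3,4,5) rz by (intro exI[of _ p]) (auto simp: cp, simp add: p_def)
  with n0 show ?thesis by blast
qed

text \<open>Obstructions for both \<open>x\<close> and its inverse would descend forever, since the
  longer of the two can always be shortened.\<close>

lemma valuation_R: "x \<in> R \<or> inverse x \<in> R"
proof (rule ccontr)
  assume "\<not> ?thesis"
  then have x: "x \<notin> R" "inverse x \<notin> R" by auto
  have x0: "x \<noteq> 0" using x zero_R by auto
  have "\<not> (obstruction x n \<and> obstruction (inverse x) k)" for n k
  proof (induction "n + k" arbitrary: n k rule: less_induct)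
    case less
    show ?case
    proof
      assume o: "obstruction x n \<and> obstruction (inverse x) k"
      show False
      proof (cases "k \<le> n")
        case True
        then have "n > 0 \<and> obstruction x (n - 1)" using obstruction_reduce[OF x0] o by blast
        then show False using less.hyps[of "n - 1" k] o by auto
      next
        case False
        then have "k > 0 \<and> obstruction (inverse x) (k - 1)"
          using obstruction_reduce[of "inverse x" k n] o x0 by auto
        then show False using less.hyps[of n "k - 1"] o by auto
      qed
    qed
  qed
  then show False using obstruction_exists[OF x(1)] obstruction_exists[OF x(2)] by blast
qed

end

theorem place_extension:
  fixes G0 :: "('a::field \<times> 'b::alg_closed_field) set"
  assumes "hom_graph G0"
  shows "\<exists>R rd. maximal_hom R rd \<and> (\<forall>(x, u)\<in>G0. x \<in> R \<and> rd x = u)"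
proof -
  define A where "A = {G. hom_graph G \<and> G0 \<subseteq> G}"
  have "\<exists>U\<in>A. \<forall>G\<in>C. G \<subseteq> U" if C: "C \<in> chains A" for C
  proof (cases "C = {}")
    case True
    then show ?thesis using assms by (auto simp: A_def)
  next
    case False
    have "hom_graph (\<Union>C)"
      using C False by (intro hom_graph_Union) (auto simp: chains_def chain_subset_def A_def)
    moreover have "G0 \<subseteq> \<Union>C" using C False by (auto simp: chains_def A_def)
    ultimately show ?thesis by (auto simp: A_def)
  qed
  then have "\<exists>G\<in>A. \<forall>H\<in>A. G \<subseteq> H \<longrightarrow> H = G" by (intro Zorn_Lemma2 ballI)
  then obtain G where GA: "G \<in> A" and max0: "\<forall>H\<in>A. G \<subseteq> H \<longrightarrow> H = G" by blast
  then have G: "hom_graph G" "G0 \<subseteq> G" by (auto simp: A_def)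
  have max: "H = G" if "hom_graph H" "G \<subseteq> H" for H
    using max0 that G(2) by (auto simp: A_def)
  define rd where "rd x = (THE u. (x, u) \<in> G)" for x
  have rd: "rd x = u" if "(x, u) \<in> G" for x u
    unfolding rd_def using that hom_graph_unique[OF G(1)] by blast
  have rdG: "(x, rd x) \<in> G" if "x \<in> Domain G" for x using that rd by blast
  have dm: "(x - y, rd x - rd y) \<in> G" "(x * y, rd x * rd y) \<in> G" if "x \<in> Domain G" "y \<in> Domain G" for x y
    using G(1) rdG[OF that(1)] rdG[OF that(2)] unfolding hom_graph_def by blast+
  have one: "(1, 1) \<in> G" using G(1) by (simp add: hom_graph_def)
  have "maximal_hom (Domain G) rd"
  proof unfold_locales
    show "1 \<in> Domain G" "rd 1 = 1" using one rd by blast+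
    show "x - y \<in> Domain G" "rd (x - y) = rd x - rd y" "x * y \<in> Domain G" "rd (x * y) = rd x * rd y"
      if "x \<in> Domain G" "y \<in> Domain G" for x y using dm[OF that] rd by blast+
    show "x \<in> Domain G" if H: "hom_graph H" "\<And>x. x \<in> Domain G \<Longrightarrow> (x, rd x) \<in> H" "(x, u) \<in> H" for H x u
    proof -
      have "G \<subseteq> H" using H(2) rd by auto
      then show ?thesis using max[OF H(1)] H(3) by auto
    qed
  qed
  moreover have "\<forall>(x, u)\<in>G0. x \<in> Domain G \<and> rd x = u" using G(2) rd by blast
  ultimately show ?thesis by blast
qed

section \<open>Integral forms, reduction and Gauss's lemma\<close>

definition fadd :: "'a::comm_ring_1 form \<Rightarrow> 'a form \<Rightarrow> 'a form" where
  "fadd F G = (fst F + fst G, snd F + snd G)"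

lemma fmul_fadd: "fmul h g (fadd F G) H = fadd (fmul h g F H) (fmul h g G H)"
  "fmul h g H (fadd F G) = fadd (fmul h g H F) (fmul h g H G)"
  by (simp_all add: fmul_def fadd_def algebra_simps)

lemma scale_form_fadd: "scale_form c (fadd F G) = fadd (scale_form c F) (scale_form c G)"
  by (simp add: scale_form_def fadd_def smult_add_right)

lemma fmul_scalar_cancel:
  fixes P :: "'a::idom poly"
  assumes "P \<noteq> 0" "fmul h g (P, 0) F = fmul h g (P, 0) G"
  shows "F = G"
  using assms by (simp add: fmul_scalar prod_eq_iff)

section \<open>Reduction of forms at a place\<close>

context maximal_hom
begin

lemma not_R: "x \<notin> R \<Longrightarrow> x \<noteq> 0 \<and> inverse x \<in> R \<and> rd (inverse x) = 0"
  using valuation_R[of x] inverse_R[of "inverse x"] zero_R by auto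

text \<open>Otherwise the equation divided by \<open>y^2\<close> would reduce to 1 = 0.\<close>

lemma integral_R:
  assumes "h \<in> R" "g \<in> R" "y\<^sup>2 + h * y = g"
  shows "y \<in> R"
proof (rule ccontr)
  assume "y \<notin> R"
  then have i: "y \<noteq> 0" "inverse y \<in> R" "rd (inverse y) = 0" using not_R by auto
  let ?z = "inverse y"
  have "1 + h * ?z - g * (?z * ?z) = 0"
    unfolding assms(3)[symmetric] using i(1) by (simp add: field_simps power2_eq_square)
  moreover have "rd (1 + h * ?z - g * (?z * ?z)) = 1"
    using assms i by (simp add: rd_add rd_diff rd_mult add_R mult_R one_R rd_1)
  ultimately show False by (simp add: rd_0)
qed

text \<open>\<open>m\<close> is an element of least valuation.\<close>

lemma common_denominator:
  assumes "finite S" "\<exists>x\<in>S. x \<noteq> 0"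
  shows "\<exists>m\<in>S. m \<noteq> 0 \<and> (\<forall>x\<in>S. x / m \<in> R)"
  using assms
proof (induction S rule: finite_induct)
  case (insert x S)
  show ?case
  proof (cases "\<exists>y\<in>S. y \<noteq> 0")
    case False
    then have "x \<noteq> 0" "\<forall>y\<in>insert x S. y = x \<or> y = 0" using insert.prems by auto
    then show ?thesis using one_R zero_R by (intro bexI[of _ x]) auto
  next
    case True
    then obtain m where m: "m \<in> S" "m \<noteq> 0" "\<forall>y\<in>S. y / m \<in> R" using insert.IH by blast
    show ?thesis
    proof (cases "x / m \<in> R")
      case True
      then show ?thesis using m by blast
    next
      case False
      then have i: "x / m \<noteq> 0" "m / x \<in> R" using not_R[of "x / m"] by (auto simp: field_simps)
      then have x: "x \<noteq> 0" by auto
      have "y / x \<in> R" if "y \<in> S" for y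
      proof -
        have "y / x = y / m * (m / x)" using m(2) by simp
        then show ?thesis using mult_R m(3) that i(2) by metis
      qed
      then show ?thesis using x one_R by (intro bexI[of _ x]) auto
    qed
  qed
qed simp

definition Rf :: "'a form \<Rightarrow> bool" where "Rf F \<longleftrightarrow> Rp (fst F) \<and> Rp (snd F)"

definition rf :: "'a form \<Rightarrow> 'b form" where "rf F = (rp (fst F), rp (snd F))"

lemma Rf_fadd: "Rf F \<Longrightarrow> Rf G \<Longrightarrow> Rf (fadd F G)"
  and rf_fadd: "Rf F \<Longrightarrow> Rf G \<Longrightarrow> rf (fadd F G) = fadd (rf F) (rf G)"
  by (simp_all add: Rf_def rf_def fadd_def Rp_add rp_add)

lemma Rf_scale_form: "c \<in> R \<Longrightarrow> Rf F \<Longrightarrow> Rf (scale_form c F)"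
  and rf_scale_form: "c \<in> R \<Longrightarrow> Rf F \<Longrightarrow> rf (scale_form c F) = scale_form (rd c) (rf F)"
  by (simp_all add: Rf_def rf_def scale_form_def Rp_smult rp_smult)

lemma Rf_scalar: "Rf (q, 0) \<longleftrightarrow> Rp q" and rf_scalar: "rf (q, 0) = (rp q, 0)"
  by (simp_all add: Rf_def rf_def Rp_0 rp_0)

lemma Rf_fmul: "Rp h \<Longrightarrow> Rp g \<Longrightarrow> Rf F \<Longrightarrow> Rf G \<Longrightarrow> Rf (fmul h g F G)"
  and rf_fmul: "Rp h \<Longrightarrow> Rp g \<Longrightarrow> Rf F \<Longrightarrow> Rf G \<Longrightarrow> rf (fmul h g F G) = fmul (rp h) (rp g) (rf F) (rf G)"
  by (simp_all add: Rf_def rf_def fmul_def Rp_add rp_add Rp_diff rp_diff Rp_mult rp_mult)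

lemma Rf_fpow: "Rp h \<Longrightarrow> Rp g \<Longrightarrow> Rf F \<Longrightarrow> Rf (fpow h g F n)"
  and rf_fpow: "Rp h \<Longrightarrow> Rp g \<Longrightarrow> Rf F \<Longrightarrow> rf (fpow h g F n) = fpow (rp h) (rp g) (rf F) n"
proof -
  have "Rp h \<Longrightarrow> Rp g \<Longrightarrow> Rf F \<Longrightarrow> Rf (fpow h g F n) \<and> rf (fpow h g F n) = fpow (rp h) (rp g) (rf F) n"
    by (induction n) (simp_all add: fpow_0 fpow_Suc Rf_scalar rf_scalar Rp_1 rp_1 Rf_fmul rf_fmul)
  then show "Rp h \<Longrightarrow> Rp g \<Longrightarrow> Rf F \<Longrightarrow> Rf (fpow h g F n)"
    "Rp h \<Longrightarrow> Rp g \<Longrightarrow> Rf F \<Longrightarrow> rf (fpow h g F n) = fpow (rp h) (rp g) (rf F) n" by auto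
qed

lemma rp_fnorm: "Rp h \<Longrightarrow> Rp g \<Longrightarrow> Rf F \<Longrightarrow> Rp (fnorm h g F)"
  "Rp h \<Longrightarrow> Rp g \<Longrightarrow> Rf F \<Longrightarrow> rp (fnorm h g F) = fnorm (rp h) (rp g) (rf F)"
  by (simp_all add: Rf_def rf_def fnorm_def Rp_diff rp_diff Rp_mult rp_mult Rp_power rp_power)

lemma isf_rf: "isf N F \<Longrightarrow> isf N (rf F)"
  using degree_rp[of "fst F"] degree_rp[of "snd F"] by (auto simp: isf_def rf_def rp_0)

lemma primitive_form:
  assumes "F \<noteq> (0, 0)"
  shows "\<exists>c. c \<noteq> 0 \<and> Rf (scale_form c F) \<and> rf (scale_form c F) \<noteq> (0, 0)"
proof -
  let ?S = "set (coeffs (fst F)) \<union> set (coeffs (snd F))"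
  have "\<exists>x\<in>?S. x \<noteq> 0"
  proof (cases "fst F = 0")
    case True
    then have "snd F \<noteq> 0" using assms by (cases F) auto
    then show ?thesis by (intro bexI[of _ "Polynomial.lead_coeff (snd F)"]) (auto simp: coeffs_def)
  next
    case False
    then show ?thesis by (intro bexI[of _ "Polynomial.lead_coeff (fst F)"]) (auto simp: coeffs_def)
  qed
  from common_denominator[OF _ this] obtain m where m: "m \<in> ?S" "m \<noteq> 0" "\<forall>x\<in>?S. x / m \<in> R" by auto
  have "Polynomial.coeff q i / m \<in> R" if "q = fst F \<or> q = snd F" for q i
  proof (cases "Polynomial.coeff q i = 0")
    case False
    then have "Polynomial.coeff q i \<in> set (coeffs q)" by (intro coeff_in_coeffs) (auto intro: le_degree)
    then show ?thesis using m(3) that by auto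
  qed (simp add: zero_R)
  then have 1: "Rf (scale_form (1 / m) F)" by (auto simp: Rf_def Rp_def scale_form_def)
  from m(1) obtain q i where q: "q = fst F \<or> q = snd F" "Polynomial.coeff q i = m" by (auto simp: coeffs_def split: if_splits)
  then have "Polynomial.coeff (rp (smult (1 / m) q)) i = 1" using m(2) by (simp add: coeff_rp rd_1)
  then have "rp (smult (1 / m) q) \<noteq> 0" by (metis coeff_0 zero_neq_one)
  then have "rf (scale_form (1 / m) F) \<noteq> (0, 0)" using q(1) by (auto simp: rf_def scale_form_def)
  with 1 m(2) show ?thesis by (intro exI[of _ "1 / m"]) simp
qed

text \<open>Let \<open>c\<close> make \<open>c G\<close> primitive. If \<open>inverse c\<close> were
  not integral, \<open>c\<close> would reduce to 0, and so would \<open>c P G\<close>; but this is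
  the product of \<open>P\<close> and \<open>c G\<close>, both with nonzero reduction. The lemma is
  what makes the cofactors of the divisibility identities integral.\<close>

lemma gauss:
  assumes P: "Rp P" "rp P \<noteq> 0" and G: "Rf (fmul h g (P, 0) G)"
  shows "Rf G"
proof (cases "G = (0, 0)")
  case False
  obtain c where c: "c \<noteq> 0" "Rf (scale_form c G)" "rf (scale_form c G) \<noteq> (0, 0)"
    using primitive_form[OF False] by blast
  have "inverse c \<in> R"
  proof (rule ccontr)
    assume "inverse c \<notin> R"
    then have cR: "c \<in> R" "rd c = 0" using not_R[of "inverse c"] by auto
    have PG: "Rf (P * fst G, P * snd G)" using G by (simp add: fmul_scalar)
    have "rf (scale_form c (P * fst G, P * snd G)) = (0, 0)"
      unfolding rf_scale_form[OF cR(1) PG] cR(2) by (simp add: scale_form_def)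
    moreover have "scale_form c (P * fst G, P * snd G) = (P * fst (scale_form c G), P * snd (scale_form c G))"
      by (simp add: scale_form_def)
    ultimately have "rp P * rp (fst (scale_form c G)) = 0" "rp P * rp (snd (scale_form c G)) = 0"
      using P(1) c(2) by (auto simp: rf_def Rf_def rp_mult)
    then show False using P(2) c(3) by (simp add: rf_def)
  qed
  from Rf_scale_form[OF this c(2)] c(1) show ?thesis by (simp add: scale_form_scale_form scale_form_one)
qed (simp add: Rf_def Rp_0)

lemma gauss_poly:
  assumes "Rp P" "rp P \<noteq> 0" "Rp (P * q)"
  shows "Rp q"
  using gauss[of P 0 0 "(q, 0)"] assms by (simp add: fmul_scalar Rf_scalar)

end

section \<open>Injectivity of reduction on 5-torsion\<close>

lemma linear_power_dvd_cancel:
  fixes p q :: "'a::idom poly"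
  assumes "[:- a, 1:] ^ n dvd r ^ m * q" "poly r a \<noteq> 0"
  shows "[:- a, 1:] ^ n dvd q"
proof (cases "q = 0")
  case False
  have r: "r \<noteq> 0" using assms(2) by auto
  have "Polynomial.order a (r ^ m) = 0" using assms(2) by (intro order_0I) simp
  then have "Polynomial.order a (r ^ m * q) = Polynomial.order a q"
    using False r by (subst order_mult) auto
  then show ?thesis using assms(1) False r unfolding order_divides by simp
qed simp

definition feval :: "'a::comm_ring_1 form \<Rightarrow> 'a \<Rightarrow> 'a \<Rightarrow> 'a" where
  "feval F x y = poly (fst F) x + poly (snd F) x * y"

lemma feval_fmul:
  assumes "y\<^sup>2 + poly h x * y = poly g x"
  shows "feval (fmul h g F G) x y = feval F x y * feval G x y"
  unfolding feval_def fmul_def using assms[symmetric] by (simp add: algebra_simps power2_eq_square)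

text \<open>\<open>T1\<^sup>n - T2\<^sup>n = k (T1\<^sup>n\<^sup>-\<^sup>1 + \<dots> + T2\<^sup>n\<^sup>-\<^sup>1)\<close> for \<open>T1 = T2 + k\<close>.\<close>

primrec power_quotient :: "'a::comm_ring_1 poly \<Rightarrow> 'a poly \<Rightarrow> 'a form \<Rightarrow> 'a form \<Rightarrow> nat \<Rightarrow> 'a form" where
  "power_quotient h g T1 T2 0 = (0, 0)"
| "power_quotient h g T1 T2 (Suc n) = fadd (fmul h g T1 (power_quotient h g T1 T2 n)) (fpow h g T2 n)"

lemma fpow_power_quotient:
  assumes "T1 = fadd T2 ([:k:], 0)"
  shows "fpow h g T1 n = fadd (fpow h g T2 n) (scale_form k (power_quotient h g T1 T2 n))"
proof (induction n)
  case 0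
  then show ?case by (simp add: fpow_0 fadd_def scale_form_def)
next
  case (Suc n)
  have *: "fmul h g T1 G = fadd (fmul h g T2 G) (scale_form k G)" for G
    unfolding assms fmul_fadd by (simp add: fmul_scalar scale_form_def)
  have "fpow h g T1 (Suc n) = fadd (fmul h g T1 (fpow h g T2 n)) (scale_form k (fmul h g T1 (power_quotient h g T1 T2 n)))"
    by (simp only: fpow_Suc Suc fmul_fadd fmul_scale_form)
  then show ?case unfolding *[of "fpow h g T2 n"]
    by (simp add: fpow_Suc fadd_def scale_form_def smult_add_right algebra_simps)
qed

text \<open>When \<open>T1\<close> and \<open>T2\<close> have the same reduction, all terms of the
  sum coincide and it becomes the derivative of a power. The factor 5 of the final contradiction
  arises here.\<close>

lemma (in maximal_hom) power_quotient_reduction: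
  assumes "Rp h" "Rp g" "Rf T1" "Rf T2" "rf T1 = T" "rf T2 = T"
  shows "Rf (power_quotient h g T1 T2 (Suc n)) \<and>
    rf (power_quotient h g T1 T2 (Suc n)) = scale_form (of_nat (Suc n)) (fpow (rp h) (rp g) T n)"
proof (induction n)
  case 0
  have "fmul h g T1 (0, 0) = (0, 0)" by (simp add: fmul_def)
  then show ?case by (simp add: fadd_def fpow_0 Rf_scalar rf_scalar Rp_1 rp_1 scale_form_def)
next
  case (Suc n)
  define Q where "Q = power_quotient h g T1 T2 (Suc n)"
  have Q: "Rf Q" "rf Q = scale_form (of_nat (Suc n)) (fpow (rp h) (rp g) T n)"
    using Suc.IH by (simp_all only: Q_def)
  have eq: "power_quotient h g T1 T2 (Suc (Suc n)) = fadd (fmul h g T1 Q) (fpow h g T2 (Suc n))"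
    unfolding Q_def by (rule power_quotient.simps(2))
  have "rf (fadd (fmul h g T1 Q) (fpow h g T2 (Suc n)))
      = fadd (scale_form (of_nat (Suc n)) (fpow (rp h) (rp g) T (Suc n))) (fpow (rp h) (rp g) T (Suc n))"
    using assms Q by (simp only: rf_fadd rf_fmul rf_fpow Rf_fmul Rf_fpow fmul_scale_form fpow_Suc)
  also have "\<dots> = scale_form (of_nat (Suc (Suc n))) (fpow (rp h) (rp g) T (Suc n))"
    unfolding of_nat_Suc[of "Suc n"] fadd_def scale_form_def smult_add_left
    by (simp only: fst_conv snd_conv smult_1_left add.commute)
  finally show ?case unfolding eq using assms Q by (simp only: Rf_fadd Rf_fmul Rf_fpow simp_thms)
qed

lemma coeff_linear_power_self: "Polynomial.coeff ([:- z, 1:] ^ n) n = (1 :: 'a::idom)"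
proof -
  have "Polynomial.lead_coeff ([:- z, 1:] ^ n) = 1" by (simp add: lead_coeff_power)
  moreover have "Polynomial.degree ([:- z, 1:] ^ n) = n" by (simp add: degree_power_eq)
  ultimately show ?thesis by simp
qed

text \<open>Here \<open>(x2, y2)\<close> plays the opposite of the second point of the divisor, so
  the function in question is \<open>F / (X - x2)^5\<close>, with a fivefold zero at
  \<open>(x1, y1)\<close> and a fivefold pole at \<open>(x2, y2)\<close>. \<open>Fid\<close> is the
  identity of \<open>quintic_div_identity12\<close> in this notation, and \<open>Fne\<close> says
  that the function is not constant.\<close>

lemma (in maximal_hom) reduction_not_opposite:
  assumes five: "(5 :: 'b) \<noteq> 0"
    and hg: "Rp h" "Rp g" "Polynomial.degree h \<le> 3"
    and F: "isf 5 F"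
    and R: "x1 \<in> R" "y1 \<in> R" "x2 \<in> R" "y2 \<in> R"
    and P1: "y1\<^sup>2 + poly h x1 * y1 = poly g x1" and P2: "y2\<^sup>2 + poly h x2 * y2 = poly g x2"
    and red: "rd x1 = rd x2" "rd y1 = rd y2"
    and ns: "\<not> singular_at (rp h) (rp g) (rd x2) (rd y2)"
    and ne: "\<not> (x1 = x2 \<and> y1 = y2)"
    and Fid: "\<And>w1 w2. Polynomial.degree w1 \<le> 3 \<Longrightarrow> Polynomial.degree w2 \<le> 3 \<Longrightarrow>
      poly w1 x1 = y1 + poly h x1 \<Longrightarrow> poly w2 x2 = - y2 \<Longrightarrow>
      \<exists>G. fmul h g F (fmul h g (fpow h g (w1, 1) 5) (fpow h g (w2, 1) 5))
        = fmul h g (([:- x1, 1:] * [:- x2, 1:]) ^ 5, 0) G"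
    and Fne: "\<And>c. F \<noteq> (smult c ([:- x2, 1:] ^ 5), 0)"
  shows False
proof -
  define x y where "x = rd x2" and "y = rd y2"
  let ?h = "rp h" and ?g = "rp g"
  let ?m = "fmul h g" and ?n = "fmul ?h ?g"
  have cv: "y\<^sup>2 + poly ?h x * y = poly ?g x"
  proof -
    have "rd (y2\<^sup>2 + poly h x2 * y2) = rd (poly g x2)" using P2 by simp
    then show ?thesis using hg R
      by (simp add: x_def y_def rd_add rd_mult rd_power rd_poly power_R mult_R poly_R)
  qed
  \<comment> \<open>A slope for which the line through the reduced point is not tangent to the
    reduced curve. If slope 0 is tangent, nonsingularity makes slope 1 transversal.\<close>
  define s :: 'a where "s = (if poly (pderiv ?g) x = poly (pderiv ?h) x * y then 1 else 0)"
  have sR: "s \<in> R" by (simp add: s_def one_R zero_R)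
  have sgood: "poly (pderiv ?g) x - poly (pderiv ?h) x * y - rd s * (poly ?h x + 2 * y) \<noteq> 0"
    using ns cv by (auto simp: s_def rd_0 rd_1 singular_at_def x_def y_def algebra_simps)
  define p1 p2 where "p1 = [:y1 - s * x1, s:]" and "p2 = [:y2 - s * x2, s:]"
  define p where "p = [:y - rd s * x, rd s:]"
  have p12: "Rp p1" "Rp p2" "rp p1 = p" "rp p2 = p"
    using R sR red by (simp_all add: p1_def p2_def p_def Rp_pCons Rp_0 rp_pCons rp_0 diff_R mult_R
        rd_diff rd_mult x_def y_def)
  define l1 l2 l where "l1 = [:- x1, 1:]" and "l2 = [:- x2, 1:]" and "l = [:- x, 1:]"
  have l12: "Rp l1" "Rp l2" "rp l1 = l" "rp l2 = l"
    using R red by (simp_all add: l1_def l2_def l_def Rp_pCons Rp_0 rp_pCons rp_0 uminus_R rd_uminus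
        one_R rd_1 x_def Rp_1 rp_1)
  have l0: "l \<noteq> 0" "l1 \<noteq> 0" "l2 \<noteq> 0" by (simp_all add: l_def l1_def l2_def)
  have "poly (g - h * p1 - p1\<^sup>2) x1 = 0" "poly (g - h * p2 - p2\<^sup>2) x2 = 0"
    by (simp_all add: p1_def p2_def P1[symmetric] P2[symmetric] algebra_simps)
  then obtain r1 r2 where r12: "g - h * p1 - p1\<^sup>2 = l1 * r1" "g - h * p2 - p2\<^sup>2 = l2 * r2"
    unfolding poly_eq_0_iff_dvd l1_def l2_def by (elim dvdE)
  have "Rp (g - h * p1 - p1\<^sup>2)" "Rp (g - h * p2 - p2\<^sup>2)" using hg p12 by (simp_all add: Rp_diff Rp_mult Rp_power)
  then have Rr: "Rp r1" "Rp r2"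
    using gauss_poly[OF l12(1), of r1] gauss_poly[OF l12(2), of r2] l0(1) unfolding r12 l12(3,4) by blast+
  define r where "r = rp r2"
  have redr: "?g - ?h * p - p\<^sup>2 = l * rp r1" "?g - ?h * p - p\<^sup>2 = l * r"
    using arg_cong[OF r12(1), of rp] arg_cong[OF r12(2), of rp] hg p12 l12 Rr
    by (simp_all add: rp_diff rp_mult rp_power Rp_diff Rp_mult Rp_power r_def)
  then have r1: "rp r1 = r" using l0(1) by (metis mult_left_cancel)
  \<comment> \<open>Transversality of the chosen line, in the form that the second factor of its
    norm is a unit at the reduced point.\<close>
  have rx: "poly r x \<noteq> 0"
  proof -
    have "poly (pderiv (?g - ?h * p - p\<^sup>2)) x = poly r x"
      unfolding redr(2) by (simp add: pderiv_mult l_def pderiv_pCons del: mult_pCons_left)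
    moreover have "poly (pderiv (?g - ?h * p - p\<^sup>2)) x
        = poly (pderiv ?g) x - poly (pderiv ?h) x * y - rd s * (poly ?h x + 2 * y)"
    proof -
      have "poly p x = y" "poly (pderiv p) x = rd s" by (simp_all add: p_def pderiv_pCons)
      then show ?thesis by (simp add: power2_eq_square pderiv_diff pderiv_add pderiv_mult algebra_simps)
    qed
    ultimately show ?thesis using sgood by simp
  qed
  then have r0: "r \<noteq> 0" by auto
  \<comment> \<open>The difference of the intercepts of the two parallel lines. It is nonzero: a
    common line would pass through both points, so \<open>r1\<close> would vanish at
    \<open>x2\<close> and \<open>r\<close> at the reduced point.\<close>
  define \<delta> where "\<delta> = (y1 - y2) - s * (x1 - x2)"
  have \<delta>R: "\<delta> \<in> R" using R sR by (simp add: \<delta>_def diff_R mult_R)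
  have \<delta>0: "\<delta> \<noteq> 0"
  proof
    assume "\<delta> = 0"
    then have e: "y1 - s * x1 = y2 - s * x2" by (simp add: \<delta>_def algebra_simps)
    then have pp: "p1 = p2" by (simp add: p1_def p2_def)
    have "x1 \<noteq> x2" using e ne by auto
    moreover have "poly l1 x2 * poly r1 x2 = 0"
    proof -
      have "l1 * r1 = l2 * r2" by (rule trans[OF r12(1)[unfolded pp, symmetric] r12(2)])
      moreover have "poly l2 x2 = 0" by (simp add: l2_def)
      ultimately show ?thesis by (metis poly_mult mult_zero_left)
    qed
    ultimately have "poly r1 x2 = 0" by (simp add: l1_def)
    then have "poly r x = 0" using rd_poly[OF Rr(1) R(3)] by (simp add: r1 x_def rd_0)
    then show False using rx by contradiction
  qed
  \<comment> \<open>\<open>T1\<close> and \<open>T2\<close> are the lines through the two points.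
    \<open>S1\<close> and \<open>S2\<close> are their conjugates up to sign, so each product is a
    norm, which splits into the vertical line and a factor that is a unit at the reduced
    point.\<close>
  define T1 T2 S1 S2 where "T1 = (- p1, 1 :: 'a poly)" and "T2 = (- p2, 1 :: 'a poly)"
    and "S1 = (h + p1, 1 :: 'a poly)" and "S2 = (h + p2, 1 :: 'a poly)"
  define T S where "T = (- p, 1 :: 'b poly)" and "S = (?h + p, 1 :: 'b poly)"
  have TS: "?m T1 S1 = (l1 * r1, 0)" "?m T2 S2 = (l2 * r2, 0)" "?n T S = (l * r, 0)"
    unfolding r12[symmetric] redr(2)[symmetric]
    by (simp_all add: fmul_def T1_def S1_def T2_def S2_def T_def S_def algebra_simps power2_eq_square)
  have RTS: "Rf T1" "Rf T2" "Rf S1" "Rf S2" "rf T1 = T" "rf T2 = T" "rf S2 = S"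
    using p12 hg by (simp_all add: Rf_def rf_def T1_def T2_def S1_def S2_def T_def S_def
        Rp_uminus rp_uminus Rp_1 rp_1 Rp_add rp_add)
  have T12: "T1 = fadd T2 ([:- \<delta>:], 0)"
    by (simp add: T1_def T2_def fadd_def p1_def p2_def \<delta>_def algebra_simps)
  obtain u where u: "u \<noteq> 0" "Rf (scale_form u F)" "rf (scale_form u F) \<noteq> (0, 0)"
    using primitive_form[of F] Fne[of 0] by auto
  define F0 where "F0 = scale_form u F"
  note F0 = u(2,3)[folded F0_def]
  have F05: "isf 5 F0" unfolding F0_def by (rule isf_scale_form[OF F])
  have degp: "Polynomial.degree p1 \<le> 1" "Polynomial.degree p2 \<le> 1" by (simp_all add: p1_def p2_def)
  obtain G0 where G0: "?m F (?m (fpow h g S1 5) (fpow h g T2 5)) = ?m ((l1 * l2) ^ 5, 0) G0"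
  proof -
    have "\<exists>G. ?m F (?m (fpow h g (h + p1, 1) 5) (fpow h g (- p2, 1) 5)) = ?m (([:- x1, 1:] * [:- x2, 1:]) ^ 5, 0) G"
      using degp hg(3) by (intro Fid degree_add_le) (simp_all add: p1_def p2_def)
    then show thesis using that unfolding S1_def T2_def l1_def l2_def by blast
  qed
  define G where "G = scale_form u G0"
  have G: "?m F0 (?m (fpow h g S1 5) (fpow h g T2 5)) = ?m ((l1 * l2) ^ 5, 0) G"
    unfolding F0_def G_def fmul_scale_form G0 ..
  have "Rf (?m ((l1 * l2) ^ 5, 0) G)" unfolding G[symmetric] using hg F0 RTS by (intro Rf_fmul Rf_fpow)
  then have RG: "Rf G"
    by (rule gauss[rotated 2]) (use l12 l0 in \<open>simp_all add: Rp_power Rp_mult rp_power rp_mult\<close>)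
  have TSpow: "?m (fpow h g T1 5) (fpow h g S1 5) = ((l1 * r1) ^ 5, 0)"
    "?m (fpow h g T2 5) (fpow h g S2 5) = ((l2 * r2) ^ 5, 0)"
    "?n (fpow ?h ?g T 5) (fpow ?h ?g S 5) = ((l * r) ^ 5, 0)"
    unfolding fpow_mult[symmetric] TS fpow_scalar by (rule refl)+
  \<comment> \<open>In terms of functions:
    \<open>F0 / l2^5 = (G / r1^5) (T1 / T2)^5\<close>.\<close>
  have eq3: "?m ((r1 * r2) ^ 5, 0) F0 = ?m G (?m (fpow h g T1 5) (fpow h g S2 5))"
  proof (rule fmul_scalar_cancel[of "(l1 * l2) ^ 5"])
    have "?m ((l1 * l2) ^ 5, 0) (?m ((r1 * r2) ^ 5, 0) F0)
        = ?m (?m ((l1 * r1) ^ 5, 0) ((l2 * r2) ^ 5, 0)) F0"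
      unfolding fmul_scalar_scalar fmul_assoc[symmetric] by (simp add: power_mult_distrib mult_ac)
    also have "\<dots> = ?m (?m F0 (?m (fpow h g S1 5) (fpow h g T2 5))) (?m (fpow h g T1 5) (fpow h g S2 5))"
      unfolding TSpow[symmetric] by (simp only: fmul_ac)
    also have "\<dots> = ?m ((l1 * l2) ^ 5, 0) (?m G (?m (fpow h g T1 5) (fpow h g S2 5)))"
      unfolding G by (simp only: fmul_assoc)
    finally show "?m ((l1 * l2) ^ 5, 0) (?m ((r1 * r2) ^ 5, 0) F0)
        = ?m ((l1 * l2) ^ 5, 0) (?m G (?m (fpow h g T1 5) (fpow h g S2 5)))" .
  qed (use l0 in simp)
  have "?n ((r * r) ^ 5, 0) (rf F0) = ?n (rf G) (?n (fpow ?h ?g T 5) (fpow ?h ?g S 5))"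
    using arg_cong[OF eq3, of rf] hg RTS Rr F0(1) RG
    by (simp add: rf_fmul Rf_fmul rf_fpow Rf_fpow Rf_scalar rf_scalar Rp_power rp_power Rp_mult rp_mult r1 r_def)
  then have "?n (r ^ 5, 0) (?n (r ^ 5, 0) (rf F0)) = ?n (r ^ 5, 0) (?n (l ^ 5, 0) (rf G))"
    unfolding TSpow fmul_assoc[symmetric] fmul_scalar_scalar
    by (simp add: power_mult_distrib fmul_commute[of _ _ "rf G"] mult.commute)
  \<comment> \<open>With \<open>T1\<close> and \<open>T2\<close> both reducing to \<open>T\<close>,
    zero and pole cancel. By degrees the reduction of \<open>F0\<close> is then a constant multiple
    of \<open>l ^ 5\<close>.\<close>
  then have eqbar: "?n (r ^ 5, 0) (rf F0) = ?n (l ^ 5, 0) (rf G)"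
    by (rule fmul_scalar_cancel[rotated]) (use r0 in simp)
  have degl: "Polynomial.degree (l ^ n) = n" for n by (simp add: l_def degree_power_eq)
  have lc: "Polynomial.coeff (l ^ 5) 5 = 1" "Polynomial.coeff (l2 ^ 5) 5 = 1"
    unfolding l_def l2_def by (rule coeff_linear_power_self)+
  have small: "q = 0" if "l ^ n dvd q" "q = 0 \<or> Polynomial.degree q < n" for n q
  proof (rule ccontr)
    assume "q \<noteq> 0"
    then show False using dvd_imp_degree_le[OF that(1)] that(2) degl[of n] by simp
  qed
  have dvdF: "l ^ 5 dvd fst (rf F0)" "l ^ 5 dvd snd (rf F0)"
  proof -
    have "r ^ 5 * fst (rf F0) = l ^ 5 * fst (rf G)" "r ^ 5 * snd (rf F0) = l ^ 5 * snd (rf G)"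
      using eqbar by (simp_all add: fmul_scalar)
    then have "l ^ 5 dvd r ^ 5 * fst (rf F0)" "l ^ 5 dvd r ^ 5 * snd (rf F0)" by auto
    then show "l ^ 5 dvd fst (rf F0)" "l ^ 5 dvd snd (rf F0)"
      using linear_power_dvd_cancel rx unfolding l_def by blast+
  qed
  have isfr: "isf 5 (rf F0)" by (rule isf_rf[OF F05])
  have snd0: "snd (rf F0) = 0" by (rule small[OF dvdF(2)]) (use isfr in \<open>auto simp: isf_def\<close>)
  \<comment> \<open>The lift of that constant is taken to be the coefficient of degree 5, so that
    the same coefficient of \<open>H\<close> below vanishes exactly. This later excludes a nonzero
    constant as the reduction of the scaled function.\<close>
  define c where "c = Polynomial.coeff (fst F0) 5"
  have cR: "c \<in> R" using F0(1) by (simp add: c_def Rf_def Rp_def)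
  have fst0: "fst (rf F0) = smult (rd c) (l ^ 5)"
  proof -
    obtain k where k: "fst (rf F0) = l ^ 5 * k" using dvdF(1) by (rule dvdE)
    have "Polynomial.degree (l ^ 5 * k) \<le> 5" using isfr k by (simp add: isf_def)
    then have "k = 0 \<or> Polynomial.degree (l ^ 5) + Polynomial.degree k \<le> 5"
      using l0(1) by (cases "k = 0") (simp_all add: degree_mult_eq)
    then have "Polynomial.degree k = 0" using degl[of 5] by auto
    then obtain j where j: "k = [:j:]" by (auto elim: degree_eq_zeroE)
    then have f: "fst (rf F0) = smult j (l ^ 5)" using k by simp
    have "Polynomial.coeff (fst (rf F0)) 5 = rd c" by (simp add: rf_def c_def coeff_rp)
    then have "j = rd c" using lc by (simp add: f)
    with f show ?thesis by simp
  qed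
  have c0: "rd c \<noteq> 0" using F0(2) fst0 snd0 by (cases "rf F0") auto
  have rfG: "rf G = (smult (rd c) (r ^ 5), 0)"
  proof (rule fmul_scalar_cancel[of "l ^ 5"])
    show "?n (l ^ 5, 0) (rf G) = ?n (l ^ 5, 0) (smult (rd c) (r ^ 5), 0)"
      unfolding eqbar[symmetric] by (simp add: fmul_scalar fst0 snd0 mult.commute)
  qed (use l0 in simp)
  \<comment> \<open>The numerator over \<open>l2 ^ 5\<close> of the function minus
    \<open>c\<close>.\<close>
  define H where "H = fadd F0 (scale_form (- c) (l2 ^ 5, 0))"
  have "H \<noteq> (0, 0)"
  proof
    assume "H = (0, 0)"
    then have "fst F0 = smult c (l2 ^ 5)" "snd F0 = 0"
      by (simp_all add: H_def fadd_def scale_form_def)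
    moreover have "F = scale_form (1 / u) F0" using u(1) by (simp add: F0_def scale_form_scale_form scale_form_one)
    ultimately have "F = (smult (1 / u * c) (l2 ^ 5), 0)" by (simp add: scale_form_def)
    then show False using Fne unfolding l2_def by blast
  qed
  then obtain v where v: "v \<noteq> 0" "Rf (scale_form v H)" "rf (scale_form v H) \<noteq> (0, 0)"
    using primitive_form by blast
  define F' where "F' = scale_form v H"
  note F' = v(2,3)[folded F'_def]
  have H: "H = scale_form (1 / v) F'" using v(1) by (simp add: F'_def scale_form_scale_form scale_form_one)
  have F'5: "isf 5 F'"
  proof -
    have "isf 5 (scale_form (- c) (l2 ^ 5, 0))"
      using degree_power_le_exponent[of l2 5] by (intro isf_scale_form) (simp add: isf_scalar l2_def)
    then have "isf 5 H" using F05 unfolding H_def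
      by (auto simp: isf_def fadd_def scale_form_def intro!: degree_add_le degree_diff_le)
    then show ?thesis unfolding F'_def by (rule isf_scale_form)
  qed
  have F'c: "Polynomial.coeff (fst (rf F')) 5 = 0"
    using lc by (simp add: rf_def coeff_rp F'_def H_def fadd_def scale_form_def c_def rd_0)
  define \<Sigma> where "\<Sigma> = power_quotient h g T1 T2 5"
  have \<Sigma>: "Rf \<Sigma>" "rf \<Sigma> = scale_form 5 (fpow ?h ?g T 4)"
    using power_quotient_reduction[OF hg(1,2) RTS(1,2,5,6), of 4] by (simp_all add: \<Sigma>_def eval_nat_numeral)
  have T1pow: "fpow h g T1 5 = fadd (fpow h g T2 5) (scale_form (- \<delta>) \<Sigma>)"
    unfolding \<Sigma>_def by (rule fpow_power_quotient[OF T12])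
  define K where "K = fadd G (scale_form (- c) (r1 ^ 5, 0))"
  define V where "V = ?m G (?m \<Sigma> (fpow h g S2 5))"
  \<comment> \<open>\<open>T1pow\<close> is inserted into \<open>eq3\<close>; the term with
    \<open>T2 ^ 5\<close> combines with \<open>S2 ^ 5\<close> to \<open>(l2 r2)^5\<close>.\<close>
  have eq4: "?m ((r1 * r2) ^ 5, 0) H = fadd (?m ((l2 * r2) ^ 5, 0) K) (scale_form (- \<delta>) V)"
  proof -
    have "?m ((r1 * r2) ^ 5, 0) H
        = fadd (?m G (?m (fpow h g T1 5) (fpow h g S2 5))) (scale_form (- c) ((r1 * r2) ^ 5 * l2 ^ 5, 0))"
      unfolding H_def fmul_fadd eq3 fmul_scale_form fmul_scalar_scalar ..
    also have "?m G (?m (fpow h g T1 5) (fpow h g S2 5))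
        = fadd (?m ((l2 * r2) ^ 5, 0) G) (scale_form (- \<delta>) V)"
      unfolding T1pow fmul_fadd fmul_scale_form TSpow V_def fmul_commute[of h g G "((l2 * r2) ^ 5, 0)"] ..
    finally show ?thesis unfolding K_def fmul_fadd fmul_scale_form fmul_scalar_scalar
      by (simp add: fadd_def scale_form_def power_mult_distrib algebra_simps)
  qed
  define \<epsilon> where "\<epsilon> = 1 / v"
  have "\<epsilon> \<noteq> 0" using v(1) by (simp add: \<epsilon>_def)
  \<comment> \<open>Division by whichever of \<open>\<epsilon>\<close> and \<open>\<delta>\<close>
    is larger in the valuation makes both coefficients integral and one of them equal to 1.\<close>
  then have "\<exists>m\<in>{\<epsilon>, \<delta>}. m \<noteq> 0 \<and> (\<forall>x\<in>{\<epsilon>, \<delta>}. x / m \<in> R)"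
    by (intro common_denominator) simp_all
  then obtain m where m: "m \<in> {\<epsilon>, \<delta>}" "m \<noteq> 0" "\<epsilon> / m \<in> R" "\<delta> / m \<in> R" by blast
  define e k where "e = \<epsilon> / m" and "k = \<delta> / m"
  have ek: "e \<in> R" "k \<in> R" "e = 1 \<or> k = 1" using m by (auto simp: e_def k_def)
  have eq5: "?m ((l2 * r2) ^ 5, 0) (scale_form (1 / m) K)
      = fadd (scale_form e (?m ((r1 * r2) ^ 5, 0) F')) (scale_form k V)"
  proof -
    have 1: "?m ((r1 * r2) ^ 5, 0) H = scale_form \<epsilon> (?m ((r1 * r2) ^ 5, 0) F')"
      unfolding H fmul_scale_form \<epsilon>_def ..
    have "?m ((l2 * r2) ^ 5, 0) K = fadd (?m ((r1 * r2) ^ 5, 0) H) (scale_form \<delta> V)"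
      unfolding eq4 by (simp add: fadd_def scale_form_def prod_eq_iff)
    then show ?thesis unfolding fmul_scale_form 1
      by (simp add: scale_form_fadd scale_form_scale_form e_def k_def)
  qed
  have RV: "Rf V" "rf V = ?n (rf G) (?n (scale_form 5 (fpow ?h ?g T 4)) (fpow ?h ?g S 5))"
    using RG \<Sigma> RTS hg by (simp_all add: V_def Rf_fmul rf_fmul Rf_fpow rf_fpow)
  have Rrr: "Rf ((r1 * r2) ^ 5, 0)" "rf ((r1 * r2) ^ 5, 0) = ((r * r) ^ 5, 0)"
    using Rr by (simp_all add: Rf_scalar rf_scalar Rp_power rp_power Rp_mult rp_mult r1 r_def)
  have Rlr: "Rp ((l2 * r2) ^ 5)" "rp ((l2 * r2) ^ 5) = (l * r) ^ 5"
    using Rr l12 by (simp_all add: Rp_power rp_power Rp_mult rp_mult r_def)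
  have "Rf (fadd (scale_form e (?m ((r1 * r2) ^ 5, 0) F')) (scale_form k V))"
    by (intro Rf_fadd Rf_scale_form ek Rf_fmul hg Rrr F' RV)
  then have RK: "Rf (scale_form (1 / m) K)"
    unfolding eq5[symmetric] by (rule gauss[rotated 2]) (use Rlr r0 l0 in simp_all)
  define K' where "K' = rf (scale_form (1 / m) K)"
  have eq6: "?n ((l * r) ^ 5, 0) K' = fadd (scale_form (rd e) (?n ((r * r) ^ 5, 0) (rf F'))) (scale_form (rd k) (rf V))"
  proof -
    have "rf (?m ((l2 * r2) ^ 5, 0) (scale_form (1 / m) K)) = ?n ((l * r) ^ 5, 0) K'"
      using Rlr RK hg by (simp add: rf_fmul Rf_scalar rf_scalar K'_def)
    moreover have "rf (fadd (scale_form e (?m ((r1 * r2) ^ 5, 0) F')) (scale_form k V))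
        = fadd (scale_form (rd e) (?n ((r * r) ^ 5, 0) (rf F'))) (scale_form (rd k) (rf V))"
      using ek Rrr F' RV(1) hg by (simp add: rf_fadd Rf_scale_form rf_scale_form Rf_fmul rf_fmul)
    ultimately show ?thesis using eq5 by simp
  qed
  \<comment> \<open>\<open>V\<close> reduces to a multiple of \<open>5 c T^4 S^5\<close>, which one
    more factor \<open>T\<close> completes to a fifth power of the norm
    \<open>T S = l r\<close>.\<close>
  have VT: "?n T (rf V) = scale_form (5 * rd c) (?n ((l * r) ^ 5, 0) (r ^ 5, 0))"
  proof -
    have "?n T (rf V) = scale_form 5 (?n (?n (fpow ?h ?g T 5) (fpow ?h ?g S 5)) (rf G))"
    proof -
      have "fpow ?h ?g T 5 = ?n T (fpow ?h ?g T 4)" using fpow_Suc[of ?h ?g T 4] by simp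
      then show ?thesis unfolding RV(2) fmul_scale_form by (simp only: fmul_ac)
    qed
    also have "rf G = scale_form (rd c) (r ^ 5, 0)" unfolding rfG by (simp add: scale_form_def)
    finally show ?thesis unfolding TSpow fmul_scale_form scale_form_scale_form .
  qed
  have "?n (r ^ 5, 0) (?n (l ^ 5, 0) (?n T K'))
      = ?n (r ^ 5, 0) (fadd (scale_form (rd e) (?n (r ^ 5, 0) (?n T (rf F')))) (scale_form (rd k * (5 * rd c)) ((l * r) ^ 5, 0)))"
  proof -
    have "?n (r ^ 5, 0) (?n (l ^ 5, 0) (?n T K')) = ?n T (?n ((l * r) ^ 5, 0) K')"
    proof -
      have "((l * r) ^ 5, 0) = ?n (r ^ 5, 0) (l ^ 5, 0)"
        by (simp add: fmul_scalar_scalar power_mult_distrib mult.commute)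
      then show ?thesis by (simp only: fmul_ac)
    qed
    also have "\<dots> = fadd (scale_form (rd e) (?n T (?n ((r * r) ^ 5, 0) (rf F')))) (scale_form (rd k) (?n T (rf V)))"
      unfolding eq6 fmul_fadd fmul_scale_form ..
    also have "?n T (?n ((r * r) ^ 5, 0) (rf F')) = ?n (r ^ 5, 0) (?n (r ^ 5, 0) (?n T (rf F')))"
    proof -
      have "((r * r) ^ 5, 0) = ?n (r ^ 5, 0) (r ^ 5, 0)" by (simp add: fmul_scalar_scalar power_mult_distrib)
      then show ?thesis by (simp only: fmul_ac)
    qed
    finally show ?thesis unfolding VT fmul_fadd fmul_scale_form scale_form_scale_form
      by (simp only: fmul_commute)
  qed
  then have eq7: "?n (l ^ 5, 0) (?n T K')
      = fadd (scale_form (rd e) (?n (r ^ 5, 0) (?n T (rf F')))) (scale_form (rd k * (5 * rd c)) ((l * r) ^ 5, 0))"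
    by (rule fmul_scalar_cancel[rotated]) (use r0 in simp)
  define A where "A = scale_form (rd e) (rf F')"
  have A5: "isf 5 A" unfolding A_def by (intro isf_scale_form isf_rf F'5)
  define B where "B = ?n T A"
  have eq8: "l ^ 5 * fst (?n T K') = r ^ 5 * fst B + smult (rd k * (5 * rd c)) ((l * r) ^ 5)"
    "l ^ 5 * snd (?n T K') = r ^ 5 * snd B"
  proof -
    have "B = scale_form (rd e) (?n T (rf F'))" by (simp only: B_def A_def fmul_scale_form)
    then show "l ^ 5 * fst (?n T K') = r ^ 5 * fst B + smult (rd k * (5 * rd c)) ((l * r) ^ 5)"
      "l ^ 5 * snd (?n T K') = r ^ 5 * snd B"
      using eq7 by (simp_all add: fmul_scalar fadd_def scale_form_def)
  qed
  \<comment> \<open>\<open>A / l^5\<close> is the reduction of the scaled function. That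
    \<open>l ^ 5\<close> divides \<open>T A\<close> says that its only pole on this fibre is at the
    reduced point and at most simple.\<close>
  have "l ^ 5 dvd r ^ 5 * fst B"
  proof -
    have "r ^ 5 * fst B = l ^ 5 * (fst (?n T K') - smult (rd k * (5 * rd c)) (r ^ 5))"
      using eq8(1) by (simp add: algebra_simps power_mult_distrib)
    then show ?thesis by simp
  qed
  moreover have "l ^ 5 dvd r ^ 5 * snd B" using eq8(2) by (metis dvd_triv_left)
  ultimately have "l ^ 5 dvd fst B" "l ^ 5 dvd snd B"
    using linear_power_dvd_cancel rx unfolding l_def by blast+
  then obtain J1 J2 where J: "fst B = l ^ 5 * J1" "snd B = l ^ 5 * J2" by (elim dvdE)
  \<comment> \<open>Multiplication by \<open>S\<close> replaces \<open>T\<close> by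
    \<open>l r\<close>. After one \<open>l\<close> is cancelled, \<open>l ^ 4\<close> divides the
    y-component of \<open>A\<close>, whose degree is at most 5 - 3 = 2 because y has weight
    3.\<close>
  have "?n S B = ?n (l * r, 0) A" unfolding B_def TS(3)[symmetric] by (simp only: fmul_ac)
  moreover have "B = ?n (l ^ 5, 0) (J1, J2)" using J by (simp add: fmul_scalar prod_eq_iff)
  ultimately have "?n (l, 0) (?n (r, 0) A) = ?n (l, 0) (?n (l ^ 4, 0) (?n S (J1, J2)))"
  proof -
    assume a: "?n S B = ?n (l * r, 0) A" and b: "B = ?n (l ^ 5, 0) (J1, J2)"
    have "?n (l, 0) (?n (r, 0) A) = ?n S (?n (l ^ 5, 0) (J1, J2))"
      unfolding b[symmetric] a fmul_assoc[symmetric] fmul_scalar_scalar ..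
    also have "(l ^ 5, 0) = ?n (l, 0) (l ^ 4, 0)" by (simp add: fmul_scalar_scalar eval_nat_numeral)
    finally show ?thesis by (simp only: fmul_ac)
  qed
  then have "?n (r, 0) A = ?n (l ^ 4, 0) (?n S (J1, J2))"
    by (rule fmul_scalar_cancel[rotated]) (use l0 in simp)
  then have "r ^ 1 * snd A = l ^ 4 * snd (?n S (J1, J2))" by (simp add: fmul_scalar)
  then have "l ^ 4 dvd r ^ 1 * snd A" by simp
  then have "l ^ 4 dvd snd A" using linear_power_dvd_cancel rx unfolding l_def by blast
  then have A2: "snd A = 0" by (rule small) (use A5 in \<open>auto simp: isf_def\<close>)
  then have "fst A = snd B" by (simp add: B_def fmul_def T_def)
  then have A1: "fst A = l ^ 5 * J2" using J by simp
  \<comment> \<open>The function is now constant, and the constant is the coefficient of degree 5,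
    which is zero by the choice of \<open>c\<close>.\<close>
  have "J2 = 0"
  proof (rule ccontr)
    assume "J2 \<noteq> 0"
    then have "Polynomial.degree (l ^ 5) + Polynomial.degree J2 \<le> 5"
      using A5 A1 l0 by (simp add: isf_def degree_mult_eq)
    then have "Polynomial.degree J2 = 0" using degl[of 5] by simp
    then obtain j where j: "J2 = [:j:]" by (auto elim: degree_eq_zeroE)
    have "Polynomial.coeff (fst A) 5 = 0" using F'c by (simp add: A_def scale_form_def)
    then have "j = 0" unfolding A1 j using lc by (simp add: mult.commute)
    then show False using j \<open>J2 \<noteq> 0\<close> by simp
  qed
  then have A0: "A = (0, 0)" using A1 A2 by (cases A) simp
  then have "rd e = 0" using F'(2) by (cases "rf F'") (auto simp: A_def scale_form_def)
  then have "k = 1" using ek(3) rd_1 by auto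
  then have e: "l ^ 5 * fst (?n T K') = l ^ 5 * smult (5 * rd c) (r ^ 5)" "l ^ 5 * snd (?n T K') = 0"
    using eq8 A0 by (simp_all add: B_def fmul_def rd_1 power_mult_distrib)
  have l5: "l ^ 5 \<noteq> 0" using l0(1) by simp
  have "fst (?n T K') = smult (5 * rd c) (r ^ 5)" using e(1) unfolding mult_left_cancel[OF l5] .
  moreover have "snd (?n T K') = 0" using e(2) l5 by simp
  \<comment> \<open>Evaluation at the reduced point, where \<open>T\<close> vanishes but the
    right-hand side does not.\<close>
  ultimately have "feval (?n T K') x y = 5 * rd c * poly r x ^ 5" by (simp add: feval_def)
  moreover have "feval T x y = 0" by (simp add: feval_def T_def p_def algebra_simps)
  ultimately have "5 * rd c * poly r x ^ 5 = 0" using feval_fmul[OF cv, of T K'] by simp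
  then show False using five c0 rx by simp
qed

section \<open>Residues of a quadratic field at a split prime\<close>

lemma csqrt_square: "csqrt z * csqrt z = z"
  using power2_csqrt[of z] by (simp add: power2_eq_square)

lemma quadratic_fieldI: "of_rat q + of_rat r * csqrt (of_int d) \<in> quadratic_field d"
  by (auto simp: quadratic_field_def)

lemma of_rat_in_quadratic_field: "of_rat q \<in> quadratic_field d"
  using quadratic_fieldI[of q 0 d] by simp

lemma csqrt_in_quadratic_field: "csqrt (of_int d) \<in> quadratic_field d"
  using quadratic_fieldI[of 0 1 d] by simp

lemma quadratic_field_add: "x \<in> quadratic_field d \<Longrightarrow> y \<in> quadratic_field d \<Longrightarrow> x + y \<in> quadratic_field d"
proof -
  assume "x \<in> quadratic_field d" "y \<in> quadratic_field d"
  then obtain a b c e where "x = of_rat a + of_rat b * csqrt (of_int d)" "y = of_rat c + of_rat e * csqrt (of_int d)"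
    by (auto simp: quadratic_field_def)
  then have "x + y = of_rat (a + c) + of_rat (b + e) * csqrt (of_int d)" by (simp add: of_rat_add algebra_simps)
  then show ?thesis by (simp only: quadratic_fieldI)
qed

lemma quadratic_field_mult: "x \<in> quadratic_field d \<Longrightarrow> y \<in> quadratic_field d \<Longrightarrow> x * y \<in> quadratic_field d"
proof -
  let ?s = "csqrt (of_int d)"
  assume "x \<in> quadratic_field d" "y \<in> quadratic_field d"
  then obtain a b c e where xy: "x = of_rat a + of_rat b * ?s" "y = of_rat c + of_rat e * ?s"
    by (auto simp: quadratic_field_def)
  have "x * y = of_rat a * of_rat c + of_rat b * of_rat e * (?s * ?s) + (of_rat a * of_rat e + of_rat b * of_rat c) * ?s"
    by (simp add: xy algebra_simps)
  also have "\<dots> = of_rat (a * c + b * e * of_int d) + of_rat (a * e + b * c) * ?s"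
    unfolding csqrt_square by (simp add: of_rat_add of_rat_mult)
  finally show ?thesis by (simp only: quadratic_fieldI)
qed

lemma quadratic_field_uminus: "x \<in> quadratic_field d \<Longrightarrow> - x \<in> quadratic_field d"
  using quadratic_field_mult[OF of_rat_in_quadratic_field[of "- 1"], of x d] by (simp add: of_rat_minus)

lemma quadratic_field_diff: "x \<in> quadratic_field d \<Longrightarrow> y \<in> quadratic_field d \<Longrightarrow> x - y \<in> quadratic_field d"
  using quadratic_field_add[of x d "- y"] quadratic_field_uminus[of y d] by simp

lemma quadratic_field_inverse:
  assumes "x \<in> quadratic_field d"
  shows "inverse x \<in> quadratic_field d"
proof (cases "x = 0")
  case False
  let ?s = "csqrt (of_int d)"
  obtain a b where x: "x = of_rat a + of_rat b * ?s" using assms by (auto simp: quadratic_field_def)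
  define x' where "x' = of_rat a - of_rat b * ?s"
  have x'K: "x' \<in> quadratic_field d" using quadratic_fieldI[of a "- b" d] by (simp add: x'_def of_rat_minus)
  have "x * x' = of_rat a * of_rat a - of_rat b * of_rat b * (?s * ?s)" by (simp add: x x'_def algebra_simps)
  also have "\<dots> = of_rat (a * a - b * b * of_int d)"
    unfolding csqrt_square by (simp add: of_rat_diff of_rat_mult)
  finally have n: "x * x' = of_rat (a * a - b * b * of_int d)" .
  show ?thesis
  proof (cases "x' = 0")
    case True
    then have "x = of_rat (2 * a)" by (simp add: x x'_def of_rat_mult)
    then have "inverse x = of_rat (inverse (2 * a))" by (simp only: of_rat_inverse)
    then show ?thesis by (simp only: of_rat_in_quadratic_field)
  next
    case x'0: False
    have "inverse x = x' * inverse (x * x')" using False x'0 by (simp add: field_simps)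
    also have "inverse (x * x') = of_rat (inverse (a * a - b * b * of_int d))" unfolding n by (simp only: of_rat_inverse)
    finally show ?thesis using quadratic_field_mult[OF x'K of_rat_in_quadratic_field] by simp
  qed
qed (use of_rat_in_quadratic_field[of 0 d] in simp)

lemma csqrt_squarefree_irrational:
  assumes "squarefree d" "d \<noteq> 1"
  shows "csqrt (of_int d) \<notin> \<rat>"
proof
  assume "csqrt (of_int d) \<in> \<rat>"
  moreover have "algebraic_int (csqrt (of_int d))" by (intro algebraic_int_csqrt) simp
  ultimately have "csqrt (of_int d) \<in> \<int>" by (intro rational_algebraic_int_is_int)
  then obtain e where e: "csqrt (of_int d) = of_int e" by (auto elim: Ints_cases)
  then have "(of_int d :: complex) = of_int (e * e)" using csqrt_square[of "of_int d"] by simp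
  then have d: "d = e * e" by (simp only: of_int_eq_iff)
  then have "e dvd 1" using assms(1) by (auto simp: squarefree_def power2_eq_square)
  then have "e = 1 \<or> e = - 1" by (auto simp: zdvd1_eq)
  then show False using d assms(2) by auto
qed

lemma quadratic_unique:
  assumes "csqrt (of_int d) \<notin> \<rat>" "of_rat a + of_rat b * csqrt (of_int d) = 0"
  shows "a = 0 \<and> b = 0"
proof (cases "b = 0")
  case False
  have "of_rat b * csqrt (of_int d) = - of_rat a" using assms(2) by (simp add: add_eq_0_iff)
  then have "csqrt (of_int d) = - of_rat a / of_rat b" using False by (simp add: field_simps)
  also have "\<dots> = of_rat (- a / b)" by (simp add: of_rat_divide of_rat_minus)
  finally show ?thesis using assms(1) by simp
qed (use assms(2) in simp)

lemma field_degree_quadratic: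
  assumes "csqrt (of_int d) \<notin> \<rat>"
  shows "field_degree (quadratic_field d) = 2"
proof -
  let ?s = "csqrt (of_int d)"
  interpret vs: vector_space "\<lambda>(q::rat) (z::complex). of_rat q * z"
    by unfold_locales (simp_all add: algebra_simps of_rat_add of_rat_mult)
  have s1: "?s \<noteq> 1" using assms by auto
  have ind: "\<not> vs.dependent {1, ?s}"
  proof
    assume "vs.dependent {1, ?s}"
    then obtain u where u: "\<exists>v\<in>{1, ?s}. u v \<noteq> 0" "(\<Sum>v\<in>{1, ?s}. of_rat (u v) * v) = 0"
      using vs.dependent_finite[of "{1, ?s}"] by auto
    then have "of_rat (u 1) + of_rat (u ?s) * ?s = 0" using s1 by simp
    then have "u 1 = 0 \<and> u ?s = 0" by (rule quadratic_unique[OF assms])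
    then show False using u(1) by auto
  qed
  have "quadratic_field d = vs.span {1, ?s}"
  proof (rule Set.set_eqI)
    fix x
    have "x \<in> vs.span {1, ?s} \<longleftrightarrow> (\<exists>k. x - of_rat k * 1 \<in> vs.span {?s})" by (rule vs.span_breakdown_eq)
    also have "\<dots> \<longleftrightarrow> (\<exists>k j. x - of_rat k = of_rat j * ?s)" by (auto simp: vs.span_singleton)
    also have "\<dots> \<longleftrightarrow> x \<in> quadratic_field d"
      by (auto simp: quadratic_field_def diff_eq_eq add.commute)
    finally show "x \<in> quadratic_field d \<longleftrightarrow> x \<in> vs.span {1, ?s}" ..
  qed
  then show ?thesis unfolding field_degree_def using vs.dim_span_eq_card_independent[OF ind] s1 by simp
qed

text \<open>\<open>z\<close> is taken in one of the two primes above \<open>p\<close> but not in the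
  other, and \<open>z'\<close> is its conjugate. The norm is an integer in the first prime, hence
  divisible by \<open>p\<close>. The second prime contains the norm but not \<open>z\<close>, hence
  it contains \<open>z'\<close>, and so it cannot contain the trace. The argument is uniform in
  \<open>p\<close>, including 2.\<close>

lemma split_prime_element:
  assumes irr: "csqrt (of_int d) \<notin> \<rat>" and p: "prime p" and split: "splits_in p (quadratic_field d)"
  shows "\<exists>z z' :: complex. \<exists>T N :: int. z \<in> quadratic_field d \<and> z \<notin> \<rat> \<and>
    z + z' = of_int T \<and> z * z' = of_int N \<and> int p dvd N \<and> \<not> int p dvd T"
proof -
  let ?K = "quadratic_field d" and ?s = "csqrt (of_int d)"
  let ?O = "ring_of_integers ?K"
  have "card (primes_above ?K p) = 2" using split field_degree_quadratic[OF irr] by (simp add: splits_in_def)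
  then obtain I J where IJ: "I \<in> primes_above ?K p" "J \<in> primes_above ?K p" "I \<noteq> J"
    by (auto simp: card_2_iff)
  have carrier: "carrier ?O = {z \<in> ?K. algebraic_int z}"
    and mult: "x \<otimes>\<^bsub>?O\<^esub> y = x * y" and add: "x \<oplus>\<^bsub>?O\<^esub> y = x + y" and one: "\<one>\<^bsub>?O\<^esub> = 1" for x y
    by (simp_all add: ring_of_integers_def ring_of_type_algebra_def)
  have core: ?thesis if I: "I \<in> primes_above ?K p" and J: "J \<in> primes_above ?K p" and z: "z \<in> I" "z \<notin> J" for I J z
  proof -
    have Ip: "primeideal I ?O" "of_nat p \<in> I" and Jp: "primeideal J ?O" "of_nat p \<in> J"
      using I J by (auto simp: primes_above_def)
    interpret I: primeideal I ?O by (rule Ip)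
    interpret J: primeideal J ?O by (rule Jp)
    have zO: "z \<in> ?K" "algebraic_int z" using I.Icarr[OF z(1)] carrier by auto
    then obtain a b where zab: "z = of_rat a + of_rat b * ?s" by (auto simp: quadratic_field_def)
    define z' where "z' = of_rat a - of_rat b * ?s"
    have z'K: "z' \<in> ?K" using quadratic_fieldI[of a "- b" d] by (simp add: z'_def of_rat_minus)
    \<comment> \<open>Integral polynomials commute with conjugation, so a monic equation for
      \<open>z\<close> also holds for \<open>z'\<close>.\<close>
    have conj: "\<exists>c e. poly P z = of_rat c + of_rat e * ?s \<and> poly P z' = of_rat c - of_rat e * ?s"
      if "\<forall>i. Polynomial.coeff P i \<in> \<int>" for P
      using that
    proof (induction P)
      case (pCons c0 P)
      have "\<forall>i. Polynomial.coeff P i \<in> \<int>" using pCons.prems by (metis coeff_pCons_Suc)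
      then obtain c e where ce: "poly P z = of_rat c + of_rat e * ?s" "poly P z' = of_rat c - of_rat e * ?s"
        using pCons.IH by blast
      obtain n where n: "c0 = of_int n" using pCons.prems by (metis Ints_cases coeff_pCons_0)
      have "poly (pCons c0 P) z = of_int n + of_rat a * of_rat c + of_rat b * of_rat e * (?s * ?s)
          + (of_rat a * of_rat e + of_rat b * of_rat c) * ?s"
      proof -
        have "poly (pCons c0 P) z = of_int n + z * (of_rat c + of_rat e * ?s)" by (simp add: ce n)
        then show ?thesis unfolding zab by (simp add: algebra_simps)
      qed
      moreover have "poly (pCons c0 P) z' = of_int n + of_rat a * of_rat c + of_rat b * of_rat e * (?s * ?s)
          - (of_rat a * of_rat e + of_rat b * of_rat c) * ?s"
      proof -
        have "poly (pCons c0 P) z' = of_int n + z' * (of_rat c - of_rat e * ?s)" by (simp add: ce n)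
        then show ?thesis unfolding z'_def by (simp add: algebra_simps)
      qed
      ultimately show ?case unfolding csqrt_square
        by (intro exI[of _ "of_int n + a * c + b * e * of_int d"] exI[of _ "a * e + b * c"])
           (simp add: of_rat_add of_rat_mult)
    qed (auto intro!: exI[of _ 0])
    obtain P where P: "monic P" "\<forall>i. Polynomial.coeff P i \<in> \<int>" "poly P z = 0"
      using zO(2) by (auto elim: algebraic_int.cases)
    obtain c e where ce: "poly P z = of_rat c + of_rat e * ?s" "poly P z' = of_rat c - of_rat e * ?s"
      using conj[OF P(2)] by blast
    have "c = 0 \<and> e = 0" using quadratic_unique[OF irr, of c e] ce(1) P(3) by simp
    then have "poly P z' = 0" using ce(2) by simp
    then have "algebraic_int z'" using P by (intro algebraic_int.intros[of P]) auto
    then have z'c: "z' \<in> carrier ?O" using z'K by (simp add: carrier)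
    have zc: "z \<in> carrier ?O" using zO by (simp add: carrier)
    have "z + z' \<in> carrier ?O" using I.a_closed[OF zc z'c] by (simp add: add)
    moreover have "z + z' = of_rat (2 * a)" by (simp add: zab z'_def of_rat_mult)
    ultimately have "z + z' \<in> \<int>" by (intro rational_algebraic_int_is_int) (auto simp: carrier)
    then obtain T where T: "z + z' = of_int T" by (auto elim: Ints_cases)
    have "z * z' \<in> carrier ?O" using I.m_closed[OF zc z'c] by (simp add: mult)
    moreover have "z * z' = of_rat (a * a - b * b * of_int d)"
    proof -
      have "z * z' = of_rat a * of_rat a - of_rat b * of_rat b * (?s * ?s)" by (simp add: zab z'_def algebra_simps)
      then show ?thesis unfolding csqrt_square by (simp add: of_rat_diff of_rat_mult)
    qed
    ultimately have "z * z' \<in> \<int>" by (intro rational_algebraic_int_is_int) (auto simp: carrier)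
    then obtain N where N: "z * z' = of_int N" by (auto elim: Ints_cases)
    have int_carrier: "of_int n \<in> carrier ?O" for n
      using of_rat_in_quadratic_field[of "of_int n" d] by (simp add: carrier)
    have NI: "of_int N \<in> I" using I.I_r_closed[OF z(1) z'c] N by (simp add: mult)
    have pN: "int p dvd N"
    proof (rule ccontr)
      assume "\<not> int p dvd N"
      then have "coprime (int p) N" using p by (simp add: prime_imp_coprime)
      then obtain u v where uv: "u * int p + v * N = 1" using bezout_int[of "int p" N] by auto
      have "of_int u * of_nat p \<in> I" using I.I_l_closed[OF Ip(2) int_carrier[of u]] by (simp add: mult)
      moreover have "of_int v * of_int N \<in> I" using I.I_l_closed[OF NI int_carrier[of v]] by (simp add: mult)
      ultimately have "of_int u * of_nat p + of_int v * of_int N \<in> I" using additive_subgroup.a_closed[OF I.additive_subgroup_axioms] by (simp add: add)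
      moreover have "of_int u * of_nat p + of_int v * of_int N = (1 :: complex)"
        using arg_cong[OF uv, of "of_int :: int \<Rightarrow> complex"] by simp
      ultimately have "I = carrier ?O" using I.one_imp_carrier one by simp
      then show False using I.I_notcarr by simp
    qed
    have p_mult: "of_int n \<in> J" if "int p dvd n" for n
    proof -
      from that obtain k where "n = int p * k" by (rule dvdE)
      then show ?thesis using J.I_r_closed[OF Jp(2) int_carrier[of k]] by (simp add: mult)
    qed
    have "z * z' \<in> J" unfolding N by (rule p_mult[OF pN])
    then have z'J: "z' \<in> J" using J.I_prime[OF zc z'c] z(2) by (simp add: mult)
    have "\<not> int p dvd T"
    proof
      assume "int p dvd T"
      then have "z + z' \<in> J" unfolding T by (rule p_mult)
      moreover have "of_int (- 1) * z' \<in> J" using J.I_l_closed[OF z'J int_carrier[of "- 1"]] by (simp add: mult)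
      ultimately have "z + z' + of_int (- 1) * z' \<in> J" using additive_subgroup.a_closed[OF J.additive_subgroup_axioms] by (simp only: add)
      then show False using z(2) by simp
    qed
    moreover have "z \<notin> \<rat>"
    proof
      assume "z \<in> \<rat>"
      then obtain q where q: "z = of_rat q" by (auto elim: Rats_cases)
      have "of_rat (a - q) + of_rat b * ?s = 0" using zab q by (simp add: of_rat_diff)
      then have "b = 0" using quadratic_unique[OF irr] by blast
      then have "z = z'" by (simp add: zab z'_def)
      then show False using z'J z(2) by simp
    qed
    ultimately show ?thesis using zO(1) T N pN by blast
  qed
  from IJ(3) obtain z where "z \<in> I \<and> z \<notin> J \<or> z \<in> J \<and> z \<notin> I" by blast
  then show ?thesis using core[OF IJ(1,2)] core[OF IJ(2,1)] by blast
qed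

text \<open>For prime characteristic these are the elements of the prime field; the description by
  Frobenius is the one that rationality over it refers to.\<close>

definition prime_field :: "'b::field set" where
  "prime_field = {u. u ^ CHAR('b) = u}"

context
  assumes char: "prime CHAR('b::field)"
begin

lemma prime_field_1: "(1 :: 'b) \<in> prime_field"
  by (simp add: prime_field_def)

lemma prime_field_0: "(0 :: 'b) \<in> prime_field"
  using prime_gt_0_nat[OF char] by (simp add: prime_field_def)

lemma prime_field_add: "(u :: 'b) \<in> prime_field \<Longrightarrow> v \<in> prime_field \<Longrightarrow> u + v \<in> prime_field"
  using freshmans_dream[OF char refl, of u v] by (simp add: prime_field_def)

lemma prime_field_mult: "(u :: 'b) \<in> prime_field \<Longrightarrow> v \<in> prime_field \<Longrightarrow> u * v \<in> prime_field"
  by (simp add: prime_field_def power_mult_distrib)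

lemma prime_field_inverse: "(u :: 'b) \<in> prime_field \<Longrightarrow> inverse u \<in> prime_field"
  by (simp add: prime_field_def power_inverse)

lemma prime_field_divide: "(u :: 'b) \<in> prime_field \<Longrightarrow> v \<in> prime_field \<Longrightarrow> u / v \<in> prime_field"
  by (simp add: divide_inverse prime_field_mult prime_field_inverse)

lemma prime_field_uminus: "(u :: 'b) \<in> prime_field \<Longrightarrow> - u \<in> prime_field"
proof -
  assume u: "u \<in> prime_field"
  have "(u + - u) ^ CHAR('b) = u ^ CHAR('b) + (- u) ^ CHAR('b)" by (rule freshmans_dream[OF char refl])
  moreover have "(u + - u) ^ CHAR('b) = 0" using prime_gt_0_nat[OF char] by (simp add: zero_power)
  ultimately have "u + (- u) ^ CHAR('b) = 0" using u by (simp add: prime_field_def)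
  then show ?thesis by (simp add: prime_field_def eq_neg_iff_add_eq_0 add.commute)
qed

lemma prime_field_diff: "(u :: 'b) \<in> prime_field \<Longrightarrow> v \<in> prime_field \<Longrightarrow> u - v \<in> prime_field"
  using prime_field_add[OF _ prime_field_uminus, of u v] by simp

lemma prime_field_of_nat: "(of_nat n :: 'b) \<in> prime_field"
  by (induction n) (auto intro: prime_field_0 prime_field_1 prime_field_add)

lemma prime_field_of_int: "(of_int n :: 'b) \<in> prime_field"
  by (cases n) (auto intro: prime_field_of_nat prime_field_uminus simp del: of_nat_Suc)

end

lemma (in maximal_hom) R_unit:
  assumes "x \<in> R" "rd x \<noteq> 0" "x * y \<in> R"
  shows "y \<in> R \<and> rd y = rd (x * y) / rd x"
proof -
  have "x \<noteq> 0" using assms(2) rd_0 by auto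
  then have "y = x * y / x" by simp
  then show ?thesis using divide_R[OF assms(3,1,2)] rd_divide[OF assms(3,1,2)] by simp
qed

text \<open>The element \<open>z\<close> of \<open>split_prime_element\<close> satisfies an equation
  that reduces to X (X - T), so its reduction is 0 or T. A general \<open>w\<close> is
  \<open>q (m + n z)\<close> with \<open>q\<close> rational and \<open>p\<close> not dividing both
  \<open>m\<close> and \<open>n\<close>; the difficulty is that \<open>q\<close> need not be
  integral at the place.\<close>

theorem quadratic_residue_field:
  fixes R :: "complex set" and rd :: "complex \<Rightarrow> 'b::alg_closed_field"
  assumes "maximal_hom R rd" and d: "squarefree d" and p: "prime p" "CHAR('b) = p"
    and split: "splits_in p (quadratic_field d)" and w: "w \<in> quadratic_field d" "w \<in> R"
  shows "rd w \<in> prime_field"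
proof -
  interpret maximal_hom R rd by fact
  have char: "prime CHAR('b)" using p by simp
  have int0: "(of_int n :: 'b) = 0 \<longleftrightarrow> int p dvd n" for n
    using of_int_eq_0_iff_char_dvd[of n, where ?'a = 'b] p(2) by simp
  note pf = prime_field_0[OF char] prime_field_1[OF char] prime_field_add[OF char] prime_field_mult[OF char]
    prime_field_divide[OF char] prime_field_of_int[OF char] prime_field_diff[OF char]
  have rat: "rd (of_rat q) \<in> prime_field" if "of_rat q \<in> R" for q
  proof -
    obtain m n where q: "quotient_of q = (m, n)" by (cases "quotient_of q")
    have n: "n > 0" "coprime m n" "q = of_int m / of_int n"
      using quotient_of_denom_pos[OF q] quotient_of_coprime[OF q] quotient_of_div[OF q] by auto
    have e: "of_int n * of_rat q = (of_int m :: complex)" using n by (simp add: of_rat_divide)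
    have nR: "(of_int n :: complex) \<in> R" "rd (of_int n) = of_int n" by (rule of_int_R rd_of_int)+
    show ?thesis
    proof (cases "int p dvd n")
      case False
      then have "rd (of_int n) \<noteq> 0" using int0 nR by simp
      from R_unit[OF nR(1) this, of "of_rat q"] show ?thesis
        unfolding e using of_int_R rd_of_int nR by (auto intro!: pf)
    next
      case True
      have "rd (of_int n * of_rat q) = 0" using rd_mult[OF nR(1) that] nR True int0 by simp
      then have "int p dvd m" unfolding e rd_of_int int0 .
      then have "is_unit (int p)" using True n(2) by (intro coprime_common_divisor[of m n])
      then show ?thesis using p(1) by (metis int_dvd_int_iff nat_dvd_1_iff_1 not_prime_1 of_nat_1)
    qed
  qed
  show ?thesis
  proof (cases "d = 1")
    case True
    then obtain q r where "w = of_rat q + of_rat r" using w(1) by (auto simp: quadratic_field_def)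
    then have "w = of_rat (q + r)" by (simp add: of_rat_add)
    then show ?thesis using rat w(2) by simp
  next
    case False
    let ?s = "csqrt (of_int d)"
    have irr: "?s \<notin> \<rat>" by (rule csqrt_squarefree_irrational[OF d False])
    obtain z z' :: complex and T N :: int where z: "z \<in> quadratic_field d" "z \<notin> \<rat>"
      "z + z' = of_int T" "z * z' = of_int N" "int p dvd N" "\<not> int p dvd T"
      using split_prime_element[OF irr p(1) split] by blast
    have z': "z' = of_int T - z" using z(3) by (simp add: algebra_simps)
    have "z\<^sup>2 + (- of_int T) * z = - of_int N"
      using z(4) unfolding z' by (simp add: algebra_simps power2_eq_square)
    from integral_R[OF uminus_R[OF of_int_R] uminus_R[OF of_int_R] this] have zR: "z \<in> R" .
    have z'R: "z' \<in> R" unfolding z' by (intro diff_R of_int_R zR)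
    have rz': "rd z' = of_int T - rd z" unfolding z' using rd_diff[OF of_int_R zR] rd_of_int by simp
    have "rd z * rd z' = of_int N" using rd_mult[OF zR z'R] z(4) rd_of_int by simp
    also have "\<dots> = 0" using z(5) by (simp only: int0)
    finally have "rd z * rd z' = 0" .
    then have rz: "rd z = 0 \<or> rd z = of_int T" unfolding rz' by auto
    then have pz: "rd z \<in> prime_field" by (auto intro: pf)
    have T0: "(of_int T :: 'b) \<noteq> 0" using z(6) int0 by simp
    obtain a b where zab: "z = of_rat a + of_rat b * ?s" using z(1) by (auto simp: quadratic_field_def)
    have b0: "b \<noteq> 0" using z(2) zab by auto
    obtain c e where wce: "w = of_rat c + of_rat e * ?s" using w(1) by (auto simp: quadratic_field_def)
    have "?s = (z - of_rat a) / of_rat b" using zab b0 by simp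
    then have wz: "w = of_rat (c - e * a / b) + of_rat (e / b) * z"
      unfolding wce
      by (simp add: of_rat_diff of_rat_mult of_rat_divide diff_divide_distrib right_diff_distrib mult.commute)
    show ?thesis
    proof (cases "w = 0")
      case True
      then show ?thesis using rd_0 pf by simp
    next
      case w0: False
      have "\<exists>q m n. q \<noteq> 0 \<and> w = of_rat q * (of_int m + of_int n * z) \<and> \<not> (int p dvd m \<and> int p dvd n)"
      proof -
        obtain A D where A: "quotient_of (c - e * a / b) = (A, D)" by (cases "quotient_of (c - e * a / b)")
        obtain A' D' where A': "quotient_of (e / b) = (A', D')" by (cases "quotient_of (e / b)")
        have D: "D > 0" "D' > 0" using quotient_of_denom_pos[OF A] quotient_of_denom_pos[OF A'] by auto
        define m0 n0 where "m0 = A * D'" and "n0 = A' * D"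
        define g where "g = gcd m0 n0"
        have wq: "w = of_rat (1 / of_int (D * D')) * (of_int m0 + of_int n0 * z)"
        proof -
          have "c - e * a / b = of_int m0 / of_int (D * D')" "e / b = of_int n0 / of_int (D * D')"
            using quotient_of_div[OF A] quotient_of_div[OF A'] D by (simp_all add: m0_def n0_def)
          then show ?thesis unfolding wz
            by (simp add: of_rat_divide of_rat_mult add_divide_distrib distrib_left mult_ac)
        qed
        have "m0 \<noteq> 0 \<or> n0 \<noteq> 0" using w0 wq by auto
        then have g0: "g \<noteq> 0" by (auto simp: g_def)
        define m n where "m = m0 div g" and "n = n0 div g"
        have mn: "m0 = g * m" "n0 = g * n" by (simp_all add: m_def n_def g_def)
        have cop: "coprime m n" unfolding m_def n_def g_def using g0 by (intro div_gcd_coprime) (auto simp: g_def)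
        have "w = of_rat (of_int g / of_int (D * D')) * (of_int m + of_int n * z)"
          unfolding wq mn using D by (simp add: of_rat_divide of_rat_mult add_divide_distrib distrib_left mult_ac)
        moreover have "of_int g / of_int (D * D') \<noteq> (0 :: rat)" using g0 D by simp
        moreover have "\<not> (int p dvd m \<and> int p dvd n)"
          using coprime_common_divisor[OF cop, of "int p"] p(1)
          by (metis int_dvd_int_iff nat_dvd_1_iff_1 not_prime_1 of_nat_1)
        ultimately show ?thesis by blast
      qed
      then obtain q m n where q: "q \<noteq> 0" "w = of_rat q * (of_int m + of_int n * z)"
        and mn: "\<not> (int p dvd m \<and> int p dvd n)" by blast
      define \<mu> \<mu>' where "\<mu> = of_int m + of_int n * z" and "\<mu>' = of_int m + of_int n * z'"
      have \<mu>R: "\<mu> \<in> R" "\<mu>' \<in> R" unfolding \<mu>_def \<mu>'_def by (intro add_R mult_R of_int_R zR z'R)+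
      have r\<mu>: "rd \<mu> = of_int m + of_int n * rd z" "rd \<mu>' = of_int m + of_int n * rd z'"
        unfolding \<mu>_def \<mu>'_def using zR z'R by (simp_all add: rd_add rd_mult rd_of_int of_int_R mult_R)
      have p\<mu>: "rd \<mu> \<in> prime_field" "rd \<mu>' \<in> prime_field" unfolding r\<mu> rz' by (intro pf pz)+
      \<comment> \<open>If \<open>\<mu>\<close> reduces to a unit, then \<open>q\<close> is integral
        and can be reduced. Otherwise the conjugate \<open>\<mu>'\<close> does, and
        \<open>\<mu>' * w\<close> is rational.\<close>
      show ?thesis
      proof (cases "rd \<mu> = 0")
        case False
        have "\<mu> * of_rat q \<in> R" using w(2) q(2) by (simp add: \<mu>_def mult.commute)
        from R_unit[OF \<mu>R(1) False this] have qR: "of_rat q \<in> R" by blast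
        have "rd w = rd (of_rat q) * rd \<mu>" using rd_mult[OF qR \<mu>R(1)] q(2) by (simp add: \<mu>_def)
        then show ?thesis using prime_field_mult[OF char rat[OF qR] p\<mu>(1)] by (simp only:)
      next
        case True
        have n0: "(of_int n :: 'b) \<noteq> 0" 
        proof
          assume n: "(of_int n :: 'b) = 0"
          then have "(of_int m :: 'b) = 0" using True unfolding r\<mu> by simp
          with n show False using mn int0[of m] int0[of n] by simp
        qed
        \<comment> \<open>If both conjugates reduced to 0, \<open>z\<close> and \<open>z'\<close>
          would have the same reduction; but these are 0 and T in some order, and T is
          nonzero.\<close>
        have r': "rd \<mu>' \<noteq> 0"
        proof
          assume "rd \<mu>' = 0"
          then have "(of_int m + of_int n * rd z) - (of_int m + of_int n * rd z') = 0"
            using True unfolding r\<mu> by (simp only: diff_self)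
          then have "of_int n * (rd z - rd z') = 0" by (simp only: add_diff_cancel_left right_diff_distrib)
          then have "rd z = rd z'" using n0 by simp
          then have e: "rd z = of_int T - rd z" by (simp only: rz')
          from rz show False
          proof
            assume "rd z = 0"
            with e show False using T0 by simp
          next
            assume "rd z = of_int T"
            with e show False using T0 by (simp only: diff_self)
          qed
        qed
        have "\<mu> * \<mu>' = of_int m * of_int m + of_int m * of_int n * (z + z') + of_int n * of_int n * (z * z')"
          by (simp add: \<mu>_def \<mu>'_def algebra_simps)
        also have "\<dots> = of_rat (of_int (m * m + m * n * T + n * n * N))"
          unfolding z(3,4) by (simp add: of_rat_add of_rat_mult)
        finally have "\<mu>' * w = of_rat (q * of_int (m * m + m * n * T + n * n * N))"
          unfolding q(2) \<mu>_def[symmetric] by (simp add: of_rat_mult mult_ac)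
        then have "\<mu>' * w \<in> R \<and> rd (\<mu>' * w) \<in> prime_field" using mult_R[OF \<mu>R(2) w(2)] rat by metis
        then have c: "\<mu>' * w \<in> R" "rd (\<mu>' * w) \<in> prime_field" by blast+
        have "w * \<mu>' \<in> R" using c(1) by (simp only: mult.commute)
        have "rd (\<mu>' * w) = rd \<mu>' * rd w" by (rule rd_mult[OF \<mu>R(2) w(2)])
        then have "rd w = rd (\<mu>' * w) / rd \<mu>'" using r' by simp
        then show ?thesis using prime_field_divide[OF char c(2) p\<mu>(2)] by (simp only:)
      qed
    qed
  qed
qed

section \<open>Reduction of points and of quintic forms\<close>

context maximal_hom
begin

text \<open>If \<open>x\<close> is not integral, \<open>1 / x\<close> is integral with reduction 0
  (\<open>infinite_integral\<close>), so the point is read in the other chart and lands at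
  infinity.\<close>

fun rpt :: "'a point \<Rightarrow> 'b point" where
  "rpt (Affine x y) = (if x \<in> R then Affine (rd x) (rd y) else Inf (rd (y / x ^ 3)))"
| "rpt (Inf y) = Inf (rd y)"

lemma Rp_rev_poly: "Rp q \<Longrightarrow> Rp (rev_poly n q)"
  by (simp add: Rp_def coeff_rev_poly zero_R)

lemma rp_rev_poly: "rp (rev_poly n q) = rev_poly n (rp q)"
  by (rule poly_eqI) (simp add: coeff_rp coeff_rev_poly rd_0)

end

lemma poly_rev_poly_inverse:
  fixes q :: "'a::field poly"
  assumes "Polynomial.degree q \<le> n" "x \<noteq> 0"
  shows "poly (rev_poly n q) (1 / x) = poly q x / x ^ n"
proof -
  have "poly (rev_poly n q) (1 / x) = hpoly n (rev_poly n q) (1 / x) 1"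
    using comm_ring_hom.heval_Z_1[OF id_ring_hom degree_rev_poly, of n q "1 / x"]
      map_poly_idI[of "rev_poly n q" "\<lambda>x. x"] by simp
  also have "\<dots> = hpoly n q 1 (1 / x)" by (rule comm_ring_hom.heval_rev_poly[OF id_ring_hom])
  also have "\<dots> = (1 / x) ^ n * poly q (1 / (1 / x))" using assms by (intro hpoly_Z_nonzero) auto
  finally show ?thesis by (simp add: power_divide)
qed

lemma infinite_chart:
  fixes h g :: "'a::field poly"
  assumes "Polynomial.degree h \<le> 3" "Polynomial.degree g \<le> 6" "x \<noteq> 0" "y\<^sup>2 + poly h x * y = poly g x"
  shows "(y / x ^ 3)\<^sup>2 + poly (rev_poly 3 h) (1 / x) * (y / x ^ 3) = poly (rev_poly 6 g) (1 / x)"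
proof -
  have x6: "x ^ 6 = x ^ 3 * x ^ 3" by (simp flip: power_add)
  have "(y / v)\<^sup>2 + H / v * (y / v) = (y\<^sup>2 + H * y) / (v * v)" for v H
    by (simp add: add_divide_distrib power2_eq_square)
  from this[of "x ^ 3" "poly h x"] show ?thesis
    unfolding poly_rev_poly_inverse[OF assms(1,3)] poly_rev_poly_inverse[OF assms(2,3)] assms(4) x6 .
qed

context maximal_hom
begin

lemma affine_integral:
  assumes hg: "Rp h" "Rp g" and P: "y\<^sup>2 + poly h x * y = poly g x" and x: "x \<in> R"
  shows "y \<in> R"
  using integral_R[OF poly_R[OF hg(1) x] poly_R[OF hg(2) x] P] .

lemma infinite_integral:
  assumes hg: "Rp h" "Rp g" "Polynomial.degree h \<le> 3" "Polynomial.degree g \<le> 6"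
    and P: "y\<^sup>2 + poly h x * y = poly g x" and x: "x \<notin> R"
  shows "1 / x \<in> R" "rd (1 / x) = 0" "y / x ^ 3 \<in> R"
proof -
  show s: "1 / x \<in> R" "rd (1 / x) = 0" using not_R[OF x] by (auto simp: inverse_eq_divide)
  show "y / x ^ 3 \<in> R"
    using affine_integral[OF Rp_rev_poly[OF hg(1)] Rp_rev_poly[OF hg(2)] infinite_chart[OF hg(3,4) _ P] s(1)]
      not_R[OF x] by blast
qed

lemma reduce_equation:
  assumes "Rp h" "Rp g" "x \<in> R" "y \<in> R" "y\<^sup>2 + poly h x * y = poly g x"
  shows "(rd y)\<^sup>2 + poly (rp h) (rd x) * rd y = poly (rp g) (rd x)"
proof -
  have "rd (y\<^sup>2 + poly h x * y) = rd (poly g x)" using assms(5) by simp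
  then show ?thesis using assms(1-4) by (simp add: rd_add rd_mult rd_power rd_poly power_R mult_R poly_R)
qed

text \<open>Parts two and three supply the auxiliary forms of the divisibility identities, chosen so
  that they reduce to valid choices at the reduced point. For a point reducing to infinity the
  linear form must be rescaled, and \<open>w\<close> is a multiple of the cube of x.\<close>

lemma point_reduction:
  assumes hg: "Rp h" "Rp g" "Polynomial.degree h \<le> 3" "Polynomial.degree g \<le> 6"
    and P: "P \<in> points h g"
  shows "rpt P \<in> points (rp h) (rp g)"
    and "\<exists>k. k \<noteq> 0 \<and> Rp (smult k (lin P)) \<and> rp (smult k (lin P)) = lin (rpt P)"
    and "\<exists>w. Rp w \<and> Polynomial.degree w \<le> 3 \<and> wval w (iota h P) = 0 \<and> wval (rp w) (iota (rp h) (rpt P)) = 0"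
proof -
  have hR: "Polynomial.coeff h 3 \<in> R" "Polynomial.coeff g 6 \<in> R" using hg by (auto simp: Rp_def)
  have mon: "Rp (Polynomial.monom c 3)" "Polynomial.degree (Polynomial.monom c 3) \<le> 3"
    "Polynomial.coeff (Polynomial.monom c 3) 3 = c" "rp (Polynomial.monom c 3) = Polynomial.monom (rd c) 3"
    if "c \<in> R" for c
    using that by (simp_all add: Rp_monom rp_monom degree_monom_le)
  have "rpt P \<in> points (rp h) (rp g)
    \<and> (\<exists>k. k \<noteq> 0 \<and> Rp (smult k (lin P)) \<and> rp (smult k (lin P)) = lin (rpt P))
    \<and> (\<exists>w. Rp w \<and> Polynomial.degree w \<le> 3 \<and> wval w (iota h P) = 0 \<and> wval (rp w) (iota (rp h) (rpt P)) = 0)"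
  proof (cases P)
    case (Affine x y)
    then have eq: "y\<^sup>2 + poly h x * y = poly g x" using P by (simp add: points_simps)
    show ?thesis
    proof (cases "x \<in> R")
      case True
      have yR: "y \<in> R" by (rule affine_integral[OF hg(1,2) eq True])
      have hx: "poly h x \<in> R" by (rule poly_R[OF hg(1) True])
      have "rpt P \<in> points (rp h) (rp g)"
        using reduce_equation[OF hg(1,2) True yR eq] True by (simp add: Affine points_simps)
      moreover have "\<exists>k. k \<noteq> 0 \<and> Rp (smult k (lin P)) \<and> rp (smult k (lin P)) = lin (rpt P)"
        using True by (intro exI[of _ 1]) (simp add: Affine Rp_pCons Rp_1 rp_pCons rp_1 Rp_0 rp_0 uminus_R rd_uminus one_R rd_1)
      moreover have "\<exists>w. Rp w \<and> Polynomial.degree w \<le> 3 \<and> wval w (iota h P) = 0 \<and> wval (rp w) (iota (rp h) (rpt P)) = 0"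
        using True yR hx by (intro exI[of _ "[:y + poly h x:]"]) (simp add: Affine Rp_pCons Rp_0 rp_pCons rp_0 add_R rd_add rd_poly hg(1))
      ultimately show ?thesis by (intro conjI)
    next
      case False
      let ?t = "y / x ^ 3"
      have x0: "x \<noteq> 0" using not_R[OF False] by blast
      note s = infinite_integral[OF hg eq False]
      have eq': "?t\<^sup>2 + poly (rev_poly 3 h) (1 / x) * ?t = poly (rev_poly 6 g) (1 / x)"
        by (rule infinite_chart[OF hg(3,4) x0 eq])
      have "rpt P \<in> points (rp h) (rp g)"
        using reduce_equation[OF Rp_rev_poly[OF hg(1)] Rp_rev_poly[OF hg(2)] s(1) s(3) eq'] False
        by (simp add: Affine points_simps rp_rev_poly s(2))
      moreover have "\<exists>k. k \<noteq> 0 \<and> Rp (smult k (lin P)) \<and> rp (smult k (lin P)) = lin (rpt P)"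
      proof -
        have "smult (- (1 / x)) (lin P) = [:1, - (1 / x):]" using x0 by (simp add: Affine)
        moreover have "rp [:1, - (1 / x):] = 1"
          using s by (simp add: rp_pCons rp_0 rd_1 rd_uminus)
        ultimately show ?thesis using x0 s False
          by (intro exI[of _ "- (1 / x)"]) (simp add: Affine Rp_pCons Rp_0 one_R uminus_R)
      qed
      moreover have "\<exists>w. Rp w \<and> Polynomial.degree w \<le> 3 \<and> wval w (iota h P) = 0 \<and> wval (rp w) (iota (rp h) (rpt P)) = 0"
      proof -
        \<comment> \<open>In the chart at infinity \<open>w\<close> is the constant
          \<open>c\<close>, and this value makes \<open>w + y\<close> vanish at the opposite of
          \<open>P\<close>.\<close>
        define c where "c = ?t + poly (rev_poly 3 h) (1 / x)"
        have c: "c \<in> R" unfolding c_def by (intro add_R s poly_R Rp_rev_poly hg)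
        have "rd c = rd ?t + Polynomial.coeff (rp h) 3"
          using s hg(1) by (simp add: c_def rd_add poly_R Rp_rev_poly rd_poly rp_rev_poly poly_rev_poly_0)
        moreover have "c * x ^ 3 = y + poly h x"
          using x0 by (simp add: c_def poly_rev_poly_inverse[OF hg(3) x0] distrib_right)
        ultimately show ?thesis using mon[OF c] False
          by (intro exI[of _ "Polynomial.monom c 3"]) (simp add: Affine poly_monom)
      qed
      ultimately show ?thesis by (intro conjI)
    qed
  next
    case (Inf y)
    then have eq: "y\<^sup>2 + Polynomial.coeff h 3 * y = Polynomial.coeff g 6"
      using P by (simp add: points_simps poly_rev_poly_0)
    have yR: "y \<in> R" by (rule integral_R[OF hR eq])
    have "rd (y\<^sup>2 + Polynomial.coeff h 3 * y) = rd (Polynomial.coeff g 6)" using eq by simp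
    then have "rpt P \<in> points (rp h) (rp g)"
      using yR hR by (simp add: Inf points_simps poly_rev_poly_0 coeff_rp rd_add rd_mult rd_power power_R mult_R)
    moreover have "\<exists>k. k \<noteq> 0 \<and> Rp (smult k (lin P)) \<and> rp (smult k (lin P)) = lin (rpt P)"
      by (intro exI[of _ 1]) (simp add: Inf Rp_1 rp_1)
    moreover have "\<exists>w. Rp w \<and> Polynomial.degree w \<le> 3 \<and> wval w (iota h P) = 0 \<and> wval (rp w) (iota (rp h) (rpt P)) = 0"
      using mon[OF add_R[OF yR hR(1)]] yR hR
      by (intro exI[of _ "Polynomial.monom (y + Polynomial.coeff h 3) 3"]) (simp add: Inf rd_add coeff_rp)
    ultimately show ?thesis by (intro conjI)
  qed
  then show "rpt P \<in> points (rp h) (rp g)"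
    and "\<exists>k. k \<noteq> 0 \<and> Rp (smult k (lin P)) \<and> rp (smult k (lin P)) = lin (rpt P)"
    and "\<exists>w. Rp w \<and> Polynomial.degree w \<le> 3 \<and> wval w (iota h P) = 0 \<and> wval (rp w) (iota (rp h) (rpt P)) = 0"
    by blast+
qed

end

lemma fnorm_scale_form: "fnorm h g (scale_form u F) = smult (u\<^sup>2) (fnorm h g F)"
  by (simp add: fnorm_def scale_form_def power2_eq_square smult_diff_right)

lemma scale_scalar: "fmul h g (P, 0) G = fmul h g (smult k P, 0) (scale_form (1 / k) G)" if "k \<noteq> (0 :: 'a::field)"
  using that by (simp add: fmul_scalar scale_form_def)

text \<open>After \<open>L\<close> is scaled to an integral form with nonzero reduction,
  \<open>gauss\<close> makes the cofactor integral and the identity can be reduced term by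
  term.\<close>

lemma (in maximal_hom) identity_reduction:
  assumes hg: "Rp h" "Rp g" and F: "Rf F" and W: "Rf W"
    and L: "k \<noteq> 0" "Rp (smult k L)" "rp (smult k L) \<noteq> 0"
    and G: "isf N G" "fmul h g F W = fmul h g (L, 0) G"
  shows "\<exists>G'. isf N G' \<and> fmul (rp h) (rp g) (rf F) (rf W) = fmul (rp h) (rp g) (rp (smult k L), 0) G'"
proof -
  have e: "fmul h g F W = fmul h g (smult k L, 0) (scale_form (1 / k) G)" using G(2) scale_scalar[OF L(1)] by metis
  have "Rf (fmul h g (smult k L, 0) (scale_form (1 / k) G))" unfolding e[symmetric] by (rule Rf_fmul[OF hg F W])
  then have RG: "Rf (scale_form (1 / k) G)" by (rule gauss[OF L(2,3)])
  have "fmul (rp h) (rp g) (rf F) (rf W) = fmul (rp h) (rp g) (rp (smult k L), 0) (rf (scale_form (1 / k) G))"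
    using arg_cong[OF e, of rf] hg F W RG L(2) by (simp add: rf_fmul Rf_scalar rf_scalar)
  then show ?thesis using isf_rf[OF isf_scale_form[OF G(1)]] by blast
qed

locale closed_place = maximal_hom R rd for R :: "'a::alg_closed_field set" and rd :: "'a \<Rightarrow> 'b::alg_closed_field"

text \<open>The identities are reduced for a primitive multiple of \<open>F\<close>, and
  \<open>quintic_divI\<close> is applied on the reduced curve. The constant \<open>c'\<close> in the
  norm formula stays nonzero because norms of nonzero forms on the reduced curve do not
  vanish.\<close>

lemma (in closed_place) quintic_div_reduction:
  assumes hg: "Rp h" "Rp g" and cv: "genus2_curve h g" and rcv: "genus2_curve (rp h) (rp g)"
    and F: "quintic_div h g P1 P2 F" and P: "P1 \<in> points h g" "P2 \<in> points h g"
    and ne: "rpt P1 \<noteq> iota (rp h) (rpt P2)"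
  shows "\<exists>F'. quintic_div (rp h) (rp g) (rpt P1) (rpt P2) F'"
proof -
  note d = genus2_degree[OF cv]
  note r1 = point_reduction[OF hg d P(1)] and r2 = point_reduction[OF hg d P(2)]
  obtain k1 where k1: "k1 \<noteq> 0" "Rp (smult k1 (lin P1))" "rp (smult k1 (lin P1)) = lin (rpt P1)" using r1(2) by blast
  obtain k2 where k2: "k2 \<noteq> 0" "Rp (smult k2 (lin P2))" "rp (smult k2 (lin P2)) = lin (rpt P2)" using r2(2) by blast
  obtain w1 where w1: "Rp w1" "Polynomial.degree w1 \<le> 3" "wval w1 (iota h P1) = 0" "wval (rp w1) (iota (rp h) (rpt P1)) = 0"
    using r1(3) by blast
  obtain w2 where w2: "Rp w2" "Polynomial.degree w2 \<le> 3" "wval w2 (iota h P2) = 0" "wval (rp w2) (iota (rp h) (rpt P2)) = 0"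
    using r2(3) by blast
  have F5: "isf 5 F" "F \<noteq> (0, 0)" using F by (auto simp: quintic_div_def)
  obtain u where u: "u \<noteq> 0" "Rf (scale_form u F)" "rf (scale_form u F) \<noteq> (0, 0)" using primitive_form[OF F5(2)] by blast
  define F0 where "F0 = scale_form u F"
  note F0 = u(2,3)[folded F0_def]
  have F05: "isf 5 F0" unfolding F0_def by (rule isf_scale_form[OF F5(1)])
  define L where "L = lin P1 * lin P2"
  have L5: "Rp (smult (k ^ n) (L0 ^ n))" "rp (smult (k ^ n) (L0 ^ n)) = rp (smult k L0) ^ n"
    if "Rp (smult k L0)" for k n L0
    using that by (simp_all add: Rp_power rp_power flip: smult_power)
  have kL: "Rp (smult (k1 * k2) L)" "rp (smult (k1 * k2) L) = lin (rpt P1) * lin (rpt P2)"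
  proof -
    have e: "smult (k1 * k2) L = smult k1 (lin P1) * smult k2 (lin P2)" by (simp add: L_def mult.commute)
    show "Rp (smult (k1 * k2) L)" unfolding e by (rule Rp_mult[OF k1(2) k2(2)])
    show "rp (smult (k1 * k2) L) = lin (rpt P1) * lin (rpt P2)"
      unfolding e rp_mult[OF k1(2) k2(2)] k1(3) k2(3) ..
  qed
  obtain c where c: "c \<noteq> 0" "fnorm h g F = smult c (L ^ 5)" using quintic_div_norm[OF cv F P] by (auto simp: L_def)
  define c' where "c' = u\<^sup>2 * c / (k1 * k2) ^ 5"
  have N: "fnorm h g F0 = smult ((k1 * k2) ^ 5) (L ^ 5) * [:c':]"
    unfolding F0_def fnorm_scale_form c(2) c'_def using k1(1) k2(1) by simp
  have "Rp (smult ((k1 * k2) ^ 5) (L ^ 5) * [:c':])" unfolding N[symmetric] by (rule rp_fnorm(1)[OF hg F0(1)])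
  then have "Rp [:c':]" by (rule gauss_poly[rotated 2]) (simp_all add: L5[OF kL(1)] kL(2))
  then have c'R: "c' \<in> R" by (simp add: Rp_pCons)
  have rN: "fnorm (rp h) (rp g) (rf F0) = smult (rd c') ((lin (rpt P1) * lin (rpt P2)) ^ 5)"
  proof -
    have "fnorm (rp h) (rp g) (rf F0) = rp (smult ((k1 * k2) ^ 5) (L ^ 5) * [:c':])"
      unfolding N[symmetric] by (rule rp_fnorm(2)[OF hg F0(1), symmetric])
    also have "\<dots> = (lin (rpt P1) * lin (rpt P2)) ^ 5 * [:rd c':]"
      using L5[OF kL(1), of 5] c'R by (simp only: rp_mult Rp_pCons Rp_0 rp_pCons rp_0 kL(2) simp_thms)
    finally show ?thesis by simp
  qed
  have c'0: "rd c' \<noteq> 0" using rN fnorm_nonzero[OF rcv F0(2)] by auto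
  have RW: "Rf (fpow h g (w, 1) 5)" "rf (fpow h g (w, 1) 5) = fpow (rp h) (rp g) (rp w, 1) 5" if "Rp w" for w
  proof -
    have "Rf (w, 1)" "rf (w, 1) = (rp w, 1)" using that by (simp_all add: Rf_def rf_def Rp_1 rp_1)
    then show "Rf (fpow h g (w, 1) 5)" "rf (fpow h g (w, 1) 5) = fpow (rp h) (rp g) (rp w, 1) 5"
      by (simp_all add: Rf_fpow rf_fpow hg)
  qed
  have F0id: "fmul h g F0 W = fmul h g (M, 0) (scale_form u G)" if "fmul h g F W = fmul h g (M, 0) G" for W M G
    unfolding F0_def fmul_scale_form that ..
  have single: "\<exists>G'. isf 15 G' \<and> fmul (rp h) (rp g) (rf F0) (fpow (rp h) (rp g) (rp w, 1) 5)
      = fmul (rp h) (rp g) (lin (rpt P) ^ 5, 0) G'"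
    if k: "k \<noteq> 0" "Rp (smult k (lin P))" "rp (smult k (lin P)) = lin (rpt P)" and w: "Rp w"
      and ex: "\<exists>G. isf 15 G \<and> fmul h g F (fpow h g (w, 1) 5) = fmul h g (lin P ^ 5, 0) G" for k P w
  proof -
    obtain G where G: "isf 15 G" "fmul h g F (fpow h g (w, 1) 5) = fmul h g (lin P ^ 5, 0) G" using ex by blast
    have "\<exists>G'. isf 15 G' \<and> fmul (rp h) (rp g) (rf F0) (rf (fpow h g (w, 1) 5))
        = fmul (rp h) (rp g) (rp (smult (k ^ 5) (lin P ^ 5)), 0) G'"
      using k by (intro identity_reduction[OF hg F0(1) RW(1)[OF w] _ _ _ isf_scale_form[OF G(1)] F0id[OF G(2)]])
        (simp_all add: L5)
    then show ?thesis unfolding RW(2)[OF w] L5(2)[OF k(2)] k(3) .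
  qed
  obtain G1 where G1: "isf 15 G1" "fmul (rp h) (rp g) (rf F0) (fpow (rp h) (rp g) (rp w1, 1) 5)
      = fmul (rp h) (rp g) (lin (rpt P1) ^ 5, 0) G1"
    using single[OF k1 w1(1) quintic_div_identity1[OF cv F P w1(2,3)]] by blast
  have F': "quintic_div h g P2 P1 F" using F quintic_div_commute[OF cv] by blast
  obtain G2 where G2: "isf 15 G2" "fmul (rp h) (rp g) (rf F0) (fpow (rp h) (rp g) (rp w2, 1) 5)
      = fmul (rp h) (rp g) (lin (rpt P2) ^ 5, 0) G2"
    using single[OF k2 w2(1) quintic_div_identity1[OF cv F' P(2,1) w2(2,3)]] by blast
  obtain G where G: "isf 25 G" "fmul h g F (fmul h g (fpow h g (w1, 1) 5) (fpow h g (w2, 1) 5)) = fmul h g (L ^ 5, 0) G"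
    using quintic_div_identity12[OF cv F P w1(2,3) w2(2,3)] unfolding L_def by blast
  have RWW: "Rf (fmul h g (fpow h g (w1, 1) 5) (fpow h g (w2, 1) 5))"
    "rf (fmul h g (fpow h g (w1, 1) 5) (fpow h g (w2, 1) 5))
      = fmul (rp h) (rp g) (fpow (rp h) (rp g) (rp w1, 1) 5) (fpow (rp h) (rp g) (rp w2, 1) 5)"
    using RW[OF w1(1)] RW[OF w2(1)] hg by (simp_all add: Rf_fmul rf_fmul)
  have "\<exists>G'. isf 25 G' \<and> fmul (rp h) (rp g) (rf F0) (rf (fmul h g (fpow h g (w1, 1) 5) (fpow h g (w2, 1) 5)))
      = fmul (rp h) (rp g) (rp (smult ((k1 * k2) ^ 5) (L ^ 5)), 0) G'"
    using k1(1) k2(1) by (intro identity_reduction[OF hg F0(1) RWW(1) _ _ _ isf_scale_form[OF G(1)] F0id[OF G(2)]])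
      (simp_all add: L5[OF kL(1)] kL(2))
  then obtain G' where G': "isf 25 G'" "fmul (rp h) (rp g) (rf F0)
      (fmul (rp h) (rp g) (fpow (rp h) (rp g) (rp w1, 1) 5) (fpow (rp h) (rp g) (rp w2, 1) 5))
      = fmul (rp h) (rp g) ((lin (rpt P1) * lin (rpt P2)) ^ 5, 0) G'"
    unfolding RWW(2) L5(2)[OF kL(1)] kL(2) by blast
  have dw: "Polynomial.degree (rp w1) \<le> 3" "Polynomial.degree (rp w2) \<le> 3"
    using degree_rp[of w1] degree_rp[of w2] w1(2) w2(2) by linarith+
  show ?thesis
    using quintic_divI[OF rcv isf_rf[OF F05] r1(1) r2(1) ne rN c'0 dw(1) w1(4) dw(2) w2(4) G1 G2 G'] by blast
qed

text \<open>\<open>reduction_not_opposite\<close> is applied to the first point and the opposite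
  \<open>q2\<close> of the second. A constant multiple of \<open>(X - x2)^5\<close> is excluded as
  \<open>F\<close>: its order at the opposite of the second point would be too large, as this point
  is not the first one.\<close>

lemma (in closed_place) affine_not_opposite:
  assumes five: "(5 :: 'b) \<noteq> 0" and hg: "Rp h" "Rp g" and cv: "genus2_curve h g"
    and ns: "\<And>b. \<not> singular_at (rp h) (rp g) (rd x2) b"
    and F: "quintic_div h g (Affine x1 y1) (Affine x2 y2) F"
    and P: "Affine x1 y1 \<in> points h g" "Affine x2 y2 \<in> points h g"
    and ne: "Affine x1 y1 \<noteq> iota h (Affine x2 y2)" and R: "x1 \<in> R" "x2 \<in> R"
  shows "rpt (Affine x1 y1) \<noteq> iota (rp h) (rpt (Affine x2 y2))"
proof
  assume op: "rpt (Affine x1 y1) = iota (rp h) (rpt (Affine x2 y2))"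
  note d = genus2_degree[OF cv]
  define q2 where "q2 = - y2 - poly h x2"
  have e1: "y1\<^sup>2 + poly h x1 * y1 = poly g x1" and e2: "y2\<^sup>2 + poly h x2 * y2 = poly g x2"
    using P by (simp_all add: points_simps)
  have q2: "q2\<^sup>2 + poly h x2 * q2 = poly g x2"
    using e2 by (simp add: q2_def power2_eq_square algebra_simps)
  have yR: "y1 \<in> R" "y2 \<in> R" using affine_integral[OF hg e1 R(1)] affine_integral[OF hg e2 R(2)] by auto
  have qR: "q2 \<in> R" unfolding q2_def by (intro diff_R uminus_R yR poly_R hg R)
  have "rd q2 = - rd y2 - poly (rp h) (rd x2)"
    using yR R hg by (simp add: q2_def rd_diff rd_uminus uminus_R poly_R rd_poly)
  then have red: "rd x1 = rd x2" "rd y1 = rd q2" using op R by auto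
  have F5: "isf 5 F" "F \<noteq> (0, 0)" using F by (auto simp: quintic_div_def)
  show False
  proof (rule reduction_not_opposite[OF five hg d(1) F5(1) R(1) yR(1) R(2) qR e1 q2 red ns])
    show "\<not> (x1 = x2 \<and> y1 = q2)" using ne by (simp add: q2_def)
    show "\<exists>G. fmul h g F (fmul h g (fpow h g (w1, 1) 5) (fpow h g (w2, 1) 5)) = fmul h g (([:- x1, 1:] * [:- x2, 1:]) ^ 5, 0) G"
      if "Polynomial.degree w1 \<le> 3" "Polynomial.degree w2 \<le> 3" "poly w1 x1 = y1 + poly h x1" "poly w2 x2 = - q2" for w1 w2
    proof -
      have "wval w1 (iota h (Affine x1 y1)) = 0" "wval w2 (iota h (Affine x2 y2)) = 0"
        using that by (simp_all add: q2_def)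
      from quintic_div_identity12[OF cv F P that(1) this(1) that(2) this(2)] show ?thesis by auto
    qed
    show "F \<noteq> (smult c ([:- x2, 1:] ^ 5), 0)" for c
    proof
      assume Fc: "F = (smult c ([:- x2, 1:] ^ 5), 0)"
      then have c0: "c \<noteq> 0" using F5(2) by auto
      let ?P2 = "Affine x2 y2"
      have "iota h ?P2 \<in> points h g" using P(2) iota_points by blast
      then obtain Xs Zs Ys where t: "tri h g (iota h ?P2) Xs Zs Ys" using tri_exists[OF cv] by blast
      have "fev 5 F Xs Zs Ys = fps_const c * heval fps_const 5 (lin ?P2 ^ 5) Xs Zs"
        by (simp add: Fc fev_scalar fps_const_hom.heval_smult)
      moreover have "heval fps_const 5 (lin ?P2 ^ 5) Xs Zs \<noteq> 0"
        by (rule heval_nonzero[OF cv t _ degree_lin_power]) simp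
      ultimately have "subdegree (fev 5 F Xs Zs Ys) = 5 * (of_bool (iota h ?P2 = ?P2) + 1)"
        using c0 subdegree_lin_power[OF cv t P(2), of 5] by simp
      moreover have "subdegree (fev 5 F Xs Zs Ys) = 5 * (of_bool (iota h ?P2 = Affine x1 y1) + of_bool (iota h ?P2 = ?P2))"
        using F t unfolding quintic_div_def by blast
      ultimately show False using ne by (auto simp del: iota.simps)
    qed
  qed
qed

section \<open>Reduction of a pair of conjugate points\<close>

text \<open>Sums and products determine each pair up to order. The mixed sum ties the two
  permutations together, so that both coordinates are exchanged simultaneously.\<close>

lemma frobenius_permutes:
  fixes u1 u2 v1 v2 :: "'b::field"
  assumes char: "prime CHAR('b)"
    and u: "u1 + u2 \<in> prime_field" "u1 * u2 \<in> prime_field"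
    and v: "v1 + v2 \<in> prime_field" "v1 * v2 \<in> prime_field"
    and uv: "u1 * v2 + u2 * v1 \<in> prime_field"
  shows "(u1 ^ CHAR('b) = u1 \<and> u2 ^ CHAR('b) = u2 \<and> v1 ^ CHAR('b) = v1 \<and> v2 ^ CHAR('b) = v2) \<or>
    (u1 ^ CHAR('b) = u2 \<and> u2 ^ CHAR('b) = u1 \<and> v1 ^ CHAR('b) = v2 \<and> v2 ^ CHAR('b) = v1)"
proof -
  define \<phi> where "\<phi> x = x ^ CHAR('b)" for x :: 'b
  have add: "\<phi> (x + y) = \<phi> x + \<phi> y" for x y unfolding \<phi>_def by (rule freshmans_dream[OF char refl])
  have mult: "\<phi> (x * y) = \<phi> x * \<phi> y" for x y unfolding \<phi>_def by (rule power_mult_distrib)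
  have pf: "\<phi> x = x" if "x \<in> prime_field" for x using that by (simp add: \<phi>_def prime_field_def)
  have swap: "(\<phi> w1 = w1 \<and> \<phi> w2 = w2) \<or> (\<phi> w1 = w2 \<and> \<phi> w2 = w1)"
    if w: "w1 + w2 \<in> prime_field" "w1 * w2 \<in> prime_field" for w1 w2
  proof -
    have s: "\<phi> w1 + \<phi> w2 = w1 + w2" using pf[OF w(1)] by (simp only: add)
    have q: "\<phi> w1 * \<phi> w2 = w1 * w2" using pf[OF w(2)] by (simp only: mult)
    have "(\<phi> w1 - w1) * (\<phi> w1 - w2) = \<phi> w1 * \<phi> w1 - \<phi> w1 * (w1 + w2) + w1 * w2" by (simp add: algebra_simps)
    also have "\<dots> = 0" unfolding s[symmetric] q[symmetric] by (simp add: algebra_simps)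
    finally have "\<phi> w1 = w1 \<or> \<phi> w1 = w2" by simp
    then show ?thesis
    proof
      assume e: "\<phi> w1 = w1"
      then have "\<phi> w2 = w2" using s by (simp only: e add_left_cancel)
      with e show ?thesis by blast
    next
      assume e: "\<phi> w1 = w2"
      then have "w2 + \<phi> w2 = w2 + w1" using s by (simp only: e add.commute[of w1 w2])
      then have "\<phi> w2 = w1" by (simp only: add_left_cancel)
      with e show ?thesis by blast
    qed
  qed
  have sv: "\<phi> v1 + \<phi> v2 - (v1 + v2) = 0" using pf[OF v(1)] by (simp add: add)
  have tv: "\<phi> u1 * \<phi> v2 + \<phi> u2 * \<phi> v1 - (u1 * v2 + u2 * v1) = 0" using pf[OF uv] by (simp add: add mult)
  have "(\<phi> u1 = u1 \<and> \<phi> u2 = u2 \<and> \<phi> v1 = v1 \<and> \<phi> v2 = v2) \<or> (\<phi> u1 = u2 \<and> \<phi> u2 = u1 \<and> \<phi> v1 = v2 \<and> \<phi> v2 = v1)"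
  proof (cases "u1 = u2")
    case True
    have "\<phi> u1 = u2" "\<phi> u2 = u1" using swap[OF u] True by auto
    then show ?thesis using swap[OF v] True by simp
  next
    case False
    from swap[OF u] show ?thesis
    proof
      assume e: "\<phi> u1 = u1 \<and> \<phi> u2 = u2"
      have "(u1 - u2) * (\<phi> v2 - v2)
          = (u1 * \<phi> v2 + u2 * \<phi> v1 - (u1 * v2 + u2 * v1)) - u2 * (\<phi> v1 + \<phi> v2 - (v1 + v2))"
        by (simp add: algebra_simps)
      also have "\<dots> = 0" using tv unfolding sv by (simp add: e)
      finally have "\<phi> v2 = v2" using False by simp
      moreover from this have "\<phi> v1 = v1" using sv by simp
      ultimately show ?thesis using e by blast
    next
      assume e: "\<phi> u1 = u2 \<and> \<phi> u2 = u1"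
      have "(u1 - u2) * (\<phi> v1 - v2)
          = (u2 * \<phi> v2 + u1 * \<phi> v1 - (u1 * v2 + u2 * v1)) - u2 * (\<phi> v1 + \<phi> v2 - (v1 + v2))"
        by (simp add: algebra_simps)
      also have "\<dots> = 0" using tv unfolding sv by (simp add: e)
      finally have "\<phi> v1 = v2" using False by simp
      moreover from this have "\<phi> v2 = v1" using sv by (simp add: algebra_simps)
      ultimately show ?thesis using e by blast
    qed
  qed
  then show ?thesis by (simp only: \<phi>_def)
qed

text \<open>\<open>x1\<close> and \<open>x2\<close> are the two roots of a quadratic polynomial over
  \<open>K\<close>; they may lie in \<open>K\<close> or generate a further quadratic
  extension.\<close>

locale conjugate_pair = maximal_hom R rd for R :: "'a::field set" and rd :: "'a \<Rightarrow> 'b::alg_closed_field" +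
  fixes K :: "'a set" and x1 x2 :: 'a
  assumes K_1: "1 \<in> K" and K_diff: "x \<in> K \<Longrightarrow> y \<in> K \<Longrightarrow> x - y \<in> K"
    and K_mult: "x \<in> K \<Longrightarrow> y \<in> K \<Longrightarrow> x * y \<in> K" and K_inverse: "x \<in> K \<Longrightarrow> inverse x \<in> K"
    and char: "prime CHAR('b)"
    and residue: "w \<in> K \<Longrightarrow> w \<in> R \<Longrightarrow> rd w \<in> prime_field"
    and x_sum: "x1 + x2 \<in> K" and x_prod: "x1 * x2 \<in> K"
begin

lemma K_0: "0 \<in> K" using K_diff[OF K_1 K_1] by simp

lemma K_uminus: "x \<in> K \<Longrightarrow> - x \<in> K" using K_diff[OF K_0] by force

lemma K_add: "x \<in> K \<Longrightarrow> y \<in> K \<Longrightarrow> x + y \<in> K" using K_diff[OF _ K_uminus, of x y] by simp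

lemma K_divide: "x \<in> K \<Longrightarrow> y \<in> K \<Longrightarrow> x / y \<in> K" unfolding divide_inverse by (intro K_mult K_inverse)

text \<open>\<open>z2\<close> arises from \<open>z1\<close> by exchanging \<open>x1\<close> and
  \<open>x2\<close>. In this form the notion also makes sense when the roots lie in \<open>K\<close>
  and no automorphism exchanges them.\<close>

definition cpair :: "'a \<Rightarrow> 'a \<Rightarrow> bool" where
  "cpair z1 z2 \<longleftrightarrow> (\<exists>m n. m \<in> K \<and> n \<in> K \<and> z1 = m * x1 + n \<and> z2 = m * x2 + n)"

lemma cpairI: "m \<in> K \<Longrightarrow> n \<in> K \<Longrightarrow> z1 = m * x1 + n \<Longrightarrow> z2 = m * x2 + n \<Longrightarrow> cpair z1 z2"
  unfolding cpair_def by (intro exI conjI)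

lemma cpairE:
  assumes "cpair z1 z2"
  obtains m n where "m \<in> K" "n \<in> K" "z1 = m * x1 + n" "z2 = m * x2 + n"
  using assms unfolding cpair_def by (elim exE conjE)

lemma cpair_const: "c \<in> K \<Longrightarrow> cpair c c"
  by (rule cpairI[OF K_0]) simp_all

lemma cpair_x: "cpair x1 x2"
  by (rule cpairI[OF K_1 K_0]) simp_all

lemma cpair_add:
  assumes "cpair z1 z2" "cpair w1 w2"
  shows "cpair (z1 + w1) (z2 + w2)"
proof -
  obtain m n m' n' where z: "m \<in> K" "n \<in> K" "z1 = m * x1 + n" "z2 = m * x2 + n"
    and w: "m' \<in> K" "n' \<in> K" "w1 = m' * x1 + n'" "w2 = m' * x2 + n'"
    using assms by (elim cpairE)
  show ?thesis
    by (rule cpairI[OF K_add[OF z(1) w(1)] K_add[OF z(2) w(2)]]) (simp_all only: z w, simp_all add: algebra_simps)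
qed

lemma cpair_mult:
  assumes "cpair z1 z2" "cpair w1 w2"
  shows "cpair (z1 * w1) (z2 * w2)"
proof -
  obtain m n m' n' where z: "m \<in> K" "n \<in> K" "z1 = m * x1 + n" "z2 = m * x2 + n"
    and w: "m' \<in> K" "n' \<in> K" "w1 = m' * x1 + n'" "w2 = m' * x2 + n'"
    using assms by (elim cpairE)
  show ?thesis
  proof (rule cpairI)
    show "m * m' * (x1 + x2) + (m * n' + m' * n) \<in> K" by (intro K_add K_mult z w x_sum)
    show "n * n' - m * m' * (x1 * x2) \<in> K" by (intro K_diff K_mult z w x_prod)
  qed (simp_all only: z w, simp_all add: algebra_simps)
qed

lemma cpair_uminus: "cpair z1 z2 \<Longrightarrow> cpair (- z1) (- z2)"
  using cpair_mult[OF cpair_const[OF K_uminus[OF K_1]], of z1 z2] by simp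

lemma cpair_diff: "cpair z1 z2 \<Longrightarrow> cpair w1 w2 \<Longrightarrow> cpair (z1 - w1) (z2 - w2)"
  using cpair_add[OF _ cpair_uminus, of z1 z2 w1 w2] by simp

lemma cpair_power: "cpair z1 z2 \<Longrightarrow> cpair (z1 ^ n) (z2 ^ n)"
  by (induction n) (simp_all add: cpair_mult cpair_const K_1)

lemma cpair_sum: "(\<And>i. i \<in> I \<Longrightarrow> cpair (s1 i) (s2 i)) \<Longrightarrow> cpair (sum s1 I) (sum s2 I)"
  by (induction I rule: infinite_finite_induct) (simp_all add: cpair_add cpair_const K_0)

lemma cpair_swap:
  assumes "cpair z1 z2"
  shows "cpair z2 z1"
proof -
  obtain m n where z: "m \<in> K" "n \<in> K" "z1 = m * x1 + n" "z2 = m * x2 + n" using assms by (elim cpairE)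
  show ?thesis
  proof (rule cpairI)
    show "- m \<in> K" by (intro K_uminus z)
    show "n + m * (x1 + x2) \<in> K" by (intro K_add K_mult z x_sum)
  qed (simp_all only: z, simp_all add: algebra_simps)
qed

lemma cpair_sum_in_K:
  assumes "cpair z1 z2"
  shows "z1 + z2 \<in> K"
proof -
  obtain m n where z: "m \<in> K" "n \<in> K" "z1 = m * x1 + n" "z2 = m * x2 + n" using assms by (elim cpairE)
  have "m * (x1 + x2) + (n + n) \<in> K" by (intro K_add K_mult z x_sum)
  moreover have "z1 + z2 = m * (x1 + x2) + (n + n)" unfolding z by (simp add: algebra_simps)
  ultimately show ?thesis by (simp only:)
qed

lemma cpair_prod_in_K:
  assumes "cpair z1 z2"
  shows "z1 * z2 \<in> K"
proof -
  obtain m n where z: "m \<in> K" "n \<in> K" "z1 = m * x1 + n" "z2 = m * x2 + n" using assms by (elim cpairE)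
  have "m * m * (x1 * x2) + m * n * (x1 + x2) + n * n \<in> K" by (intro K_add K_mult z x_sum x_prod)
  moreover have "z1 * z2 = m * m * (x1 * x2) + m * n * (x1 + x2) + n * n" unfolding z by (simp add: algebra_simps)
  ultimately show ?thesis by (simp only:)
qed

lemma cpair_in_K:
  assumes "x1 \<in> K" "cpair z1 z2"
  shows "z1 \<in> K" "z2 \<in> K"
proof -
  have x2: "x2 \<in> K" using K_diff[OF x_sum assms(1)] by simp
  obtain m n where z: "m \<in> K" "n \<in> K" "z1 = m * x1 + n" "z2 = m * x2 + n" using assms(2) by (elim cpairE)
  show "z1 \<in> K" "z2 \<in> K" unfolding z by (intro K_add K_mult z x2 assms(1))+
qed

lemma cpair_eq_0:
  assumes "x1 \<notin> K" "cpair z1 z2"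
  shows "z1 = 0 \<longleftrightarrow> z2 = 0"
proof -
  have x2: "x2 \<notin> K"
  proof
    assume "x2 \<in> K"
    from K_diff[OF x_sum this] show False using assms(1) by simp
  qed
  have lin: "m = 0" if "m * x + n = 0" "x \<notin> K" "m \<in> K" "n \<in> K" for m n x
  proof (rule ccontr)
    assume "m \<noteq> 0"
    have "m * x = - n" using that(1) by (simp only: eq_neg_iff_add_eq_0)
    then have "x = (- n) / m" using nonzero_mult_div_cancel_left[OF \<open>m \<noteq> 0\<close>, of x] by (simp only:)
    moreover have "(- n) / m \<in> K" by (intro K_divide K_uminus that(3,4))
    ultimately have "x \<in> K" by (rule ssubst)
    with that(2) show False by (rule notE)
  qed
  obtain m n where z: "m \<in> K" "n \<in> K" "z1 = m * x1 + n" "z2 = m * x2 + n" using assms(2) by (elim cpairE)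
  show ?thesis using lin[OF _ assms(1) z(1,2)] lin[OF _ x2 z(1,2)] unfolding z(3,4) by auto
qed

text \<open>With \<open>x1\<close> outside \<open>K\<close> the two denominators vanish together
  (\<open>cpair_eq_0\<close>).\<close>

lemma cpair_divide:
  assumes x1: "x1 \<notin> K" and z: "cpair z1 z2" and w: "cpair w1 w2"
  shows "cpair (z1 / w1) (z2 / w2)"
proof (cases "w1 = 0")
  case True
  then have "w2 = 0" using cpair_eq_0[OF x1 w] by simp
  then show ?thesis using True cpair_const[OF K_0] by simp
next
  case False
  then have "w2 \<noteq> 0" using cpair_eq_0[OF x1 w] by simp
  have "cpair (z1 * (w2 * inverse (w1 * w2))) (z2 * (w1 * inverse (w1 * w2)))"
    by (intro cpair_mult z cpair_swap[OF w] cpair_const K_inverse cpair_prod_in_K[OF w])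
  then show ?thesis using False \<open>w2 \<noteq> 0\<close> by (simp add: field_simps)
qed

abbreviation "frob \<equiv> map_point (\<lambda>x :: 'b. x ^ CHAR('b))"

lemma frob_prime_field: "u \<in> prime_field \<Longrightarrow> u ^ CHAR('b) = (u :: 'b)"
  by (simp add: prime_field_def)

lemma residue_cpair:
  assumes "cpair z1 z2" "z1 \<in> R" "z2 \<in> R"
  shows "rd z1 + rd z2 \<in> prime_field" "rd z1 * rd z2 \<in> prime_field"
  using residue[OF cpair_sum_in_K[OF assms(1)] add_R[OF assms(2,3)]]
    residue[OF cpair_prod_in_K[OF assms(1)] mult_R[OF assms(2,3)]]
  by (simp_all only: rd_add[OF assms(2,3)] rd_mult[OF assms(2,3)])

lemma frobenius_cpair:
  assumes z: "cpair z1 z2" "z1 \<in> R" "z2 \<in> R" and w: "cpair w1 w2" "w1 \<in> R" "w2 \<in> R"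
  shows "(rd z1 ^ CHAR('b) = rd z1 \<and> rd z2 ^ CHAR('b) = rd z2 \<and> rd w1 ^ CHAR('b) = rd w1 \<and> rd w2 ^ CHAR('b) = rd w2) \<or>
    (rd z1 ^ CHAR('b) = rd z2 \<and> rd z2 ^ CHAR('b) = rd z1 \<and> rd w1 ^ CHAR('b) = rd w2 \<and> rd w2 ^ CHAR('b) = rd w1)"
proof (rule frobenius_permutes[OF char residue_cpair[OF z] residue_cpair[OF w]])
  have "z1 * w2 + z2 * w1 \<in> K" by (rule cpair_sum_in_K[OF cpair_mult[OF z(1) cpair_swap[OF w(1)]]])
  moreover have "z1 * w2 + z2 * w1 \<in> R" by (intro add_R mult_R z w)
  ultimately have "rd (z1 * w2 + z2 * w1) \<in> prime_field" by (rule residue)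
  then show "rd z1 * rd w2 + rd z2 * rd w1 \<in> prime_field"
    by (simp only: rd_add[OF mult_R[OF z(2) w(3)] mult_R[OF z(3) w(2)]] rd_mult[OF z(2) w(3)] rd_mult[OF z(3) w(2)])
qed

text \<open>One point reduces to an affine point and the other to infinity, so Frobenius cannot
  exchange them and each must be rational. Each reduced coordinate is recovered from the reduction
  of a symmetric expression, which lies in \<open>K\<close>; the terms containing the inverse of
  \<open>a2\<close> drop out.\<close>

lemma residue_mixed:
  assumes a: "cpair a1 a2" "a1 \<in> R" "a2 \<notin> R" and b: "cpair b1 b2" "b1 \<in> R" "b2 / a2 ^ 3 \<in> R"
  shows "rd a1 \<in> prime_field" "rd b1 \<in> prime_field" "rd (b2 / a2 ^ 3) \<in> prime_field"
proof -
  define w t where "w = inverse a2" and "t = b2 / a2 ^ 3"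
  have a2: "a2 \<noteq> 0" and w: "w \<in> R" "rd w = 0" using not_R[OF a(3)] by (simp_all add: w_def)
  have t: "t \<in> R" using b(3) by (simp add: t_def)
  \<comment> \<open>\<open>D\<close> is \<open>(a1 + a2) / a2\<close> and \<open>E\<close> its
    analogue for the cubes. Both reduce to 1, which makes the symmetric quotients below
    integral.\<close>
  define D E where "D = 1 + a1 * w" and "E = 1 + a1 ^ 3 * w ^ 3"
  have DR: "D \<in> R" "E \<in> R" unfolding D_def E_def by (intro add_R one_R mult_R power_R a w)+
  have rD: "rd D = 1" unfolding D_def
    by (simp only: rd_add[OF one_R mult_R[OF a(2) w(1)]] rd_mult[OF a(2) w(1)] rd_1 w(2) mult_zero_right add_0_right)
  have "rd E = 1 + rd a1 ^ 3 * rd w ^ 3" unfolding E_def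
    using a(2) w(1) by (simp add: rd_add rd_mult rd_power rd_1 one_R mult_R power_R)
  then have rE: "rd E = 1" using w(2) by simp
  have s: "a1 + a2 = a2 * D" "a1 ^ 3 + a2 ^ 3 = a2 ^ 3 * E"
    unfolding D_def E_def w_def using a2 by (simp_all add: distrib_left power_inverse)
  have K3: "a1 ^ 3 + a2 ^ 3 \<in> K" by (rule cpair_sum_in_K[OF cpair_power[OF a(1)]])
  have "a1 * a2 / (a1 + a2) \<in> K" by (intro K_divide cpair_prod_in_K cpair_sum_in_K a)
  moreover have "a1 * a2 / (a1 + a2) = a1 / D" unfolding s using a2 by simp
  ultimately have "a1 / D \<in> K" by (simp only:)
  from residue[OF this divide_R[OF a(2) DR(1)]] rD show ra1: "rd a1 \<in> prime_field"
    using rd_divide[OF a(2) DR(1)] by simp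
  have "(b1 + b2) / (a1 ^ 3 + a2 ^ 3) \<in> K" by (intro K_divide cpair_sum_in_K b K3)
  moreover have "(b1 + b2) / (a1 ^ 3 + a2 ^ 3) = (b1 * w ^ 3 + t) / E"
  proof -
    have "b1 + b2 = a2 ^ 3 * (b1 * w ^ 3 + t)" unfolding w_def t_def using a2 by (simp add: distrib_left power_inverse)
    then show ?thesis unfolding s using a2 by simp
  qed
  ultimately have k: "(b1 * w ^ 3 + t) / E \<in> K" by (simp only:)
  have nR: "b1 * w ^ 3 + t \<in> R" by (intro add_R mult_R power_R b w t)
  have "rd (b1 * w ^ 3 + t) = rd t" using b(2) w t by (simp add: rd_add rd_mult rd_power mult_R power_R)
  then have rt: "rd t \<in> prime_field"
    using residue[OF k divide_R[OF nR DR(2)]] rd_divide[OF nR DR(2)] rE by simp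
  then show "rd (b2 / a2 ^ 3) \<in> prime_field" by (simp add: t_def)
  have "a2 ^ 3 * b1 + a1 ^ 3 * b2 \<in> K"
    by (rule cpair_sum_in_K[OF cpair_mult[OF cpair_swap[OF cpair_power[OF a(1)]] b(1)]])
  then have "(a2 ^ 3 * b1 + a1 ^ 3 * b2) / (a1 ^ 3 + a2 ^ 3) \<in> K" by (intro K_divide K3)
  moreover have "(a2 ^ 3 * b1 + a1 ^ 3 * b2) / (a1 ^ 3 + a2 ^ 3) = (b1 + a1 ^ 3 * t) / E"
  proof -
    have "a2 ^ 3 * b1 + a1 ^ 3 * b2 = a2 ^ 3 * (b1 + a1 ^ 3 * t)" unfolding t_def using a2 by (simp add: distrib_left)
    then show ?thesis unfolding s using a2 by simp
  qed
  ultimately have k: "(b1 + a1 ^ 3 * t) / E \<in> K" by (simp only:)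
  have nR: "b1 + a1 ^ 3 * t \<in> R" by (intro add_R mult_R power_R a b t)
  have e: "rd (b1 + a1 ^ 3 * t) = rd b1 + rd a1 ^ 3 * rd t" using a(2) b(2) t by (simp add: rd_add rd_mult rd_power mult_R power_R)
  have "rd b1 + rd a1 ^ 3 * rd t \<in> prime_field"
    using residue[OF k divide_R[OF nR DR(2)]] rd_divide[OF nR DR(2)] rE unfolding e by simp
  moreover have "rd a1 ^ 3 * rd t \<in> prime_field"
    unfolding power3_eq_cube by (intro prime_field_mult[OF char] ra1 rt)
  ultimately have "(rd b1 + rd a1 ^ 3 * rd t) - rd a1 ^ 3 * rd t \<in> prime_field" by (rule prime_field_diff[OF char])
  then show "rd b1 \<in> prime_field" by (simp only: add_diff_cancel_right')
qed

fun rational_point :: "'a point \<Rightarrow> bool" where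
  "rational_point (Affine x y) \<longleftrightarrow> x \<in> K \<and> y \<in> K"
| "rational_point (Inf y) \<longleftrightarrow> y \<in> K"

lemma K_cube: "x \<in> K \<Longrightarrow> x ^ 3 \<in> K"
  unfolding power3_eq_cube by (intro K_mult)

context
  fixes h g :: "'a poly"
  assumes hg: "Rp h" "Rp g" and deg: "Polynomial.degree h \<le> 3" "Polynomial.degree g \<le> 6"
begin

lemma infinite_R:
  assumes "Inf y \<in> points h g"
  shows "y \<in> R"
proof (rule affine_integral[OF Rp_rev_poly[OF hg(1)] Rp_rev_poly[OF hg(2)] _ zero_R])
  show "y\<^sup>2 + poly (rev_poly 3 h) 0 * y = poly (rev_poly 6 g) 0" using assms by (simp add: points_simps)
qed

lemma rational_point_fixed:
  assumes P: "P \<in> points h g" "rational_point P"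
  shows "frob (rpt P) = rpt P"
proof (cases P)
  case (Affine x y)
  then have eq: "y\<^sup>2 + poly h x * y = poly g x" and K: "x \<in> K" "y \<in> K" using P by (simp_all add: points_simps)
  show ?thesis
  proof (cases "x \<in> R")
    case True
    have y: "y \<in> R" by (rule affine_integral[OF hg eq True])
    show ?thesis using True frob_prime_field[OF residue[OF K(1) True]] frob_prime_field[OF residue[OF K(2) y]]
      by (simp add: Affine)
  next
    case False
    have "y / x ^ 3 \<in> K" by (intro K_divide K_cube K)
    from frob_prime_field[OF residue[OF this infinite_integral(3)[OF hg deg eq False]]] show ?thesis
      using False by (simp add: Affine)
  qed
next
  case (Inf y)
  then show ?thesis using frob_prime_field[OF residue[OF _ infinite_R]] P by simp
qed

lemma infinite_pair:
  assumes "cpair t1 t2" "t1 \<in> R" "t2 \<in> R"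
  shows "(frob (Inf (rd t1)) = Inf (rd t1) \<and> frob (Inf (rd t2)) = Inf (rd t2)) \<or>
    (frob (Inf (rd t1)) = Inf (rd t2) \<and> frob (Inf (rd t2)) = Inf (rd t1))"
  using frobenius_cpair[OF assms assms] by auto

lemma affine_pair:
  assumes x1: "x1 \<notin> K" and ab: "cpair a1 a2" "cpair b1 b2"
    and P: "Affine a1 b1 \<in> points h g" "Affine a2 b2 \<in> points h g"
  defines "P1 \<equiv> rpt (Affine a1 b1)" and "P2 \<equiv> rpt (Affine a2 b2)"
  shows "(frob P1 = P1 \<and> frob P2 = P2) \<or> (frob P1 = P2 \<and> frob P2 = P1)"
proof -
  have eq: "b1\<^sup>2 + poly h a1 * b1 = poly g a1" "b2\<^sup>2 + poly h a2 * b2 = poly g a2"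
    using P by (simp_all add: points_simps)
  note b1R = affine_integral[OF hg eq(1)] and b2R = affine_integral[OF hg eq(2)]
  note t1R = infinite_integral(3)[OF hg deg eq(1)] and t2R = infinite_integral(3)[OF hg deg eq(2)]
  show ?thesis
  proof (cases "a1 \<in> R")
    case a1: True
    show ?thesis
    proof (cases "a2 \<in> R")
      case True
      from frobenius_cpair[OF ab(1) a1 True ab(2) b1R[OF a1] b2R[OF True]] show ?thesis
        using a1 True by (auto simp: P1_def P2_def)
    next
      case False
      from residue_mixed[OF ab(1) a1 False ab(2) b1R[OF a1] t2R[OF False], THEN frob_prime_field] show ?thesis
        using a1 False by (simp add: P1_def P2_def)
    qed
  next
    case a1: False
    show ?thesis
    proof (cases "a2 \<in> R")
      case True
      from residue_mixed[OF cpair_swap[OF ab(1)] True a1 cpair_swap[OF ab(2)] b2R[OF True] t1R[OF a1],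
          THEN frob_prime_field]
      show ?thesis using a1 True by (simp add: P1_def P2_def)
    next
      case False
      from infinite_pair[OF cpair_divide[OF x1 ab(2) cpair_power[OF ab(1)]] t1R[OF a1] t2R[OF False]] show ?thesis
        using a1 False by (simp only: P1_def P2_def rpt.simps if_False)
    qed
  qed
qed

text \<open>If \<open>x1\<close> lies in \<open>K\<close>, both points are rational over
  \<open>K\<close> and each reduction is fixed. Otherwise conjugate coordinates vanish together, so
  both points lie in the same chart before reduction; \<open>affine_pair\<close> treats the charts
  after reduction.\<close>

theorem conjugate_points_permuted:
  assumes XZY: "cpair X1 X2" "cpair Z1 Z2" "cpair Y1 Y2"
    and P: "tpt X1 Z1 Y1 \<in> points h g" "tpt X2 Z2 Y2 \<in> points h g"
  defines "P1 \<equiv> rpt (tpt X1 Z1 Y1)" and "P2 \<equiv> rpt (tpt X2 Z2 Y2)"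
  shows "(frob P1 = P1 \<and> frob P2 = P2) \<or> (frob P1 = P2 \<and> frob P2 = P1)"
proof (cases "x1 \<in> K")
  case True
  have "rational_point (tpt X1 Z1 Y1)" "rational_point (tpt X2 Z2 Y2)"
    using cpair_in_K[OF True XZY(1)] cpair_in_K[OF True XZY(2)] cpair_in_K[OF True XZY(3)]
    by (simp_all add: tpt_def K_divide K_cube)
  then show ?thesis unfolding P1_def P2_def using rational_point_fixed P by blast
next
  case x1: False
  show ?thesis
  proof (cases "Z1 = 0")
    case True
    then have "Z2 = 0" using cpair_eq_0[OF x1 XZY(2)] by simp
    with True have e: "tpt X1 Z1 Y1 = Inf (Y1 / X1 ^ 3)" "tpt X2 Z2 Y2 = Inf (Y2 / X2 ^ 3)" by (simp_all add: tpt_def)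
    show ?thesis unfolding P1_def P2_def e rpt.simps
      by (intro infinite_pair cpair_divide[OF x1] cpair_power XZY infinite_R P[unfolded e])
  next
    case False
    then have "Z2 \<noteq> 0" using cpair_eq_0[OF x1 XZY(2)] by simp
    with False have e: "tpt X1 Z1 Y1 = Affine (X1 / Z1) (Y1 / Z1 ^ 3)" "tpt X2 Z2 Y2 = Affine (X2 / Z2) (Y2 / Z2 ^ 3)"
      by (simp_all add: tpt_def)
    show ?thesis unfolding P1_def P2_def e
      by (intro affine_pair[OF x1] cpair_divide[OF x1] cpair_power XZY P[unfolded e])
  qed
qed

end

end

section \<open>The action of field automorphisms on divisor classes\<close>

locale curve_automorphism =
  fixes \<sigma> :: "'a::alg_closed_field \<Rightarrow> 'a" and h g :: "'a poly"
  assumes \<sigma>_add: "\<sigma> (x + y) = \<sigma> x + \<sigma> y" and \<sigma>_mult: "\<sigma> (x * y) = \<sigma> x * \<sigma> y"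
    and \<sigma>_1: "\<sigma> 1 = 1" and \<sigma>_bij: "bij \<sigma>"
    and \<sigma>_h: "map_poly \<sigma> h = h" and \<sigma>_g: "map_poly \<sigma> g = g"
    and curve: "genus2_curve h g"
begin

lemma \<sigma>_0 [simp]: "\<sigma> 0 = 0"
  using \<sigma>_add[of 0 0] by (metis add_cancel_right_right add_0_left)

lemma \<sigma>_eq_0 [simp]: "\<sigma> x = 0 \<longleftrightarrow> x = 0"
  using bij_is_inj[OF \<sigma>_bij] by (metis \<sigma>_0 injD)

fun act :: "'a point \<Rightarrow> 'a point" where
  "act (Affine x y) = Affine (\<sigma> x) (\<sigma> y)"
| "act (Inf y) = Inf (\<sigma> y)"

text \<open>The automorphism applied to coefficients of power series. It carries branches to
  branches and keeps the subdegree, hence orders of forms.\<close>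

definition fact :: "'a fps \<Rightarrow> 'a fps" where "fact f = Abs_fps (\<lambda>n. \<sigma> (f $ n))"

lemma fact_nth [simp]: "fact f $ n = \<sigma> (f $ n)"
  by (simp add: fact_def)

lemma \<sigma>_sum: "\<sigma> (sum f I) = (\<Sum>i\<in>I. \<sigma> (f i))"
  by (induction I rule: infinite_finite_induct) (simp_all add: \<sigma>_add)

lemma fact_add: "fact (f + k) = fact f + fact k"
  by (simp add: fps_eq_iff \<sigma>_add)

lemma fact_mult: "fact (f * k) = fact f * fact k"
  by (simp add: fps_eq_iff fps_mult_nth \<sigma>_sum \<sigma>_mult)

lemma fact_0 [simp]: "fact 0 = 0" and fact_1 [simp]: "fact 1 = 1"
  by (simp_all add: fps_eq_iff \<sigma>_1)

lemma fact_const: "fact (fps_const c) = fps_const (\<sigma> c)"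
  by (simp add: fps_eq_iff)

lemma fact_fpoly: "fact (fpoly q \<xi>) = fpoly (map_poly \<sigma> q) (fact \<xi>)"
  by (induction q) (simp_all add: fact_add fact_mult fact_const map_poly_pCons)

lemma subdegree_fact: "subdegree (fact f) = subdegree f"
proof (cases "f = 0")
  case False
  show ?thesis
  proof (rule subdegreeI)
    show "fact f $ subdegree f \<noteq> 0" using nth_subdegree_nonzero[OF False] by (simp only: fact_nth \<sigma>_eq_0 not_False_eq_True)
    show "fact f $ i = 0" if "i < subdegree f" for i
      using nth_less_subdegree_zero[OF that] by (simp only: fact_nth \<sigma>_0)
  qed
qed (simp only: fact_0)

lemma coeff_map_\<sigma>: "Polynomial.coeff (map_poly \<sigma> q) i = \<sigma> (Polynomial.coeff q i)"
  by (simp add: coeff_map_poly)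

lemma map_\<sigma>_rev_poly: "map_poly \<sigma> (rev_poly n q) = rev_poly n (map_poly \<sigma> q)"
  by (rule poly_eqI) (simp add: coeff_map_\<sigma> coeff_rev_poly)

lemma branch_fact:
  assumes "branch h0 g0 a b \<xi> \<eta>" "map_poly \<sigma> h0 = h0" "map_poly \<sigma> g0 = g0"
  shows "branch h0 g0 (\<sigma> a) (\<sigma> b) (fact \<xi>) (fact \<eta>)"
proof -
  have "fact (\<eta>\<^sup>2 + fpoly h0 \<xi> * \<eta>) = fact (fpoly g0 \<xi>)" using assms(1) by (simp add: branch_def)
  then have "(fact \<eta>)\<^sup>2 + fpoly h0 (fact \<xi>) * fact \<eta> = fpoly g0 (fact \<xi>)"
    using assms(2,3) by (simp add: fact_add fact_mult fact_fpoly power2_eq_square)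
  then show ?thesis using assms(1) by (auto simp: branch_def)
qed

lemma tri_fact: "tri h g Q Xs Zs Ys \<Longrightarrow> tri h g (act Q) (fact Xs) (fact Zs) (fact Ys)"
  by (cases Q) (auto simp: map_\<sigma>_rev_poly \<sigma>_h \<sigma>_g dest: branch_fact)

lemma fact_power: "fact (f ^ n) = fact f ^ n"
  by (induction n) (simp_all add: fact_mult)

lemma fact_sum: "fact (sum f I) = (\<Sum>i\<in>I. fact (f i))"
  by (induction I rule: infinite_finite_induct) (simp_all add: fact_add)

lemma fact_heval: "fact (heval fps_const n A Xs Zs) = heval fps_const n (map_poly \<sigma> A) (fact Xs) (fact Zs)"
  by (simp add: heval_def fact_sum fact_mult fact_power fact_const coeff_map_\<sigma>)

lemma fact_fev:
  "fact (fev N (A, B) Xs Zs Ys) = fev N (map_poly \<sigma> A, map_poly \<sigma> B) (fact Xs) (fact Zs) (fact Ys)"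
  by (simp add: fev_def fact_add fact_mult fact_heval)

lemma is_form_act: "is_form N A B \<Longrightarrow> is_form N (map_poly \<sigma> A) (map_poly \<sigma> B)"
  using degree_map_poly_le[of \<sigma> A] degree_map_poly_le[of \<sigma> B]
  by (auto simp: is_form_def poly_eq_iff coeff_map_\<sigma>)

lemma act_points: "Q \<in> points h g \<Longrightarrow> act Q \<in> points h g"
  using tri_exists[OF curve] tri_fact tri_point by blast

lemma form_ord_act:
  assumes F: "is_form N A B" and Q: "Q \<in> points h g"
  shows "form_ord h g N (map_poly \<sigma> A) (map_poly \<sigma> B) (act Q) = form_ord h g N A B Q"
proof -
  obtain Xs Zs Ys where t: "tri h g Q Xs Zs Ys" using tri_exists[OF curve Q] by blast
  note F' = is_form_act[OF F]
  have nz: "fev N (A, B) Xs Zs Ys \<noteq> 0" using fev_nonzero[OF curve t] F by (auto simp: is_form_isf)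
  have nz': "fev N (map_poly \<sigma> A, map_poly \<sigma> B) (fact Xs) (fact Zs) (fact Ys) \<noteq> 0"
    using fev_nonzero[OF curve tri_fact[OF t]] F' by (auto simp: is_form_isf)
  show ?thesis
    unfolding form_ord_fev[OF curve t F nz] form_ord_fev[OF curve tri_fact[OF t] F' nz'] fact_fev[symmetric] subdegree_fact ..
qed

lemma act_inj: "act P = act Q \<longleftrightarrow> P = Q"
  using bij_is_inj[OF \<sigma>_bij] by (cases P; cases Q) (auto dest: injD)

lemma act_surj: "\<exists>P. act P = Q"
proof (cases Q)
  case (Affine x y)
  then show ?thesis using bij_is_surj[OF \<sigma>_bij] by (metis act.simps(1) surjD)
next
  case (Inf y)
  then show ?thesis using bij_is_surj[OF \<sigma>_bij] by (metis act.simps(2) surjD)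
qed

lemma curve_automorphism_inverse: "curve_automorphism (inv_into UNIV \<sigma>) h g"
proof
  have i: "inv_into UNIV \<sigma> (\<sigma> x) = x" "\<sigma> (inv_into UNIV \<sigma> x) = x" for x
    using \<sigma>_bij by (simp_all add: bij_is_inj bij_is_surj surj_f_inv_f)
  show "inv_into UNIV \<sigma> (x + y) = inv_into UNIV \<sigma> x + inv_into UNIV \<sigma> y" for x y by (metis i \<sigma>_add)
  show "inv_into UNIV \<sigma> (x * y) = inv_into UNIV \<sigma> x * inv_into UNIV \<sigma> y" for x y by (metis i \<sigma>_mult)
  show "inv_into UNIV \<sigma> 1 = 1" by (metis i \<sigma>_1)
  show "bij (inv_into UNIV \<sigma>)" by (rule bij_imp_bij_inv[OF \<sigma>_bij])
  have inv0: "inv_into UNIV \<sigma> 0 = 0" by (metis i \<sigma>_0)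
  have c: "inv_into UNIV \<sigma> (Polynomial.coeff q n) = Polynomial.coeff q n" if "map_poly \<sigma> q = q" for q n
    using i that by (metis coeff_map_\<sigma>)
  show "map_poly (inv_into UNIV \<sigma>) h = h" "map_poly (inv_into UNIV \<sigma>) g = g"
    using c[OF \<sigma>_h] c[OF \<sigma>_g] inv0 by (auto intro!: poly_eqI simp: coeff_map_poly)
  show "genus2_curve h g" by (rule curve)
qed

text \<open>The transformed divisor is specified by its values only, so the lemma applies both to
  \<open>frob_divisor\<close> and to a divisor constructed for the inverse automorphism.\<close>

lemma principal_divisors_act:
  assumes D: "D \<in> principal_divisors h g"
    and D': "\<And>Q. Poly_Mapping.lookup D' (act Q) = Poly_Mapping.lookup D Q"
  shows "D' \<in> principal_divisors h g"
proof -
  obtain N A1 B1 A2 B2 where N: "is_form N A1 B1" "is_form N A2 B2"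
    and ord: "\<And>Q. Q \<in> points h g \<Longrightarrow> Poly_Mapping.lookup D Q
      = int (form_ord h g N A1 B1 Q) - int (form_ord h g N A2 B2 Q)"
    and keys: "Poly_Mapping.keys D \<subseteq> points h g"
    using D unfolding principal_divisors_def by blast
  have "Poly_Mapping.keys D' \<subseteq> points h g"
  proof
    fix Q assume "Q \<in> Poly_Mapping.keys D'"
    then have "Poly_Mapping.lookup D' Q \<noteq> 0" by (simp add: in_keys_iff)
    moreover obtain P where "Q = act P" using act_surj by metis
    ultimately have "P \<in> Poly_Mapping.keys D" by (simp add: D' in_keys_iff)
    then show "Q \<in> points h g" using keys act_points \<open>Q = act P\<close> by blast
  qed
  moreover have "Poly_Mapping.lookup D' Q = int (form_ord h g N (map_poly \<sigma> A1) (map_poly \<sigma> B1) Q)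
      - int (form_ord h g N (map_poly \<sigma> A2) (map_poly \<sigma> B2) Q)" if Q: "Q \<in> points h g" for Q
  proof -
    obtain P where P: "Q = act P" using act_surj by metis
    interpret i: curve_automorphism "inv_into UNIV \<sigma>" h g by (rule curve_automorphism_inverse)
    have "i.act (act P) = P" using \<sigma>_bij by (cases P) (simp_all add: bij_is_inj)
    then have "P \<in> points h g" using i.act_points[OF Q] P by simp
    then show ?thesis unfolding P D' using ord form_ord_act[OF N(1)] form_ord_act[OF N(2)] by simp
  qed
  ultimately show ?thesis unfolding principal_divisors_def using is_form_act[OF N(1)] is_form_act[OF N(2)] by blast
qed

end

section \<open>Principal divisors\<close>

context
  fixes h g :: "'a::alg_closed_field poly"
  assumes curve: "genus2_curve h g"
begin

lemma principal_divisorI: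
  assumes "Poly_Mapping.keys D \<subseteq> points h g" and F: "isf N F1" "F1 \<noteq> (0, 0)" "isf N F2" "F2 \<noteq> (0, 0)" "3 \<le> N"
    and ord: "\<And>Q Xs Zs Ys. tri h g Q Xs Zs Ys \<Longrightarrow> Poly_Mapping.lookup D Q
      = int (subdegree (fev N F1 Xs Zs Ys)) - int (subdegree (fev N F2 Xs Zs Ys))"
  shows "D \<in> principal_divisors h g"
proof -
  have N: "is_form N (fst F1) (snd F1)" "is_form N (fst F2) (snd F2)"
    using F by (auto simp: is_form_isf prod_eq_iff)
  have "Poly_Mapping.lookup D Q = int (form_ord h g N (fst F1) (snd F1) Q) - int (form_ord h g N (fst F2) (snd F2) Q)"
    if Q: "Q \<in> points h g" for Q
  proof -
    obtain Xs Zs Ys where t: "tri h g Q Xs Zs Ys" using tri_exists[OF curve Q] by blast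
    show ?thesis
      using ord[OF t] form_ord_fev[OF curve t N(1)] form_ord_fev[OF curve t N(2)]
        fev_nonzero[OF curve t F(1,2)] fev_nonzero[OF curve t F(3,4)] by simp
  qed
  with assms(1) N show ?thesis unfolding principal_divisors_def by blast
qed

lemma principal_divisorE:
  assumes "D \<in> principal_divisors h g"
  obtains N F1 F2 where "3 \<le> N" "isf N F1" "F1 \<noteq> (0, 0)" "isf N F2" "F2 \<noteq> (0, 0)"
    "\<And>Q Xs Zs Ys. tri h g Q Xs Zs Ys \<Longrightarrow> Poly_Mapping.lookup D Q
      = int (subdegree (fev N F1 Xs Zs Ys)) - int (subdegree (fev N F2 Xs Zs Ys))"
proof -
  obtain N A1 B1 A2 B2 where N: "is_form N A1 B1" "is_form N A2 B2"
    and ord: "\<And>Q. Q \<in> points h g \<Longrightarrow> Poly_Mapping.lookup D Q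
      = int (form_ord h g N A1 B1 Q) - int (form_ord h g N A2 B2 Q)"
    using assms unfolding principal_divisors_def by blast
  have F: "isf N (A1, B1)" "(A1, B1) \<noteq> (0, 0)" "isf N (A2, B2)" "(A2, B2) \<noteq> (0, 0)" "3 \<le> N"
    using N by (auto simp: is_form_isf)
  show thesis
  proof (rule that[OF F(5,1-4)])
    fix Q Xs Zs Ys assume t: "tri h g Q Xs Zs Ys"
    show "Poly_Mapping.lookup D Q
      = int (subdegree (fev N (A1, B1) Xs Zs Ys)) - int (subdegree (fev N (A2, B2) Xs Zs Ys))"
      using ord[OF tri_point[OF t]] form_ord_fev[OF curve t N(1)] form_ord_fev[OF curve t N(2)]
        fev_nonzero[OF curve t F(1,2)] fev_nonzero[OF curve t F(3,4)] by simp
  qed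
qed

lemma principal_divisor_zero: "0 \<in> principal_divisors h g"
  by (rule principal_divisorI[of 0 3 "(1, 0)" "(1, 0)"]) (simp_all add: isf_scalar)

lemma principal_divisor_keys: "D \<in> principal_divisors h g \<Longrightarrow> Poly_Mapping.keys D \<subseteq> points h g"
  by (simp add: principal_divisors_def)

lemma principal_divisor_uminus:
  assumes D: "D \<in> principal_divisors h g"
  shows "- D \<in> principal_divisors h g"
proof -
  obtain N F1 F2 where *: "3 \<le> N" "isf N F1" "F1 \<noteq> (0, 0)" "isf N F2" "F2 \<noteq> (0, 0)"
    "\<And>Q Xs Zs Ys. tri h g Q Xs Zs Ys \<Longrightarrow> Poly_Mapping.lookup D Q
      = int (subdegree (fev N F1 Xs Zs Ys)) - int (subdegree (fev N F2 Xs Zs Ys))"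
    using D by (elim principal_divisorE) blast
  show ?thesis
    by (rule principal_divisorI[OF _ *(4,5,2,3,1)]) (use principal_divisor_keys[OF D] *(6) in simp_all)
qed

lemma principal_divisor_add:
  assumes D: "D \<in> principal_divisors h g" and E: "E \<in> principal_divisors h g"
  shows "D + E \<in> principal_divisors h g"
proof -
  note d = genus2_degree[OF curve]
  obtain N F1 F2 where F: "3 \<le> N" "isf N F1" "F1 \<noteq> (0, 0)" "isf N F2" "F2 \<noteq> (0, 0)"
    "\<And>Q Xs Zs Ys. tri h g Q Xs Zs Ys \<Longrightarrow> Poly_Mapping.lookup D Q
      = int (subdegree (fev N F1 Xs Zs Ys)) - int (subdegree (fev N F2 Xs Zs Ys))"
    using D by (elim principal_divisorE) blast
  obtain M G1 G2 where G: "3 \<le> M" "isf M G1" "G1 \<noteq> (0, 0)" "isf M G2" "G2 \<noteq> (0, 0)"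
    "\<And>Q Xs Zs Ys. tri h g Q Xs Zs Ys \<Longrightarrow> Poly_Mapping.lookup E Q
      = int (subdegree (fev M G1 Xs Zs Ys)) - int (subdegree (fev M G2 Xs Zs Ys))"
    using E by (elim principal_divisorE) blast
  show ?thesis
  proof (rule principal_divisorI[of _ "N + M" "fmul h g F1 G1" "fmul h g F2 G2"])
    show "Poly_Mapping.keys (D + E) \<subseteq> points h g"
      using principal_divisor_keys[OF D] principal_divisor_keys[OF E] Poly_Mapping.keys_add[of D E] by blast
    show "isf (N + M) (fmul h g F1 G1)" "isf (N + M) (fmul h g F2 G2)"
      by (intro isf_fmul d F G)+
    show "fmul h g F1 G1 \<noteq> (0, 0)" "fmul h g F2 G2 \<noteq> (0, 0)" by (intro fmul_nonzero[OF curve] F G)+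
    show "3 \<le> N + M" using F(1) by simp
    fix Q Xs Zs Ys assume t: "tri h g Q Xs Zs Ys"
    show "Poly_Mapping.lookup (D + E) Q = int (subdegree (fev (N + M) (fmul h g F1 G1) Xs Zs Ys))
        - int (subdegree (fev (N + M) (fmul h g F2 G2) Xs Zs Ys))"
      unfolding fev_fmul[OF d tri_curve[OF d t] F(2) G(2)] fev_fmul[OF d tri_curve[OF d t] F(4) G(4)]
      using F(6)[OF t] G(6)[OF t] fev_nonzero[OF curve t F(2,3)] fev_nonzero[OF curve t F(4,5)]
        fev_nonzero[OF curve t G(2,3)] fev_nonzero[OF curve t G(4,5)]
      by (simp add: lookup_add)
  qed
qed

lemma principal_divisor_diff: "D \<in> principal_divisors h g \<Longrightarrow> E \<in> principal_divisors h g \<Longrightarrow> D - E \<in> principal_divisors h g"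
  using principal_divisor_add[OF _ principal_divisor_uminus, of D E] by simp

text \<open>The quotient of the two linear forms, both regarded in degree 3, the least degree
  \<open>is_form\<close> admits; the common factor \<open>Z^2\<close> cancels.\<close>

lemma fibre_principal:
  assumes P: "P \<in> points h g" "Q \<in> points h g"
  shows "Poly_Mapping.single P 1 + Poly_Mapping.single (iota h P) 1
    - (Poly_Mapping.single Q 1 + Poly_Mapping.single (iota h Q) 1) \<in> principal_divisors h g"
proof (rule principal_divisorI[of _ 3 "(lin P, 0)" "(lin Q, 0)"])
  let ?D = "Poly_Mapping.single P (1 :: int) + Poly_Mapping.single (iota h P) 1
    - (Poly_Mapping.single Q 1 + Poly_Mapping.single (iota h Q) 1)"
  have "Poly_Mapping.lookup ?D S = 0" if "S \<notin> points h g" for S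
    using that P iota_points[of h P g] iota_points[of h Q g]
    by (auto simp: lookup_add lookup_minus lookup_single when_def)
  then show "Poly_Mapping.keys ?D \<subseteq> points h g" by (auto simp: in_keys_iff)
  show "isf 3 (lin P, 0)" "isf 3 (lin Q, 0)" using degree_lin[of P] degree_lin[of Q] by (auto simp: isf_scalar)
  fix S Xs Zs Ys assume t: "tri h g S Xs Zs Ys"
  have z: "fev 3 (lin T, 0) Xs Zs Ys = Zs ^ 2 * heval fps_const 1 (lin T) Xs Zs" for T
    using fps_const_hom.heval_raise[OF degree_lin[of T], of 2 Xs Zs] by (simp only: fev_scalar) (simp add: numeral_3_eq_3)
  have nz: "heval fps_const 1 (lin T) Xs Zs \<noteq> 0" for T by (rule heval_nonzero[OF curve t _ degree_lin]) simp
  have "heval fps_const 1 1 Xs Zs \<noteq> 0" by (rule heval_nonzero[OF curve t]) simp_all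
  then have "Zs \<noteq> 0" by (simp add: fps_const_hom.heval_1)
  then show "Poly_Mapping.lookup ?D S
      = int (subdegree (fev 3 (lin P, 0) Xs Zs Ys)) - int (subdegree (fev 3 (lin Q, 0) Xs Zs Ys))"
    unfolding z using nz subdegree_lin[OF curve t P(1)] subdegree_lin[OF curve t P(2)]
    by (auto simp: lookup_add lookup_minus lookup_single when_def of_bool_def)
qed simp_all

text \<open>There is no function of degree 1. Multiplied by \<open>lin P2\<close>, such a function
  would become a form of degree 1 with divisor P1 + P2. A form of degree 1 vanishing at
  \<open>P1\<close> is a multiple of \<open>lin P1\<close>, whose divisor is P1 plus its
  opposite.\<close>

lemma difference_not_principal:
  assumes P: "P1 \<in> points h g" "P2 \<in> points h g" and ne: "P1 \<noteq> iota h P2"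
  shows "Poly_Mapping.single P1 1 - Poly_Mapping.single (iota h P2) 1 \<notin> principal_divisors h g"
proof
  note d = genus2_degree[OF curve]
  assume "Poly_Mapping.single P1 1 - Poly_Mapping.single (iota h P2) 1 \<in> principal_divisors h g"
  then obtain N F1 F2 where F: "3 \<le> N" "isf N F1" "F1 \<noteq> (0, 0)" "isf N F2" "F2 \<noteq> (0, 0)"
    and ord: "\<And>Q Xs Zs Ys. tri h g Q Xs Zs Ys \<Longrightarrow>
      Poly_Mapping.lookup (Poly_Mapping.single P1 1 - Poly_Mapping.single (iota h P2) 1) Q
      = int (subdegree (fev N F1 Xs Zs Ys)) - int (subdegree (fev N F2 Xs Zs Ys))"
    by (elim principal_divisorE) blast
  let ?n = "fnorm h g F2" and ?c = "fconj h F2"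
  have n0: "?n \<noteq> 0" by (rule fnorm_nonzero[OF curve F(5)])
  have nd: "Polynomial.degree ?n \<le> N + N" by (rule degree_fnorm[OF curve F(4)])
  have c: "isf N ?c" "?c \<noteq> (0, 0)" using isf_fconj[OF d(1) F(4)] F(5) by (auto simp: fconj_def prod_eq_iff)
  let ?G = "fmul h g (lin P2, 0) (fmul h g F1 ?c)"
  have l: "isf 1 (lin P2, 0)" "(lin P2, 0) \<noteq> (0, 0 :: 'a poly)" using degree_lin[of P2] by (simp_all add: isf_scalar)
  have FC: "isf (N + N) (fmul h g F1 ?c)" by (rule isf_fmul[OF d F(2) c(1)])
  have G: "isf (1 + (N + N)) ?G" "?G \<noteq> (0, 0)"
    using isf_fmul[OF d l(1) FC] fmul_nonzero[OF curve l(2) fmul_nonzero[OF curve F(3) c(2)]] by auto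
  have sdG: "subdegree (fev (1 + (N + N)) ?G Xs Zs Ys)
      = subdegree (heval fps_const (N + N) ?n Xs Zs) + (of_bool (Q = P1) + of_bool (Q = P2))"
    if t: "tri h g Q Xs Zs Ys" for Q Xs Zs Ys
  proof -
    let ?Y = "- Ys - heval fps_const 3 h Xs Zs"
    have "fev (1 + (N + N)) ?G Xs Zs Ys = heval fps_const 1 (lin P2) Xs Zs * (fev N F1 Xs Zs Ys * fev N F2 Xs Zs ?Y)"
      unfolding fev_fmul[OF d tri_curve[OF d t] l(1) FC] fev_fmul[OF d tri_curve[OF d t] F(2) c(1)]
        fev_fconj[OF d(1) F(4)] fev_scalar ..
    moreover have nz: "fev N F1 Xs Zs Ys \<noteq> 0" "fev N F2 Xs Zs Ys \<noteq> 0" "fev N F2 Xs Zs ?Y \<noteq> 0"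
      "heval fps_const 1 (lin P2) Xs Zs \<noteq> 0"
      using fev_nonzero[OF curve t F(2,3)] fev_nonzero[OF curve t F(4,5)]
        fev_nonzero[OF curve tri_iota[OF d(1) t] F(4,5)] heval_nonzero[OF curve t _ degree_lin, of P2] by auto
    ultimately have "subdegree (fev (1 + (N + N)) ?G Xs Zs Ys)
        = (of_bool (Q = P2) + of_bool (Q = iota h P2)) + (subdegree (fev N F1 Xs Zs Ys) + subdegree (fev N F2 Xs Zs ?Y))"
      using subdegree_lin[OF curve t P(2)] by simp
    moreover have "subdegree (heval fps_const (N + N) ?n Xs Zs)
        = subdegree (fev N F2 Xs Zs Ys) + subdegree (fev N F2 Xs Zs ?Y)"
      by (rule subdegree_norm[OF curve t F(4,5)])
    moreover have "int (subdegree (fev N F1 Xs Zs Ys)) + of_bool (Q = iota h P2)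
        = int (subdegree (fev N F2 Xs Zs Ys)) + of_bool (Q = P1)"
      using ord[OF t] by (auto simp: lookup_minus lookup_single when_def of_bool_def)
    then have "subdegree (fev N F1 Xs Zs Ys) + of_bool (Q = iota h P2)
        = subdegree (fev N F2 Xs Zs Ys) + of_bool (Q = P1)"
      by (auto simp: of_bool_def split: if_splits)
    ultimately show ?thesis by linarith
  qed
  have "\<exists>L. isf 1 L \<and> ?G = fmul h g (?n, 0) L"
    by (rule form_divide_exact[OF curve G n0 nd]) (simp, subst sdG, assumption, rule le_add1)
  then obtain L where L: "isf 1 L" "?G = fmul h g (?n, 0) L" by blast
  have L0: "L \<noteq> (0, 0)" using L(2) G(2) by (auto simp: fmul_def)
  have sdL: "subdegree (fev 1 L Xs Zs Ys) = of_bool (Q = P1) + of_bool (Q = P2)"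
    if t: "tri h g Q Xs Zs Ys" for Q Xs Zs Ys
  proof -
    have "isf (N + N) (?n, 0)" using nd by (simp add: isf_scalar)
    then have "fev (N + N + 1) ?G Xs Zs Ys = fev (N + N) (?n, 0) Xs Zs Ys * fev 1 L Xs Zs Ys"
      unfolding L(2) by (rule fev_fmul[OF d tri_curve[OF d t] _ L(1)])
    then show ?thesis
      using sdG[OF t] heval_nonzero[OF curve t n0 nd] fev_nonzero[OF curve t L(1) L0] by (simp add: fev_scalar)
  qed
  \<comment> \<open>The y-component vanishes because y has weight 3.\<close>
  have sL: "snd L = 0" "Polynomial.degree (fst L) \<le> 1" using L(1) by (auto simp: isf_def)
  define q where "q = fst L"
  have Lq: "L = (q, 0)" using sL by (simp add: q_def prod_eq_iff)
  have hq: "heval fps_const 1 q Xs Zs = fps_const (Polynomial.coeff q 0) * Zs + fps_const (Polynomial.coeff q 1) * Xs" for Xs Zs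
    by (simp add: heval_def)
  obtain Xs Zs Ys where t: "tri h g P1 Xs Zs Ys" using tri_exists[OF curve P(1)] by blast
  have "subdegree (heval fps_const 1 q Xs Zs) \<noteq> 0" using sdL[OF t] by (simp add: Lq fev_scalar)
  then have v: "heval fps_const 1 q Xs Zs $ 0 = 0" using subdegree_eq_0_iff by blast
  have q: "q = [:Polynomial.coeff q 0, Polynomial.coeff q 1:]"
    using sL(2) by (intro poly_eqI) (auto simp: q_def coeff_pCons coeff_eq_0 split: nat.split)
  have "\<exists>c. q = smult c (lin P1)"
  proof (cases P1)
    case (Affine x y)
    then have "Polynomial.coeff q 0 + Polynomial.coeff q 1 * x = 0"
      using v t unfolding hq by (simp add: branch_def)
    then have "Polynomial.coeff q 0 = - (Polynomial.coeff q 1 * x)" by (simp only: eq_neg_iff_add_eq_0)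
    then show ?thesis by (intro exI[of _ "Polynomial.coeff q 1"], subst q) (simp add: Affine)
  next
    case (Inf y)
    then have "Polynomial.coeff q 1 = 0" using v t unfolding hq by (simp add: branch_def)
    then show ?thesis by (intro exI[of _ "Polynomial.coeff q 0"], subst q) (simp add: Inf)
  qed
  then obtain c where c: "q = smult c (lin P1)" by blast
  have c0: "c \<noteq> 0" using L0 Lq c by auto
  obtain Xs Zs Ys where t: "tri h g P2 Xs Zs Ys" using tri_exists[OF curve P(2)] by blast
  have "heval fps_const 1 q Xs Zs = fps_const c * heval fps_const 1 (lin P1) Xs Zs"
    by (simp add: c heval_def distrib_left mult_ac flip: fps_const_mult)
  then have "subdegree (heval fps_const 1 q Xs Zs) = subdegree (heval fps_const 1 (lin P1) Xs Zs)"
    using c0 heval_nonzero[OF curve t _ degree_lin, of P1] by simp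
  \<comment> \<open>The two descriptions of the divisor of \<open>L\<close> are compared at
    \<open>P2\<close>.\<close>
  then have "of_bool (P2 = P1) + of_bool (P2 = P2) = (of_bool (P2 = P1) + of_bool (P2 = iota h P1) :: nat)"
    using sdL[OF t] subdegree_lin[OF curve t P(1)] by (simp only: Lq fev_scalar)
  then show False using ne iota_eq_iff[of h P2 P1] by (auto split: if_splits)
qed

text \<open>The function is \<open>F / lin P2 ^ 5\<close>: the fivefold zero at \<open>P2\<close>
  cancels and leaves the pole at the opposite point.\<close>

lemma quintic_principal:
  assumes P: "P1 \<in> points h g" "P2 \<in> points h g" and F: "quintic_div h g P1 P2 F"
    and keys: "Poly_Mapping.keys D \<subseteq> points h g"
    and D: "\<And>Q. Poly_Mapping.lookup D Q = 5 * (of_bool (Q = P1) - of_bool (Q = iota h P2))"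
  shows "D \<in> principal_divisors h g"
proof (rule principal_divisorI[OF keys, of 5 F "(lin P2 ^ 5, 0)"])
  show "isf 5 F" "F \<noteq> (0, 0)" using F by (auto simp: quintic_div_def)
  show "isf 5 (lin P2 ^ 5, 0)" by (simp only: isf_scalar degree_lin_power)
  fix Q Xs Zs Ys assume t: "tri h g Q Xs Zs Ys"
  have "subdegree (fev 5 F Xs Zs Ys) = 5 * (of_bool (Q = P1) + of_bool (Q = P2))"
    using F t unfolding quintic_div_def by blast
  then show "Poly_Mapping.lookup D Q = int (subdegree (fev 5 F Xs Zs Ys)) - int (subdegree (fev 5 (lin P2 ^ 5, 0) Xs Zs Ys))"
    unfolding D fev_scalar subdegree_lin_power[OF curve t P(2)] by simp
qed simp_all

end

section \<open>Divisor classes\<close>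

lemma div0_coset: "Hs #>\<^bsub>div0_group h g\<^esub> D = {E + D | E. E \<in> Hs}"
  by (auto simp: r_coset_def div0_group_def)

context
  fixes h g :: "'a::alg_closed_field poly"
  assumes curve: "genus2_curve h g"
begin

lemma coset_principal:
  assumes "E \<in> principal_divisors h g"
  shows "principal_divisors h g #>\<^bsub>div0_group h g\<^esub> E = principal_divisors h g"
proof (rule Set.set_eqI, rule iffI)
  fix A assume "A \<in> principal_divisors h g #>\<^bsub>div0_group h g\<^esub> E"
  then show "A \<in> principal_divisors h g" unfolding div0_coset using principal_divisor_add[OF curve _ assms] by blast
next
  fix A assume "A \<in> principal_divisors h g"
  then have "A - E \<in> principal_divisors h g" by (rule principal_divisor_diff[OF curve _ assms])
  moreover have "A = (A - E) + E" by simp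
  ultimately show "A \<in> principal_divisors h g #>\<^bsub>div0_group h g\<^esub> E" unfolding div0_coset by blast
qed

lemma coset_mult:
  "(principal_divisors h g #>\<^bsub>div0_group h g\<^esub> A) <#>\<^bsub>div0_group h g\<^esub> (principal_divisors h g #>\<^bsub>div0_group h g\<^esub> B)
    = principal_divisors h g #>\<^bsub>div0_group h g\<^esub> (A + B)"
proof (rule Set.set_eqI, rule iffI)
  fix S assume "S \<in> (principal_divisors h g #>\<^bsub>div0_group h g\<^esub> A) <#>\<^bsub>div0_group h g\<^esub> (principal_divisors h g #>\<^bsub>div0_group h g\<^esub> B)"
  then obtain E E' where E: "E \<in> principal_divisors h g" "E' \<in> principal_divisors h g" and S: "S = (E + A) + (E' + B)"
    by (auto simp: set_mult_def div0_coset) (simp add: div0_group_def)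
  have "S = (E + E') + (A + B)" unfolding S by (simp add: ac_simps)
  then show "S \<in> principal_divisors h g #>\<^bsub>div0_group h g\<^esub> (A + B)"
    unfolding div0_coset using principal_divisor_add[OF curve E] by blast
next
  fix S assume "S \<in> principal_divisors h g #>\<^bsub>div0_group h g\<^esub> (A + B)"
  then obtain E where E: "E \<in> principal_divisors h g" and S: "S = E + (A + B)" unfolding div0_coset by blast
  have "S = (E + A) \<otimes>\<^bsub>div0_group h g\<^esub> (0 + B)" unfolding S by (simp add: div0_group_def ac_simps)
  then show "S \<in> (principal_divisors h g #>\<^bsub>div0_group h g\<^esub> A) <#>\<^bsub>div0_group h g\<^esub> (principal_divisors h g #>\<^bsub>div0_group h g\<^esub> B)"
    unfolding set_mult_def div0_coset using E principal_divisor_zero[OF curve] by blast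
qed

lemma coset_power:
  "\<exists>E. (principal_divisors h g #>\<^bsub>div0_group h g\<^esub> D) [^]\<^bsub>jacobian h g\<^esub> n = principal_divisors h g #>\<^bsub>div0_group h g\<^esub> E
    \<and> (\<forall>Q. Poly_Mapping.lookup E Q = int n * Poly_Mapping.lookup D Q)"
proof (induction n)
  case 0
  have "(principal_divisors h g #>\<^bsub>div0_group h g\<^esub> D) [^]\<^bsub>jacobian h g\<^esub> (0 :: nat)
    = principal_divisors h g #>\<^bsub>div0_group h g\<^esub> 0"
    using coset_principal[OF principal_divisor_zero[OF curve]] by (simp add: nat_pow_def jacobian_def)
  then show ?case by (intro exI[of _ 0]) simp
next
  case (Suc n)
  then obtain E where E: "(principal_divisors h g #>\<^bsub>div0_group h g\<^esub> D) [^]\<^bsub>jacobian h g\<^esub> n = principal_divisors h g #>\<^bsub>div0_group h g\<^esub> E"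
    and l: "\<forall>Q. Poly_Mapping.lookup E Q = int n * Poly_Mapping.lookup D Q" by blast
  have "(principal_divisors h g #>\<^bsub>div0_group h g\<^esub> D) [^]\<^bsub>jacobian h g\<^esub> Suc n
    = (principal_divisors h g #>\<^bsub>div0_group h g\<^esub> D) [^]\<^bsub>jacobian h g\<^esub> n
      <#>\<^bsub>div0_group h g\<^esub> (principal_divisors h g #>\<^bsub>div0_group h g\<^esub> D)"
    by (simp add: nat_pow_def jacobian_def)
  also have "\<dots> = principal_divisors h g #>\<^bsub>div0_group h g\<^esub> (E + D)" unfolding E by (rule coset_mult)
  finally show ?case using l by (intro exI[of _ "E + D"]) (simp add: lookup_add distrib_right)
qed

lemma torsion_principal:
  assumes "principal_divisors h g #>\<^bsub>div0_group h g\<^esub> D \<in> torsion_points (jacobian h g) n"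
  shows "\<exists>E \<in> principal_divisors h g. \<forall>Q. Poly_Mapping.lookup E Q = int n * Poly_Mapping.lookup D Q"
proof -
  obtain E where E: "(principal_divisors h g #>\<^bsub>div0_group h g\<^esub> D) [^]\<^bsub>jacobian h g\<^esub> n = principal_divisors h g #>\<^bsub>div0_group h g\<^esub> E"
    and l: "\<forall>Q. Poly_Mapping.lookup E Q = int n * Poly_Mapping.lookup D Q"
    using coset_power by blast
  have "principal_divisors h g #>\<^bsub>div0_group h g\<^esub> E = principal_divisors h g"
    using assms unfolding E[symmetric] torsion_points_def by (simp add: jacobian_def)
  moreover have "E \<in> principal_divisors h g #>\<^bsub>div0_group h g\<^esub> E"
    unfolding div0_coset using principal_divisor_zero[OF curve] by force
  ultimately show ?thesis using l by blast
qed

lemma difference_torsion: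
  assumes P: "P1 \<in> points h g" "P2 \<in> points h g" and ne: "P1 \<noteq> iota h P2" and F: "quintic_div h g P1 P2 F"
  defines "c \<equiv> principal_divisors h g #>\<^bsub>div0_group h g\<^esub> (Poly_Mapping.single P1 1 - Poly_Mapping.single (iota h P2) 1)"
  shows "c \<in> torsion_points (jacobian h g) 5" "c \<noteq> \<one>\<^bsub>jacobian h g\<^esub>"
proof -
  define D :: "'a divisor" where "D = Poly_Mapping.single P1 1 - Poly_Mapping.single (iota h P2) 1"
  have l: "Poly_Mapping.lookup D Q = of_bool (Q = P1) - of_bool (Q = iota h P2)" for Q
    by (auto simp: D_def lookup_minus lookup_single when_def of_bool_def)
  have k: "Poly_Mapping.keys D \<subseteq> {P1, iota h P2}" by (auto simp: in_keys_iff l of_bool_def split: if_splits)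
  have kp: "Poly_Mapping.keys D \<subseteq> points h g" using k P iota_points[of h P2 g] by blast
  have "div_degree D = (\<Sum>Q\<in>{P1, iota h P2}. Poly_Mapping.lookup D Q)"
    unfolding div_degree_def by (rule sum.mono_neutral_left[OF _ k]) (auto simp: in_keys_iff)
  then have "div_degree D = 0" using ne by (simp add: l)
  then have "D \<in> carrier (div0_group h g)" using kp by (simp add: div0_group_def)
  then have car: "c \<in> carrier (jacobian h g)" by (simp add: c_def jacobian_def carrier_FactGroup D_def)
  obtain E where E: "c [^]\<^bsub>jacobian h g\<^esub> (5 :: nat) = principal_divisors h g #>\<^bsub>div0_group h g\<^esub> E"
    and lE: "\<forall>Q. Poly_Mapping.lookup E Q = int 5 * Poly_Mapping.lookup D Q"
    using coset_power[of D 5] by (auto simp: c_def D_def)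
  have "Poly_Mapping.keys E \<subseteq> points h g" using kp lE by (auto simp: in_keys_iff)
  then have "E \<in> principal_divisors h g"
    by (rule quintic_principal[OF curve P F]) (use lE l in simp)
  from E coset_principal[OF this] show "c \<in> torsion_points (jacobian h g) 5"
    using car by (simp add: torsion_points_def jacobian_def)
  have "D \<in> c" unfolding c_def div0_coset D_def[symmetric] using principal_divisor_zero[OF curve] by force
  moreover have "D \<notin> principal_divisors h g" unfolding D_def by (rule difference_not_principal[OF curve P ne])
  ultimately show "c \<noteq> \<one>\<^bsub>jacobian h g\<^esub>" by (auto simp: jacobian_def)
qed

end

context curve_automorphism
begin

lemma \<sigma>_uminus: "\<sigma> (- x) = - \<sigma> x"
  using \<sigma>_add[of x "- x"] by (simp add: eq_neg_iff_add_eq_0 add.commute)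

lemma \<sigma>_diff: "\<sigma> (x - y) = \<sigma> x - \<sigma> y"
  using \<sigma>_add[of x "- y"] by (simp add: \<sigma>_uminus)

lemma \<sigma>_poly: "\<sigma> (poly q x) = poly (map_poly \<sigma> q) (\<sigma> x)"
  by (induction q) (simp_all add: map_poly_pCons \<sigma>_add \<sigma>_mult)

lemma act_iota: "act (iota h Q) = iota h (act Q)"
proof (cases Q)
  case (Affine x y)
  then show ?thesis by (simp add: \<sigma>_diff \<sigma>_uminus \<sigma>_poly \<sigma>_h)
next
  case (Inf y)
  have "\<sigma> (poly (rev_poly 3 h) 0) = poly (rev_poly 3 h) 0" by (simp add: \<sigma>_poly map_\<sigma>_rev_poly \<sigma>_h)
  then show ?thesis using poly_rev_poly_0[of 3 h] by (simp add: Inf \<sigma>_diff \<sigma>_uminus)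
qed

text \<open>If the action exchanges the two points, then \<open>\<Phi> D - D\<close> is a difference
  of two fibres of x, which is principal; if it fixes them, the difference is 0.\<close>

lemma coset_stable:
  assumes \<Phi>: "\<And>D Q. Poly_Mapping.lookup (\<Phi> D) (act Q) = Poly_Mapping.lookup D Q"
    and P: "P1 \<in> points h g" "P2 \<in> points h g"
    and st: "(act P1 = P1 \<and> act P2 = P2) \<or> (act P1 = P2 \<and> act P2 = P1)"
  defines "c \<equiv> principal_divisors h g #>\<^bsub>div0_group h g\<^esub> (Poly_Mapping.single P1 1 - Poly_Mapping.single (iota h P2) 1)"
  shows "\<Phi> ` c = c"
proof -
  define D :: "'a divisor" where "D = Poly_Mapping.single P1 1 - Poly_Mapping.single (iota h P2) 1"
  have inj: "inj act" by (rule injI) (simp add: act_inj)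
  have eqI: "A = B" if "\<And>Q. Poly_Mapping.lookup A (act Q) = Poly_Mapping.lookup B (act Q)" for A B :: "'a divisor"
    by (rule poly_mapping_eqI) (metis act_surj that)
  have add: "\<Phi> (A + B) = \<Phi> A + \<Phi> B" for A B by (rule eqI) (simp add: \<Phi> lookup_add)
  have pr: "\<Phi> E \<in> principal_divisors h g" if "E \<in> principal_divisors h g" for E
    by (rule principal_divisors_act[OF that]) (rule \<Phi>)
  have \<Phi>D: "\<Phi> D = Poly_Mapping.single (act P1) 1 - Poly_Mapping.single (iota h (act P2)) 1"
    by (rule eqI) (auto simp: \<Phi> D_def lookup_minus lookup_single when_def act_inj simp flip: act_iota)
  have d: "\<Phi> D - D \<in> principal_divisors h g"
    using st
  proof
    assume "act P1 = P1 \<and> act P2 = P2"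
    then have "\<Phi> D - D = 0" unfolding \<Phi>D unfolding D_def by simp
    then show ?thesis using principal_divisor_zero[OF curve] by (simp only:)
  next
    assume "act P1 = P2 \<and> act P2 = P1"
    then have "\<Phi> D - D = Poly_Mapping.single P2 1 + Poly_Mapping.single (iota h P2) 1
      - (Poly_Mapping.single P1 1 + Poly_Mapping.single (iota h P1) 1)" unfolding \<Phi>D unfolding D_def by simp
    then show ?thesis using fibre_principal[OF curve P(2,1)] by (simp only:)
  qed
  show ?thesis
  proof (rule Set.set_eqI, rule iffI)
    fix A assume "A \<in> \<Phi> ` c"
    then obtain E where E: "E \<in> principal_divisors h g" "A = \<Phi> (E + D)"
      unfolding c_def div0_coset D_def[symmetric] by blast
    have "\<Phi> E + (\<Phi> D - D) \<in> principal_divisors h g" by (rule principal_divisor_add[OF curve pr[OF E(1)] d])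
    moreover have "A = (\<Phi> E + (\<Phi> D - D)) + D" by (simp add: E(2) add)
    ultimately show "A \<in> c" unfolding c_def div0_coset D_def[symmetric] by blast
  next
    fix A assume "A \<in> c"
    then obtain E where E: "E \<in> principal_divisors h g" "A = E + D"
      unfolding c_def div0_coset D_def[symmetric] by blast
    define B where "B = E - (\<Phi> D - D)"
    have B: "B \<in> principal_divisors h g" unfolding B_def by (rule principal_divisor_diff[OF curve E(1) d])
    \<comment> \<open>\<open>\<Phi>\<close> is known only through its values, so a preimage of
      \<open>B\<close> is built by composing with \<open>act\<close>; its principality comes from
      the inverse automorphism.\<close>
    define E' where "E' = Poly_Mapping.map_key act B"
    have E': "Poly_Mapping.lookup E' Q = Poly_Mapping.lookup B (act Q)" for Q
      using inj by (simp add: E'_def map_key.rep_eq)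
    interpret i: curve_automorphism "inv_into UNIV \<sigma>" h g by (rule curve_automorphism_inverse)
    have ai: "act (i.act Q) = Q" for Q using \<sigma>_bij by (cases Q) (simp_all add: bij_is_surj surj_f_inv_f)
    have "E' \<in> principal_divisors h g" by (rule i.principal_divisors_act[OF B]) (simp only: E' ai)
    then have "E' + D \<in> c" unfolding c_def div0_coset D_def[symmetric] by blast
    moreover have "\<Phi> E' = B" by (rule eqI) (simp only: \<Phi> E')
    then have "\<Phi> (E' + D) = A" unfolding add E(2) by (simp add: B_def)
    ultimately show "A \<in> \<Phi> ` c" by blast
  qed
qed

end

section \<open>The Frobenius automorphism\<close>

lemma CHAR_Fp_bar: "CHAR('p::prime_card Fp_bar) = CARD('p)"
  by simp

lemma prime_CHAR_Fp_bar: "prime CHAR('p::prime_card Fp_bar)"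
  using prime_card[where ?'a = 'p] by (simp only: CHAR_Fp_bar)

lemma frobenius_automorphism:
  fixes h g :: "int poly"
  assumes "genus2_curve (reduction h :: 'p::prime_card Fp_bar poly) (reduction g)"
  shows "curve_automorphism (\<lambda>x :: 'p Fp_bar. x ^ CHAR('p Fp_bar)) (reduction h) (reduction g)"
proof
  let ?p = "CHAR('p Fp_bar)"
  note char = prime_CHAR_Fp_bar[where ?'p = 'p]
  have p: "?p > 0" by (rule prime_gt_0_nat[OF char])
  show add: "(x + y) ^ ?p = x ^ ?p + y ^ ?p" for x y :: "'p Fp_bar" by (rule freshmans_dream[OF char refl])
  show "(x * y) ^ ?p = x ^ ?p * y ^ ?p" for x y :: "'p Fp_bar" by (rule power_mult_distrib)
  show "(1 :: 'p Fp_bar) ^ ?p = 1" by (rule power_one)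
  show "bij (\<lambda>x :: 'p Fp_bar. x ^ ?p)"
  proof (rule bijI)
    show "inj (\<lambda>x :: 'p Fp_bar. x ^ ?p)"
    proof (rule injI)
      fix x y :: "'p Fp_bar" assume e: "x ^ ?p = y ^ ?p"
      have "(x - y) ^ ?p + y ^ ?p = x ^ ?p" unfolding add[symmetric] by simp
      then have "(x - y) ^ ?p = 0" using e by simp
      then have "x - y = 0" by (rule power_eq_0_iff[THEN iffD1, THEN conjunct1])
      then show "x = y" by simp
    qed
    show "surj (\<lambda>x :: 'p Fp_bar. x ^ ?p)"
    proof (unfold surj_def, rule allI)
      fix y :: "'p Fp_bar"
      obtain x where "x ^ ?p = y" using nth_root_exists[OF p] by blast
      then show "\<exists>x. y = x ^ ?p" by (intro exI[of _ x]) (rule sym)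
    qed
  qed
  have fixp: "map_poly (\<lambda>x :: 'p Fp_bar. x ^ ?p) (reduction q) = reduction q" for q :: "int poly"
    by (rule poly_eqI)
      (use prime_field_of_int[OF char] p in \<open>simp add: coeff_map_poly reduction_def prime_field_def del: CHAR_alg_closure\<close>)
  show "map_poly (\<lambda>x :: 'p Fp_bar. x ^ ?p) (reduction h) = reduction h"
    "map_poly (\<lambda>x :: 'p Fp_bar. x ^ ?p) (reduction g) = reduction g" by (rule fixp)+
qed (rule assms)

lemma frob_point_map: "frob_point Q = map_point (\<lambda>x :: 'p::prime_card Fp_bar. x ^ CHAR('p Fp_bar)) Q"
  unfolding CHAR_Fp_bar by (cases Q) (simp_all only: frob_point.simps point.map)

lemma lookup_frob_divisor:
  assumes "inj (frob_point :: 'p::prime_card Fp_bar point \<Rightarrow> _)"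
  shows "Poly_Mapping.lookup (frob_divisor D) (frob_point Q) = Poly_Mapping.lookup (D :: 'p Fp_bar divisor) Q"
proof -
  have "Poly_Mapping.lookup (frob_divisor D) (frob_point Q)
    = (\<Sum>Q'\<in>Poly_Mapping.keys D. if Q' = Q then Poly_Mapping.lookup D Q' else 0)"
    unfolding frob_divisor_def lookup_sum
    by (rule sum.cong[OF refl]) (use assms in \<open>auto simp: lookup_single when_def dest: injD\<close>)
  also have "\<dots> = Poly_Mapping.lookup D Q" by (simp add: in_keys_iff)
  finally show ?thesis .
qed

theorem rational_torsion_class:
  fixes h g :: "int poly" and P1 P2 :: "'p::prime_card Fp_bar point"
  assumes curve: "genus2_curve (reduction h :: 'p Fp_bar poly) (reduction g)"
    and P: "P1 \<in> points (reduction h) (reduction g)" "P2 \<in> points (reduction h) (reduction g)"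
    and ne: "P1 \<noteq> iota (reduction h) P2" and F: "quintic_div (reduction h) (reduction g) P1 P2 F"
    and st: "(frob_point P1 = P1 \<and> frob_point P2 = P2) \<or> (frob_point P1 = P2 \<and> frob_point P2 = P1)"
  shows "\<exists>Q \<in> torsion_points (jacobian (reduction h :: 'p Fp_bar poly) (reduction g)) 5.
           Q \<noteq> \<one>\<^bsub>jacobian (reduction h :: 'p Fp_bar poly) (reduction g)\<^esub> \<and> Fp_rational Q"
proof -
  interpret curve_automorphism "\<lambda>x :: 'p Fp_bar. x ^ CHAR('p Fp_bar)" "reduction h" "reduction g"
    by (rule frobenius_automorphism[OF curve])
  have a: "frob_point Q = act Q" for Q by (cases Q) (simp_all only: frob_point_map point.map act.simps)
  have inj: "inj (frob_point :: 'p Fp_bar point \<Rightarrow> _)" by (rule injI) (simp only: a act_inj)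
  let ?c = "principal_divisors (reduction h) (reduction g) #>\<^bsub>div0_group (reduction h) (reduction g)\<^esub>
    (Poly_Mapping.single P1 1 - Poly_Mapping.single (iota (reduction h) P2) 1)"
  have "Fp_rational ?c"
    unfolding Fp_rational_def
    by (rule coset_stable[OF lookup_frob_divisor[OF inj, unfolded a] P st[unfolded a]])
  then show ?thesis using difference_torsion[OF curve P ne F] by blast
qed

section \<open>The reduced points are not opposite\<close>

text \<open>A point reducing to infinity becomes, after exchange of X and Z, an affine point whose
  abscissa reduces to 0. The three minus signs are a rescaling by -1, with odd weight 3 on y, and
  match \<open>swap_im\<close>.\<close>

lemma (in maximal_hom) tpt_swap:
  assumes xz: "x \<noteq> 0 \<or> z \<noteq> 0" and u: "rpt (tpt x z y) = Inf u"
  shows "\<exists>s v. tpt (- z) (- x) (- y) = Affine s v \<and> s \<in> R \<and> rd s = 0 \<and> rd v = u"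
proof (cases "z = 0")
  case True
  then have "tpt (- z) (- x) (- y) = Affine 0 (y / x ^ 3)" "rd (y / x ^ 3) = u"
    using xz u by (simp_all add: tpt_def power3_eq_cube)
  then show ?thesis using zero_R rd_0 by (intro exI[of _ 0] exI[of _ "y / x ^ 3"]) simp
next
  case False
  then have n: "x / z \<notin> R" and r: "rd (y / z ^ 3 / (x / z) ^ 3) = u"
    using u by (auto simp: tpt_def split: if_splits)
  have x: "x \<noteq> 0" using n zero_R by auto
  have "inverse (x / z) \<in> R \<and> rd (inverse (x / z)) = 0" using not_R[OF n] by blast
  then have s: "z / x \<in> R" "rd (z / x) = 0" by (simp_all add: inverse_eq_divide)
  have "y / z ^ 3 / (x / z) ^ 3 = y / x ^ 3" using False by (simp add: power_divide)
  then have v: "rd (y / x ^ 3) = u" using r by (simp only:)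
  have "tpt (- z) (- x) (- y) = Affine (z / x) (y / x ^ 3)" using x by (simp add: tpt_def power3_eq_cube)
  then show ?thesis using s v by (intro exI[of _ "z / x"] exI[of _ "y / x ^ 3"]) (intro conjI)
qed

context model_change
begin

lemma swap_model_change: "model_change f (rev_poly 3 h) (rev_poly 6 g) b a d c e (rev_poly 3 t)"
  by unfold_locales (rule f_curve f_degree two same_curve_swap[OF iso] degree_rev_poly)+

text \<open>Swapping the columns changes the sign of the determinant, hence of the adjugate matrix
  and of the cube of the determinant in \<open>imy\<close>.\<close>

lemma swap_im:
  "model_change.im b a d c e (rev_poly 3 t) x y = tpt (- imz x) (- imx x) (- imy x y)"
proof -
  interpret s: model_change f "rev_poly 3 h" "rev_poly 6 g" b a d c e "rev_poly 3 t"
    by (rule swap_model_change)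
  have xz: "s.imx x = - imz x" "s.imz x = - imx x"
    by (simp_all add: s.imx_def s.imz_def imx_def imz_def)
  have "hpoly 3 (rev_poly 3 t) (- imz x) (- imx x) = hpoly 3 t ((- 1) * imx x) ((- 1) * imz x)"
    using comm_ring_hom.heval_rev_poly[OF id_ring_hom, of 3 t "- imz x" "- imx x"] by simp
  also have "\<dots> = (- 1) ^ 3 * hpoly 3 t (imx x) (imz x)" by (rule comm_ring_hom.heval_scale[OF id_ring_hom])
  finally have t: "hpoly 3 (rev_poly 3 t) (- imz x) (- imx x) = - hpoly 3 t (imx x) (imz x)" by simp
  have "(b * c - a * d) ^ 3 = ((- 1) * (a * d - b * c)) ^ 3" by simp
  also have "\<dots> = (- 1) ^ 3 * (a * d - b * c) ^ 3" by (rule power_mult_distrib)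
  finally have dd: "(b * c - a * d) ^ 3 = - ((a * d - b * c) ^ 3)" by simp
  have "s.imy x y = - imy x y" using e0 unfolding s.imy_def imy_def xz t dd by (simp add: field_simps)
  then show ?thesis by (simp only: s.im_def xz)
qed

end

text \<open>\<open>affine_not_opposite\<close> covers a common reduction in the affine chart. If it
  lies at infinity, the same lemma is applied on the model with X and Z exchanged, to which the
  quintic form is transported anew.\<close>

lemma (in closed_place) im_reduction_not_opposite:
  assumes mc: "model_change f h g a b c d e t" and five: "(5 :: 'b) \<noteq> 0"
    and hg: "Rp h" "Rp g" and rcv: "genus2_curve (rp h) (rp g)"
    and F: "quintic_div 0 f (Affine x1 y1) (Affine x2 y2) F"
    and P: "Affine x1 y1 \<in> points 0 f" "Affine x2 y2 \<in> points 0 f"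
    and ne: "\<not> (x1 = x2 \<and> y1 = - y2)"
  shows "rpt (model_change.im a b c d e t x1 y1) \<noteq> iota (rp h) (rpt (model_change.im a b c d e t x2 y2))"
proof
  interpret m: model_change f h g a b c d e t by (rule mc)
  interpret s: model_change f "rev_poly 3 h" "rev_poly 6 g" b a d c e "rev_poly 3 t"
    by (rule m.swap_model_change)
  note ns = points_nonsingular[OF rcv]
  assume eq: "rpt (m.im x1 y1) = iota (rp h) (rpt (m.im x2 y2))"
  show False
  proof (cases "rpt (m.im x2 y2)")
    case (Affine u2 v2)
    then obtain X2 Y2 where P2: "m.im x2 y2 = Affine X2 Y2" "X2 \<in> R" by (cases "m.im x2 y2") (auto split: if_splits)
    obtain u1 v1 where "rpt (m.im x1 y1) = Affine u1 v1" using eq Affine by simp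
    then obtain X1 Y1 where P1: "m.im x1 y1 = Affine X1 Y1" "X1 \<in> R" by (cases "m.im x1 y1") (auto split: if_splits)
    obtain F' where F': "quintic_div h g (m.im x1 y1) (m.im x2 y2) F'" using m.quintic_div_im[OF F P ne] by blast
    have "rpt (Affine X1 Y1) \<noteq> iota (rp h) (rpt (Affine X2 Y2))"
      using affine_not_opposite[OF five hg m.hg_curve ns(1) F'[unfolded P1(1) P2(1)]
        m.im_points[OF P(1), unfolded P1(1)] m.im_points[OF P(2), unfolded P2(1)]
        m.im_not_iota[OF ne, unfolded P1(1) P2(1)] P1(2) P2(2)] .
    then show False using eq by (simp only: P1(1) P2(1))
  next
    case (Inf w2)
    then have w1: "rpt (m.im x1 y1) = Inf (- w2 - Polynomial.coeff (rp h) 3)" using eq by simp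
    obtain s1 v1 where s1: "s.im x1 y1 = Affine s1 v1" "s1 \<in> R" "rd s1 = 0" "rd v1 = - w2 - Polynomial.coeff (rp h) 3"
      using tpt_swap[OF m.imxz_nonzero w1[unfolded m.im_def]] unfolding m.swap_im by blast
    obtain s2 v2 where s2: "s.im x2 y2 = Affine s2 v2" "s2 \<in> R" "rd s2 = 0" "rd v2 = w2"
      using tpt_swap[OF m.imxz_nonzero Inf[unfolded m.im_def]] unfolding m.swap_im by blast
    obtain F' where F': "quintic_div (rev_poly 3 h) (rev_poly 6 g) (s.im x1 y1) (s.im x2 y2) F'"
      using s.quintic_div_im[OF F P ne] by blast
    have n: "\<not> singular_at (rp (rev_poly 3 h)) (rp (rev_poly 6 g)) (rd s2) b" for b
      using ns(2) by (simp add: rp_rev_poly s2(3))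
    have "rpt (Affine s1 v1) \<noteq> iota (rp (rev_poly 3 h)) (rpt (Affine s2 v2))"
      using affine_not_opposite[OF five Rp_rev_poly[OF hg(1)] Rp_rev_poly[OF hg(2)] s.hg_curve n
        F'[unfolded s1(1) s2(1)] s.im_points[OF P(1), unfolded s1(1)] s.im_points[OF P(2), unfolded s2(1)]
        s.im_not_iota[OF ne, unfolded s1(1) s2(1)] s1(2) s2(2)] .
    then show False using s1(2-4) s2(2-4) by (simp add: rp_rev_poly poly_rev_poly_0)
  qed
qed

section \<open>Torsion points and models over the rational numbers\<close>

lemma finite_infinite_points:
  fixes f :: "complex poly"
  shows "finite (infinite_points 0 f)"
proof (rule finite_subset)
  let ?s = "csqrt (Polynomial.coeff f 6)"
  show "infinite_points 0 f \<subseteq> {Inf ?s, Inf (- ?s)}"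
  proof
    fix Q assume "Q \<in> infinite_points 0 f"
    then obtain b where b: "Q = Inf b" "b\<^sup>2 = ?s\<^sup>2" by (auto simp: infinite_points_def poly_rev_poly_0)
    from b(2) have "b = ?s \<or> b = - ?s" by (simp only: power2_eq_iff)
    then show "Q \<in> {Inf ?s, Inf (- ?s)}" using b(1) by blast
  qed
qed simp

text \<open>Opposite points with a common value of \<open>v\<close> have ordinate 0. Then
  \<open>u\<close> is the square of a linear polynomial and divides \<open>v^2\<close>, hence also
  \<open>f\<close>, which gives \<open>f\<close> a double root.\<close>

lemma opposite_singular:
  fixes f :: "complex poly"
  assumes m: "mumford_coordinates f (x1, y1) (x2, y2) u v" and P: "Affine x1 y1 \<in> points 0 f"
    and op: "x1 = x2 \<and> y1 = - y2"
  shows "singular_at 0 f x1 0"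
proof -
  have u: "u = [:- x1, 1:] * [:- x1, 1:]" and v: "poly v x1 = y1" "poly v x1 = y2" and d: "u dvd v\<^sup>2 - f"
    using m op by (auto simp: mumford_coordinates_def)
  have "y2 = - y2" using v op by simp
  then have "y2 = 0" by simp
  then have v0: "poly v x1 = 0" using v by simp
  then have "[:- x1, 1:] dvd v" by (simp only: poly_eq_0_iff_dvd)
  then have "u dvd v\<^sup>2" unfolding u power2_eq_square by (intro mult_dvd_mono)
  then have "u dvd v\<^sup>2 - (v\<^sup>2 - f)" using d by (rule dvd_diff)
  then have "u dvd f" by simp
  then obtain k where k: "f = [:- x1, 1:] * ([:- x1, 1:] * k)" unfolding u by (metis dvdE mult.assoc)
  define q where "q = [:- x1, 1:]"
  have "poly q x1 = 0" by (simp add: q_def)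
  then have "poly f x1 = 0" "poly (pderiv f) x1 = 0" unfolding k q_def[symmetric] by (simp_all add: pderiv_mult)
  then show ?thesis by (simp add: singular_at_def)
qed

lemma simple_quadratic_quintic_form:
  fixes f :: "rat poly"
  assumes s: "simple_quadratic_5_torsion f d P"
    and cv: "genus2_curve 0 (map_poly of_rat f :: complex poly)" and deg: "Polynomial.degree f = 6"
  shows "squarefree d \<and> (\<exists>x1 y1 x2 y2 F. \<exists>\<alpha> \<beta> a b :: rat.
    Affine x1 y1 \<in> points 0 (map_poly of_rat f) \<and> Affine x2 y2 \<in> points 0 (map_poly of_rat f) \<and>
    quintic_div 0 (map_poly of_rat f :: complex poly) (Affine x1 y1) (Affine x2 y2) F \<and>
    \<not> (x1 = x2 \<and> y1 = - y2) \<and> x1 + x2 = - of_rat \<alpha> \<and> x1 * x2 = of_rat \<beta> \<and>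
    y1 = of_rat a * csqrt (of_int d) * x1 + of_rat b * csqrt (of_int d) \<and>
    y2 = of_rat a * csqrt (of_int d) * x2 + of_rat b * csqrt (of_int d))"
proof -
  define fC where "fC = (map_poly of_rat f :: complex poly)"
  define Dinf where "Dinf = (\<Sum>Q\<in>infinite_points 0 fC. Poly_Mapping.single Q (1 :: int))"
  obtain x1 y1 x2 y2 u v and \<alpha> \<beta> a b :: rat where d: "squarefree d" and t: "P \<in> torsion_points (jacobian 0 fC) 5"
    and A: "Affine x1 y1 \<in> affine_points 0 fC" "Affine x2 y2 \<in> affine_points 0 fC"
    and PD: "P = principal_divisors 0 fC #>\<^bsub>div0_group 0 fC\<^esub>
      (Poly_Mapping.single (Affine x1 y1) 1 + Poly_Mapping.single (Affine x2 y2) 1 - Dinf)"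
    and m: "mumford_coordinates fC (x1, y1) (x2, y2) u v" and u: "u = [:of_rat \<beta>, of_rat \<alpha>, 1:]"
    and v: "v = [:of_rat b * csqrt (of_int d), of_rat a * csqrt (of_int d):]"
    using s unfolding simple_quadratic_5_torsion_def Let_def fC_def[symmetric] Dinf_def[symmetric] by blast
  have cvC: "genus2_curve 0 fC" using cv by (simp only: fC_def)
  have degC: "Polynomial.degree fC = 6" using deg by (simp add: fC_def)
  have P: "Affine x1 y1 \<in> points 0 fC" "Affine x2 y2 \<in> points 0 fC" using A by (simp_all add: points_def)
  obtain E where E: "E \<in> principal_divisors 0 fC"
    and lE: "\<forall>Q. Poly_Mapping.lookup E Q = int 5 * Poly_Mapping.lookup
      (Poly_Mapping.single (Affine x1 y1) 1 + Poly_Mapping.single (Affine x2 y2) 1 - Dinf) Q"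
    using torsion_principal[OF cvC t[unfolded PD]] by blast
  have li: "Poly_Mapping.lookup Dinf Q = of_bool (Q \<in> infinite_points 0 fC)" for Q
    using finite_infinite_points[of fC] by (simp add: Dinf_def lookup_sum lookup_single when_def)
  have "\<exists>F. quintic_div 0 fC (Affine x1 y1) (Affine x2 y2) F"
  proof (rule torsion_quintic_form[OF cvC degC _ E])
    show "Poly_Mapping.lookup E Q
      = 5 * (of_bool (Q = Affine x1 y1) + of_bool (Q = Affine x2 y2) - of_bool (Q \<in> infinite_points 0 fC))" for Q
      unfolding lE[rule_format] lookup_minus lookup_add li by (auto simp: lookup_single when_def of_bool_def)
  qed simp
  then obtain F where F: "quintic_div 0 fC (Affine x1 y1) (Affine x2 y2) F" by blast
  have ne: "\<not> (x1 = x2 \<and> y1 = - y2)"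
    using opposite_singular[OF m P(1)] points_nonsingular(1)[OF cvC] by blast
  have mm: "u = [:- x1, 1:] * [:- x2, 1:]" "poly v x1 = y1" "poly v x2 = y2"
    using m by (simp_all add: mumford_coordinates_def)
  have "[:of_rat \<beta>, of_rat \<alpha>, 1:] = [:x1 * x2, - (x1 + x2), 1:]" using mm(1) unfolding u by simp
  then have "x1 * x2 = of_rat \<beta>" "of_rat \<alpha> = - (x1 + x2)" by (simp_all only: pCons_eq_iff)
  then have r: "x1 + x2 = - of_rat \<alpha>" "x1 * x2 = of_rat \<beta>" by simp_all
  have y: "y1 = of_rat a * csqrt (of_int d) * x1 + of_rat b * csqrt (of_int d)"
    "y2 = of_rat a * csqrt (of_int d) * x2 + of_rat b * csqrt (of_int d)"
    using mm(2,3) unfolding v by (simp_all add: mult.commute add.commute)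
  show ?thesis
    unfolding fC_def[symmetric]
    by (rule conjI[OF d], intro exI) (intro conjI, rule P, rule P, rule F, rule ne, rule r, rule r, rule y, rule y)
qed

text \<open>The witnesses are kept rational: the coordinates of the transported points are then
  conjugate over the quadratic field.\<close>

lemma good_model_same_curve:
  fixes f :: "rat poly" and h g :: "int poly"
  assumes "isomorphic_models 0 f (map_poly of_int h) (map_poly of_int g)"
  shows "\<exists>a b c d e :: rat. \<exists>t :: rat poly. same_curve (map_poly of_rat f :: complex poly) (map_poly of_int h) (map_poly of_int g)
    (of_rat a) (of_rat b) (of_rat c) (of_rat d) (of_rat e) (map_poly of_rat t)"
proof -
  interpret m: map_poly_comm_ring_hom "of_rat :: rat \<Rightarrow> complex" ..
  let ?C = "map_poly of_rat :: rat poly \<Rightarrow> complex poly"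
  obtain a b c d e t where D: "a * d - b * c \<noteq> 0" "e \<noteq> 0" and t: "Polynomial.degree t \<le> 3"
    and h: "smult e (map_poly of_int h) = hom_subst 3 0 [:b, a:] [:d, c:] + 2 * t"
    and g: "smult (e\<^sup>2) (map_poly of_int g)
      = hom_subst 6 f [:b, a:] [:d, c:] - hom_subst 3 0 [:b, a:] [:d, c:] * t - t\<^sup>2"
    using assms unfolding isomorphic_models_def Let_def by blast
  have z: "hom_subst 3 0 [:b, a:] [:d, c:] = 0" by (simp add: hom_subst_def)
  have i: "?C (map_poly of_int q) = map_poly of_int q" for q :: "int poly"
    by (rule poly_eqI) (simp add: coeff_map_poly)
  have sm: "?C (smult k q) = smult (of_rat k) (?C q)" for k q
    by (rule poly_eqI) (simp add: coeff_map_poly of_rat_mult)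
  have lin: "?C [:k, l:] = [:of_rat k, of_rat l:]" for k l
    by (rule poly_eqI) (simp add: coeff_map_poly coeff_pCons split: nat.split)
  have "smult (of_rat e) (?C (map_poly of_int h)) = ?C (2 * t)" using h unfolding z sm[symmetric] by simp
  also have "\<dots> = 2 * ?C t" by (simp only: mult_2 m.hom_add)
  finally have h': "smult (of_rat e) (map_poly of_int h) = 2 * ?C t" by (simp only: i)
  have "smult (of_rat (e\<^sup>2)) (?C (map_poly of_int g)) = ?C (hom_subst 6 f [:b, a:] [:d, c:] - t\<^sup>2)"
    using g unfolding z sm[symmetric] by simp
  also have "\<dots> = ?C (hom_subst 6 f [:b, a:] [:d, c:]) - (?C t)\<^sup>2" by (simp only: m.hom_minus m.hom_power)
  also have "?C (hom_subst 6 f [:b, a:] [:d, c:]) = hom_subst 6 (?C f) [:of_rat b, of_rat a:] [:of_rat d, of_rat c:]"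
    unfolding hom_subst_def m.hom_sum sm m.hom_mult m.hom_power lin by (simp add: coeff_map_poly)
  finally have g': "smult ((of_rat e)\<^sup>2) (map_poly of_int g)
      = hom_subst 6 (?C f) [:of_rat b, of_rat a:] [:of_rat d, of_rat c:] - (?C t)\<^sup>2"
    by (simp only: i of_rat_power)
  have "of_rat a * of_rat d - of_rat b * of_rat c = (of_rat (a * d - b * c) :: complex)"
    by (simp add: of_rat_mult of_rat_diff)
  then have "of_rat a * of_rat d - of_rat b * of_rat c \<noteq> (0 :: complex)" using D(1) by simp
  moreover have "(of_rat e :: complex) \<noteq> 0" using D(2) by simp
  moreover have "Polynomial.degree (?C t) \<le> 3" using t degree_map_poly_le le_trans by blast
  ultimately have "same_curve (?C f) (map_poly of_int h) (map_poly of_int g)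
      (of_rat a) (of_rat b) (of_rat c) (of_rat d) (of_rat e) (?C t)"
    unfolding same_curve_def using h' g' by blast
  then show ?thesis by (intro exI)
qed

text \<open>The place extends the map from the integers to the target field, whose graph is
  single-valued because the complex numbers have characteristic 0. That a place respects integers is
  \<open>rd_of_int\<close>.\<close>

lemma integral_place:
  "\<exists>R rd. closed_place R (rd :: complex \<Rightarrow> 'b::alg_closed_field)"
proof -
  have "hom_graph (range (\<lambda>n :: int. (of_int n :: complex, of_int n :: 'b)))"
    unfolding hom_graph_def
  proof (intro conjI allI impI)
    show "(1, 1) \<in> range (\<lambda>n :: int. (of_int n :: complex, of_int n :: 'b))" by (rule range_eqI[of _ _ 1]) simp
    show "u = 0" if "(0, u) \<in> range (\<lambda>n :: int. (of_int n :: complex, of_int n :: 'b))" for u using that by auto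
    fix x u y v assume "(x, u) \<in> range (\<lambda>n :: int. (of_int n :: complex, of_int n :: 'b))"
      "(y, v) \<in> range (\<lambda>n :: int. (of_int n :: complex, of_int n :: 'b))"
    then obtain m n where mn: "x = of_int m" "u = of_int m" "y = of_int n" "v = of_int n" by auto
    show "(x - y, u - v) \<in> range (\<lambda>n :: int. (of_int n :: complex, of_int n :: 'b))"
      by (rule range_eqI[of _ _ "m - n"]) (simp add: mn)
    show "(x * y, u * v) \<in> range (\<lambda>n :: int. (of_int n :: complex, of_int n :: 'b))"
      by (rule range_eqI[of _ _ "m * n"]) (simp add: mn)
  qed
  from place_extension[OF this] show ?thesis unfolding closed_place_def by blast
qed

theorem mainTheorem10:
  fixes f :: "rat poly" and d :: int and P :: "complex divisor set"
    and h g :: "int poly" and p :: nat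
  assumes "Polynomial.degree f = 6"
    and "genus2_curve 0 (map_poly of_rat f :: complex poly)"
    and "simple_quadratic_5_torsion f d P"
    and "p = CARD('p::prime_card)" and "p \<noteq> 5"
    and "good_model TYPE('p) f h g"
    and "splits_in p (quadratic_field d)"
  shows "\<exists>Q \<in> torsion_points (jacobian (reduction h :: 'p Fp_bar poly) (reduction g)) 5.
           Q \<noteq> \<one>\<^bsub>jacobian (reduction h :: 'p Fp_bar poly) (reduction g)\<^esub> \<and> Fp_rational Q"
proof -
  define K where "K = quadratic_field d"
  define fC where "fC = (map_poly of_rat f :: complex poly)"
  define hC gC where "hC = (map_poly of_int h :: complex poly)" and "gC = (map_poly of_int g :: complex poly)"
  have p: "prime p" "CHAR('p Fp_bar) = p" using prime_card[where ?'a = 'p] assms(4) by simp_all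
  have hg_degree: "Polynomial.degree h \<le> 3" "Polynomial.degree g \<le> 6"
    and iso: "isomorphic_models 0 f (map_poly of_int h) (map_poly of_int g)"
    and rcv: "genus2_curve (reduction h :: 'p Fp_bar poly) (reduction g)"
    using assms(6) by (simp_all add: good_model_def)
  obtain x1 y1 x2 y2 F and \<alpha> \<beta> a b :: rat where sq: "squarefree d"
    and P: "Affine x1 y1 \<in> points 0 fC" "Affine x2 y2 \<in> points 0 fC"
    and F: "quintic_div 0 fC (Affine x1 y1) (Affine x2 y2) F"
    and ne: "\<not> (x1 = x2 \<and> y1 = - y2)" and x: "x1 + x2 = - of_rat \<alpha>" "x1 * x2 = of_rat \<beta>"
    and y: "y1 = of_rat a * csqrt (of_int d) * x1 + of_rat b * csqrt (of_int d)"
      "y2 = of_rat a * csqrt (of_int d) * x2 + of_rat b * csqrt (of_int d)"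
    using simple_quadratic_quintic_form[OF assms(3,2,1)] unfolding fC_def by (elim conjE exE)
  obtain A B C D E :: rat and t :: "rat poly" where
    sc: "same_curve fC hC gC (of_rat A) (of_rat B) (of_rat C) (of_rat D) (of_rat E) (map_poly of_rat t)"
    using good_model_same_curve[OF iso] unfolding fC_def hC_def gC_def by (elim exE)
  have mc: "model_change fC hC gC (of_rat A) (of_rat B) (of_rat C) (of_rat D) (of_rat E) (map_poly of_rat t)"
  proof unfold_locales
    show "genus2_curve 0 fC" using assms(2) by (simp only: fC_def)
    show "Polynomial.degree fC = 6" using assms(1) by (simp add: fC_def)
    show "Polynomial.degree hC \<le> 3" "Polynomial.degree gC \<le> 6"
      unfolding hC_def gC_def using degree_map_poly_le le_trans hg_degree by blast+
  qed (simp, rule sc)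
  interpret m: model_change fC hC gC "of_rat A" "of_rat B" "of_rat C" "of_rat D" "of_rat E" "map_poly of_rat t"
    by (rule mc)
  obtain R and rd :: "complex \<Rightarrow> 'p Fp_bar" where cp: "closed_place R rd" using integral_place by blast
  interpret closed_place R rd by (rule cp)
  have rp: "Rp (map_poly of_int q)" "rp (map_poly of_int q) = reduction q" for q :: "int poly"
    by (auto simp: Rp_def coeff_map_poly of_int_R coeff_rp rd_of_int reduction_def intro!: poly_eqI)
  have Rhg: "Rp hC" "Rp gC" and rhg: "rp hC = reduction h" "rp gC = reduction g"
    by (simp_all only: hC_def gC_def rp)
  have rat: "of_rat q \<in> K" for q unfolding K_def by (rule of_rat_in_quadratic_field)
  have s: "csqrt (of_int d) \<in> K" unfolding K_def by (rule csqrt_in_quadratic_field)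
  \<comment> \<open>The abscissae are roots of the first Mumford polynomial, so their sum and
    product are rational.\<close>
  interpret conjugate_pair R rd K x1 x2
  proof unfold_locales
    show "1 \<in> K" using rat[of 1] by simp
    show "u - v \<in> K" "u * v \<in> K" if "u \<in> K" "v \<in> K" for u v
      using that quadratic_field_diff quadratic_field_mult unfolding K_def by blast+
    show "inverse u \<in> K" if "u \<in> K" for u using that unfolding K_def by (rule quadratic_field_inverse)
    show "prime CHAR('p Fp_bar)" by (rule prime_CHAR_Fp_bar)
    show "rd w \<in> prime_field" if "w \<in> K" "w \<in> R" for w
      using quadratic_residue_field[OF maximal_hom_axioms sq p assms(7)] that unfolding K_def by blast
    show "x1 + x2 \<in> K" "x1 * x2 \<in> K" unfolding x using rat[of "- \<alpha>"] rat[of \<beta>] by (simp_all add: of_rat_minus)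
  qed
  \<comment> \<open>The ordinates are the values of one linear polynomial over \<open>K\<close>, the
    second Mumford coordinate. The image points are then conjugate because the change of model has
    rational coefficients.\<close>
  have y_pair: "cpair y1 y2" by (rule cpairI[OF K_mult[OF rat s] K_mult[OF rat s] y])
  have imx: "cpair (m.imx x1) (m.imx x2)" and imz: "cpair (m.imz x1) (m.imz x2)"
    unfolding m.imx_def m.imz_def by (intro cpair_diff cpair_mult cpair_const cpair_x rat)+
  have ht: "cpair (hpoly 3 (map_poly of_rat t) (m.imx x1) (m.imz x1)) (hpoly 3 (map_poly of_rat t) (m.imx x2) (m.imz x2))"
    unfolding heval_def
    by (intro cpair_sum cpair_mult cpair_power imx imz cpair_const) (simp add: coeff_map_poly rat)
  have imy: "cpair (m.imy x1 y1) (m.imy x2 y2)"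
    unfolding m.imy_def divide_inverse
    by (intro cpair_mult cpair_diff ht y_pair cpair_const K_inverse rat cpair_power)
  define P1 P2 where "P1 = m.im x1 y1" and "P2 = m.im x2 y2"
  have pts: "P1 \<in> points hC gC" "P2 \<in> points hC gC" unfolding P1_def P2_def by (rule m.im_points P)+
  have rpts: "rpt P1 \<in> points (reduction h) (reduction g)" "rpt P2 \<in> points (reduction h) (reduction g)"
    using point_reduction(1)[OF Rhg m.hg_degree] pts by (simp_all only: rhg)
  have st: "(frob_point (rpt P1) = rpt P1 \<and> frob_point (rpt P2) = rpt P2) \<or>
      (frob_point (rpt P1) = rpt P2 \<and> frob_point (rpt P2) = rpt P1)"
    unfolding frob_point_map P1_def P2_def m.im_def
    by (rule conjugate_points_permuted[OF Rhg m.hg_degree imx imz imy pts[unfolded P1_def P2_def m.im_def]])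
  have "(of_nat 5 :: 'p Fp_bar) \<noteq> 0"
  proof
    assume "(of_nat 5 :: 'p Fp_bar) = 0"
    then have "p dvd 5" by (simp only: of_nat_eq_0_iff_char_dvd p(2))
    then have "p = 5" using p(1) prime_nat_iff[of 5] primes_dvd_imp_eq[of p 5] by simp
    then show False using assms(5) by simp
  qed
  then have five: "(5 :: 'p Fp_bar) \<noteq> 0" by simp
  have no: "rpt P1 \<noteq> iota (rp hC) (rpt P2)"
    unfolding P1_def P2_def
    by (rule im_reduction_not_opposite[OF mc five Rhg _ F P ne]) (simp only: rhg rcv)
  obtain F1 where F1: "quintic_div hC gC P1 P2 F1" using m.quintic_div_im[OF F P ne] unfolding P1_def P2_def by blast
  obtain F2 where F2: "quintic_div (rp hC) (rp gC) (rpt P1) (rpt P2) F2"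
    using quintic_div_reduction[OF Rhg m.hg_curve _ F1 pts no] rcv unfolding rhg by blast
  show ?thesis by (rule rational_torsion_class[OF rcv rpts no[unfolded rhg] F2[unfolded rhg] st])
qed

end
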